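(* Let $d\le3$, let $G$ be a symmorphic magnetic space group in $\mathbb{R}^d$ (spinless, or double in the spinful case), and suppose that an elementary band representation of $G$ splits into two orthogonal bands $S_1$ and $S_2$ with $G$ symmetry (each of positive rank). (a) If $S_1$ is a band representation of $G$, then $S_2$ is fragile localizable topological. (b) If $S_1$ is a simple band, or is composed of several simple bands with $G$ symmetry, each with vanishing first Chern class, then $S_1$ is a band representation of $G$, and hence $S_2$ is fragile localizable topological.
   Context: Groups. $BL\subset\mathbb{R}^d$ is a full-rank lattice (Bravais lattice), $RL=\{K: K\cdot R\in2\pi\mathbb{Z}\ \forall R\in BL\}$, $T^d=\mathbb{R}^d/RL$ the Brillouin torus. The point group $\mathcal P$ is a finite group with a homomorphism $p\mapsto(\check p,s_p)\in O(d)\times\{\pm1\}$ such that $\check p\,BL=BL$ ($s_p=-1$ means $p$ involves time reversal). $G=\{(p|R):p\in\mathcal P,R\in BL\}$ with $(q|R')(p|R)=(qp|\check qR+R')$ is the symmorphic magnetic space group, acting by $(p|R)\circ r=\check pr+R$. Wavefunctions take values in $V_0^{\oplus m}$ ($m\ge1$ arbitrary), where $V_0$ is a finite-dimensional complex Hilbert space on which $\mathcal P$ acts by operators $D_p$ with $D_qD_p=D_{qp}$, $D_p$ unitary if $s_p=1$ and antiunitary if $s_p=-1$. Spinless case: $p\mapsto(\check p,s_p)$ is injective, $V_0=\mathbb{C}$, and $D_p$ is the identity or complex conjugation according to $s_p=1$ or $-1$. Spinful case: $G$ is a double group, i.e. the kernel of $p\mapsto(\check p,s_p)$ is $\{E,\bar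 E\}$ with $\bar E$ the $2\pi$ rotation, $V_0$ is the spinor space and $D_{\bar E}=-1$. For $g=(p|R)$, $(\hat gf)(r)=D_pf(g^{-1}\circ r)$. Bands. A Bloch function with wavevector $k$ is a locally square-integrable function with $\psi(r+R)=e^{ik\cdot R}\psi(r)$ for $R\in BL$. A rank-$N$ band with $G$ symmetry assigns to each $k\in\mathbb{R}^d$ an $N$-dimensional space $\mathcal E_k$ of Bloch functions with wavevector $k$, with orthogonal projection $P(k)$ (inner product over a unit cell), such that $P(k+K)=P(k)$ for $K\in RL$, $e^{-ik\cdot r}P(k)e^{ik\cdot r}$ is real-analytic in $k$, and $\hat g\mathcal E_k=\mathcal E_{s_p\check pk}$ for all $g=(p|R)\in G$. A simple band is a band of rank one. The first Chern class is that of the complex vector bundle over $T^d$ with fibre $\mathcal E_k$. A band splits into (is composed of) bands with $G$ symmetry if at each $k$ its fibre is the orthogonal direct sum of their fibres. The sum of two bands is their Whitney sum: the band with fibre $\mathcal E_k\oplus\mathcal E'_k$ (with values in $V_0^{\oplus(m+m')}$). Localizable. An orthonormal frame $\psi_{1,k},\dots,\psi_{N,k}$ of $\mathcal E_k$ is analytic if $e^{-ik\cdot r}\psi_{j,k}$ is real-analytic in $k$, and periodic if $\psi_{j,k+K}=\psi_{j,k}$ for $K\in RL$. The band is localizable if it has an analytic periodic orthonormal frame; equivalently it is spanned by exponentially localized Wannier functions $w_{j,R}(r)=|T^d|^{-1/2}\int_{T^d}e^{-ik\cdot R}\psi_{j,k}(r)\,dk$, $R\in BL$. Band representation. A band with $G$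 symmetry is a band representation (BR) of $G$ if there are points $\varpi_1,\dots,\varpi_M\in\mathbb{R}^d$, pairwise distinct modulo $BL$, with $X=\{\varpi_n+R\}_{n,R\in BL}$ invariant under $G$, and an analytic periodic orthonormal frame $\psi^\alpha_{n,k}$ indexed by $n$ and $\alpha$, such that, with $W_{\varpi_n+R}$ the span over $\alpha$ of the Wannier functions $w^\alpha_{n,R}$, one has $\hat gW_x=W_{g\circ x}$ for all $g\in G$, $x\in X$ (that is, the representation is induced from representations of site stabilizers on Wannier functions). An elementary band representation of $G$ is a BR of $G$ that cannot be split into two or more bands of smaller (positive) rank that are all BRs of $G$. Localizable topological. A band with $G$ symmetry is localizable topological if it is localizable but not a BR of $G$; it is fragile localizable topological if moreover its sum with some BR of $G$ is a BR of $G$. *)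

theory Defs
  imports
    "HOL-Analysis.Analysis"
    "HOL-Algebra.Group"
    "HOL-Library.Function_Algebras"
begin

section \<open>Symmorphic magnetic space groups\<close>

text \<open>
  \<open>prim\<close> is a basis of the Bravais lattice, used only to write down unit cells; nothing below
  depends on which basis of the lattice is chosen.  The internal space \<open>V\<^sub>0\<close> is identified with
  \<open>complex ^ 'v\<close> by an orthonormal basis.
\<close>

record ('d :: finite, 'p, 'v :: finite) crystal =
  prim :: "'d \<Rightarrow> real ^ 'd"
  PG   :: "'p monoid"
  rot  :: "'p \<Rightarrow> real ^ 'd ^ 'd"
  trs  :: "'p \<Rightarrow> real"
  Dop  :: "'p \<Rightarrow> complex ^ 'v \<Rightarrow> complex ^ 'v"

definition BL :: "('d::finite, 'p, 'v::finite) crystal \<Rightarrow> (real ^ 'd) set" where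
  "BL C = {(\<Sum>j\<in>UNIV. of_int (n j) *\<^sub>R prim C j) | n :: 'd \<Rightarrow> int. True}"

definition RL :: "('d::finite, 'p, 'v::finite) crystal \<Rightarrow> (real ^ 'd) set" where
  "RL C = {K. \<forall>R\<in>BL C. \<exists>n :: int. K \<bullet> R = 2 * pi * of_int n}"

definition unit_cell :: "('d::finite, 'p, 'v::finite) crystal \<Rightarrow> (real ^ 'd) set" where
  "unit_cell C = {(\<Sum>j\<in>UNIV. t j *\<^sub>R prim C j) | t :: 'd \<Rightarrow> real. \<forall>j. 0 \<le> t j \<and> t j < 1}"

text \<open>
  A fundamental domain for \<open>T\<^sup>d = \<real>\<^sup>d / RL\<close>: if \<open>b\<close> is the basis of \<open>RL\<close> with
  \<open>b\<^sub>i \<bullet> prim\<^sub>j = 2 \<pi> \<delta>\<^sub>i\<^sub>j\<close>, these are the points \<open>\<Sum>\<^sub>i t\<^sub>i b\<^sub>i\<close> with all \<open>t\<^sub>i\<close> in \<open>[0, 1)\<close>.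
\<close>

definition BZ :: "('d::finite, 'p, 'v::finite) crystal \<Rightarrow> (real ^ 'd) set" where
  "BZ C = {k. \<forall>j. 0 \<le> k \<bullet> prim C j \<and> k \<bullet> prim C j < 2 * pi}"

definition space_group ::
    "('d::finite, 'p, 'v::finite) crystal \<Rightarrow> ('p \<times> (real ^ 'd)) monoid" where
  "space_group C =
     \<lparr>carrier = carrier (PG C) \<times> BL C,
      mult = (\<lambda>(q, R') (p, R). (q \<otimes>\<^bsub>PG C\<^esub> p, rot C q *v R + R')),
      one = (\<one>\<^bsub>PG C\<^esub>, 0)\<rparr>"

definition act ::
    "('d::finite, 'p, 'v::finite) crystal \<Rightarrow> 'p \<times> (real ^ 'd) \<Rightarrow> real ^ 'd \<Rightarrow> real ^ 'd" where
  "act C g r = rot C (fst g) *v r + snd g"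

definition cdot :: "complex ^ 'v::finite \<Rightarrow> complex ^ 'v \<Rightarrow> complex" where
  "cdot u v = (\<Sum>i\<in>UNIV. cnj (u $ i) * v $ i)"

definition unitary_op :: "(complex ^ 'v::finite \<Rightarrow> complex ^ 'v) \<Rightarrow> bool" where
  "unitary_op T \<longleftrightarrow>
     (\<forall>u v. T (u + v) = T u + T v) \<and> (\<forall>c u. T (c *s u) = c *s T u) \<and>
     (\<forall>u v. cdot (T u) (T v) = cdot u v)"

definition antiunitary_op :: "(complex ^ 'v::finite \<Rightarrow> complex ^ 'v) \<Rightarrow> bool" where
  "antiunitary_op T \<longleftrightarrow>
     (\<forall>u v. T (u + v) = T u + T v) \<and> (\<forall>c u. T (c *s u) = cnj c *s T u) \<and>
     (\<forall>u v. cdot (T u) (T v) = cnj (cdot u v))"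

definition magnetic_crystal :: "('d::finite, 'p, 'v::finite) crystal \<Rightarrow> bool" where
  "magnetic_crystal C \<longleftrightarrow>
     inj (prim C) \<and> independent (range (prim C)) \<and>
     group (PG C) \<and> finite (carrier (PG C)) \<and>
     (\<forall>p\<in>carrier (PG C).
        orthogonal_matrix (rot C p) \<and> trs C p \<in> {1, -1} \<and>
        (\<lambda>R. rot C p *v R) ` BL C = BL C \<and>
        (trs C p = 1 \<longrightarrow> unitary_op (Dop C p)) \<and>
        (trs C p = -1 \<longrightarrow> antiunitary_op (Dop C p))) \<and>
     (\<forall>q\<in>carrier (PG C). \<forall>p\<in>carrier (PG C).
        rot C (q \<otimes>\<^bsub>PG C\<^esub> p) = rot C q ** rot C p \<and>
        trs C (q \<otimes>\<^bsub>PG C\<^esub> p) = trs C q * trs C p \<and>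
        Dop C (q \<otimes>\<^bsub>PG C\<^esub> p) = Dop C q \<circ> Dop C p)"

definition spinless :: "('d::finite, 'p, 'v::finite) crystal \<Rightarrow> bool" where
  "spinless C \<longleftrightarrow>
     inj_on (\<lambda>p. (rot C p, trs C p)) (carrier (PG C)) \<and>
     CARD('v) = 1 \<and>
     (\<forall>p\<in>carrier (PG C). \<forall>v.
        Dop C p v = (if trs C p = 1 then v else (\<chi> i. cnj (v $ i))))"

text \<open>
  \<open>Ebar\<close> is the rotation by \<open>2 \<pi>\<close> and the spinor space is two-dimensional.  Which spin rotation
  or time reversal \<open>D\<^sub>p\<close> is, is not prescribed: \<open>D\<close> is any representation with \<open>D Ebar = -1\<close>.
\<close>

definition spinful :: "('d::finite, 'p, 'v::finite) crystal \<Rightarrow> bool" where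
  "spinful C \<longleftrightarrow>
     CARD('v) = 2 \<and>
     (\<exists>Ebar\<in>carrier (PG C). Ebar \<noteq> \<one>\<^bsub>PG C\<^esub> \<and>
        {p \<in> carrier (PG C). rot C p = mat 1 \<and> trs C p = 1} = {\<one>\<^bsub>PG C\<^esub>, Ebar} \<and>
        (\<forall>v. Dop C Ebar v = - v))"


section \<open>Wavefunctions\<close>

text \<open>
  A wavefunction with values in the \<open>m\<close>-fold sum of \<open>V\<^sub>0\<close> is a function \<open>f\<close> with components
  \<open>f r 0, \<dots>, f r (m - 1)\<close> (the others are zero).  Wavefunctions stand for their classes modulo
  equality almost everywhere, and the sets of wavefunctions below are unions of such classes.
\<close>

type_synonym ('d, 'v) wavefun = "real ^ 'd \<Rightarrow> nat \<Rightarrow> complex ^ 'v"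

definition aeq :: "('d::finite, 'v::finite) wavefun \<Rightarrow> ('d, 'v) wavefun \<Rightarrow> bool"
    (infix \<open>\<approx>\<^sub>a\<^sub>e\<close> 50) where
  "f \<approx>\<^sub>a\<^sub>e g \<longleftrightarrow> (AE r in lborel. f r = g r)"

definition scl :: "complex \<Rightarrow> ('d::finite, 'v::finite) wavefun \<Rightarrow> ('d, 'v) wavefun" where
  "scl c f = (\<lambda>r i. c *s f r i)"

definition plane_wave :: "real ^ 'd::finite \<Rightarrow> ('d, 'v::finite) wavefun \<Rightarrow> ('d, 'v) wavefun" where
  "plane_wave k f = (\<lambda>r i. cis (k \<bullet> r) *s f r i)"

definition wavefuns :: "nat \<Rightarrow> ('d::finite, 'v::finite) wavefun set" where
  "wavefuns m = {f. (\<forall>i. (\<lambda>r. f r i) \<in> borel_measurable borel) \<and> (\<forall>r. \<forall>i\<ge>m. f r i = 0)}"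

definition loc_sq_integrable :: "('d::finite, 'v::finite) wavefun \<Rightarrow> bool" where
  "loc_sq_integrable f \<longleftrightarrow>
     (\<forall>S i. compact S \<longrightarrow> set_integrable lborel S (\<lambda>r. (norm (f r i))\<^sup>2))"

definition bloch_space ::
    "('d::finite, 'p, 'v::finite) crystal \<Rightarrow> nat \<Rightarrow> real ^ 'd \<Rightarrow> ('d, 'v) wavefun set" where
  "bloch_space C m k =
     {f \<in> wavefuns m. loc_sq_integrable f \<and>
        (\<forall>R\<in>BL C. (\<lambda>r. f (r + R)) \<approx>\<^sub>a\<^sub>e scl (cis (k \<bullet> R)) f)}"

definition inner_cell ::
    "('d::finite, 'p, 'v::finite) crystal \<Rightarrow> nat \<Rightarrow> ('d, 'v) wavefun \<Rightarrow> ('d, 'v) wavefun \<Rightarrow> complex"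
  where
  "inner_cell C m f g = (LINT r:unit_cell C|lborel. (\<Sum>i<m. cdot (f r i) (g r i)))"

definition norm_cell ::
    "('d::finite, 'p, 'v::finite) crystal \<Rightarrow> nat \<Rightarrow> ('d, 'v) wavefun \<Rightarrow> real" where
  "norm_cell C m f = sqrt (Re (inner_cell C m f f))"

text \<open>The operator \<open>g\<close>-hat; \<open>D\<^sub>p\<close> acts on each of the \<open>m\<close> components.\<close>

definition ghat ::
    "('d::finite, 'p, 'v::finite) crystal \<Rightarrow> 'p \<times> (real ^ 'd) \<Rightarrow> ('d, 'v) wavefun \<Rightarrow> ('d, 'v) wavefun"
  where
  "ghat C g f = (\<lambda>r i. Dop C (fst g) (f (act C (inv\<^bsub>space_group C\<^esub> g) r) i))"

definition orthonormal_basis ::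
    "('d::finite, 'p, 'v::finite) crystal \<Rightarrow> nat \<Rightarrow> real ^ 'd \<Rightarrow> 'j set \<Rightarrow>
     ('j \<Rightarrow> ('d, 'v) wavefun) \<Rightarrow> ('d, 'v) wavefun set \<Rightarrow> bool" where
  "orthonormal_basis C m k J \<psi> V \<longleftrightarrow>
     finite J \<and> (\<forall>j\<in>J. \<psi> j \<in> bloch_space C m k) \<and>
     (\<forall>i\<in>J. \<forall>j\<in>J. inner_cell C m (\<psi> i) (\<psi> j) = (if i = j then 1 else 0)) \<and>
     V = {f \<in> bloch_space C m k. \<exists>c. f \<approx>\<^sub>a\<^sub>e (\<Sum>j\<in>J. scl (c j) (\<psi> j))}"


section \<open>Analyticity\<close>

text \<open>
  Real-analyticity of functions of \<open>k\<close> with values in the Hilbert space \<open>bloch_space C m 0\<close> of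
  lattice-periodic wavefunctions, resp. in its bounded operators with the operator norm: local
  expansion into a power series that converges (unconditionally) in norm.
\<close>

definition monomial :: "('d::finite \<Rightarrow> nat) \<Rightarrow> real ^ 'd \<Rightarrow> real" where
  "monomial \<alpha> x = (\<Prod>i\<in>UNIV. (x $ i) ^ \<alpha> i)"

definition analytic_vectors ::
    "('d::finite, 'p, 'v::finite) crystal \<Rightarrow> nat \<Rightarrow> (real ^ 'd \<Rightarrow> ('d, 'v) wavefun) \<Rightarrow> bool" where
  "analytic_vectors C m F \<longleftrightarrow>
     (\<forall>k\<^sub>0. \<exists>\<rho>>0. \<exists>c. (\<forall>\<alpha>. c \<alpha> \<in> bloch_space C m 0) \<and>
        (\<forall>k. (\<forall>i. \<bar>k $ i - k\<^sub>0 $ i\<bar> < \<rho>) \<longrightarrow>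
           ((\<lambda>S. norm_cell C m
                   (F k - (\<Sum>\<alpha>\<in>S. scl (of_real (monomial \<alpha> (k - k\<^sub>0))) (c \<alpha>)))) \<longlongrightarrow> 0)
             (finite_subsets_at_top UNIV)))"

definition bounded_op ::
    "('d::finite, 'p, 'v::finite) crystal \<Rightarrow> nat \<Rightarrow> (('d, 'v) wavefun \<Rightarrow> ('d, 'v) wavefun) \<Rightarrow> bool"
  where
  "bounded_op C m T \<longleftrightarrow>
     (\<forall>f\<in>bloch_space C m 0. T f \<in> bloch_space C m 0) \<and>
     (\<forall>f\<in>bloch_space C m 0. \<forall>g\<in>bloch_space C m 0. T (f + g) \<approx>\<^sub>a\<^sub>e T f + T g) \<and>
     (\<forall>c. \<forall>f\<in>bloch_space C m 0. T (scl c f) \<approx>\<^sub>a\<^sub>e scl c (T f)) \<and>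
     (\<exists>B. \<forall>f\<in>bloch_space C m 0. norm_cell C m (T f) \<le> B * norm_cell C m f)"

definition analytic_operators ::
    "('d::finite, 'p, 'v::finite) crystal \<Rightarrow> nat \<Rightarrow>
     (real ^ 'd \<Rightarrow> ('d, 'v) wavefun \<Rightarrow> ('d, 'v) wavefun) \<Rightarrow> bool" where
  "analytic_operators C m T \<longleftrightarrow>
     (\<forall>k\<^sub>0. \<exists>\<rho>>0. \<exists>c. (\<forall>\<alpha>. bounded_op C m (c \<alpha>)) \<and>
        (\<forall>k. (\<forall>i. \<bar>k $ i - k\<^sub>0 $ i\<bar> < \<rho>) \<longrightarrow>
           (\<forall>\<epsilon>>0. \<forall>\<^sub>F S in finite_subsets_at_top UNIV. \<forall>f\<in>bloch_space C m 0.
              norm_cell C m (T k f - (\<Sum>\<alpha>\<in>S. scl (of_real (monomial \<alpha> (k - k\<^sub>0))) (c \<alpha> f)))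
                \<le> \<epsilon> * norm_cell C m f)))"


section \<open>Bands\<close>

type_synonym ('d, 'v) fibres = "real ^ 'd \<Rightarrow> ('d, 'v) wavefun set"

text \<open>
  The orthogonal projection \<open>P(k)\<close> onto the fibre at \<open>k\<close>; its values are determined up to
  equality almost everywhere.
\<close>

definition band_proj ::
    "('d::finite, 'p, 'v::finite) crystal \<Rightarrow> nat \<Rightarrow> ('d, 'v) fibres \<Rightarrow>
     real ^ 'd \<Rightarrow> ('d, 'v) wavefun \<Rightarrow> ('d, 'v) wavefun" where
  "band_proj C m E k f = (SOME g. g \<in> E k \<and> (\<forall>h\<in>E k. inner_cell C m h (f - g) = 0))"

definition band ::
    "('d::finite, 'p, 'v::finite) crystal \<Rightarrow> nat \<Rightarrow> nat \<Rightarrow> ('d, 'v) fibres \<Rightarrow> bool" where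
  "band C m N E \<longleftrightarrow>
     m \<ge> 1 \<and>
     (\<forall>k. \<exists>\<psi>. orthonormal_basis C m k {..<N} \<psi> (E k)) \<and>
     (\<forall>k. \<forall>K\<in>RL C. E (k + K) = E k) \<and>
     analytic_operators C m (\<lambda>k f. plane_wave (- k) (band_proj C m E k (plane_wave k f))) \<and>
     (\<forall>g\<in>carrier (space_group C). \<forall>k.
        ghat C g ` E k = E (trs C (fst g) *\<^sub>R (rot C (fst g) *v k)))"

definition splits_into ::
    "('d::finite, 'p, 'v::finite) crystal \<Rightarrow> nat \<Rightarrow> ('d, 'v) fibres \<Rightarrow> ('d, 'v) fibres list \<Rightarrow> bool"
  where
  "splits_into C m E Fs \<longleftrightarrow>
     (\<forall>F\<in>set Fs. \<exists>N. band C m N F) \<and>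
     (\<forall>k. (\<forall>i<length Fs. \<forall>j<length Fs. i \<noteq> j \<longrightarrow>
             (\<forall>f\<in>(Fs ! i) k. \<forall>g\<in>(Fs ! j) k. inner_cell C m f g = 0)) \<and>
          E k = {f \<in> bloch_space C m k.
                   \<exists>h. (\<forall>j<length Fs. h j \<in> (Fs ! j) k) \<and> f \<approx>\<^sub>a\<^sub>e (\<Sum>j<length Fs. h j)})"

text \<open>
  Whitney sum of \<open>E\<close>, with values in the \<open>m\<close>-fold sum of \<open>V\<^sub>0\<close>, and \<open>E'\<close>: the components of the
  second summand come after the first \<open>m\<close>.
\<close>

definition whitney_sum ::
    "nat \<Rightarrow> ('d::finite, 'v::finite) fibres \<Rightarrow> ('d, 'v) fibres \<Rightarrow> ('d, 'v) fibres" where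
  "whitney_sum m E E' k =
     {(\<lambda>r i. if i < m then f r i else f' r (i - m)) | f f'. f \<in> E k \<and> f' \<in> E' k}"


section \<open>First Chern class of a simple band\<close>

text \<open>
  The first Chern class of the line bundle over \<open>T\<^sup>d\<close> with fibre \<open>E k\<close> is the image of its
  transition functions under the connecting map \<open>H\<^sup>1(T\<^sup>d, U(1)) \<rightarrow> H\<^sup>2(T\<^sup>d, \<int>)\<close> of the exponential
  sequence, in Cech cohomology.  Open sets and functions on the torus are \<open>RL\<close>-periodic ones on
  \<open>\<real>\<^sup>d\<close>.  As the torus is compact, finite covers suffice.
\<close>

definition torus_cover ::
    "('d::finite, 'p, 'v::finite) crystal \<Rightarrow> nat \<Rightarrow> (nat \<Rightarrow> (real ^ 'd) set) \<Rightarrow> bool" where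
  "torus_cover C n U \<longleftrightarrow>
     (\<forall>a<n. open (U a) \<and> (\<forall>k\<in>U a. \<forall>K\<in>RL C. k + K \<in> U a)) \<and> (\<Union>a<n. U a) = UNIV"

definition torus_function ::
    "('d::finite, 'p, 'v::finite) crystal \<Rightarrow> (real ^ 'd) set \<Rightarrow>
     (real ^ 'd \<Rightarrow> 'b::topological_space) \<Rightarrow> bool" where
  "torus_function C W \<theta> \<longleftrightarrow>
     continuous_on W \<theta> \<and> (\<forall>k\<in>W. \<forall>K\<in>RL C. \<theta> (k + K) = \<theta> k)"

definition unit_section ::
    "('d::finite, 'p, 'v::finite) crystal \<Rightarrow> nat \<Rightarrow> ('d, 'v) fibres \<Rightarrow> (real ^ 'd) set \<Rightarrow>
     (real ^ 'd \<Rightarrow> ('d, 'v) wavefun) \<Rightarrow> bool" where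
  "unit_section C m E W s \<longleftrightarrow>
     (\<forall>k\<in>W. s k \<in> E k \<and> inner_cell C m (s k) (s k) = 1 \<and> (\<forall>K\<in>RL C. s (k + K) \<approx>\<^sub>a\<^sub>e s k)) \<and>
     (\<forall>k\<^sub>0\<in>W. ((\<lambda>k. norm_cell C m (plane_wave (- k) (s k) - plane_wave (- k\<^sub>0) (s k\<^sub>0)))
                  \<longlongrightarrow> 0) (at k\<^sub>0 within W))"

definition c1_cocycle ::
    "('d::finite, 'p, 'v::finite) crystal \<Rightarrow> nat \<Rightarrow> ('d, 'v) fibres \<Rightarrow> nat \<Rightarrow>
     (nat \<Rightarrow> (real ^ 'd) set) \<Rightarrow> (nat \<Rightarrow> nat \<Rightarrow> nat \<Rightarrow> real ^ 'd \<Rightarrow> int) \<Rightarrow> bool" where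
  "c1_cocycle C m E n U z \<longleftrightarrow>
     torus_cover C n U \<and>
     (\<exists>s \<theta>.
        (\<forall>a<n. unit_section C m E (U a) (s a)) \<and>
        (\<forall>a<n. \<forall>b<n. torus_function C (U a \<inter> U b) (\<theta> a b :: real ^ 'd \<Rightarrow> real) \<and>
           (\<forall>k\<in>U a \<inter> U b. s b k \<approx>\<^sub>a\<^sub>e scl (cis (2 * pi * \<theta> a b k)) (s a k))) \<and>
        (\<forall>a<n. \<forall>b<n. \<forall>c<n. \<forall>k\<in>U a \<inter> U b \<inter> U c.
           of_int (z a b c k) = \<theta> b c k - \<theta> a c k + \<theta> a b k))"

text \<open>
  A Cech class vanishes iff one of its representatives, over some cover, is the coboundary of a
  cochain of continuous (that is, locally constant) integer-valued functions.
\<close>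

definition c1_vanishes ::
    "('d::finite, 'p, 'v::finite) crystal \<Rightarrow> nat \<Rightarrow> ('d, 'v) fibres \<Rightarrow> bool" where
  "c1_vanishes C m E \<longleftrightarrow>
     (\<exists>n U z \<nu>. c1_cocycle C m E n U z \<and>
        (\<forall>a<n. \<forall>b<n. torus_function C (U a \<inter> U b) (\<nu> a b :: real ^ 'd \<Rightarrow> int)) \<and>
        (\<forall>a<n. \<forall>b<n. \<forall>c<n. \<forall>k\<in>U a \<inter> U b \<inter> U c.
           z a b c k = \<nu> b c k - \<nu> a c k + \<nu> a b k))"


section \<open>Localizable bands and band representations\<close>

text \<open>
  Measurability in \<open>(k, r)\<close> fixes representatives for which the integral over \<open>k\<close> in the Wannier
  functions makes sense pointwise in \<open>r\<close>; an analytic periodic frame always has such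
  representatives.
\<close>

definition analytic_periodic_frame ::
    "('d::finite, 'p, 'v::finite) crystal \<Rightarrow> nat \<Rightarrow> ('d, 'v) fibres \<Rightarrow> 'j set \<Rightarrow>
     ('j \<Rightarrow> real ^ 'd \<Rightarrow> ('d, 'v) wavefun) \<Rightarrow> bool" where
  "analytic_periodic_frame C m E J \<psi> \<longleftrightarrow>
     (\<forall>k. orthonormal_basis C m k J (\<lambda>j. \<psi> j k) (E k)) \<and>
     (\<forall>j\<in>J. analytic_vectors C m (\<lambda>k. plane_wave (- k) (\<psi> j k)) \<and>
        (\<forall>k. \<forall>K\<in>RL C. \<psi> j (k + K) \<approx>\<^sub>a\<^sub>e \<psi> j k) \<and>
        (\<forall>i. (\<lambda>x. \<psi> j (fst x) (snd x) i) \<in> borel_measurable borel))"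

definition localizable ::
    "('d::finite, 'p, 'v::finite) crystal \<Rightarrow> nat \<Rightarrow> ('d, 'v) fibres \<Rightarrow> bool" where
  "localizable C m E \<longleftrightarrow>
     (\<exists>N. band C m N E \<and>
        (\<exists>\<psi> :: nat \<Rightarrow> real ^ 'd \<Rightarrow> ('d, 'v) wavefun. analytic_periodic_frame C m E {..<N} \<psi>))"

definition wannier ::
    "('d::finite, 'p, 'v::finite) crystal \<Rightarrow> (real ^ 'd \<Rightarrow> ('d, 'v) wavefun) \<Rightarrow> real ^ 'd \<Rightarrow>
     ('d, 'v) wavefun" where
  "wannier C \<psi> R =
     (\<lambda>r i. (1 / sqrt (measure lborel (BZ C))) *\<^sub>R
        (LINT k:BZ C|lborel. cis (- (k \<bullet> R)) *s \<psi> k r i))"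

text \<open>
  \<open>wannier_space C m M l \<omega> \<psi> x\<close> is the space \<open>W\<^sub>x\<close> for \<open>x = \<omega>\<^sub>n + R\<close>, where \<open>n < M\<close> and
  \<open>\<alpha> < l n\<close>; the pair \<open>(n, R)\<close> is unique when the \<open>\<omega>\<^sub>n\<close> are distinct modulo \<open>BL\<close>.
\<close>

definition wannier_space ::
    "('d::finite, 'p, 'v::finite) crystal \<Rightarrow> nat \<Rightarrow> nat \<Rightarrow> (nat \<Rightarrow> nat) \<Rightarrow> (nat \<Rightarrow> real ^ 'd) \<Rightarrow>
     (nat \<times> nat \<Rightarrow> real ^ 'd \<Rightarrow> ('d, 'v) wavefun) \<Rightarrow> real ^ 'd \<Rightarrow> ('d, 'v) wavefun set" where
  "wannier_space C m M l \<omega> \<psi> x =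
     {f \<in> wavefuns m. \<exists>n<M. \<exists>R\<in>BL C. x = \<omega> n + R \<and>
        (\<exists>c. f \<approx>\<^sub>a\<^sub>e (\<Sum>\<alpha><l n. scl (c \<alpha>) (wannier C (\<psi> (n, \<alpha>)) R)))}"

definition band_rep ::
    "('d::finite, 'p, 'v::finite) crystal \<Rightarrow> nat \<Rightarrow> ('d, 'v) fibres \<Rightarrow> bool" where
  "band_rep C m E \<longleftrightarrow>
     (\<exists>N. band C m N E) \<and>
     (\<exists>M l \<omega> \<psi>.
        (\<forall>n<M. l n \<ge> 1) \<and>
        (\<forall>n<M. \<forall>n'<M. n \<noteq> n' \<longrightarrow> \<omega> n - \<omega> n' \<notin> BL C) \<and>
        analytic_periodic_frame C m E {(n, \<alpha>). n < M \<and> \<alpha> < l n} \<psi> \<and>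
        (let X = {\<omega> n + R | n R. n < M \<and> R \<in> BL C} in
           \<forall>g\<in>carrier (space_group C).
             act C g ` X = X \<and>
             (\<forall>x\<in>X. ghat C g ` wannier_space C m M l \<omega> \<psi> x =
                      wannier_space C m M l \<omega> \<psi> (act C g x))))"

definition elementary_band_rep ::
    "('d::finite, 'p, 'v::finite) crystal \<Rightarrow> nat \<Rightarrow> nat \<Rightarrow> ('d, 'v) fibres \<Rightarrow> bool" where
  "elementary_band_rep C m N E \<longleftrightarrow>
     band C m N E \<and> band_rep C m E \<and>
     \<not> (\<exists>Fs. length Fs \<ge> 2 \<and> splits_into C m E Fs \<and>
           (\<forall>F\<in>set Fs. band_rep C m F \<and> (\<exists>N'. 0 < N' \<and> N' < N \<and> band C m N' F)))"

definition localizable_topological ::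
    "('d::finite, 'p, 'v::finite) crystal \<Rightarrow> nat \<Rightarrow> ('d, 'v) fibres \<Rightarrow> bool" where
  "localizable_topological C m E \<longleftrightarrow> localizable C m E \<and> \<not> band_rep C m E"

definition fragile_localizable_topological ::
    "('d::finite, 'p, 'v::finite) crystal \<Rightarrow> nat \<Rightarrow> ('d, 'v) fibres \<Rightarrow> bool" where
  "fragile_localizable_topological C m E \<longleftrightarrow>
     localizable_topological C m E \<and>
     (\<exists>m' E'. band_rep C m' E' \<and> band_rep C (m + m') (whitney_sum m E E'))"

definition simple_band ::
    "('d::finite, 'p, 'v::finite) crystal \<Rightarrow> nat \<Rightarrow> ('d, 'v) fibres \<Rightarrow> bool" where
  "simple_band C m E \<longleftrightarrow> band C m 1 E"

end

theory Submission
 imports Defs "HOL-Complex_Analysis.Cauchy_Integral_Formula"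
begin

text \<open>
 (a) In an analytic periodic frame of the band representation, a frame of \<open>S\<^sub>1\<close> is a family of
 orthonormal columns.  A unit column with \<open>n \<ge> 3\<close> entries is a smooth map from \<open>\<real>\<^sup>d\<close>, \<open>d \<le> 3\<close>, to a
 sphere of dimension \<open>2 n - 1 \<ge> 5\<close>, so it misses a point, and a Householder-like unitary that is
 analytic in \<open>k\<close> takes that point to the column; for \<open>n = 2\<close> the complement of the column is
 explicit.  Splitting off the columns one by one leaves a frame of \<open>S\<^sub>2\<close>.  By elementarity \<open>S\<^sub>2\<close> is not
 a band representation.  If \<open>\<psi>\<close> is the frame of \<open>E\<close> and \<open>P\<^sub>1, P\<^sub>2\<close> are the projections onto the two
 bands, the sections \<open>(P\<^sub>2 \<psi>, P\<^sub>1 \<psi>)\<close> of \<open>S\<^sub>2 \<oplus> S\<^sub>1\<close> are an orthonormal frame that transforms like \<open>\<psi>\<close>.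

 (b) A vanishing Chern class gives a continuous periodic section of a simple band.  Approximating its
 coefficients by trigonometric polynomials, projecting back and normalising makes it analytic.
 The phases of the point group in this gauge are a cocycle up to constants; subtracting their average
 over the group leaves factors \<open>e\<^sup>-\<^sup>i\<^sup>q\<^sup>\<cdot>\<^sup>\<xi>\<close> with \<open>\<xi>\<close> a lattice vector, which come from one position
 \<open>\<omega>\<close>.  The sections with the same \<open>\<omega>\<close> modulo \<open>BL\<close> span the Wannier spaces at \<open>\<omega>\<close>.

 By uniqueness of Fourier coefficients, covariance of Wannier functions means that the Bloch functions
 transform with constant matrices times such factors.
\<close>

section \<open>Semi-inner products\<close>

text \<open>The bound on \<open>d\<close> enters through a count of dimensions. All constructions
  must be analytic and periodic at once. This rules out cut-off functions and leaves expressions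
  rational in the coefficients and their conjugates, or projections of trigonometric polynomials. In
  (b) a continuous section \<open>s\<close> of a simple band has coefficients \<open>f i\<close>
  that are known to be continuous only, since its phase is arbitrary. The products
  \<open>f i * cnj (f j)\<close> are free of that phase: they are matrix elements of the projection,
  hence analytic. For this reason the projected polynomials are analytic, although \<open>s\<close>
  is not known to be. Wavefunctions are determined only almost everywhere. The Hilbert space
  therefore appears as a semi-inner product on representatives, and membership in a span as the
  vanishing of the norm of a residual.\<close>

lemma mult_cnj_cmod: "z * cnj z = (complex_of_real (cmod z))\<^sup>2" "cnj z * z = (complex_of_real (cmod z))\<^sup>2"
 using complex_norm_square[of z] by (simp_all add: mult.commute)

text \<open>Representatives that agree almost everywhere are not identified, so the form is only
  positive semidefinite. The vectors form a set \<open>V\<close> because the square integrable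
  wavefunctions are a subset of a function type; \<open>minus_smul\<close> ties the group structure
  of that type to the scaling.\<close>

locale semi_inner =
 fixes V :: "'a::ab_group_add set" and smul :: "complex \<Rightarrow> 'a \<Rightarrow> 'a" (infixr \<open>\<odot>\<close> 75)
  and ip :: "'a \<Rightarrow> 'a \<Rightarrow> complex"
 assumes zero_mem: "0 \<in> V"
  and add_mem: "x \<in> V \<Longrightarrow> y \<in> V \<Longrightarrow> x + y \<in> V"
  and smul_mem: "x \<in> V \<Longrightarrow> c \<odot> x \<in> V"
  and minus_smul: "- x = (-1) \<odot> x"
  and ip_add: "x \<in> V \<Longrightarrow> y \<in> V \<Longrightarrow> z \<in> V \<Longrightarrow> ip x (y + z) = ip x y + ip x z"
  and ip_smul: "x \<in> V \<Longrightarrow> y \<in> V \<Longrightarrow> ip x (c \<odot> y) = c * ip x y"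
  and ip_cnj: "x \<in> V \<Longrightarrow> y \<in> V \<Longrightarrow> ip y x = cnj (ip x y)"
  and ip_ge0: "x \<in> V \<Longrightarrow> 0 \<le> Re (ip x x)"
begin

definition nrm :: "'a \<Rightarrow> real" where "nrm x = sqrt (Re (ip x x))"

lemma minus_mem: "x \<in> V \<Longrightarrow> - x \<in> V"
 by (simp add: minus_smul smul_mem)

lemma diff_mem: "x \<in> V \<Longrightarrow> y \<in> V \<Longrightarrow> x - y \<in> V"
 using add_mem[OF _ minus_mem] by fastforce

lemma sum_mem: "(\<And>i. i \<in> I \<Longrightarrow> f i \<in> V) \<Longrightarrow> (\<Sum>i\<in>I. f i) \<in> V"
 by (induction I rule: infinite_finite_induct) (auto simp: zero_mem add_mem)

lemma ip_minus: "x \<in> V \<Longrightarrow> y \<in> V \<Longrightarrow> ip x (- y) = - ip x y"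
 by (simp add: minus_smul ip_smul)

lemma ip_diff: "x \<in> V \<Longrightarrow> y \<in> V \<Longrightarrow> z \<in> V \<Longrightarrow> ip x (y - z) = ip x y - ip x z"
 using ip_add[of x y "-z"] by (simp add: ip_minus minus_mem)

lemma ip_zero: "x \<in> V \<Longrightarrow> ip x 0 = 0"
 using ip_diff[of x x x] by simp

lemma ip_add_left: "x \<in> V \<Longrightarrow> y \<in> V \<Longrightarrow> z \<in> V \<Longrightarrow> ip (y + z) x = ip y x + ip z x"
 by (metis add_mem complex_cnj_add ip_add ip_cnj)

lemma ip_diff_left: "x \<in> V \<Longrightarrow> y \<in> V \<Longrightarrow> z \<in> V \<Longrightarrow> ip (y - z) x = ip y x - ip z x"
 by (metis diff_mem complex_cnj_diff ip_diff ip_cnj)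

lemma ip_smul_left: "x \<in> V \<Longrightarrow> y \<in> V \<Longrightarrow> ip (c \<odot> y) x = cnj c * ip y x"
 by (metis smul_mem complex_cnj_mult ip_smul ip_cnj)

lemma ip_zero_left: "x \<in> V \<Longrightarrow> ip 0 x = 0"
 using ip_diff_left[of x x x] by simp

lemma ip_sum: "x \<in> V \<Longrightarrow> (\<And>i. i \<in> I \<Longrightarrow> f i \<in> V) \<Longrightarrow> ip x (\<Sum>i\<in>I. f i) = (\<Sum>i\<in>I. ip x (f i))"
 by (induction I rule: infinite_finite_induct) (auto simp: ip_zero ip_add sum_mem)

lemma ip_sum_left:
 "x \<in> V \<Longrightarrow> (\<And>i. i \<in> I \<Longrightarrow> f i \<in> V) \<Longrightarrow> ip (\<Sum>i\<in>I. f i) x = (\<Sum>i\<in>I. ip (f i) x)"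
 by (induction I rule: infinite_finite_induct) (auto simp: ip_zero_left ip_add_left sum_mem)

lemma nrm_ge0: "x \<in> V \<Longrightarrow> 0 \<le> nrm x"
 by (simp add: nrm_def ip_ge0)

lemma ip_self: "x \<in> V \<Longrightarrow> ip x x = of_real ((nrm x)\<^sup>2)"
 using ip_cnj[of x x] ip_ge0[of x] by (auto simp: nrm_def complex_eq_iff)

lemma nrm_smul: assumes "x \<in> V" shows "nrm (c \<odot> x) = cmod c * nrm x"
proof -
 have "ip (c \<odot> x) (c \<odot> x) = (cmod c)\<^sup>2 * ip x x"
  using assms by (simp add: ip_smul ip_smul_left smul_mem mult_cnj_cmod flip: mult.assoc)
 thus ?thesis
  unfolding nrm_def by (simp add: real_sqrt_mult)
qed

lemma cauchy_schwarz:
 assumes x: "x \<in> V" and y: "y \<in> V" shows "cmod (ip x y) \<le> nrm x * nrm y"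
proof -
 \<comment> \<open>The square norm of \<open>x - c y\<close> with \<open>c = t <y, x>\<close>, as a
   quadratic in the real number \<open>t\<close>. It replaces a division by \<open>nrm y\<close>,
   which may be 0 for a nonzero \<open>y\<close>.\<close>
 have quad: "0 \<le> (nrm x)\<^sup>2 - 2 * t * (cmod (ip x y))\<^sup>2 + t\<^sup>2 * (cmod (ip x y))\<^sup>2 * (nrm y)\<^sup>2" for t :: real
 proof -
  define c where "c = of_real t * ip y x"
  have cc: "c * ip x y = of_real (t * (cmod (ip x y))\<^sup>2)"
   unfolding c_def of_real_mult of_real_power
   using complex_norm_square[of "ip x y"] ip_cnj[OF x y] by (simp add: mult_ac)
  have "ip (x - c \<odot> y) (x - c \<odot> y)
    = ip x x - c * ip x y - cnj (c * ip x y) + c * cnj c * ip y y"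
   using x y ip_cnj[OF x y]
   by (simp add: ip_diff ip_diff_left ip_smul ip_smul_left smul_mem diff_mem algebra_simps)
  moreover have "c * cnj c = of_real (t\<^sup>2 * (cmod (ip x y))\<^sup>2)"
   unfolding mult_cnj_cmod using ip_cnj[OF x y] by (simp add: c_def norm_mult power_mult_distrib flip: of_real_power)
  ultimately have "Re (ip (x - c \<odot> y) (x - c \<odot> y))
    = (nrm x)\<^sup>2 - 2 * (t * (cmod (ip x y))\<^sup>2) + t\<^sup>2 * (cmod (ip x y))\<^sup>2 * (nrm y)\<^sup>2"
   unfolding cc by (simp add: ip_self x y flip: of_real_mult of_real_power)
  thus ?thesis
   using ip_ge0[OF diff_mem[OF x smul_mem[OF y, of c]]] by (simp add: mult.assoc)
 qed
 let ?q = "(cmod (ip x y))\<^sup>2"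
 have "?q \<le> (nrm x)\<^sup>2 * (nrm y)\<^sup>2"
 proof (cases "nrm y = 0")
  case True
  have "?q = 0"
  proof (rule ccontr)
   assume "?q \<noteq> 0"
   hence q: "?q > 0" by simp
   \<comment> \<open>With \<open>nrm y = 0\<close> the bound is affine in \<open>t\<close>, and at
     this \<open>t\<close> it reads \<open>0 \<le> - 1\<close>.\<close>
   show False using quad[of "((nrm x)\<^sup>2 + 1) / (2 * ?q)"] q True by (simp add: field_simps)
  qed
  thus ?thesis by simp
 next
  case False
  hence Y: "(nrm y)\<^sup>2 > 0" by simp
  hence "(1 / (nrm y)\<^sup>2)\<^sup>2 * ?q * (nrm y)\<^sup>2 = 1 / (nrm y)\<^sup>2 * ?q"
   by (simp add: power2_eq_square)
  hence "?q / (nrm y)\<^sup>2 \<le> (nrm x)\<^sup>2" using quad[of "1 / (nrm y)\<^sup>2"] by simp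
  thus ?thesis using Y by (simp add: pos_divide_le_eq)
 qed
 hence "?q \<le> (nrm x * nrm y)\<^sup>2" by (simp add: power_mult_distrib)
 thus ?thesis
  using nrm_ge0[OF x] nrm_ge0[OF y] by (meson mult_nonneg_nonneg power2_le_imp_le)
qed

lemma nrm_triangle:
 assumes x: "x \<in> V" and y: "y \<in> V" shows "nrm (x + y) \<le> nrm x + nrm y"
proof -
 have "(nrm (x + y))\<^sup>2 = Re (ip (x + y) (x + y))"
  by (simp add: nrm_def ip_ge0 add_mem x y)
 also have "\<dots> = (nrm x)\<^sup>2 + (nrm y)\<^sup>2 + 2 * Re (ip x y)"
  using ip_cnj[OF x y] by (simp add: ip_add ip_add_left add_mem x y nrm_def ip_ge0)
 also have "\<dots> \<le> (nrm x)\<^sup>2 + (nrm y)\<^sup>2 + 2 * (nrm x * nrm y)"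
  using cauchy_schwarz[OF x y] complex_Re_le_cmod[of "ip x y"] by linarith
 also have "\<dots> = (nrm x + nrm y)\<^sup>2" by (simp add: power2_sum)
 finally show ?thesis using nrm_ge0[OF x] nrm_ge0[OF y] by (meson add_nonneg_nonneg power2_le_imp_le)
qed

lemma nrm_minus: "x \<in> V \<Longrightarrow> nrm (- x) = nrm x"
 by (simp add: minus_smul nrm_smul)

lemma nrm_diff: "x \<in> V \<Longrightarrow> y \<in> V \<Longrightarrow> nrm (x - y) \<le> nrm x + nrm y"
 using nrm_triangle[of x "-y"] by (simp add: nrm_minus minus_mem)

lemma nrm_zero: "nrm 0 = 0"
 by (simp add: nrm_def ip_zero zero_mem)

lemma nrm_sum:
 "finite I \<Longrightarrow> (\<And>i. i \<in> I \<Longrightarrow> f i \<in> V) \<Longrightarrow> nrm (\<Sum>i\<in>I. f i) \<le> (\<Sum>i\<in>I. nrm (f i))"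
proof (induction I rule: finite_induct)
 case (insert i I)
 hence "nrm (f i + sum f I) \<le> nrm (f i) + nrm (sum f I)"
  by (intro nrm_triangle sum_mem) auto
 with insert show ?case by fastforce
qed (simp add: nrm_zero)

section \<open>Orthonormal systems and residuals\<close>

definition ons :: "'i set \<Rightarrow> ('i \<Rightarrow> 'a) \<Rightarrow> bool" where
 "ons I e \<longleftrightarrow> finite I \<and> (\<forall>i\<in>I. e i \<in> V) \<and>
   (\<forall>i\<in>I. \<forall>j\<in>I. ip (e i) (e j) = (if i = j then 1 else 0))"

text \<open>\<open>nrm (res I e x) = 0\<close> is how membership of \<open>x\<close> in the span of
  \<open>e\<close>, modulo null vectors, is expressed throughout.\<close>

definition res :: "'i set \<Rightarrow> ('i \<Rightarrow> 'a) \<Rightarrow> 'a \<Rightarrow> 'a" where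
 "res I e x = x - (\<Sum>i\<in>I. ip (e i) x \<odot> e i)"

lemma res_mem: "ons I e \<Longrightarrow> x \<in> V \<Longrightarrow> res I e x \<in> V"
 unfolding res_def ons_def by (intro diff_mem sum_mem smul_mem) auto

lemma ip_ons_sum:
 assumes "ons I e" "j \<in> I" shows "ip (e j) (\<Sum>i\<in>I. c i \<odot> e i) = c j"
proof -
 have "ip (e j) (\<Sum>i\<in>I. c i \<odot> e i) = (\<Sum>i\<in>I. c i * (if j = i then 1 else 0))"
  using assms by (simp add: ons_def ip_sum smul_mem ip_smul)
 also have "\<dots> = c j" using assms by (simp add: ons_def sum.delta' if_distrib cong: if_cong)
 finally show ?thesis .
qed

lemma ip_ons_res: "ons I e \<Longrightarrow> j \<in> I \<Longrightarrow> x \<in> V \<Longrightarrow> ip (e j) (res I e x) = 0"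
 unfolding res_def using ip_ons_sum[of I e j "\<lambda>i. ip (e i) x"]
 by (subst ip_diff) (auto simp: ons_def intro!: sum_mem smul_mem)

lemma nrm_res:
 assumes e: "ons I e" and x: "x \<in> V"
 shows "(nrm (res I e x))\<^sup>2 = (nrm x)\<^sup>2 - (\<Sum>i\<in>I. (cmod (ip (e i) x))\<^sup>2)"
proof -
 let ?s = "\<Sum>i\<in>I. ip (e i) x \<odot> e i"
 have s: "?s \<in> V" using e by (auto simp: ons_def intro!: sum_mem smul_mem)
 have eV: "\<And>i. i \<in> I \<Longrightarrow> e i \<in> V" using e by (auto simp: ons_def)
 have "ip ?s (res I e x) = 0"
  using e x res_mem[OF e x] by (subst ip_sum_left) (auto simp: eV smul_mem ip_smul_left ip_ons_res)
 hence "ip (res I e x) (res I e x) = ip x (res I e x)"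
  using res_mem[OF e x] s x by (subst res_def) (simp add: ip_diff_left)
 also have "\<dots> = ip x x - (\<Sum>i\<in>I. ip (e i) x * ip x (e i))"
  unfolding res_def using s x eV by (simp add: ip_diff ip_sum smul_mem ip_smul)
 also have "(\<Sum>i\<in>I. ip (e i) x * ip x (e i)) = of_real (\<Sum>i\<in>I. (cmod (ip (e i) x))\<^sup>2)"
  unfolding of_real_sum
  using ip_cnj[OF eV x] by (intro sum.cong refl) (simp add: mult_cnj_cmod)
 finally have "complex_of_real ((nrm (res I e x))\<^sup>2) = of_real ((nrm x)\<^sup>2 - (\<Sum>i\<in>I. (cmod (ip (e i) x))\<^sup>2))"
  by (simp add: ip_self res_mem[OF e x] x)
 thus ?thesis using of_real_eq_iff by blast
qed

lemma ip_ons_sums: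
 assumes e: "ons I e"
 shows "ip (\<Sum>i\<in>I. c i \<odot> e i) (\<Sum>i\<in>I. d i \<odot> e i) = (\<Sum>i\<in>I. cnj (c i) * d i)"
proof -
 have eV: "\<And>i. i \<in> I \<Longrightarrow> e i \<in> V" using e by (auto simp: ons_def)
 show ?thesis
  by (subst ip_sum_left) (auto simp: eV sum_mem smul_mem ip_smul_left ip_ons_sum[OF e])
qed

lemma nrm_ons: "ons I e \<Longrightarrow> i \<in> I \<Longrightarrow> nrm (e i) = 1"
 by (simp add: nrm_def ons_def)

text \<open>Double counting of the squares |<e i, f l>|^2. For fixed \<open>l\<close> they add up to
  1, since \<open>f l\<close> lies in the span of \<open>e\<close>; for fixed \<open>i\<close> they
  add up to \<open>1 - (nrm (res L f (e i)))\<^sup>2\<close>. Equal cardinalities leave no room for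
  residuals. This takes the place of dimension theory.\<close>

lemma ons_card_le:
 assumes e: "ons I e" and f: "ons L f" and r: "\<And>l. l \<in> L \<Longrightarrow> nrm (res I e (f l)) = 0"
 shows "card L \<le> card I"
  and "card L = card I \<Longrightarrow> i \<in> I \<Longrightarrow> nrm (res L f (e i)) = 0"
proof -
 have eV: "\<And>i. i \<in> I \<Longrightarrow> e i \<in> V" and fV: "\<And>i. i \<in> L \<Longrightarrow> f i \<in> V"
  and fin: "finite I" "finite L" using e f by (auto simp: ons_def)
 have 1: "1 = (\<Sum>i\<in>I. (cmod (ip (e i) (f l)))\<^sup>2)" if "l \<in> L" for l
  using nrm_res[OF e fV[OF that]] r[OF that] nrm_ons[OF f that] by simp
 have "real (card L) = (\<Sum>l\<in>L. \<Sum>i\<in>I. (cmod (ip (e i) (f l)))\<^sup>2)" using 1 by simp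
 also have "\<dots> = (\<Sum>i\<in>I. \<Sum>l\<in>L. (cmod (ip (e i) (f l)))\<^sup>2)" by (rule sum.swap)
 also have "\<dots> = (\<Sum>i\<in>I. \<Sum>l\<in>L. (cmod (ip (f l) (e i)))\<^sup>2)"
  by (intro sum.cong refl, subst ip_cnj) (auto simp: eV fV)
 also have "\<dots> = (\<Sum>i\<in>I. 1 - (nrm (res L f (e i)))\<^sup>2)"
  by (intro sum.cong refl) (simp add: nrm_res[OF f eV] nrm_ons[OF e])
 finally have eq: "real (card L) = real (card I) - (\<Sum>i\<in>I. (nrm (res L f (e i)))\<^sup>2)"
  by (simp add: sum_subtractf)
 have "0 \<le> (\<Sum>i\<in>I. (nrm (res L f (e i)))\<^sup>2)" by (intro sum_nonneg) auto
 thus "card L \<le> card I" using eq by linarith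
 assume "card L = card I" "i \<in> I"
 hence "(\<Sum>i\<in>I. (nrm (res L f (e i)))\<^sup>2) = 0" using eq by simp
 thus "nrm (res L f (e i)) = 0" using fin \<open>i \<in> I\<close> by (simp add: sum_nonneg_eq_0_iff)
qed

lemma ip_null: "x \<in> V \<Longrightarrow> y \<in> V \<Longrightarrow> nrm y = 0 \<Longrightarrow> ip x y = 0"
 using cauchy_schwarz[of x y] by simp

lemma ip_cong_null:
 assumes "x \<in> V" "y \<in> V" "z \<in> V" "nrm (y - z) = 0" shows "ip x y = ip x z"
 using ip_null[of x "y - z"] assms by (simp add: ip_diff diff_mem)

end

section \<open>Real-analytic functions of several variables\<close>

abbreviation wt :: "('d::finite \<Rightarrow> nat) \<Rightarrow> nat" where "wt \<alpha> \<equiv> sum \<alpha> UNIV"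

text \<open>The ball of radius \<open>M\<close> in the algebra of power series with finite weighted
  l1 norm at polyradius \<open>r\<close>. That norm is submultiplicative, and an explicit
  \<open>M\<close> keeps infinite sums of such functions under control.\<close>

definition pser :: "real ^ 'd::finite \<Rightarrow> real \<Rightarrow> real \<Rightarrow> (real ^ 'd \<Rightarrow> complex) \<Rightarrow> bool" where
 "pser k0 r M f \<longleftrightarrow> 0 < r \<and> (\<exists>a.
   (\<lambda>\<alpha>. norm (a \<alpha>) * r ^ wt \<alpha>) summable_on UNIV \<and> (\<Sum>\<^sub>\<infinity>\<alpha>. norm (a \<alpha>) * r ^ wt \<alpha>) \<le> M \<and>
   (\<forall>k. (\<forall>i. \<bar>k $ i - k0 $ i\<bar> \<le> r) \<longrightarrow>
    ((\<lambda>\<alpha>. a \<alpha> * of_real (monomial \<alpha> (k - k0))) has_sum f k) UNIV))"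

definition ran_at :: "real ^ 'd::finite \<Rightarrow> (real ^ 'd \<Rightarrow> complex) \<Rightarrow> bool" where
 "ran_at k0 f \<longleftrightarrow> (\<exists>r M. pser k0 r M f)"

lemma monomial_add: "monomial (\<lambda>i. \<alpha> i + \<beta> i) x = monomial \<alpha> x * monomial \<beta> x"
 by (simp add: monomial_def power_add prod.distrib)

lemma abs_monomial_le:
 assumes "\<And>i. \<bar>x $ i\<bar> \<le> r" shows "\<bar>monomial \<alpha> x\<bar> \<le> r ^ wt \<alpha>"
proof -
 have "\<bar>monomial \<alpha> x\<bar> = (\<Prod>i\<in>UNIV. \<bar>x $ i\<bar> ^ \<alpha> i)"
  by (simp add: monomial_def abs_prod power_abs)
 also have "\<dots> \<le> (\<Prod>i\<in>UNIV. r ^ \<alpha> i)"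
  by (intro prod_mono) (auto intro: power_mono assms)
 finally show ?thesis by (simp add: power_sum)
qed

lemma pser_pos: "pser k0 r M f \<Longrightarrow> 0 < r"
 by (simp add: pser_def)

lemma pser_mono: "pser k0 r M f \<Longrightarrow> M \<le> M' \<Longrightarrow> pser k0 r M' f"
 unfolding pser_def by (blast intro: order_trans)

lemma pser_cong:
 assumes "pser k0 r M f" "\<And>k. (\<And>i. \<bar>k $ i - k0 $ i\<bar> \<le> r) \<Longrightarrow> f k = g k"
 shows "pser k0 r M g"
proof -
 obtain a where a: "(\<lambda>\<alpha>. norm (a \<alpha>) * r ^ wt \<alpha>) summable_on UNIV"
   "(\<Sum>\<^sub>\<infinity>\<alpha>. norm (a \<alpha>) * r ^ wt \<alpha>) \<le> M"
   "\<And>k. \<forall>i. \<bar>k $ i - k0 $ i\<bar> \<le> r \<Longrightarrow> ((\<lambda>\<alpha>. a \<alpha> * of_real (monomial \<alpha> (k - k0))) has_sum f k) UNIV"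
  using assms(1) unfolding pser_def by blast
 have "((\<lambda>\<alpha>. a \<alpha> * of_real (monomial \<alpha> (k - k0))) has_sum g k) UNIV"
  if "\<forall>i. \<bar>k $ i - k0 $ i\<bar> \<le> r" for k
  using a(3)[OF that] assms(2)[of k] that by simp
 thus ?thesis unfolding pser_def using a(1,2) pser_pos[OF assms(1)] by blast
qed

lemma pser_bound:
 assumes "pser k0 r M f" "\<And>i. \<bar>k $ i - k0 $ i\<bar> \<le> r" shows "cmod (f k) \<le> M"
proof -
 obtain a where a: "(\<lambda>\<alpha>. norm (a \<alpha>) * r ^ wt \<alpha>) summable_on UNIV"
   "(\<Sum>\<^sub>\<infinity>\<alpha>. norm (a \<alpha>) * r ^ wt \<alpha>) \<le> M"
   "((\<lambda>\<alpha>. a \<alpha> * of_real (monomial \<alpha> (k - k0))) has_sum f k) UNIV"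
  using assms by (auto simp: pser_def)
 have "cmod (f k) \<le> (\<Sum>\<^sub>\<infinity>\<alpha>. norm (a \<alpha>) * r ^ wt \<alpha>)"
  by (rule norm_infsum_le[OF a(3) has_sum_infsum[OF a(1)]])
    (use assms(2) in \<open>auto simp: norm_mult intro!: mult_left_mono abs_monomial_le\<close>)
 thus ?thesis using a(2) by simp
qed

lemma pser_nonneg: assumes "pser k0 r M f" shows "0 \<le> M"
proof -
 have "cmod (f k0) \<le> M" using pser_bound[OF assms, of k0] pser_pos[OF assms] by simp
 thus ?thesis using norm_ge_zero[of "f k0"] by linarith
qed

text \<open>Terms with the same exponent \<open>e i\<close> are collected, by Fubini for absolutely
  summable families along the fibres of \<open>e\<close>. Products and double series produce
  repeated exponents and so take this form.\<close>

lemma pser_family: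
 fixes b :: "'i \<Rightarrow> complex" and e :: "'i \<Rightarrow> 'd::finite \<Rightarrow> nat"
 assumes r: "0 < r" and sm: "(\<lambda>i. norm (b i) * r ^ wt (e i)) summable_on I"
  and M: "(\<Sum>\<^sub>\<infinity>i\<in>I. norm (b i) * r ^ wt (e i)) \<le> M"
  and f: "\<And>k. (\<And>i. \<bar>k $ i - k0 $ i\<bar> \<le> r) \<Longrightarrow>
    ((\<lambda>i. b i * of_real (monomial (e i) (k - k0))) has_sum f k) I"
 shows "pser k0 r M f"
proof -
 define B where "B \<gamma> = {i\<in>I. e i = \<gamma>}" for \<gamma>
 define a where "a \<gamma> = (\<Sum>\<^sub>\<infinity>i\<in>B \<gamma>. b i)" for \<gamma>
 have bij: "bij_betw snd (Sigma UNIV B) I"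
  unfolding bij_betw_def inj_on_def B_def by force
 let ?n = "\<lambda>i. norm (b i) * r ^ wt (e i)"
 have S: "(\<lambda>x. ?n (snd x)) summable_on Sigma UNIV B"
  using summable_on_reindex_bij_betw[OF bij, of ?n] sm by simp
 have SB: "?n summable_on B \<gamma>" for \<gamma>
  using sm by (rule summable_on_subset_banach) (auto simp: B_def)
 have nB: "(\<lambda>i. norm (b i)) summable_on B \<gamma>" for \<gamma>
 proof -
  have "(\<lambda>i. norm (b i) * r ^ wt \<gamma>) summable_on B \<gamma>"
   by (rule summable_on_cong[THEN iffD1, OF _ SB[of \<gamma>]]) (simp add: B_def)
  hence "(\<lambda>i. norm (b i) * r ^ wt \<gamma> * inverse (r ^ wt \<gamma>)) summable_on B \<gamma>"
   by (rule summable_on_cmult_left)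
  thus ?thesis using r by (simp add: field_simps)
 qed
 have bB: "b summable_on B \<gamma>" for \<gamma> using nB by (rule abs_summable_summable)
 define A where "A \<gamma> = (\<Sum>\<^sub>\<infinity>i\<in>B \<gamma>. ?n i)" for \<gamma>
 have Asum: "A summable_on UNIV" unfolding A_def
  using summable_on_Sigma_banach[of "\<lambda>_ i. ?n i" UNIV B] S by (simp add: case_prod_unfold)
 have Ainf: "infsum A UNIV = (\<Sum>\<^sub>\<infinity>i\<in>I. ?n i)"
  unfolding A_def using infsum_Sigma_banach[of "\<lambda>x. ?n (snd x)" UNIV B] S
   infsum_reindex_bij_betw[OF bij, of ?n] by simp
 have le: "norm (a \<gamma>) * r ^ wt \<gamma> \<le> A \<gamma>" for \<gamma>
 proof -
  have "norm (a \<gamma>) \<le> (\<Sum>\<^sub>\<infinity>i\<in>B \<gamma>. norm (b i))" unfolding a_def by (rule norm_infsum_bound)  (rule nB)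
  hence "norm (a \<gamma>) * r ^ wt \<gamma> \<le> (\<Sum>\<^sub>\<infinity>i\<in>B \<gamma>. norm (b i)) * r ^ wt \<gamma>"
   using r by (intro mult_right_mono) auto
  also have "\<dots> = (\<Sum>\<^sub>\<infinity>i\<in>B \<gamma>. norm (b i) * r ^ wt \<gamma>)" by (simp add: infsum_cmult_left')
  also have "\<dots> = A \<gamma>" unfolding A_def by (rule infsum_cong) (simp add: B_def)
  finally show ?thesis .
 qed
 have asum: "(\<lambda>\<gamma>. norm (a \<gamma>) * r ^ wt \<gamma>) summable_on UNIV"
  by (rule summable_on_comparison_test[OF Asum]) (use le r in auto)
 have "(\<Sum>\<^sub>\<infinity>\<gamma>. norm (a \<gamma>) * r ^ wt \<gamma>) \<le> M"
  using infsum_mono[OF asum Asum le] Ainf M by simp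
 moreover have "((\<lambda>\<gamma>. a \<gamma> * of_real (monomial \<gamma> (k - k0))) has_sum f k) UNIV"
  if k: "\<And>i. \<bar>k $ i - k0 $ i\<bar> \<le> r" for k
 proof (rule has_sum_Sigma'[where B = B])
  show "((\<lambda>x. b (snd x) * of_real (monomial (e (snd x)) (k - k0))) has_sum f k) (Sigma UNIV B)"
   using has_sum_reindex_bij_betw[OF bij, of "\<lambda>i. b i * of_real (monomial (e i) (k - k0))"] f[OF k]
   by simp
  fix \<gamma>
  have "((\<lambda>i. b i * of_real (monomial \<gamma> (k - k0))) has_sum a \<gamma> * of_real (monomial \<gamma> (k - k0))) (B \<gamma>)"
   unfolding a_def by (intro has_sum_cmult_left has_sum_infsum bB)
  thus "((\<lambda>i. b (snd (\<gamma>, i)) * of_real (monomial (e (snd (\<gamma>, i))) (k - k0)))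
    has_sum a \<gamma> * of_real (monomial \<gamma> (k - k0))) (B \<gamma>)"
   by (rule has_sum_cong[THEN iffD1, rotated]) (simp add: B_def)
 qed
 ultimately show ?thesis unfolding pser_def using r asum by blast
qed

text \<open>The Weierstrass test for power series: the double family of all coefficients is
  absolutely summable, with total at most \<open>infsum M I\<close>. Products, compositions with
  holomorphic functions and linear substitutions are all obtained as such sums.\<close>

lemma pser_normal_sum:
 assumes r: "0 < r" and p: "\<And>n. n \<in> I \<Longrightarrow> pser k0 r (M n) (F n)" and M: "M summable_on I"
  and f: "\<And>k. (\<And>i. \<bar>k $ i - k0 $ i\<bar> \<le> r) \<Longrightarrow> ((\<lambda>n. F n k) has_sum f k) I"
 shows "pser k0 r (infsum M I) f"
proof -
 define Q where "Q n a \<longleftrightarrow> (\<lambda>\<alpha>. norm (a \<alpha>) * r ^ wt \<alpha>) summable_on UNIV \<and>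
   (\<Sum>\<^sub>\<infinity>\<alpha>. norm (a \<alpha>) * r ^ wt \<alpha>) \<le> M n \<and>
   (\<forall>k. (\<forall>i. \<bar>k $ i - k0 $ i\<bar> \<le> r) \<longrightarrow>
    ((\<lambda>\<alpha>. a \<alpha> * of_real (monomial \<alpha> (k - k0))) has_sum F n k) UNIV)" for n a
 have "\<forall>n\<in>I. \<exists>a. Q n a"
  using p unfolding pser_def Q_def by blast
 then obtain a where "\<forall>n\<in>I. Q n (a n)" using bchoice by blast
 hence a: "\<And>n. n \<in> I \<Longrightarrow> (\<lambda>\<alpha>. norm (a n \<alpha>) * r ^ wt \<alpha>) summable_on UNIV"
   "\<And>n. n \<in> I \<Longrightarrow> (\<Sum>\<^sub>\<infinity>\<alpha>. norm (a n \<alpha>) * r ^ wt \<alpha>) \<le> M n"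
   "\<And>n k. n \<in> I \<Longrightarrow> (\<forall>i. \<bar>k $ i - k0 $ i\<bar> \<le> r) \<Longrightarrow>
    ((\<lambda>\<alpha>. a n \<alpha> * of_real (monomial \<alpha> (k - k0))) has_sum F n k) UNIV"
  unfolding Q_def by blast+
 define S where "S n = (\<Sum>\<^sub>\<infinity>\<alpha>. norm (a n \<alpha>) * r ^ wt \<alpha>)" for n
 have S0: "S n \<ge> 0" for n unfolding S_def using r by (intro infsum_nonneg) auto
 have Ssum: "S summable_on I"
  by (rule summable_on_comparison_test[OF M]) (use a(2) S0 in \<open>auto simp: S_def\<close>)
 let ?n = "\<lambda>x. norm (a (fst x) (snd x)) * r ^ wt (snd x)"
 have sm: "?n summable_on Sigma I (\<lambda>_. UNIV)"
 proof (rule summable_on_SigmaI[OF _ Ssum])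
  show "((\<lambda>y. ?n (n, y)) has_sum S n) UNIV" if "n \<in> I" for n
   using has_sum_infsum[OF a(1)[OF that]] by (simp add: S_def)
 qed (use r in auto)
 have inf: "infsum ?n (Sigma I (\<lambda>_. UNIV)) \<le> infsum M I"
 proof -
  have "infsum ?n (Sigma I (\<lambda>_. UNIV)) = infsum S I"
   using infsum_Sigma_banach[OF sm] by (simp add: S_def[abs_def])
  thus ?thesis using infsum_mono[OF Ssum M] a(2) by (simp add: S_def)
 qed
 show ?thesis
 proof (rule pser_family[OF r sm inf])
  fix k assume k: "\<And>i. \<bar>k $ i - k0 $ i\<bar> \<le> r"
  show "((\<lambda>i. a (fst i) (snd i) * of_real (monomial (snd i) (k - k0))) has_sum f k) (Sigma I (\<lambda>_. UNIV))"
  proof (rule has_sum_SigmaI)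
   show "((\<lambda>n. F n k) has_sum f k) I" using f k by blast
   show "((\<lambda>y. a (fst (n, y)) (snd (n, y)) * of_real (monomial (snd (n, y)) (k - k0))) has_sum F n k) UNIV"
    if "n \<in> I" for n using a(3)[OF that] k by simp
   show "(\<lambda>i. a (fst i) (snd i) * of_real (monomial (snd i) (k - k0))) summable_on (Sigma I (\<lambda>_. UNIV))"
    by (rule abs_summable_summable, rule summable_on_comparison_test[OF sm])
      (use k in \<open>auto simp: norm_mult intro!: mult_left_mono abs_monomial_le\<close>)
  qed
 qed
qed

lemma pser_mult:
 assumes f: "pser k0 r M f" and g: "pser k0 r N g" shows "pser k0 r (M * N) (\<lambda>k. f k * g k)"
proof -
 note r = pser_pos[OF f]
 obtain a where a: "(\<lambda>\<alpha>. norm (a \<alpha>) * r ^ wt \<alpha>) summable_on UNIV"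
   "(\<Sum>\<^sub>\<infinity>\<alpha>. norm (a \<alpha>) * r ^ wt \<alpha>) \<le> M"
   "\<And>k. (\<And>i. \<bar>k $ i - k0 $ i\<bar> \<le> r) \<Longrightarrow> ((\<lambda>\<alpha>. a \<alpha> * of_real (monomial \<alpha> (k - k0))) has_sum f k) UNIV"
  using f by (auto simp: pser_def)
 let ?A = "\<lambda>\<alpha>. norm (a \<alpha>) * r ^ wt \<alpha>"
 have "pser k0 r (\<Sum>\<^sub>\<infinity>\<alpha>. ?A \<alpha> * N) (\<lambda>k. f k * g k)"
 proof (rule pser_normal_sum[OF r])
  show "(\<lambda>\<alpha>. ?A \<alpha> * N) summable_on UNIV" by (rule summable_on_cmult_left) (rule a(1))
  fix k assume k: "\<And>i. \<bar>k $ i - k0 $ i\<bar> \<le> r"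
  show "((\<lambda>\<alpha>. a \<alpha> * of_real (monomial \<alpha> (k - k0)) * g k) has_sum f k * g k) UNIV"
   by (rule has_sum_cmult_left) (rule a(3)[OF k])
 next
  fix \<alpha> :: "'a \<Rightarrow> nat"
  obtain b where b: "(\<lambda>\<alpha>. norm (b \<alpha>) * r ^ wt \<alpha>) summable_on UNIV"
   "(\<Sum>\<^sub>\<infinity>\<alpha>. norm (b \<alpha>) * r ^ wt \<alpha>) \<le> N"
   "\<And>k. (\<And>i. \<bar>k $ i - k0 $ i\<bar> \<le> r) \<Longrightarrow> ((\<lambda>\<alpha>. b \<alpha> * of_real (monomial \<alpha> (k - k0))) has_sum g k) UNIV"
   using g by (auto simp: pser_def)
  have eq: "norm (a \<alpha> * b \<beta>) * r ^ wt (\<lambda>i. \<alpha> i + \<beta> i) = ?A \<alpha> * (norm (b \<beta>) * r ^ wt \<beta>)" for \<beta>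
   by (simp add: norm_mult sum.distrib power_add)
  show "pser k0 r (?A \<alpha> * N) (\<lambda>k. a \<alpha> * of_real (monomial \<alpha> (k - k0)) * g k)"
  proof (rule pser_family[where b = "\<lambda>\<beta>. a \<alpha> * b \<beta>" and e = "\<lambda>\<beta> i. \<alpha> i + \<beta> i" and I = UNIV, OF r])
   show "(\<lambda>\<beta>. norm (a \<alpha> * b \<beta>) * r ^ wt (\<lambda>i. \<alpha> i + \<beta> i)) summable_on UNIV"
    unfolding eq by (rule summable_on_cmult_right) (rule b(1))
   have "(\<Sum>\<^sub>\<infinity>\<beta>. ?A \<alpha> * (norm (b \<beta>) * r ^ wt \<beta>)) = ?A \<alpha> * (\<Sum>\<^sub>\<infinity>\<beta>. norm (b \<beta>) * r ^ wt \<beta>)"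
    by (rule infsum_cmult_right')
   also have "\<dots> \<le> ?A \<alpha> * N" using b(2) r by (intro mult_left_mono) auto
   finally show "(\<Sum>\<^sub>\<infinity>\<beta>. norm (a \<alpha> * b \<beta>) * r ^ wt (\<lambda>i. \<alpha> i + \<beta> i)) \<le> ?A \<alpha> * N"
    unfolding eq .
   fix k assume k: "\<And>i. \<bar>k $ i - k0 $ i\<bar> \<le> r"
   have "((\<lambda>\<beta>. a \<alpha> * of_real (monomial \<alpha> (k - k0)) * (b \<beta> * of_real (monomial \<beta> (k - k0)))) has_sum
     a \<alpha> * of_real (monomial \<alpha> (k - k0)) * g k) UNIV"
    by (rule has_sum_cmult_right) (rule b(3)[OF k])
   thus "((\<lambda>\<beta>. a \<alpha> * b \<beta> * of_real (monomial (\<lambda>i. \<alpha> i + \<beta> i) (k - k0))) has_sum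
     a \<alpha> * of_real (monomial \<alpha> (k - k0)) * g k) UNIV"
    by (simp add: monomial_add mult_ac)
  qed
 qed
 moreover have "(\<Sum>\<^sub>\<infinity>\<alpha>. ?A \<alpha> * N) \<le> M * N"
  using a(2) pser_nonneg[OF g] by (simp add: infsum_cmult_left' mult_right_mono)
 ultimately show ?thesis by (rule pser_mono)
qed

lemma monomial_zero [simp]: "monomial (\<lambda>_. 0) x = 1"
 by (simp add: monomial_def)

lemma monomial_at_zero: "monomial \<alpha> 0 = (if \<alpha> = (\<lambda>_. 0) then 1 else 0)"
 by (auto simp: monomial_def fun_eq_iff power_0_left)

lemma pser_const: assumes "0 < r" shows "pser k0 r (cmod c) (\<lambda>_. c)"
 by (rule pser_family[where I = "{()}" and b = "\<lambda>_. c" and e = "\<lambda>_ _. 0"])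
   (use assms in \<open>auto intro!: has_sum_finiteI\<close>)

lemma pser_coord: assumes "0 < r" shows "pser k0 r r (\<lambda>k. of_real (k $ i - k0 $ i))"
proof (rule pser_family[where I = "{()}" and b = "\<lambda>_. 1" and e = "\<lambda>_ j. if j = i then 1 else 0"])
 fix k :: "real ^ 'a"
 have "monomial (\<lambda>j. if j = i then 1 else 0) (k - k0) = k $ i - k0 $ i"
  unfolding monomial_def by (subst prod.remove[of _ i]) (auto intro!: prod.neutral)
 thus "((\<lambda>u. 1 * complex_of_real (monomial (\<lambda>j. if j = i then 1 else 0) (k - k0))) has_sum
   of_real (k $ i - k0 $ i)) {()}" by (auto intro!: has_sum_finiteI)
qed (use assms in \<open>auto\<close>)

lemma pser_sum:
 assumes "finite I" "0 < r" "\<And>n. n \<in> I \<Longrightarrow> pser k0 r (M n) (F n)"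
 shows "pser k0 r (\<Sum>n\<in>I. M n) (\<lambda>k. \<Sum>n\<in>I. F n k)"
 using pser_normal_sum[of r I k0 M F "\<lambda>k. \<Sum>n\<in>I. F n k"] assms
 by (simp add: has_sum_finiteI)

lemma pser_prod:
 assumes "0 < r"
 shows "finite I \<Longrightarrow> (\<And>n. n \<in> I \<Longrightarrow> pser k0 r (M n) (F n)) \<Longrightarrow>
  pser k0 r (\<Prod>n\<in>I. M n) (\<lambda>k. \<Prod>n\<in>I. F n k)"
 by (induction I rule: finite_induct) (use pser_const[OF assms, of k0 1] in \<open>auto intro: pser_mult\<close>)

lemma pser_power: "pser k0 r M f \<Longrightarrow> pser k0 r (M ^ n) (\<lambda>k. f k ^ n)"
 using pser_prod[of r "{..<n}" k0 "\<lambda>_. M" "\<lambda>_. f"] pser_pos[of k0 r M f] by simp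

lemma pser_cnj: assumes "pser k0 r M f" shows "pser k0 r M (\<lambda>k. cnj (f k))"
proof -
 obtain a where a: "(\<lambda>\<alpha>. norm (a \<alpha>) * r ^ wt \<alpha>) summable_on UNIV"
   "(\<Sum>\<^sub>\<infinity>\<alpha>. norm (a \<alpha>) * r ^ wt \<alpha>) \<le> M"
   "\<And>k. (\<And>i. \<bar>k $ i - k0 $ i\<bar> \<le> r) \<Longrightarrow> ((\<lambda>\<alpha>. a \<alpha> * of_real (monomial \<alpha> (k - k0))) has_sum f k) UNIV"
  using assms by (auto simp: pser_def)
 have "((\<lambda>\<alpha>. cnj (a \<alpha>) * of_real (monomial \<alpha> (k - k0))) has_sum cnj (f k)) UNIV"
  if "\<And>i. \<bar>k $ i - k0 $ i\<bar> \<le> r" for k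
  using has_sum_cnj_iff[THEN iffD2, OF a(3)[OF that]] by simp
 thus ?thesis unfolding pser_def using pser_pos[OF assms] a(1,2)
  by (intro conjI exI[of _ "\<lambda>\<alpha>. cnj (a \<alpha>)"]) auto
qed

text \<open>In the second claim the constant term is gone, every remaining exponent has weight at
  least 1, and passing from \<open>r\<close> to \<open>r'\<close> gains a factor
  \<open>r' / r\<close>. This is the source of the smallness, continuity and Lipschitz bounds
  below.\<close>

lemma pser_smaller:
 assumes f: "pser k0 r M f" and r': "0 < r'" "r' \<le> r"
 shows "pser k0 r' M f" and "pser k0 r' (r' / r * M) (\<lambda>k. f k - f k0)"
proof -
 note r = pser_pos[OF f]
 obtain a where a: "(\<lambda>\<alpha>. norm (a \<alpha>) * r ^ wt \<alpha>) summable_on UNIV"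
   "(\<Sum>\<^sub>\<infinity>\<alpha>. norm (a \<alpha>) * r ^ wt \<alpha>) \<le> M"
   "\<And>k. (\<And>i. \<bar>k $ i - k0 $ i\<bar> \<le> r) \<Longrightarrow> ((\<lambda>\<alpha>. a \<alpha> * of_real (monomial \<alpha> (k - k0))) has_sum f k) UNIV"
  using f by (auto simp: pser_def)
 have box: "\<And>k i. (\<And>i. \<bar>k $ i - k0 $ i\<bar> \<le> r') \<Longrightarrow> \<bar>k $ i - k0 $ i\<bar> \<le> r"
  using r' order_trans by blast
 have le: "norm (a \<alpha>) * r' ^ wt \<alpha> \<le> norm (a \<alpha>) * r ^ wt \<alpha>" for \<alpha>
  using r' by (auto intro!: mult_left_mono power_mono)
 have s': "(\<lambda>\<alpha>. norm (a \<alpha>) * r' ^ wt \<alpha>) summable_on UNIV"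
  by (rule summable_on_comparison_test[OF a(1)]) (use le r' in auto)
 have "(\<Sum>\<^sub>\<infinity>\<alpha>. norm (a \<alpha>) * r' ^ wt \<alpha>) \<le> (\<Sum>\<^sub>\<infinity>\<alpha>. norm (a \<alpha>) * r ^ wt \<alpha>)"
  by (rule infsum_mono[OF s' a(1)]) (use le in auto)
 thus "pser k0 r' M f" unfolding pser_def using a box s' r'
  by (intro conjI exI[of _ a]) auto
 let ?z = "\<lambda>_::'a. 0::nat"
 have "((\<lambda>\<alpha>. a \<alpha> * of_real (monomial \<alpha> (k0 - k0))) has_sum f k0) UNIV" using a(3)[of k0] r by simp
 moreover have "((\<lambda>\<alpha>. a \<alpha> * of_real (monomial \<alpha> (k0 - k0))) has_sum a ?z) UNIV"
  by (rule has_sum_cong_neutral[THEN iffD1, rotated 3, OF has_sum_finiteI[of "{?z}"]])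
    (auto simp: monomial_at_zero)
 ultimately have fk0: "f k0 = a ?z" by (rule has_sum_unique)
 have s'': "(\<lambda>\<alpha>. norm (a \<alpha>) * r' ^ wt \<alpha>) summable_on UNIV - {?z}"
  using s' by (rule summable_on_subset_banach) auto
 have wt1: "wt \<alpha> \<ge> 1" if "\<alpha> \<noteq> ?z" for \<alpha> :: "'a \<Rightarrow> nat"
 proof -
  have "wt \<alpha> \<noteq> 0" using that by (simp add: fun_eq_iff)
  thus ?thesis by linarith
 qed
 have le2: "norm (a \<alpha>) * r' ^ wt \<alpha> \<le> r' / r * (norm (a \<alpha>) * r ^ wt \<alpha>)" if "\<alpha> \<in> UNIV - {?z}" for \<alpha>
 proof -
  have "1 \<le> wt \<alpha>" using wt1[of \<alpha>] that by simp
  then obtain n where n: "wt \<alpha> = Suc n" by (metis One_nat_def Suc_le_D)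
  have "r' ^ n \<le> r ^ n" using r' by (intro power_mono) auto
  hence "r' * r' ^ n \<le> r' * r ^ n" using r' by (intro mult_left_mono) auto
  also have "\<dots> = r' / r * (r * r ^ n)" using r by simp
  finally show ?thesis unfolding n power_Suc
   by (metis mult.left_commute mult_left_mono norm_ge_zero)
 qed
 have sM: "(\<lambda>\<alpha>. r' / r * (norm (a \<alpha>) * r ^ wt \<alpha>)) summable_on UNIV"
  by (rule summable_on_cmult_right) (rule a(1))
 have "(\<Sum>\<^sub>\<infinity>\<alpha>\<in>UNIV - {?z}. norm (a \<alpha>) * r' ^ wt \<alpha>) \<le> (\<Sum>\<^sub>\<infinity>\<alpha>. r' / r * (norm (a \<alpha>) * r ^ wt \<alpha>))"
  by (rule infsum_mono_neutral[OF s'' sM]) (use le2 r r' in auto)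
 also have "\<dots> = r' / r * (\<Sum>\<^sub>\<infinity>\<alpha>. norm (a \<alpha>) * r ^ wt \<alpha>)" by (rule infsum_cmult_right')
 also have "\<dots> \<le> r' / r * M" using a(2) r r' by (intro mult_left_mono) auto
 finally have le3: "(\<Sum>\<^sub>\<infinity>\<alpha>\<in>UNIV - {?z}. norm (a \<alpha>) * r' ^ wt \<alpha>) \<le> r' / r * M" .
 show "pser k0 r' (r' / r * M) (\<lambda>k. f k - f k0)"
 proof (rule pser_family[where b = a and e = "\<lambda>\<alpha>. \<alpha>" and I = "UNIV - {?z}", OF r'(1) s'' le3])
  fix k assume k: "\<And>i. \<bar>k $ i - k0 $ i\<bar> \<le> r'"
  have "((\<lambda>\<alpha>. a \<alpha> * of_real (monomial \<alpha> (k - k0))) has_sum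
    f k - (\<Sum>\<alpha>\<in>{?z}. a \<alpha> * of_real (monomial \<alpha> (k - k0)))) (UNIV - {?z})"
   by (rule has_sum_Diff[OF a(3)[OF box[OF k]]]) (auto intro: has_sum_finiteI)
  thus "((\<lambda>\<alpha>. a \<alpha> * of_real (monomial \<alpha> (k - k0))) has_sum f k - f k0) (UNIV - {?z})"
   by (simp add: fk0)
 qed
qed

lemma ran_at_small:
 assumes "ran_at k0 f" "0 < \<epsilon>"
 obtains r where "pser k0 r \<epsilon> (\<lambda>k. f k - f k0)"
proof -
 obtain r M where p: "pser k0 r M f" using assms by (auto simp: ran_at_def)
 note r = pser_pos[OF p] and M = pser_nonneg[OF p]
 \<comment> \<open>Chosen so that
   \<open>r' / r * M \<le> \<epsilon> / (M + 1) * M \<le> \<epsilon>\<close>; the summand 1 covers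
   \<open>M = 0\<close>.\<close>
 define r' where "r' = min r (\<epsilon> * r / (M + 1))"
 have r': "0 < r'" "r' \<le> r" using r M assms(2) by (auto simp: r'_def)
 have "r' / r * M \<le> \<epsilon> / (M + 1) * M"
  using r M assms(2) by (intro mult_right_mono) (auto simp: r'_def divide_simps min_def)
 also have "\<dots> \<le> \<epsilon>" using M assms(2) by (simp add: divide_simps)
 finally show ?thesis using pser_mono[OF pser_smaller(2)[OF p r']] that by blast
qed

lemma ran_at_common:
 assumes "finite I" "\<And>i. i \<in> I \<Longrightarrow> ran_at k0 (F i)"
 obtains r M where "0 < r" "\<And>i. i \<in> I \<Longrightarrow> pser k0 r (M i) (F i)"
proof -
 have "\<exists>r>0. \<exists>M. \<forall>i\<in>I. pser k0 r (M i) (F i)" using assms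
 proof (induction I rule: finite_induct)
  case empty thus ?case by (auto intro: exI[of _ 1])
 next
  case (insert i I)
  then obtain r M where r: "0 < r" "\<forall>j\<in>I. pser k0 r (M j) (F j)" by auto
  obtain s N where s: "pser k0 s N (F i)" using insert(4)[of i] by (auto simp: ran_at_def)
  define t where "t = min r s"
  have t: "0 < t" "t \<le> r" "t \<le> s" using r pser_pos[OF s] by (auto simp: t_def)
  have "pser k0 t ((M(i := N)) j) (F j)" if "j \<in> insert i I" for j
   using r(2) pser_smaller(1)[OF s t(1,3)] pser_smaller(1)[of k0 r "M j" "F j" t] t that by auto
  with t show ?case by blast
 qed
 thus ?thesis using that by blast
qed

lemma ran_at_cong:
 assumes "ran_at k0 f" "open U" "k0 \<in> U" "\<And>k. k \<in> U \<Longrightarrow> f k = g k" shows "ran_at k0 g"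
proof -
 obtain r M where p: "pser k0 r M f" using assms by (auto simp: ran_at_def)
 obtain e where e: "e > 0" "ball k0 e \<subseteq> U" using assms(2,3) openE by blast
 \<comment> \<open>A point of the box of half-width \<open>r'\<close> has l1 distance at most
   \<open>CARD('a) * r'\<close> from \<open>k0\<close>, so the box lies in the ball of radius
   \<open>e\<close>.\<close>
 define r' where "r' = min r (e / (2 * (real CARD('a) + 1)))"
 have r': "0 < r'" "r' \<le> r" using pser_pos[OF p] e by (auto simp: r'_def)
 have "k \<in> U" if k: "\<And>i. \<bar>k $ i - k0 $ i\<bar> \<le> r'" for k
 proof -
  have "norm (k - k0) \<le> (\<Sum>i\<in>UNIV. \<bar>(k - k0) $ i\<bar>)" by (rule norm_le_l1_cart)
  also have "\<dots> \<le> real CARD('a) * r'" using k by (intro sum_bounded_above[where K = r', simplified]) auto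
  also have "\<dots> \<le> real CARD('a) * (e / (2 * (real CARD('a) + 1)))" by (intro mult_left_mono) (auto simp: r'_def)
  also have "\<dots> < e" using e(1) by (simp add: divide_simps)
  finally show ?thesis using e(2) by (auto simp: dist_norm norm_minus_commute subset_iff)
 qed
 thus ?thesis unfolding ran_at_def using pser_cong[OF pser_smaller(1)[OF p r']] assms(4) by blast
qed

lemma ran_at_const [simp]: "ran_at k0 (\<lambda>_. c)"
 using pser_const[of 1 k0 c] by (auto simp: ran_at_def)

lemma ran_at_sum:
 assumes "finite I" "\<And>i. i \<in> I \<Longrightarrow> ran_at k0 (F i)" shows "ran_at k0 (\<lambda>k. \<Sum>i\<in>I. F i k)"
proof -
 obtain r M where "0 < r" "\<And>i. i \<in> I \<Longrightarrow> pser k0 r (M i) (F i)"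
  using ran_at_common[of I k0 F] assms by blast
 thus ?thesis unfolding ran_at_def using pser_sum assms(1) by blast
qed

lemma ran_at_prod:
 assumes "finite I" "\<And>i. i \<in> I \<Longrightarrow> ran_at k0 (F i)" shows "ran_at k0 (\<lambda>k. \<Prod>i\<in>I. F i k)"
proof -
 obtain r M where "0 < r" "\<And>i. i \<in> I \<Longrightarrow> pser k0 r (M i) (F i)"
  using ran_at_common[of I k0 F] assms by blast
 thus ?thesis unfolding ran_at_def using pser_prod assms(1) by blast
qed

lemma ran_at_add: assumes "ran_at k0 f" "ran_at k0 g" shows "ran_at k0 (\<lambda>k. f k + g k)"
 using ran_at_sum[of "UNIV :: bool set" k0 "\<lambda>b. if b then f else g"] assms
 by (simp add: UNIV_bool if_distrib add.commute)

lemma ran_at_mult: assumes "ran_at k0 f" "ran_at k0 g" shows "ran_at k0 (\<lambda>k. f k * g k)"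
 using ran_at_prod[of "UNIV :: bool set" k0 "\<lambda>b. if b then f else g"] assms
 by (simp add: UNIV_bool if_distrib mult.commute)

lemma ran_at_minus: "ran_at k0 f \<Longrightarrow> ran_at k0 (\<lambda>k. - f k)"
 using ran_at_mult[OF ran_at_const[of k0 "-1"]] by simp

lemma ran_at_diff: "ran_at k0 f \<Longrightarrow> ran_at k0 g \<Longrightarrow> ran_at k0 (\<lambda>k. f k - g k)"
 using ran_at_add[OF _ ran_at_minus] by fastforce

lemma ran_at_cnj: "ran_at k0 f \<Longrightarrow> ran_at k0 (\<lambda>k. cnj (f k))"
 unfolding ran_at_def using pser_cnj by blast

text \<open>\<open>f - f k0\<close> is substituted into the Taylor series of \<open>\<phi>\<close>
  at \<open>f k0\<close>. On a small box it has weighted norm at most \<open>R / 2\<close>, where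
  the Taylor series converges absolutely because it converges at \<open>3 * R / 4\<close>.\<close>

lemma ran_at_compose:
 assumes f: "ran_at k0 f" and "open S" "\<phi> holomorphic_on S" "f k0 \<in> S"
 shows "ran_at k0 (\<lambda>k. \<phi> (f k))"
proof -
 obtain R where R: "R > 0" "ball (f k0) R \<subseteq> S" using assms openE by blast
 have hol: "\<phi> holomorphic_on ball (f k0) R" using assms(3) R(2) holomorphic_on_subset by blast
 define b where "b n = (deriv ^^ n) \<phi> (f k0) / fact n" for n
 have ser: "(\<lambda>n. b n * z ^ n) sums \<phi> (f k0 + z)" if "cmod z < R" for z
  using holomorphic_power_series[OF hol, of "f k0 + z"] that by (simp add: b_def dist_norm)
 have "summable (\<lambda>n. b n * of_real (3 * R / 4) ^ n)"
  using ser[of "of_real (3 * R / 4)"] R(1) by (auto simp: sums_iff simp del: of_real_mult of_real_divide)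
 hence "summable (\<lambda>n. norm (b n * of_real (R / 2) ^ n))"
  by (rule powser_insidea) (use R(1) in \<open>simp add: norm_divide norm_mult\<close>)
 hence nsum: "summable (\<lambda>n. norm (b n) * (R / 2) ^ n)"
  using R(1) by (simp add: norm_mult norm_power norm_divide)
 have Rsum: "(\<lambda>n. norm (b n) * (R / 2) ^ n) summable_on UNIV"
  by (rule norm_summable_imp_summable_on) (use nsum R(1) in \<open>simp add: abs_mult\<close>)
 obtain r where p: "pser k0 r (R / 2) (\<lambda>k. f k - f k0)"
  using ran_at_small[OF f, of "R / 2"] R(1) by auto
 note r = pser_pos[OF p]
 have "pser k0 r (\<Sum>\<^sub>\<infinity>n. norm (b n) * (R / 2) ^ n) (\<lambda>k. \<phi> (f k))"
 proof (rule pser_normal_sum[OF r _ Rsum])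
  show "pser k0 r (norm (b n) * (R / 2) ^ n) (\<lambda>k. b n * (f k - f k0) ^ n)" for n
   by (intro pser_mult pser_power p pser_const r)
  fix k assume k: "\<And>i. \<bar>k $ i - k0 $ i\<bar> \<le> r"
  have le: "cmod (f k - f k0) \<le> R / 2" using pser_bound[OF p] k by blast
  have "summable (\<lambda>n. norm (b n * (f k - f k0) ^ n))"
   by (rule summable_comparison_test'[OF nsum])
     (use le in \<open>auto simp: norm_mult norm_power intro!: mult_left_mono power_mono\<close>)
  moreover have "(\<lambda>n. b n * (f k - f k0) ^ n) sums \<phi> (f k)"
   using ser[of "f k - f k0"] le R(1) by simp
  ultimately show "((\<lambda>n. b n * (f k - f k0) ^ n) has_sum \<phi> (f k)) UNIV"
   by (rule norm_summable_imp_has_sum)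
 qed
 thus ?thesis by (auto simp: ran_at_def)
qed

text \<open>The constant \<open>c\<close> bounds the row sums of \<open>A\<close>, so at polyradius
  \<open>r = r0 / c\<close> each component of \<open>A *v (k - k0)\<close> has norm at most
  \<open>r0\<close>, and each term of the series of \<open>f\<close> keeps its bound. The lemma
  serves the action of the point group on wavevectors.\<close>

lemma ran_at_linear_compose:
 fixes A :: "real ^ 'd ^ 'd"
 assumes f: "ran_at (A *v k0) f" shows "ran_at k0 (\<lambda>k. f (A *v k))"
proof -
 obtain r0 M where p: "pser (A *v k0) r0 M f" using f by (auto simp: ran_at_def)
 note r0 = pser_pos[OF p]
 obtain a where a: "(\<lambda>\<alpha>. norm (a \<alpha>) * r0 ^ wt \<alpha>) summable_on UNIV"
   "\<And>k. (\<And>i. \<bar>k $ i - (A *v k0) $ i\<bar> \<le> r0) \<Longrightarrow>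
    ((\<lambda>\<alpha>. a \<alpha> * of_real (monomial \<alpha> (k - A *v k0))) has_sum f k) UNIV"
  using p by (auto simp: pser_def)
 define c where "c = 1 + (\<Sum>i\<in>UNIV. \<Sum>j\<in>UNIV. \<bar>A $ i $ j\<bar>)"
 have c1: "1 \<le> c" unfolding c_def by (simp add: sum_nonneg)
 have ci: "(\<Sum>j\<in>UNIV. \<bar>A $ i $ j\<bar>) \<le> c" for i
  using member_le_sum[of i UNIV "\<lambda>i. \<Sum>j\<in>UNIV. \<bar>A $ i $ j\<bar>"] by (simp add: c_def sum_nonneg)
 define r where "r = r0 / c"
 have r: "0 < r" using r0 c1 by (simp add: r_def)
 have Ax: "(A *v (k - k0)) $ i = (\<Sum>j\<in>UNIV. A $ i $ j * (k $ j - k0 $ j))" for k i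
  by (simp add: matrix_vector_mult_def)
 have rc: "(\<Sum>j\<in>UNIV. \<bar>A $ i $ j\<bar> * r) \<le> r0" for i
 proof -
  have "(\<Sum>j\<in>UNIV. \<bar>A $ i $ j\<bar> * r) = (\<Sum>j\<in>UNIV. \<bar>A $ i $ j\<bar>) * r" by (simp add: sum_distrib_right)
  also have "\<dots> \<le> c * r" using ci r by (intro mult_right_mono) auto
  also have "\<dots> = r0" using c1 by (simp add: r_def)
  finally show ?thesis .
 qed
 have pi: "pser k0 r r0 (\<lambda>k. of_real ((A *v (k - k0)) $ i))" for i
 proof -
  have "pser k0 r (\<Sum>j\<in>UNIV. cmod (of_real (A $ i $ j)) * r)
    (\<lambda>k. \<Sum>j\<in>UNIV. of_real (A $ i $ j) * of_real (k $ j - k0 $ j))"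
   by (intro pser_sum pser_mult pser_const pser_coord r) auto
  thus ?thesis using rc[of i] by (auto simp: Ax intro: pser_mono)
 qed
 have box: "\<bar>(A *v k) $ i - (A *v k0) $ i\<bar> \<le> r0" if k: "\<And>i. \<bar>k $ i - k0 $ i\<bar> \<le> r" for k i
 proof -
  have "\<bar>(A *v k) $ i - (A *v k0) $ i\<bar> = \<bar>\<Sum>j\<in>UNIV. A $ i $ j * (k $ j - k0 $ j)\<bar>"
   using Ax[of k i] by (simp add: matrix_vector_mult_diff_distrib)
  also have "\<dots> \<le> (\<Sum>j\<in>UNIV. \<bar>A $ i $ j\<bar> * r)"
   by (rule order_trans[OF sum_abs]) (auto simp: abs_mult intro!: sum_mono mult_left_mono k)
  also note rc finally show ?thesis .
 qed
 have "pser k0 r (\<Sum>\<^sub>\<infinity>\<alpha>. norm (a \<alpha>) * r0 ^ wt \<alpha>) (\<lambda>k. f (A *v k))"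
 proof (rule pser_normal_sum[OF r _ a(1)])
  fix \<alpha> :: "'d \<Rightarrow> nat"
  have "pser k0 r (norm (a \<alpha>) * (\<Prod>i\<in>UNIV. r0 ^ \<alpha> i))
    (\<lambda>k. a \<alpha> * (\<Prod>i\<in>UNIV. of_real ((A *v (k - k0)) $ i) ^ \<alpha> i))"
   by (intro pser_mult pser_const pser_prod pser_power pi r) auto
  thus "pser k0 r (norm (a \<alpha>) * r0 ^ wt \<alpha>) (\<lambda>k. a \<alpha> * of_real (monomial \<alpha> (A *v (k - k0))))"
   by (simp add: monomial_def power_sum)
 next
  fix k assume k: "\<And>i. \<bar>k $ i - k0 $ i\<bar> \<le> r"
  show "((\<lambda>\<alpha>. a \<alpha> * of_real (monomial \<alpha> (A *v (k - k0)))) has_sum f (A *v k)) UNIV"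
   using a(2)[OF box[OF k]] by (simp add: matrix_vector_mult_diff_distrib)
 qed
 thus ?thesis by (auto simp: ran_at_def)
qed

lemma ran_at_inner: "ran_at k0 (\<lambda>k. of_real (k \<bullet> \<eta>))"
proof -
 have "ran_at k0 (\<lambda>k. of_real (k $ i - k0 $ i))" for i
  using pser_coord[of 1 k0 i] by (auto simp: ran_at_def)
 hence "ran_at k0 (\<lambda>k. (\<Sum>i\<in>UNIV. of_real (\<eta> $ i) * of_real (k $ i - k0 $ i)) + of_real (k0 \<bullet> \<eta>))"
  by (intro ran_at_add ran_at_sum ran_at_mult) auto
 moreover have "(\<Sum>i\<in>UNIV. of_real (\<eta> $ i) * of_real (k $ i - k0 $ i)) + of_real (k0 \<bullet> \<eta>)
   = complex_of_real (k \<bullet> \<eta>)" for k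
  by (simp add: inner_vec_def sum.distrib[symmetric] algebra_simps flip: of_real_mult of_real_diff
    of_real_add of_real_sum)
 ultimately show ?thesis by simp
qed

lemma ran_at_exp: "ran_at k0 f \<Longrightarrow> ran_at k0 (\<lambda>k. exp (f k))"
 by (rule ran_at_compose[of _ _ UNIV]) (auto intro: holomorphic_intros)

lemma ran_at_cis: "ran_at k0 (\<lambda>k. of_real (f k)) \<Longrightarrow> ran_at k0 (\<lambda>k. cis (f k))"
 unfolding cis_conv_exp by (intro ran_at_exp ran_at_mult) auto

lemma ran_at_inverse: "ran_at k0 f \<Longrightarrow> f k0 \<noteq> 0 \<Longrightarrow> ran_at k0 (\<lambda>k. inverse (f k))"
 by (rule ran_at_compose[of _ _ "-{0}"]) (auto intro: holomorphic_intros)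

lemma ran_at_isCont: assumes "ran_at k0 f" shows "isCont f k0"
 unfolding continuous_at_eps_delta
proof (intro allI impI)
 fix e :: real assume e: "0 < e"
 obtain r where p: "pser k0 r (e / 2) (\<lambda>k. f k - f k0)"
  using ran_at_small[OF assms, of "e / 2"] e by auto
 have "dist (f k) (f k0) < e" if "dist k k0 < r" for k
 proof -
  have "\<bar>k $ i - k0 $ i\<bar> \<le> r" for i
   using that component_le_norm_cart[of "k - k0" i] by (simp add: dist_norm)
  hence "cmod (f k - f k0) \<le> e / 2" using pser_bound[OF p] by blast
  thus ?thesis using e by (simp add: dist_norm)
 qed
 thus "\<exists>d>0. \<forall>x'. dist x' k0 < d \<longrightarrow> dist (f x') (f k0) < e" using pser_pos[OF p] by blast
qed

lemma ran_continuous_on: "(\<And>k. ran_at k f) \<Longrightarrow> continuous_on S f"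
 by (intro continuous_at_imp_continuous_on ballI ran_at_isCont)

text \<open>\<open>pser_smaller\<close> is applied with the radius \<open>norm (k - k0)\<close>,
  which varies with the point; the factor gained is then proportional to the distance.\<close>

lemma ran_at_lipschitz:
 assumes "ran_at k0 f"
 obtains r B where "0 < r" "\<And>k. norm (k - k0) < r \<Longrightarrow> cmod (f k - f k0) \<le> B * norm (k - k0)"
proof -
 obtain r M where p: "pser k0 r M f" using assms by (auto simp: ran_at_def)
 note r = pser_pos[OF p]
 have "cmod (f k - f k0) \<le> M / r * norm (k - k0)" if "norm (k - k0) < r" for k
 proof (cases "k = k0")
  case False
  have "\<bar>k $ i - k0 $ i\<bar> \<le> norm (k - k0)" for i
   using component_le_norm_cart[of "k - k0" i] by simp
  with pser_bound[OF pser_smaller(2)[OF p, of "norm (k - k0)"], of k] False that show ?thesis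
   by (simp add: mult.commute)
 qed simp
 with r that show ?thesis by blast
qed

text \<open>Where \<open>\<theta>\<close> stays within 1 of \<open>\<theta> k0\<close>, the
  principal logarithm of \<open>\<rho> k / \<rho> k0\<close> is \<open>\<i>\<close> times
  \<open>\<theta> k - \<theta> k0\<close>, since \<open>1 < pi\<close>. The continuous lift is thus
  locally a holomorphic function of the analytic \<open>\<rho>\<close>.\<close>

lemma continuous_lift_ran:
 assumes \<rho>: "\<And>k. ran_at k \<rho>" and g: "continuous_on UNIV \<theta>" "\<And>k. \<rho> k = cis (\<theta> k)"
 shows "ran_at k0 (\<lambda>k. complex_of_real (\<theta> k))"
proof -
 have "\<exists>d>0. \<forall>k. dist k k0 < d \<longrightarrow> dist (\<theta> k) (\<theta> k0) < 1"
  using g(1) by (simp add: continuous_on_eq_continuous_at continuous_at_eps_delta)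
 then obtain d where d: "d > 0" "\<And>k. dist k k0 < d \<Longrightarrow> \<bar>\<theta> k - \<theta> k0\<bar> < 1" by (auto simp: dist_real_def)
 let ?u = "\<lambda>k. \<rho> k / \<rho> k0"
 have u: "?u k = cis (\<theta> k - \<theta> k0)" for k by (simp add: g(2) cis_divide)
 have 1: "ran_at k0 (\<lambda>k. Ln (?u k))"
 proof (rule ran_at_compose[where S = "- \<real>\<^sub>\<le>\<^sub>0" and f = ?u])
  show "ran_at k0 ?u" unfolding divide_inverse by (intro ran_at_mult \<rho>) auto
  show "Ln holomorphic_on - \<real>\<^sub>\<le>\<^sub>0" by (intro holomorphic_intros) auto
  show "?u k0 \<in> - \<real>\<^sub>\<le>\<^sub>0" by (simp add: g(2))
  show "open (- \<real>\<^sub>\<le>\<^sub>0 :: complex set)" by auto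
 qed
 have 2: "ran_at k0 (\<lambda>k. of_real (\<theta> k0) + Ln (?u k) * (- \<i>))"
  by (intro ran_at_add ran_at_mult 1) auto
 have 3: "of_real (\<theta> k0) + Ln (?u k) * (- \<i>) = complex_of_real (\<theta> k)" if "k \<in> ball k0 d" for k
 proof -
  have "\<bar>\<theta> k - \<theta> k0\<bar> < 1" using d(2)[of k] that by (simp add: dist_commute)
  hence "Ln (exp (\<i> * of_real (\<theta> k - \<theta> k0))) = \<i> * of_real (\<theta> k - \<theta> k0)"
   using pi_gt3 by (intro Ln_exp) auto
  hence "Ln (?u k) = \<i> * of_real (\<theta> k - \<theta> k0)" unfolding u cis_conv_exp .
  hence "Ln (?u k) * (- \<i>) = of_real (\<theta> k - \<theta> k0)" by (simp only:) (simp add: complex_eq_iff)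
  thus ?thesis by simp
 qed
 show ?thesis by (rule ran_at_cong[OF 2 open_ball[of k0 d] _ 3]) (use d(1) in simp_all)
qed

section \<open>Lattices and fundamental cells\<close>

lemma AE_shift:
 fixes t :: "real ^ 'd::finite"
 assumes "AE x in lborel. P x" shows "AE x in lborel. P (x + t)"
proof -
 have "AE x in distr lborel borel ((+) t). P x" by (subst lborel_distr_plus) (rule assms)
 from AE_distrD[OF _ this] show ?thesis by (simp add: add.commute)
qed

lemma borel_measurable_matrix_vector [measurable]:
 fixes A :: "real ^ 'd::finite ^ 'd"
 assumes "f \<in> borel_measurable M" shows "(\<lambda>x. A *v f x) \<in> borel_measurable M"
 by (rule borel_measurable_continuous_on[OF _ assms]) (intro continuous_intros)

lemma nn_integral_shift:
 fixes f :: "real ^ 'd::finite \<Rightarrow> ennreal"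
 assumes "f \<in> borel_measurable borel" shows "(\<integral>\<^sup>+v. f (t + v) \<partial>lborel) = (\<integral>\<^sup>+v. f v \<partial>lborel)"
proof -
 have "(\<integral>\<^sup>+v. f v \<partial>lborel) = (\<integral>\<^sup>+v. f v \<partial>distr lborel borel ((+) t))" by (subst lborel_distr_plus) rule
 also have "\<dots> = (\<integral>\<^sup>+v. f (t + v) \<partial>lborel)" using assms by (subst nn_integral_distr) auto
 finally show ?thesis by simp
qed

text \<open>
 Fubini for \<open>1\<^sub>U(x) 1\<^sub>B(x + A v)\<close>, \<open>U\<close> the unit ball, compares the translation-invariant measures
 \<open>distr lborel borel A\<close> and \<open>lborel\<close>, which agree on \<open>U\<close>.
\<close>

lemma distr_orthogonal_matrix:
 fixes A :: "real ^ 'd::finite ^ 'd"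
 assumes A: "orthogonal_matrix A"
 shows "distr lborel borel ((*v) A) = lborel"
proof (rule measure_eqI)
 fix S assume "S \<in> sets (distr lborel borel ((*v) A))"
 hence S [measurable]: "S \<in> sets borel" by simp
 define B where "B = transpose A"
 have inv: "A *v (B *v x) = x" "B *v (A *v x) = x" for x
  using A unfolding B_def by (simp_all add: orthogonal_matrix_def matrix_vector_mul_assoc del: transpose_matrix_vector)
 have nrm: "norm (B *v x) = norm x" for x
  using A orthogonal_matrix_transpose[of A] unfolding B_def
  by (intro orthogonal_transformation_norm) (simp add: orthogonal_transformation_matrix del: transpose_matrix_vector)
 let ?U = "ball 0 1 :: (real ^ 'd) set"
 define u :: "real ^ 'd \<Rightarrow> ennreal" where "u = indicator ?U"
 define s :: "real ^ 'd \<Rightarrow> ennreal" where "s = indicator S"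
 have um [measurable]: "u \<in> borel_measurable borel" unfolding u_def by (intro borel_measurable_indicator) simp
 have sm [measurable]: "s \<in> borel_measurable borel" unfolding s_def by (intro borel_measurable_indicator S)
 have Am [measurable]: "(*v) A \<in> borel_measurable borel" using borel_measurable_matrix_vector[of "\<lambda>x. x" borel A] by simp
 have u: "(\<integral>\<^sup>+x. u x \<partial>lborel) = emeasure lborel ?U" unfolding u_def by simp
 have s: "(\<integral>\<^sup>+x. s x \<partial>lborel) = emeasure lborel S" unfolding s_def using S by simp
 have sA: "(\<integral>\<^sup>+v. s (A *v v) \<partial>lborel) = emeasure (distr lborel borel ((*v) A)) S"
 proof -
  have "emeasure (distr lborel borel ((*v) A)) S = (\<integral>\<^sup>+v. s v \<partial>distr lborel borel ((*v) A))"
   unfolding s_def using S by simp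
  thus ?thesis by (simp add: nn_integral_distr)
 qed
 have m1: "(\<lambda>(x, v). u x * s (x + A *v v)) \<in> borel_measurable (lborel \<Otimes>\<^sub>M lborel)"
  by (simp add: case_prod_unfold)
 have m2: "(\<lambda>(x, v). u (x - A *v v) * s x) \<in> borel_measurable (lborel \<Otimes>\<^sub>M lborel)"
  by (simp add: case_prod_unfold)
 have eq: "s (x + A *v v) = s (A *v (B *v x + v))" for x v
  by (simp add: matrix_vector_right_distrib inv)
 have "emeasure lborel ?U * emeasure (distr lborel borel ((*v) A)) S
   = (\<integral>\<^sup>+x. u x * (\<integral>\<^sup>+v. s (A *v v) \<partial>lborel) \<partial>lborel)"
  by (subst nn_integral_multc) (simp_all add: u sA)
 also have "\<dots> = (\<integral>\<^sup>+x. \<integral>\<^sup>+v. u x * s (x + A *v v) \<partial>lborel \<partial>lborel)"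
  by (intro nn_integral_cong) (simp add: eq nn_integral_cmult nn_integral_shift[where f = "\<lambda>v. s (A *v v)"])
 also have "\<dots> = (\<integral>\<^sup>+v. \<integral>\<^sup>+x. u x * s (x + A *v v) \<partial>lborel \<partial>lborel)"
  by (rule lborel_pair.Fubini'[OF m1, symmetric])
 also have "\<dots> = (\<integral>\<^sup>+v. \<integral>\<^sup>+x. u (x - A *v v) * s x \<partial>lborel \<partial>lborel)"
 proof (rule nn_integral_cong)
  fix v
  have "(\<lambda>x. u (x - A *v v) * s x) \<in> borel_measurable borel" by simp
  from nn_integral_shift[OF this, of "A *v v"]
  show "(\<integral>\<^sup>+x. u x * s (x + A *v v) \<partial>lborel) = (\<integral>\<^sup>+x. u (x - A *v v) * s x \<partial>lborel)"
   by (simp add: add.commute)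
 qed
 also have "\<dots> = (\<integral>\<^sup>+x. \<integral>\<^sup>+v. u (x - A *v v) * s x \<partial>lborel \<partial>lborel)"
  by (rule lborel_pair.Fubini'[OF m2])
 also have "\<dots> = (\<integral>\<^sup>+x. emeasure lborel ?U * s x \<partial>lborel)"
 proof (rule nn_integral_cong)
  fix x :: "real ^ 'd"
  have "norm (x - A *v v) = norm (- (B *v x) + v)" for v
   using nrm[of "x - A *v v"] by (simp add: matrix_vector_mult_diff_distrib inv norm_minus_commute)
  hence "u (x - A *v v) = u (- (B *v x) + v)" for v by (simp add: u_def indicator_def)
  hence "(\<integral>\<^sup>+v. u (x - A *v v) \<partial>lborel) = emeasure lborel ?U"
   by (simp only: nn_integral_shift[OF um] u)
  thus "(\<integral>\<^sup>+v. u (x - A *v v) * s x \<partial>lborel) = emeasure lborel ?U * s x"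
   by (subst nn_integral_multc) simp_all
 qed
 also have "\<dots> = emeasure lborel ?U * emeasure lborel S" by (simp add: nn_integral_cmult s)
 finally have "emeasure lborel ?U * emeasure (distr lborel borel ((*v) A)) S = emeasure lborel ?U * emeasure lborel S" .
 moreover have "emeasure lborel ?U \<noteq> 0"
  using open_not_negligible[of ?U] by (auto simp: negligible_iff_null_sets null_sets_def)
 moreover have "emeasure lborel ?U \<noteq> \<infinity>"
  using emeasure_bounded_finite[of ?U] by simp
 ultimately show "emeasure (distr lborel borel ((*v) A)) S = emeasure lborel S"
  by (simp add: ennreal_mult_cancel_left)
qed simp

lemma AE_orthogonal_matrix:
 fixes A :: "real ^ 'd::finite ^ 'd"
 assumes A: "orthogonal_matrix A" and P: "AE x in lborel. P x"
 shows "AE x in lborel. P (A *v x)"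
proof -
 have "AE x in distr lborel borel ((*v) A). P x" by (subst distr_orthogonal_matrix[OF A]) (rule P)
 from AE_distrD[OF _ this] show ?thesis by (simp add: borel_measurable_matrix_vector)
qed

text \<open>The dual basis \<open>bd\<close> is part of the data, so that coordinates are inner
  products. The Bravais lattice and, through \<open>dual_lattice\<close> with the factor
  \<open>2 * pi\<close>, the reciprocal lattice are both instances; \<open>D\<close> is the unit
  cell in one case and the Brillouin zone in the other.\<close>

locale lattice =
 fixes b bd :: "'d::finite \<Rightarrow> real ^ 'd"
 assumes dual: "b i \<bullet> bd j = (if i = j then 1 else 0)"
  and expand: "v = (\<Sum>i\<in>UNIV. (v \<bullet> bd i) *\<^sub>R b i)"
begin

definition L :: "(real ^ 'd) set" where "L = {v. \<forall>i. v \<bullet> bd i \<in> \<int>}"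
definition D :: "(real ^ 'd) set" where "D = {v. \<forall>i. 0 \<le> v \<bullet> bd i \<and> v \<bullet> bd i < 1}"
definition fl :: "real ^ 'd \<Rightarrow> real ^ 'd" where "fl v = (\<Sum>i\<in>UNIV. of_int \<lfloor>v \<bullet> bd i\<rfloor> *\<^sub>R b i)"

lemma coord_sum: "(\<Sum>i\<in>UNIV. t i *\<^sub>R b i) \<bullet> bd j = t j"
 by (simp add: inner_sum_left dual if_distrib cong: if_cong)

lemma coord_eqI: assumes "\<And>i. u \<bullet> bd i = v \<bullet> bd i" shows "u = v"
 by (subst expand, subst (2) expand) (simp add: assms)

lemma L_add: "u \<in> L \<Longrightarrow> v \<in> L \<Longrightarrow> u + v \<in> L"
 and L_diff: "u \<in> L \<Longrightarrow> v \<in> L \<Longrightarrow> u - v \<in> L"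
 and L_minus: "u \<in> L \<Longrightarrow> - u \<in> L"
 and L_zero: "0 \<in> L"
 and L_basis: "b i \<in> L"
 by (auto simp: L_def inner_add_left inner_diff_left dual)

lemma L_alt: "L = {(\<Sum>i\<in>UNIV. of_int (n i) *\<^sub>R b i) | n. True}"
proof (intro equalityI subsetI)
 fix v assume "v \<in> L"
 hence "\<forall>i. \<exists>n. v \<bullet> bd i = of_int n" by (auto simp: L_def elim: Ints_cases)
 then obtain n where "\<And>i. v \<bullet> bd i = of_int (n i)" by metis
 hence "v = (\<Sum>i\<in>UNIV. of_int (n i) *\<^sub>R b i)" by (subst expand) simp
 thus "v \<in> {(\<Sum>i\<in>UNIV. of_int (n i) *\<^sub>R b i) | n. True}" by blast
qed (auto simp: L_def coord_sum)

lemma L_countable: "countable L"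
proof -
 have "L = range (\<lambda>n. \<Sum>i\<in>UNIV. of_int (n i) *\<^sub>R b i)" unfolding L_alt by auto
 thus ?thesis by simp
qed

lemma fl_L: "fl v \<in> L"
 unfolding L_alt fl_def by (intro CollectI exI[of _ "\<lambda>i. \<lfloor>v \<bullet> bd i\<rfloor>"]) simp

lemma fl_D: "v - fl v \<in> D"
 using frac_lt_1[of "v \<bullet> bd _", unfolded frac_def]
 by (simp add: D_def fl_def inner_diff_left coord_sum)

lemma D_unique: assumes "u \<in> D" "v \<in> D" "u - v \<in> L" shows "u = v"
proof (rule coord_eqI)
 fix i
 have "(u - v) \<bullet> bd i \<in> \<int>" using assms(3) by (simp add: L_def)
 then obtain n where n: "u \<bullet> bd i - v \<bullet> bd i = of_int n" by (auto simp: inner_diff_left elim: Ints_cases)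
 have "0 \<le> u \<bullet> bd i" "u \<bullet> bd i < 1" "0 \<le> v \<bullet> bd i" "v \<bullet> bd i < 1" using assms by (auto simp: D_def)
 hence "real_of_int n < 1" "real_of_int n > -1" using n by linarith+
 hence "n = 0" by linarith
 thus "u \<bullet> bd i = v \<bullet> bd i" using n by simp
qed

lemma D_alt: "D = {(\<Sum>i\<in>UNIV. t i *\<^sub>R b i) | t. \<forall>i. 0 \<le> t i \<and> t i < 1}"
proof (intro equalityI subsetI)
 fix v assume "v \<in> D"
 thus "v \<in> {(\<Sum>i\<in>UNIV. t i *\<^sub>R b i) | t. \<forall>i. 0 \<le> t i \<and> t i < 1}"
  using expand[of v] by (auto simp: D_def intro!: exI[of _ "\<lambda>i. v \<bullet> bd i"])
qed (auto simp: D_def coord_sum)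

lemma D_borel [measurable]: "D \<in> sets borel"
 unfolding D_def by measurable

lemma D_bounded: "bounded D"
proof (rule boundedI)
 fix v assume v: "v \<in> D"
 have "norm v = norm (\<Sum>i\<in>UNIV. (v \<bullet> bd i) *\<^sub>R b i)" using expand[of v] by simp
 also have "\<dots> \<le> (\<Sum>i\<in>UNIV. norm ((v \<bullet> bd i) *\<^sub>R b i))" by (rule norm_sum)
 also have "\<dots> \<le> (\<Sum>i\<in>UNIV. norm (b i))"
 proof (rule sum_mono)
  fix i
  have "\<bar>v \<bullet> bd i\<bar> \<le> 1" using v unfolding D_def by (metis (mono_tags) abs_of_nonneg less_imp_le mem_Collect_eq)
  thus "norm ((v \<bullet> bd i) *\<^sub>R b i) \<le> norm (b i)" by (simp add: mult_left_le_one_le)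
 qed
 finally show "norm v \<le> (\<Sum>i\<in>UNIV. norm (b i))" .
qed

text \<open>The translates of \<open>D\<close> by countably many lattice vectors cover the space, so
  the exceptional sets add up to a null set.\<close>

lemma AE_from_cell:
 assumes P: "AE v in lborel. v \<in> D \<longrightarrow> P v" and sh: "\<And>K. K \<in> L \<Longrightarrow> AE v in lborel. P v \<longrightarrow> P (v + K)"
 shows "AE v in lborel. P v"
proof -
 have "AE v in lborel. v - K \<in> D \<longrightarrow> P v" if K: "K \<in> L" for K
  using AE_shift[OF P, of "- K"] AE_shift[OF sh[OF K], of "- K"] by eventually_elim auto
 hence "AE v in lborel. \<forall>K\<in>L. v - K \<in> D \<longrightarrow> P v"
  by (subst AE_ball_countable[OF L_countable]) blast
 thus ?thesis by eventually_elim (use fl_L fl_D in blast)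
qed

text \<open>If the cell were null, \<open>AE_from_cell\<close> for the property \<open>False\<close>
  would make the whole space null.\<close>

lemma D_not_null: "emeasure lborel D \<noteq> 0"
proof
 assume "emeasure lborel D = 0"
 hence "AE v in lborel. v \<notin> D" by (intro AE_not_in) (auto simp: null_sets_def)
 hence "AE v in lborel. v \<in> D \<longrightarrow> False" by simp
 from AE_from_cell[OF this] have "AE v::real^'d in lborel. False" by simp
 thus False by (simp add: trivial_limit_def[symmetric] ae_filter_eq_bot_iff)
qed

lemma D_finite: "emeasure lborel D < \<infinity>"
 by (rule emeasure_bounded_finite[OF D_bounded])

text \<open>The map is the automorphism of the torus induced by \<open>A\<close>, read in the cell.
  The preimage of \<open>S\<close> is cut according to the lattice vector \<open>K\<close> that gets
  subtracted; \<open>A\<close> followed by the translation by \<open>- K\<close> carries the piece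
  \<open>X K\<close> onto \<open>Y K\<close>, and the pieces \<open>Y K\<close> partition
  \<open>S\<close>.\<close>

lemma cell_map_preserves:
 fixes A :: "real ^ 'd ^ 'd"
 assumes A: "orthogonal_matrix A" and AL: "(\<lambda>v. A *v v) ` L = L"
  and S: "S \<in> sets borel" "S \<subseteq> D"
 shows "emeasure lborel {v \<in> D. A *v v - fl (A *v v) \<in> S} = emeasure lborel S"
proof -
 define B where "B = transpose A"
 have inv: "A *v (B *v x) = x" "B *v (A *v x) = x" for x
  using A unfolding B_def by (simp_all add: orthogonal_matrix_def matrix_vector_mul_assoc del: transpose_matrix_vector)
 have BL: "B *v K \<in> L" if "K \<in> L" for K using that AL inv by (metis imageE)
 have AL': "A *v K \<in> L" if "K \<in> L" for K using that AL by blast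
 define X where "X K = {v \<in> D. A *v v - K \<in> S}" for K
 define Y where "Y K = {w \<in> S. B *v (w + K) \<in> D}" for K
 have [measurable]: "S \<in> sets borel" by (rule S)
 have Xm: "X K \<in> sets lborel" for K unfolding X_def by measurable
 have Ym: "Y K \<in> sets lborel" for K unfolding Y_def by measurable
 have XY: "emeasure lborel (X K) = emeasure lborel (Y K)" for K
 proof -
  have "emeasure lborel (Y K) = emeasure (distr lborel borel ((+) (- K))) (Y K)" by (simp add: lborel_distr_plus)
  also have "\<dots> = emeasure lborel ((+) (- K) -` Y K)" using Ym by (subst emeasure_distr) auto
  also have "\<dots> = emeasure (distr lborel borel ((*v) A)) ((+) (- K) -` Y K)"
   by (simp add: distr_orthogonal_matrix[OF A])
  also have "\<dots> = emeasure lborel ((*v) A -` ((+) (- K) -` Y K))"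
  proof (subst emeasure_distr)
   show "(+) (- K) -` Y K \<in> sets borel"
    using measurable_sets[of "(+) (- K)" borel borel "Y K"] Ym by simp
  qed (auto intro!: borel_measurable_matrix_vector)
  also have "(*v) A -` ((+) (- K) -` Y K) = X K" by (auto simp: X_def Y_def inv)
  finally show ?thesis by simp
 qed
 have "{v \<in> D. A *v v - fl (A *v v) \<in> S} = (\<Union>K\<in>L. X K)"
 proof (intro equalityI subsetI)
  fix v assume "v \<in> (\<Union>K\<in>L. X K)"
  then obtain K where K: "K \<in> L" "v \<in> D" "A *v v - K \<in> S" by (auto simp: X_def)
  have "A *v v - K = A *v v - fl (A *v v)"
   by (rule D_unique) (use K S fl_D L_diff[OF fl_L K(1)] in \<open>auto simp: algebra_simps\<close>)
  thus "v \<in> {v \<in> D. A *v v - fl (A *v v) \<in> S}" using K by simp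
 qed (use fl_L in \<open>auto simp: X_def\<close>)
 also have "emeasure lborel (\<Union>K\<in>L. X K) = (\<integral>\<^sup>+K. emeasure lborel (X K) \<partial>count_space L)"
 proof (rule emeasure_UN_countable[OF Xm L_countable], unfold disjoint_family_on_def, safe)
  fix K K' v assume K: "K \<in> L" "K' \<in> L" "K \<noteq> K'" "v \<in> X K" "v \<in> X K'"
  have "A *v v - K = A *v v - K'"
   by (rule D_unique) (use K S L_diff[OF K(2,1)] in \<open>auto simp: X_def\<close>)
  thus "v \<in> {}" using K by simp
 qed
 also have "\<dots> = (\<integral>\<^sup>+K. emeasure lborel (Y K) \<partial>count_space L)" by (simp add: XY)
 also have "\<dots> = emeasure lborel (\<Union>K\<in>L. Y K)"
 proof (rule emeasure_UN_countable[OF Ym L_countable, symmetric], unfold disjoint_family_on_def, safe)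
  fix K K' v assume K: "K \<in> L" "K' \<in> L" "K \<noteq> K'" "v \<in> Y K" "v \<in> Y K'"
  have "B *v (v + K) = B *v (v + K')"
   by (rule D_unique) (use K BL[OF L_diff[OF K(1,2)]] in \<open>auto simp: Y_def algebra_simps simp flip: matrix_vector_mult_diff_distrib\<close>)
  hence "A *v (B *v (v + K)) = A *v (B *v (v + K'))" by simp
  thus "v \<in> {}" using K unfolding inv by simp
 qed
 also have "(\<Union>K\<in>L. Y K) = S"
 proof (intro equalityI subsetI)
  fix w assume w: "w \<in> S"
  let ?K = "- (A *v fl (B *v w))"
  have "B *v (w + ?K) = B *v w - fl (B *v w)"
   by (simp add: matrix_vector_mult_diff_distrib inv)
  hence "w \<in> Y ?K" using w fl_D by (simp add: Y_def)
  moreover have "?K \<in> L" by (intro L_minus AL' fl_L)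
  ultimately show "w \<in> (\<Union>K\<in>L. Y K)" by blast
 qed (auto simp: Y_def)
 finally show ?thesis .
qed

lemma fl_measurable [measurable]: "fl \<in> borel_measurable borel"
 unfolding fl_def[abs_def] by measurable

text \<open>\<open>A\<close> preserves the lattice but need not map the cell to itself. Periodicity
  of \<open>f\<close> allows \<open>A *v v\<close> to be reduced to the cell, and
  \<open>cell_map_preserves\<close> is then the change of variables. Countability of the lattice
  absorbs the null sets on which periodicity fails.\<close>

lemma cell_integral_invariant:
 fixes A :: "real ^ 'd ^ 'd" and f :: "real ^ 'd \<Rightarrow> 'b::{banach, second_countable_topology}"
 assumes A: "orthogonal_matrix A" and AL: "(\<lambda>v. A *v v) ` L = L"
  and f: "f \<in> borel_measurable borel" and per: "\<And>K. K \<in> L \<Longrightarrow> AE v in lborel. f (v + K) = f v"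
 shows "(LINT v:D|lborel. f (A *v v)) = (LINT v:D|lborel. f v)"
proof -
 let ?\<mu> = "restrict_space lborel D" and ?\<phi> = "\<lambda>v. A *v v - fl (A *v v)"
 have \<phi>m: "?\<phi> \<in> measurable borel borel" by measurable
 have \<phi>: "?\<phi> \<in> measurable ?\<mu> ?\<mu>"
  by (rule measurable_restrict_space2[OF _ measurable_restrict_space1]) (use \<phi>m in \<open>auto simp: fl_D\<close>)
 have distr: "distr ?\<mu> ?\<mu> ?\<phi> = ?\<mu>"
 proof (rule measure_eqI)
  fix S assume "S \<in> sets (distr ?\<mu> ?\<mu> ?\<phi>)"
  hence S: "S \<in> sets ?\<mu>" by simp
  hence S': "S \<in> sets borel" "S \<subseteq> D" by (auto simp: sets_restrict_space)
  have "emeasure (distr ?\<mu> ?\<mu> ?\<phi>) S = emeasure ?\<mu> (?\<phi> -` S \<inter> D)"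
   using S \<phi> by (simp add: emeasure_distr space_restrict_space)
  also have "\<dots> = emeasure lborel (?\<phi> -` S \<inter> D)" by (rule emeasure_restrict_space) auto
  also have "?\<phi> -` S \<inter> D = {v \<in> D. ?\<phi> v \<in> S}" by auto
  also have "emeasure lborel \<dots> = emeasure lborel S" by (rule cell_map_preserves[OF A AL S'])
  also have "\<dots> = emeasure ?\<mu> S" using S' by (intro emeasure_restrict_space[symmetric]) auto
  finally show "emeasure (distr ?\<mu> ?\<mu> ?\<phi>) S = emeasure ?\<mu> S" .
 qed simp
 have "AE w in lborel. \<forall>K\<in>L. f (w + K) = f w"
  by (subst AE_ball_countable[OF L_countable]) (use per in blast)
 from AE_orthogonal_matrix[OF A this]
 have ae: "AE v in lborel. f (A *v v) = f (?\<phi> v)"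
 proof eventually_elim
  case (elim v)
  thus ?case using L_minus[OF fl_L[of "A *v v"]] by (metis add_uminus_conv_diff)
 qed
 have fr: "f \<in> borel_measurable ?\<mu>" using f by (intro measurable_restrict_space1) simp
 have "(LINT v:D|lborel. f (A *v v)) = (LINT v:D|lborel. f (?\<phi> v))"
  by (rule set_lebesgue_integral_cong_AE) (use ae f \<phi>m in \<open>auto intro!: measurable_compose[OF _ f] borel_measurable_matrix_vector\<close>)
 also have "\<dots> = integral\<^sup>L ?\<mu> (\<lambda>v. f (?\<phi> v))"
  by (simp add: integral_restrict_space set_lebesgue_integral_def)
 also have "\<dots> = integral\<^sup>L (distr ?\<mu> ?\<mu> ?\<phi>) f" by (rule integral_distr[OF \<phi> fr, symmetric])
 also have "\<dots> = (LINT v:D|lborel. f v)"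
  unfolding distr by (simp add: integral_restrict_space set_lebesgue_integral_def)
 finally show ?thesis .
qed

lemma expand_dual: "v = (\<Sum>i\<in>UNIV. (v \<bullet> b i) *\<^sub>R bd i)"
proof (rule vector_eq_ldot[THEN iffD1, rule_format])
 fix x show "x \<bullet> v = x \<bullet> (\<Sum>i\<in>UNIV. (v \<bullet> b i) *\<^sub>R bd i)"
  by (subst expand[of x]) (simp add: inner_sum_left inner_sum_right inner_commute mult.commute)
qed

lemma dual_lattice: assumes "c \<noteq> 0" shows "lattice (\<lambda>i. c *\<^sub>R bd i) (\<lambda>i. (1 / c) *\<^sub>R b i)"
proof
 show "c *\<^sub>R bd i \<bullet> (1 / c) *\<^sub>R b j = (if i = j then 1 else 0)" for i j
  using assms dual[of j i] by (auto simp: inner_commute)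
 show "v = (\<Sum>i\<in>UNIV. (v \<bullet> (1 / c) *\<^sub>R b i) *\<^sub>R c *\<^sub>R bd i)" for v
  using assms by (subst expand_dual) simp
qed

end

lemma lattice_of_basis:
 fixes b :: "'d::finite \<Rightarrow> real ^ 'd"
 assumes inj: "inj b" and ind: "independent (range b)"
 obtains bd where "lattice b bd"
proof -
 define T where "T t = (\<Sum>i\<in>UNIV. (t $ i) *\<^sub>R b i)" for t :: "real ^ 'd"
 have lin: "linear T" unfolding T_def by (rule linearI) (simp_all add: scaleR_add_left sum.distrib scaleR_sum_right)
 have "inj T"
 proof (subst linear_injective_0[OF lin], intro allI impI)
  fix t assume "T t = 0"
  hence "(\<Sum>v\<in>range b. (t $ (inv_into UNIV b v)) *\<^sub>R v) = 0"
   using inj by (simp add: T_def sum.reindex)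
  hence "\<forall>v\<in>range b. t $ (inv_into UNIV b v) = 0"
   using ind unfolding independent_explicit_finite_subsets by (meson finite finite_imageI order_refl)
  thus "t = 0" using inj by (auto simp: vec_eq_iff)
 qed
 then obtain S where S: "linear S" "\<And>x. S (T x) = x" "\<And>x. T (S x) = x"
  using linear_injective_isomorphism[OF lin] by blast
 \<comment> \<open>\<open>S\<close> sends a vector to its coordinates in the basis \<open>b\<close>;
   its adjoint turns the coordinate functionals into the vectors of the dual basis.\<close>
 define bd where "bd i = adjoint S (axis i 1)" for i
 have bd: "v \<bullet> bd i = S v $ i" for v i
  unfolding bd_def using adjoint_works[OF S(1)] by (simp add: inner_axis)
 have Tax: "T (axis i 1) = b i" for i
  by (simp add: T_def axis_def if_distrib[of "\<lambda>x. x *\<^sub>R _"] cong: if_cong)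
 have "lattice b bd"
 proof
  show "b i \<bullet> bd j = (if i = j then 1 else 0)" for i j
   using arg_cong[OF S(2)[of "axis i 1"], of "\<lambda>v. v $ j"] unfolding Tax by (simp add: bd axis_def)
  show "v = (\<Sum>i\<in>UNIV. (v \<bullet> bd i) *\<^sub>R b i)" for v
   using S(3)[of v] by (simp add: bd T_def)
 qed
 thus ?thesis using that by blast
qed

section \<open>Wavefunctions\<close>

lemma norm_cvec_sq: "(norm (v :: complex ^ 'v::finite))\<^sup>2 = (\<Sum>i\<in>UNIV. (cmod (v $ i))\<^sup>2)"
 by (simp add: norm_vec_def L2_set_def sum_nonneg)

lemma cdot_self: "cdot v v = of_real ((norm v)\<^sup>2)"
 unfolding cdot_def norm_cvec_sq of_real_sum by (simp add: mult_cnj_cmod)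

lemma cdot_add_right: "cdot u (v + w) = cdot u v + cdot u w"
 by (simp add: cdot_def algebra_simps sum.distrib)

lemma cdot_scale_right: "cdot u (c *s v) = c * cdot u v"
 by (simp add: cdot_def sum_distrib_left algebra_simps)

lemma cdot_scale_left: "cdot (c *s u) v = cnj c * cdot u v"
 by (simp add: cdot_def sum_distrib_left algebra_simps)

lemma cdot_cnj: "cdot v u = cnj (cdot u v)"
 by (simp add: cdot_def mult.commute)

lemma norm_scale_cvec: "norm (c *s (v :: complex ^ 'v::finite)) = cmod c * norm v"
proof -
 have "(norm (c *s v))\<^sup>2 = (cmod c * norm v)\<^sup>2"
  unfolding power_mult_distrib norm_cvec_sq sum_distrib_left by (simp add: norm_mult power_mult_distrib)
 thus ?thesis by (simp add: power2_eq_iff_nonneg)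
qed

lemma cmod_cdot_le: "cmod (cdot u v) \<le> (norm u)\<^sup>2 + (norm v)\<^sup>2"
proof -
 have ab: "a * b \<le> a\<^sup>2 + b\<^sup>2" if "0 \<le> a" "0 \<le> b" for a b :: real
  using sum_squares_bound[of a b] mult_nonneg_nonneg[OF that] by linarith
 have "cmod (cdot u v) \<le> (\<Sum>i\<in>UNIV. cmod (cnj (u $ i) * v $ i))" unfolding cdot_def by (rule norm_sum)
 also have "\<dots> \<le> (\<Sum>i\<in>UNIV. (cmod (u $ i))\<^sup>2 + (cmod (v $ i))\<^sup>2)"
  by (intro sum_mono) (simp add: norm_mult ab)
 finally show ?thesis by (simp add: norm_cvec_sq sum.distrib)
qed

lemma measurable_cvec_nth [measurable]:
 fixes f :: "'x \<Rightarrow> complex ^ 'v::finite"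
 assumes "f \<in> borel_measurable M" shows "(\<lambda>x. f x $ j) \<in> borel_measurable M"
 by (rule borel_measurable_continuous_on[OF _ assms]) (intro continuous_intros)

lemma measurable_cdot [measurable]:
 assumes "f \<in> borel_measurable M" "g \<in> borel_measurable M"
 shows "(\<lambda>x. cdot (f x) (g x)) \<in> borel_measurable M"
proof -
 have "(\<lambda>x. cnj (f x $ i)) \<in> borel_measurable M" for i
  by (rule borel_measurable_continuous_on[OF _ measurable_cvec_nth[OF assms(1)]]) (intro continuous_intros)
 thus ?thesis unfolding cdot_def using assms by measurable
qed

lemma measurable_scale_cvec [measurable]:
 fixes f :: "'x \<Rightarrow> complex ^ 'v::finite"
 assumes "c \<in> borel_measurable M" "f \<in> borel_measurable M"
 shows "(\<lambda>x. c x *s f x) \<in> borel_measurable M"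
proof (rule borel_measurable_continuous_Pair[OF assms])
 show "continuous_on UNIV (\<lambda>x. fst x *s snd x :: complex ^ 'v)"
  unfolding vector_scalar_mult_def by (intro continuous_intros)
qed

lemma measurable_cis [measurable]:
 assumes "f \<in> borel_measurable M" shows "(\<lambda>x. cis (f x)) \<in> borel_measurable M"
 by (rule borel_measurable_continuous_on[OF _ assms]) (intro continuous_intros)

section \<open>Equality almost everywhere, scaling and plane waves\<close>

abbreviation aeq_infix (infix \<open>\<simeq>\<close> 50) where "f \<simeq> g \<equiv> f \<approx>\<^sub>a\<^sub>e g"

lemma aeq_refl [simp]: "f \<simeq> f"
 by (simp add: aeq_def)

lemma aeq_sym: "f \<simeq> g \<Longrightarrow> g \<simeq> f"
 by (simp add: aeq_def eq_commute)

lemma aeq_trans: "f \<simeq> g \<Longrightarrow> g \<simeq> h \<Longrightarrow> f \<simeq> h"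
 unfolding aeq_def by (erule (1) eventually_elim2) simp

lemma aeq_add: "f \<simeq> f' \<Longrightarrow> g \<simeq> g' \<Longrightarrow> f + g \<simeq> f' + g'"
 unfolding aeq_def by (erule (1) eventually_elim2) simp

lemma aeq_diff: "f \<simeq> f' \<Longrightarrow> g \<simeq> g' \<Longrightarrow> f - g \<simeq> f' - g'"
 unfolding aeq_def by (erule (1) eventually_elim2) simp

lemma aeq_scl: "f \<simeq> f' \<Longrightarrow> scl c f \<simeq> scl c f'"
 unfolding aeq_def by (erule eventually_mono) (simp add: scl_def)

lemma aeq_plane_wave: "f \<simeq> f' \<Longrightarrow> plane_wave k f \<simeq> plane_wave k f'"
 unfolding aeq_def by (erule eventually_mono) (simp add: plane_wave_def)

lemma aeq_sum:
 fixes f g :: "'i \<Rightarrow> ('d::finite, 'v::finite) wavefun"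
 shows "(\<And>i. i \<in> I \<Longrightarrow> f i \<simeq> g i) \<Longrightarrow> (\<Sum>i\<in>I. f i) \<simeq> (\<Sum>i\<in>I. g i)"
 by (induction I rule: infinite_finite_induct) (auto intro: aeq_add)

lemma aeq_shift: "f \<simeq> g \<Longrightarrow> (\<lambda>r. f (r + R)) \<simeq> (\<lambda>r. g (r + R))"
 unfolding aeq_def by (rule AE_shift)

lemma sum_fun_apply2:
 fixes f :: "'i \<Rightarrow> ('d::finite, 'v::finite) wavefun"
 shows "(\<Sum>i\<in>I. f i) r n = (\<Sum>i\<in>I. f i r n)"
 by (induction I rule: infinite_finite_induct) auto

lemma scl_add_right: "scl c (f + g) = scl c f + scl c g"
 and scl_add_left: "scl (c + d) f = scl c f + scl d f"
 and scl_scl: "scl c (scl d f) = scl (c * d) f"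
 and scl_one [simp]: "scl 1 f = f"
 and scl_zero_left [simp]: "scl 0 f = 0"
 and scl_zero_right [simp]: "scl c 0 = 0"
 and scl_minus_one: "scl (- 1) f = - f"
 and scl_diff_right: "scl c (f - g) = scl c f - scl c g"
 by (auto simp: scl_def fun_eq_iff vec_eq_iff algebra_simps)

lemma scl_sum:
 fixes f :: "'i \<Rightarrow> ('d::finite, 'v::finite) wavefun"
 shows "scl c (\<Sum>i\<in>I. f i) = (\<Sum>i\<in>I. scl c (f i))"
 by (rule ext, rule ext) (simp add: scl_def sum_fun_apply2 sum_cmul)

lemma scl_sum_left:
 fixes f :: "('d::finite, 'v::finite) wavefun"
 shows "scl (\<Sum>i\<in>I. c i) f = (\<Sum>i\<in>I. scl (c i) f)"
 by (induction I rule: infinite_finite_induct) (auto simp: scl_add_left)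

lemma plane_wave_add: "plane_wave k (f + g) = plane_wave k f + plane_wave k g"
 and plane_wave_diff: "plane_wave k (f - g) = plane_wave k f - plane_wave k g"
 and plane_wave_zero [simp]: "plane_wave k 0 = 0"
 and plane_wave_scl: "plane_wave k (scl c f) = scl c (plane_wave k f)"
 and plane_wave_plane_wave: "plane_wave k (plane_wave k' f) = plane_wave (k + k') f"
 and plane_wave_by_zero [simp]: "plane_wave 0 f = f"
 by (auto simp: plane_wave_def scl_def fun_eq_iff vec_eq_iff algebra_simps cis_mult[symmetric] inner_add_left)

lemma plane_wave_inverse [simp]:
 "plane_wave k (plane_wave (- k) f) = f" "plane_wave (- k) (plane_wave k f) = f"
 by (simp_all add: plane_wave_plane_wave)

lemma plane_wave_sum:
 fixes f :: "'i \<Rightarrow> ('d::finite, 'v::finite) wavefun"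
 shows "plane_wave k (\<Sum>i\<in>I. f i) = (\<Sum>i\<in>I. plane_wave k (f i))"
 by (rule ext, rule ext) (simp add: plane_wave_def sum_fun_apply2 sum_cmul)

text \<open>Without a Bloch condition, the Bloch functions of all wavevectors lie in one semi-inner
  product space, whose form integrates over a single cell.\<close>

definition LV :: "nat \<Rightarrow> ('d::finite, 'v::finite) wavefun set" where
 "LV m = {f \<in> wavefuns m. loc_sq_integrable f}"

lemma wavefuns_measurable: "f \<in> wavefuns m \<Longrightarrow> (\<lambda>r. f r i) \<in> borel_measurable borel"
 and wavefuns_zero: "f \<in> wavefuns m \<Longrightarrow> i \<ge> m \<Longrightarrow> f r i = 0"
 by (simp_all add: wavefuns_def)

lemma wavefuns_add: "f \<in> wavefuns m \<Longrightarrow> g \<in> wavefuns m \<Longrightarrow> f + g \<in> wavefuns m"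
 by (auto simp: wavefuns_def intro: borel_measurable_add)

lemma wavefuns_scl: "f \<in> wavefuns m \<Longrightarrow> scl c f \<in> wavefuns m"
 by (auto simp: wavefuns_def scl_def intro: measurable_scale_cvec)

lemma wavefuns_0: "0 \<in> wavefuns m"
 by (auto simp: wavefuns_def zero_fun_def)

lemma wavefuns_plane_wave: "f \<in> wavefuns m \<Longrightarrow> plane_wave k f \<in> wavefuns m"
 by (auto simp: wavefuns_def plane_wave_def intro!: measurable_scale_cvec)

lemma LV_measurable [measurable (raw)]: "f \<in> LV m \<Longrightarrow> (\<lambda>r. f r i) \<in> borel_measurable borel"
 by (simp add: LV_def wavefuns_def)

text \<open>Domination by two members of \<open>LV m\<close> covers scalings, plane waves and,
  through (a + b)^2 \<le> 2 a^2 + 2 b^2, sums.\<close>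

lemma LV_bound:
 assumes f: "f \<in> wavefuns m" and g: "g \<in> LV m" "h \<in> LV m"
  and le: "\<And>r i. (norm (f r i))\<^sup>2 \<le> c * (norm (g r i))\<^sup>2 + d * (norm (h r i))\<^sup>2"
 shows "f \<in> LV m"
proof -
 have "set_integrable lborel S (\<lambda>r. (norm (f r i))\<^sup>2)" if S: "compact S" for S i
 proof -
  have "set_integrable lborel S (\<lambda>r. (norm (g r i))\<^sup>2)" "set_integrable lborel S (\<lambda>r. (norm (h r i))\<^sup>2)"
   using g S by (auto simp: LV_def loc_sq_integrable_def)
  hence "set_integrable lborel S (\<lambda>r. c * (norm (g r i))\<^sup>2 + d * (norm (h r i))\<^sup>2)"
   by (intro set_integral_add) auto
  thus ?thesis
  proof (rule set_integrable_bound)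
   have [measurable]: "S \<in> sets borel" "(\<lambda>r. f r i) \<in> borel_measurable borel"
    using S f by (auto simp: wavefuns_def compact_imp_closed)
   show "set_borel_measurable lborel S (\<lambda>r. (norm (f r i))\<^sup>2)"
    unfolding set_borel_measurable_def by measurable
  qed (use le order_trans[OF le abs_ge_self] in \<open>auto\<close>)
 qed
 thus ?thesis using f by (simp add: LV_def loc_sq_integrable_def)
qed

lemma LV_zero: "0 \<in> LV m"
 by (simp add: LV_def wavefuns_0 loc_sq_integrable_def set_integrable_def)

lemma LV_scl: assumes "f \<in> LV m" shows "scl c f \<in> LV m"
 by (rule LV_bound[OF _ assms assms, of _ "(cmod c)\<^sup>2" 0])
   (use assms in \<open>auto simp: LV_def wavefuns_scl, auto simp: scl_def norm_scale_cvec power_mult_distrib\<close>)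

lemma LV_add: assumes "f \<in> LV m" "g \<in> LV m" shows "f + g \<in> LV m"
proof (rule LV_bound[OF _ assms, of _ 2 2])
 fix r i
 have "(norm (f r i + g r i))\<^sup>2 \<le> (norm (f r i) + norm (g r i))\<^sup>2"
  by (intro power_mono norm_triangle_ineq) auto
 also have "\<dots> \<le> 2 * (norm (f r i))\<^sup>2 + 2 * (norm (g r i))\<^sup>2"
  using sum_squares_bound[of "norm (f r i)" "norm (g r i)"] by (simp add: power2_sum)
 finally show "(norm ((f + g) r i))\<^sup>2 \<le> 2 * (norm (f r i))\<^sup>2 + 2 * (norm (g r i))\<^sup>2" by simp
qed (use assms in \<open>auto simp: LV_def wavefuns_add\<close>)

lemma LV_plane_wave: assumes "f \<in> LV m" shows "plane_wave k f \<in> LV m"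
 by (rule LV_bound[OF _ assms assms, of _ 1 0])
   (use assms in \<open>auto simp: LV_def wavefuns_plane_wave, auto simp: plane_wave_def norm_scale_cvec\<close>)

text \<open>The number \<open>m\<close> of components is a parameter: Whitney sums are treated by a
  second interpretation at \<open>m + m\<close>, for which \<open>inn2\<close>, \<open>nm2\<close>
  and \<open>Bl2\<close> stand.\<close>

locale mcr =
 fixes C :: "('d::finite, 'p, 'v::finite) crystal" and m :: nat
 assumes mc: "magnetic_crystal C"
begin

abbreviation "inn \<equiv> inner_cell C m"
abbreviation "nm \<equiv> norm_cell C m"
abbreviation "Bl \<equiv> bloch_space C m"
abbreviation "onb \<equiv> orthonormal_basis C m"
abbreviation "SG \<equiv> space_group C"
abbreviation "inn2 \<equiv> inner_cell C (m + m)"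
abbreviation "nm2 \<equiv> norm_cell C (m + m)"
abbreviation "Bl2 \<equiv> bloch_space C (m + m)"
abbreviation "apf \<equiv> analytic_periodic_frame C m"

definition pd :: "'d \<Rightarrow> real ^ 'd" where "pd = (SOME bd. lattice (prim C) bd)"

sublocale cell: lattice "prim C" pd
proof -
 obtain bd where "lattice (prim C) bd"
  using lattice_of_basis[of "prim C"] mc by (auto simp: magnetic_crystal_def)
 thus "lattice (prim C) pd" unfolding pd_def by (rule someI[where P = "lattice (prim C)"])
qed

sublocale bz: lattice "\<lambda>i. (2 * pi) *\<^sub>R pd i" "\<lambda>i. (1 / (2 * pi)) *\<^sub>R prim C i"
 by (rule cell.dual_lattice) simp

lemma BL_eq: "BL C = cell.L"
 by (simp add: BL_def cell.L_alt)

lemma RL_eq: "RL C = bz.L"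
proof (intro equalityI subsetI)
 fix K assume K: "K \<in> RL C"
 have "K \<bullet> ((1 / (2 * pi)) *\<^sub>R prim C i) \<in> \<int>" for i
 proof -
  obtain n :: int where "K \<bullet> prim C i = 2 * pi * of_int n"
   using K cell.L_basis[of i] by (auto simp: RL_def BL_eq)
  thus ?thesis by simp
 qed
 thus "K \<in> bz.L" by (simp add: bz.L_def)
next
 fix K assume K: "K \<in> bz.L"
 have "\<exists>n::int. K \<bullet> R = 2 * pi * of_int n" if R: "R \<in> BL C" for R
 proof -
  obtain n where n: "R = (\<Sum>i\<in>UNIV. of_int (n i) *\<^sub>R prim C i)" using R by (auto simp: BL_def)
  have "\<forall>i. \<exists>l. K \<bullet> prim C i = 2 * pi * of_int l"
  proof
   fix i
   have "K \<bullet> ((1 / (2 * pi)) *\<^sub>R prim C i) \<in> \<int>" using K unfolding bz.L_def by blast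
   then obtain l where "K \<bullet> ((1 / (2 * pi)) *\<^sub>R prim C i) = of_int l" by (elim Ints_cases)
   thus "\<exists>l. K \<bullet> prim C i = 2 * pi * of_int l" by (intro exI[of _ l]) (simp add: field_simps)
  qed
  then obtain l where l: "\<And>i. K \<bullet> prim C i = 2 * pi * of_int (l i)" by metis
  have "K \<bullet> R = 2 * pi * of_int (\<Sum>i\<in>UNIV. n i * l i)"
   by (simp add: n inner_sum_right l sum_distrib_left mult_ac)
  thus ?thesis by blast
 qed
 thus "K \<in> RL C" by (simp add: RL_def)
qed

lemma unit_cell_eq: "unit_cell C = cell.D"
 by (simp add: unit_cell_def cell.D_alt)

lemma BZ_eq: "BZ C = bz.D"
 unfolding BZ_def bz.D_def using pi_gt_zero by (simp add: pos_divide_less_eq pos_le_divide_eq)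

text \<open>The closure of the cell is compact, so local square integrability yields integrable
  squares on the cell, and these dominate the products.\<close>

lemma inner_integrable:
 fixes f g :: "('d, 'v) wavefun"
 assumes f: "f \<in> LV m" and g: "g \<in> LV m"
 shows "set_integrable lborel (unit_cell C) (\<lambda>r. \<Sum>i<m. cdot (f r i) (g r i))"
proof -
 let ?K = "closure (unit_cell C)"
 have K: "compact ?K" using cell.D_bounded by (simp add: unit_cell_eq)
 have U [measurable]: "unit_cell C \<in> sets borel" using cell.D_borel by (simp add: unit_cell_eq)
 have "set_integrable lborel ?K (\<lambda>r. (norm (h r i))\<^sup>2)" if "h \<in> LV m" for h :: "('d,'v) wavefun" and i
  using that K by (auto simp: LV_def loc_sq_integrable_def)
 hence "set_integrable lborel (unit_cell C) (\<lambda>r. (norm (h r i))\<^sup>2)" if "h \<in> LV m" for h :: "('d,'v) wavefun" and i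
  by (rule set_integrable_subset) (use that U closure_subset in auto)
 hence "set_integrable lborel (unit_cell C) (\<lambda>r. \<Sum>i<m. (norm (f r i))\<^sup>2 + (norm (g r i))\<^sup>2)"
  using f g unfolding set_integrable_def scaleR_sum_right scaleR_add_right
  by (intro Bochner_Integration.integrable_sum Bochner_Integration.integrable_add) blast+
 thus ?thesis
 proof (rule set_integrable_bound)
  have [measurable]: "\<And>i. (\<lambda>r. f r i) \<in> borel_measurable borel" "\<And>i. (\<lambda>r. g r i) \<in> borel_measurable borel"
   using f g by (simp_all add: LV_measurable)
  show "set_borel_measurable lborel (unit_cell C) (\<lambda>r. \<Sum>i<m. cdot (f r i) (g r i))"
   unfolding set_borel_measurable_def by measurable
  have "cmod (\<Sum>i<m. cdot (f r i) (g r i)) \<le> (\<Sum>i<m. (norm (f r i))\<^sup>2 + (norm (g r i))\<^sup>2)" for r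
   by (rule order_trans[OF norm_sum sum_mono]) (rule cmod_cdot_le)
  thus "AE r in lborel. r \<in> unit_cell C \<longrightarrow> norm (\<Sum>i<m. cdot (f r i) (g r i)) \<le>
    norm (\<Sum>i<m. (norm (f r i))\<^sup>2 + (norm (g r i))\<^sup>2)"
   by (auto intro: order_trans[OF _ abs_ge_self])
 qed
qed

text \<open>The \<open>rewrites\<close> clause makes the abstract norm literally
  \<open>norm_cell\<close>, so the results on semi-inner products speak of the norm used in the
  definitions of the theorem.\<close>

sublocale semi_inner "LV m :: ('d, 'v) wavefun set" scl "inn"
 rewrites "semi_inner.nrm (inn) = nm"
proof -
 show si: "semi_inner (LV m :: ('d, 'v) wavefun set) scl (inn)"
 proof
  fix x y z :: "('d, 'v) wavefun" and c
  show "0 \<in> (LV m :: ('d, 'v) wavefun set)" by (rule LV_zero)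
  show "- x = scl (- 1) x" by (simp add: scl_minus_one)
  assume x: "x \<in> LV m"
  show "scl c x \<in> LV m" using x by (rule LV_scl)
  show "0 \<le> Re (inn x x)"
  proof -
   have "inn x x = of_real (LINT r:unit_cell C|lborel. \<Sum>i<m. (norm (x r i))\<^sup>2)"
    unfolding inner_cell_def set_lebesgue_integral_def
    by (subst integral_complex_of_real[symmetric]) (simp add: cdot_self scaleR_conv_of_real)
   moreover have "0 \<le> (LINT r:unit_cell C|lborel. \<Sum>i<m. (norm (x r i))\<^sup>2)"
    unfolding set_lebesgue_integral_def by (intro integral_nonneg_AE AE_I2) (simp add: sum_nonneg)
   ultimately show ?thesis by simp
  qed
  assume y: "y \<in> LV m"
  show "x + y \<in> LV m" using x y by (rule LV_add)
  show "inn y x = cnj (inn x y)"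
  proof -
   have "indicator (unit_cell C) r *\<^sub>R (\<Sum>i<m. cdot (y r i) (x r i))
     = cnj (indicator (unit_cell C) r *\<^sub>R (\<Sum>i<m. cdot (x r i) (y r i)))" for r
    by (simp add: cdot_cnj[of "y _ _"])
   thus ?thesis unfolding inner_cell_def set_lebesgue_integral_def
    by (simp only: Bochner_Integration.integral_cnj)
  qed
  show "inn x (scl c y) = c * inn x y"
   unfolding inner_cell_def set_lebesgue_integral_def
   by (subst integral_mult_right_zero[symmetric])
     (simp add: scl_def cdot_scale_right sum_distrib_left[symmetric] mult.left_commute scaleR_conv_of_real)
  assume z: "z \<in> LV m"
  show "inn x (y + z) = inn x y + inn x z"
   unfolding inner_cell_def
   by (subst set_integral_add(2)[symmetric]) (use inner_integrable x y z in \<open>auto simp: cdot_add_right sum.distrib\<close>)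
 qed
 show "semi_inner.nrm (inn) = nm"
  by (simp add: semi_inner.nrm_def[OF si] norm_cell_def fun_eq_iff)
qed

lemma bloch_LV: "f \<in> Bl k \<Longrightarrow> f \<in> LV m"
 by (simp add: bloch_space_def LV_def)

lemma bloch_iff: "f \<in> Bl k \<longleftrightarrow>
  f \<in> LV m \<and> (\<forall>R\<in>BL C. (\<lambda>r. f (r + R)) \<simeq> scl (cis (k \<bullet> R)) f)"
 by (auto simp: bloch_space_def LV_def)

lemma bloch_zero: "0 \<in> Bl k"
 by (simp add: bloch_iff LV_zero zero_fun_def[symmetric])

lemma bloch_add: "f \<in> Bl k \<Longrightarrow> g \<in> Bl k \<Longrightarrow> f + g \<in> Bl k"
proof -
 assume f: "f \<in> Bl k" and g: "g \<in> Bl k"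
 have "(\<lambda>r. (f + g) (r + R)) = (\<lambda>r. f (r + R)) + (\<lambda>r. g (r + R))" for R by (simp add: fun_eq_iff)
 thus ?thesis using f g unfolding bloch_iff by (simp add: LV_add scl_add_right aeq_add)
qed

lemma bloch_scl: "f \<in> Bl k \<Longrightarrow> scl c f \<in> Bl k"
proof -
 assume f: "f \<in> Bl k"
 have "(\<lambda>r. scl c f (r + R)) \<simeq> scl (cis (k \<bullet> R)) (scl c f)" if "R \<in> BL C" for R
 proof -
  have "(\<lambda>r. scl c f (r + R)) = scl c (\<lambda>r. f (r + R))" by (simp add: scl_def)
  moreover have "(\<lambda>r. f (r + R)) \<simeq> scl (cis (k \<bullet> R)) f" using f that by (simp add: bloch_iff)
  from aeq_scl[OF this, of c] have "scl c (\<lambda>r. f (r + R)) \<simeq> scl (cis (k \<bullet> R)) (scl c f)"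
   by (simp add: scl_scl mult.commute)
  ultimately show ?thesis by simp
 qed
 thus ?thesis using f by (simp add: bloch_iff LV_scl)
qed

lemma bloch_sum: "(\<And>i. i \<in> I \<Longrightarrow> f i \<in> Bl k) \<Longrightarrow> (\<Sum>i\<in>I. f i) \<in> Bl k"
 by (induction I rule: infinite_finite_induct) (auto simp: bloch_zero bloch_add)

lemma bloch_diff: "f \<in> Bl k \<Longrightarrow> g \<in> Bl k \<Longrightarrow> f - g \<in> Bl k"
 using bloch_add[OF _ bloch_scl[of g k "-1"]] by (simp add: scl_minus_one)

lemma bloch_plane_wave:
 assumes f: "f \<in> Bl k" shows "plane_wave q f \<in> Bl (q + k)"
proof -
 have "(\<lambda>r. plane_wave q f (r + R)) \<simeq> scl (cis ((q + k) \<bullet> R)) (plane_wave q f)" if "R \<in> BL C" for R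
 proof -
  have "AE r in lborel. f (r + R) = scl (cis (k \<bullet> R)) f r"
   using f that by (simp add: bloch_iff aeq_def)
  thus ?thesis unfolding aeq_def
   by eventually_elim (auto simp: plane_wave_def scl_def fun_eq_iff vec_eq_iff inner_add_left inner_add_right cis_mult[symmetric])
 qed
 thus ?thesis using f by (simp add: bloch_iff LV_plane_wave)
qed

lemma bloch_plane_wave_0 [simp]:
 "f \<in> Bl k \<Longrightarrow> plane_wave (- k) f \<in> Bl 0"
 "f \<in> Bl 0 \<Longrightarrow> plane_wave k f \<in> Bl k"
 using bloch_plane_wave[of f k "- k"] bloch_plane_wave[of f 0 k] by auto

lemma inner_plane_wave [simp]: "inn (plane_wave k f) (plane_wave k g) = inn f g"
 by (simp add: inner_cell_def plane_wave_def cdot_scale_left cdot_scale_right cis_cnj cis_mult flip: mult.assoc)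

lemma norm_plane_wave [simp]: "nm (plane_wave k f) = nm f"
 by (simp add: norm_cell_def)

lemma inner_aeq:
 assumes "f \<in> LV m" "g \<in> LV m" "f' \<in> LV m" "g' \<in> LV m" "f \<simeq> f'" "g \<simeq> g'"
 shows "inn f g = inn f' g'"
proof -
 have [measurable]: "unit_cell C \<in> sets borel" using cell.D_borel by (simp add: unit_cell_eq)
 have [measurable]: "\<And>i. (\<lambda>r. f r i) \<in> borel_measurable borel" "\<And>i. (\<lambda>r. g r i) \<in> borel_measurable borel"
  "\<And>i. (\<lambda>r. f' r i) \<in> borel_measurable borel" "\<And>i. (\<lambda>r. g' r i) \<in> borel_measurable borel"
  using assms by (simp_all add: LV_measurable)
 show ?thesis unfolding inner_cell_def
 proof (rule set_lebesgue_integral_cong_AE)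
  show "AE r\<in>unit_cell C in lborel. (\<Sum>i<m. cdot (f r i) (g r i)) = (\<Sum>i<m. cdot (f' r i) (g' r i))"
   using assms(5,6) unfolding aeq_def by eventually_elim simp
 qed measurable
qed

lemma norm_aeq: "f \<in> LV m \<Longrightarrow> f' \<in> LV m \<Longrightarrow> f \<simeq> f' \<Longrightarrow> nm f = nm f'"
 unfolding norm_cell_def by (subst inner_aeq) auto

text \<open>\<open>nm\<close> sees one unit cell; the Bloch condition carries the vanishing there to
  all translates. On \<open>Bl k\<close>, as opposed to \<open>LV m\<close>, null vectors therefore
  vanish almost everywhere.\<close>

lemma norm_zero_aeq:
 assumes f: "f \<in> Bl k" and n: "nm f = 0"
 shows "f \<simeq> 0"
proof -
 have fL: "f \<in> LV m" by (rule bloch_LV[OF f])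
 have [measurable]: "unit_cell C \<in> sets borel" using cell.D_borel by (simp add: unit_cell_eq)
 have [measurable]: "\<And>i. (\<lambda>r. f r i) \<in> borel_measurable borel" using fL by (simp_all add: LV_measurable)
 let ?h = "\<lambda>r. indicator (unit_cell C) r *\<^sub>R (\<Sum>i<m. (norm (f r i))\<^sup>2)"
 have eq: "indicator (unit_cell C) r *\<^sub>R (\<Sum>i<m. cdot (f r i) (f r i)) = complex_of_real (?h r)" for r
  by (simp add: cdot_self scaleR_conv_of_real)
 have "inn f f = of_real (\<integral>r. ?h r \<partial>lborel)"
  unfolding inner_cell_def set_lebesgue_integral_def eq by (rule integral_complex_of_real)
 hence "(\<integral>r. ?h r \<partial>lborel) = 0" using n ip_self[OF fL] by simp
 moreover have "integrable lborel ?h"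
  using inner_integrable[OF fL fL] unfolding set_integrable_def eq complex_of_real_integrable_eq .
 ultimately have "AE r in lborel. ?h r = 0"
  by (subst (asm) integral_nonneg_eq_0_iff_AE) (auto simp: sum_nonneg)
 hence "AE r in lborel. r \<in> cell.D \<longrightarrow> f r = 0"
 proof eventually_elim
  case (elim r)
  show ?case
  proof
   assume "r \<in> cell.D"
   hence "(\<Sum>i<m. (norm (f r i))\<^sup>2) = 0" using elim by (simp add: unit_cell_eq)
   hence "\<forall>i<m. f r i = 0" by (simp add: sum_nonneg_eq_0_iff)
   moreover have "\<forall>i\<ge>m. f r i = 0" using wavefuns_zero[of f m] fL unfolding LV_def by blast
   ultimately have "f r i = 0" for i by (cases "i < m") auto
   thus "f r = 0" by (intro ext) simp
  qed
 qed
 hence "AE r in lborel. f r = 0"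
 proof (rule cell.AE_from_cell)
  fix K assume "K \<in> cell.L"
  hence "AE r in lborel. f (r + K) = scl (cis (k \<bullet> K)) f r" using f by (simp add: bloch_iff aeq_def BL_eq)
  thus "AE r in lborel. f r = 0 \<longrightarrow> f (r + K) = 0"
   by eventually_elim (simp add: scl_def fun_eq_iff)
 qed
 thus ?thesis by (simp add: aeq_def)
qed

lemma aeq_norm_zero: "f \<in> LV m \<Longrightarrow> f \<simeq> 0 \<Longrightarrow> nm f = 0"
 using norm_aeq[of f 0] by (simp add: LV_zero nrm_zero)

lemma aeq_iff: "f \<in> Bl k \<Longrightarrow> g \<in> Bl k \<Longrightarrow>
  f \<simeq> g \<longleftrightarrow> nm (f - g) = 0"
proof
 assume f: "f \<in> Bl k" and g: "g \<in> Bl k"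
 note d = bloch_diff[OF f g]
 { assume "f \<simeq> g"
  from aeq_diff[OF this aeq_refl[of g]] show "nm (f - g) = 0"
   using aeq_norm_zero[OF bloch_LV[OF d]] by simp }
 { assume "nm (f - g) = 0"
  from aeq_add[OF norm_zero_aeq[OF d this] aeq_refl[of g]] show "f \<simeq> g" by simp }
qed

lemma onb_ons: "onb k J \<psi> V \<Longrightarrow> ons J \<psi>"
 unfolding orthonormal_basis_def ons_def using bloch_LV by blast

lemma onb_bloch: "onb k J \<psi> V \<Longrightarrow> j \<in> J \<Longrightarrow> \<psi> j \<in> Bl k"
 unfolding orthonormal_basis_def by blast

text \<open>The coefficients are forced to be the inner products with the system, so the existential
  statement in \<open>orthonormal_basis\<close> amounts to a vanishing residual.\<close>

lemma res_aeq_iff: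
 assumes \<psi>: "ons J \<psi>" "\<And>j. j \<in> J \<Longrightarrow> \<psi> j \<in> Bl k" and f: "f \<in> Bl k"
 shows "(\<exists>c. f \<simeq> (\<Sum>j\<in>J. scl (c j) (\<psi> j))) \<longleftrightarrow> nm (res J \<psi> f) = 0"
proof
 have sb: "(\<Sum>j\<in>J. scl (c j) (\<psi> j)) \<in> Bl k" for c
  using \<psi>(2) by (intro bloch_sum bloch_scl)
 assume "nm (res J \<psi> f) = 0"
 hence "f \<simeq> (\<Sum>j\<in>J. scl (inn (\<psi> j) f) (\<psi> j))"
  using aeq_iff[OF f sb] by (simp add: res_def)
 thus "\<exists>c. f \<simeq> (\<Sum>j\<in>J. scl (c j) (\<psi> j))"
  by (rule exI[of _ "\<lambda>j. inn (\<psi> j) f"])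
next
 have sb: "(\<Sum>j\<in>J. scl (c j) (\<psi> j)) \<in> Bl k" for c
  using \<psi>(2) by (intro bloch_sum bloch_scl)
 assume "\<exists>c. f \<simeq> (\<Sum>j\<in>J. scl (c j) (\<psi> j))"
 then obtain c where c: "f \<simeq> (\<Sum>j\<in>J. scl (c j) (\<psi> j))" by blast
 have "inn (\<psi> j) f = c j" if "j \<in> J" for j
  using inner_aeq[OF _ bloch_LV[OF f] _ bloch_LV[OF sb] aeq_refl c, of "\<psi> j"] ip_ons_sum[OF \<psi>(1) that]
   bloch_LV[OF \<psi>(2)[OF that]] by simp
 hence "(\<Sum>j\<in>J. scl (inn (\<psi> j) f) (\<psi> j)) = (\<Sum>j\<in>J. scl (c j) (\<psi> j))" by simp
 thus "nm (res J \<psi> f) = 0" using aeq_iff[OF f sb] c by (simp add: res_def)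
qed

lemma onb_iff:
 "onb k J \<psi> V \<longleftrightarrow> ons J \<psi> \<and> (\<forall>j\<in>J. \<psi> j \<in> Bl k) \<and>
   V = {f \<in> Bl k. nm (res J \<psi> f) = 0}"
proof (cases "ons J \<psi> \<and> (\<forall>j\<in>J. \<psi> j \<in> Bl k)")
 case True
 hence "{f \<in> Bl k. \<exists>c. f \<simeq> (\<Sum>j\<in>J. scl (c j) (\<psi> j))} =
   {f \<in> Bl k. nm (res J \<psi> f) = 0}"
  using res_aeq_iff[of J \<psi> k] by blast
 moreover have "onb k J \<psi> V \<longleftrightarrow>
   V = {f \<in> Bl k. \<exists>c. f \<simeq> (\<Sum>j\<in>J. scl (c j) (\<psi> j))}"
 proof
  assume "onb k J \<psi> V"
  thus "V = {f \<in> Bl k. \<exists>c. f \<simeq> (\<Sum>j\<in>J. scl (c j) (\<psi> j))}"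
   unfolding orthonormal_basis_def by (elim conjE)
 next
  assume "V = {f \<in> Bl k. \<exists>c. f \<simeq> (\<Sum>j\<in>J. scl (c j) (\<psi> j))}"
  with True show "onb k J \<psi> V"
   unfolding orthonormal_basis_def ons_def by (elim conjE) (intro conjI)
 qed
 ultimately have "onb k J \<psi> V \<longleftrightarrow>
   V = {f \<in> Bl k. nm (res J \<psi> f) = 0}" by (simp only:)
 thus ?thesis using True by argo
next
 case False
 thus ?thesis using onb_ons[of k J \<psi> V] onb_bloch[of k J \<psi> V] by meson
qed

end

section \<open>Action of the space group\<close>

text \<open>Unitary and antiunitary operators share one formula this way, with \<open>s\<close> the
  time reversal sign.\<close>

definition cj :: "real \<Rightarrow> complex \<Rightarrow> complex" where
 "cj s c = (if s = 1 then c else cnj c)"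

lemma cj_mult: "cj s (c * d) = cj s c * cj s d"
 and cj_add: "cj s (c + d) = cj s c + cj s d"
 and cj_0 [simp]: "cj s 0 = 0"
 and cj_1 [simp]: "cj s 1 = 1"
 and cmod_cj [simp]: "cmod (cj s c) = cmod c"
 by (simp_all add: cj_def)

lemma cj_cis: "s \<in> {1, -1} \<Longrightarrow> cj s (cis x) = cis (s * x)"
 by (auto simp: cj_def cis_cnj)

lemma cj_sum: "cj s (\<Sum>i\<in>I. f i) = (\<Sum>i\<in>I. cj s (f i))"
 by (simp add: cj_def)

lemma ran_at_cj: "ran_at k0 f \<Longrightarrow> ran_at k0 (\<lambda>k. cj s (f k))"
 by (cases "s = 1") (simp_all add: cj_def ran_at_cnj)

context mcr
begin

lemma LV_aeq:
 fixes f g :: "('d, 'v) wavefun"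
 assumes f: "f \<in> wavefuns m" and g: "g \<in> LV m" and fg: "f \<simeq> g"
 shows "f \<in> LV m"
proof -
 have "set_integrable lborel S (\<lambda>r. (norm (f r i))\<^sup>2)" if S: "compact S" for S i
 proof -
  have [measurable]: "S \<in> sets borel" "(\<lambda>r. f r i) \<in> borel_measurable borel" "(\<lambda>r. g r i) \<in> borel_measurable borel"
   using S f g by (simp_all add: compact_imp_closed wavefuns_measurable LV_measurable)
  have "set_integrable lborel S (\<lambda>r. (norm (g r i))\<^sup>2)"
   using g S by (simp add: LV_def loc_sq_integrable_def)
  thus ?thesis unfolding set_integrable_def
   by (rule integrable_cong_AE_imp) (measurable, use fg in \<open>auto simp: aeq_def elim!: eventually_mono\<close>)
 qed
 thus ?thesis using f by (simp add: LV_def loc_sq_integrable_def)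
qed

abbreviation P where "P \<equiv> carrier (PG C)"
abbreviation pinv where "pinv p \<equiv> m_inv (PG C) p"

lemma grp: "group (PG C)" and finP: "finite P"
 using mc unfolding magnetic_crystal_def by blast+

lemma pinv_P [simp]: "p \<in> P \<Longrightarrow> pinv p \<in> P"
 by (rule group.inv_closed[OF grp])

lemma mult_P [simp]: "q \<in> P \<Longrightarrow> p \<in> P \<Longrightarrow> q \<otimes>\<^bsub>PG C\<^esub> p \<in> P"
 using grp by (simp add: group.is_monoid monoid.m_closed)

lemma one_P [simp]: "\<one>\<^bsub>PG C\<^esub> \<in> P"
 using grp by (simp add: group.is_monoid)

lemma rot_orth: "p \<in> P \<Longrightarrow> orthogonal_matrix (rot C p)"
 and trs_pm: "p \<in> P \<Longrightarrow> trs C p \<in> {1, -1}"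
 and rot_BL: "p \<in> P \<Longrightarrow> (\<lambda>R. rot C p *v R) ` BL C = BL C"
 and D_unitary: "p \<in> P \<Longrightarrow> trs C p = 1 \<Longrightarrow> unitary_op (Dop C p)"
 and D_antiunitary: "p \<in> P \<Longrightarrow> trs C p = -1 \<Longrightarrow> antiunitary_op (Dop C p)"
 using mc unfolding magnetic_crystal_def by blast+

lemma rot_mult: "q \<in> P \<Longrightarrow> p \<in> P \<Longrightarrow> rot C (q \<otimes>\<^bsub>PG C\<^esub> p) = rot C q ** rot C p"
 and trs_mult: "q \<in> P \<Longrightarrow> p \<in> P \<Longrightarrow> trs C (q \<otimes>\<^bsub>PG C\<^esub> p) = trs C q * trs C p"
 and D_mult: "q \<in> P \<Longrightarrow> p \<in> P \<Longrightarrow> Dop C (q \<otimes>\<^bsub>PG C\<^esub> p) = Dop C q \<circ> Dop C p"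
 using mc unfolding magnetic_crystal_def by blast+

lemma D_add: "p \<in> P \<Longrightarrow> Dop C p (u + v) = Dop C p u + Dop C p v"
 using trs_pm[of p] D_unitary[of p] D_antiunitary[of p] unfolding unitary_op_def antiunitary_op_def by blast

lemma D_scale: "p \<in> P \<Longrightarrow> Dop C p (c *s u) = cj (trs C p) c *s Dop C p u"
 using trs_pm[of p] D_unitary[of p] D_antiunitary[of p]
 unfolding unitary_op_def antiunitary_op_def cj_def by auto

lemma D_cdot: "p \<in> P \<Longrightarrow> cdot (Dop C p u) (Dop C p v) = cj (trs C p) (cdot u v)"
 using trs_pm[of p] D_unitary[of p] D_antiunitary[of p]
 unfolding unitary_op_def antiunitary_op_def cj_def by auto

lemma D_zero [simp]: "p \<in> P \<Longrightarrow> Dop C p 0 = 0"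
 using D_scale[of p 0 0] by simp

lemma D_norm [simp]: "p \<in> P \<Longrightarrow> norm (Dop C p u) = norm u"
proof -
 assume p: "p \<in> P"
 have "(norm (Dop C p u))\<^sup>2 = Re (cdot (Dop C p u) (Dop C p u))" by (simp add: cdot_self)
 also have "\<dots> = (norm u)\<^sup>2" unfolding D_cdot[OF p] by (simp add: cj_def cdot_self)
 finally show ?thesis by (simp add: power2_eq_iff_nonneg)
qed

lemma D_linear: assumes p: "p \<in> P" shows "linear (Dop C p)"
proof (rule linearI)
 show "Dop C p (u + v) = Dop C p u + Dop C p v" for u v by (rule D_add[OF p])
 fix c :: real and u
 have "(of_real c :: complex) *s u = c *\<^sub>R u" for u :: "complex ^ 'v" by (simp only: vec_eq_iff vector_scaleR_component vector_smult_component) (simp add: scaleR_conv_of_real)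
 thus "Dop C p (c *\<^sub>R u) = c *\<^sub>R Dop C p u" using D_scale[OF p, of "of_real c" u] by (simp add: cj_def)
qed

lemma D_bounded_linear: "p \<in> P \<Longrightarrow> bounded_linear (Dop C p)"
 using D_linear by (simp add: linear_conv_bounded_linear)

lemma D_sum: "p \<in> P \<Longrightarrow> Dop C p (\<Sum>i\<in>I. f i) = (\<Sum>i\<in>I. Dop C p (f i))"
 using D_linear by (rule linear_sum)

lemma D_measurable: "p \<in> P \<Longrightarrow> f \<in> borel_measurable M \<Longrightarrow> (\<lambda>x. Dop C p (f x)) \<in> borel_measurable M"
 by (rule borel_measurable_continuous_on[OF linear_continuous_on[OF D_bounded_linear]])

text \<open>\<open>magnetic_crystal\<close> states multiplicativity, and the values at the unit of
  the group are derived from it: an invertible idempotent is the identity.\<close>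

lemma orth_idem: fixes A :: "real ^ 'd ^ 'd" assumes "orthogonal_matrix A" "A ** A = A" shows "A = mat 1"
proof -
 have 1: "transpose A ** A = mat 1" using assms(1) by (simp add: orthogonal_matrix_def)
 have "mat 1 = transpose A ** (A ** A)" unfolding assms(2) 1 ..
 also have "\<dots> = A" unfolding matrix_mul_assoc 1 by simp
 finally show ?thesis by simp
qed

lemma rot_one [simp]: "rot C \<one>\<^bsub>PG C\<^esub> = mat 1"
 using rot_mult[of "\<one>\<^bsub>PG C\<^esub>" "\<one>\<^bsub>PG C\<^esub>"] group.is_monoid[OF grp] by (intro orth_idem rot_orth) simp_all

lemma trs_one [simp]: "trs C \<one>\<^bsub>PG C\<^esub> = 1"
 using trs_mult[of "\<one>\<^bsub>PG C\<^esub>" "\<one>\<^bsub>PG C\<^esub>"] trs_pm[of "\<one>\<^bsub>PG C\<^esub>"] group.is_monoid[OF grp] by auto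

lemma D_one [simp]: "Dop C \<one>\<^bsub>PG C\<^esub> v = v"
proof -
 let ?D = "Dop C \<one>\<^bsub>PG C\<^esub>"
 have "?D (?D v) = ?D v" using D_mult[of "\<one>\<^bsub>PG C\<^esub>" "\<one>\<^bsub>PG C\<^esub>"] group.is_monoid[OF grp]
  by (metis comp_apply monoid.l_one one_P)
 hence "?D (?D v - v) = 0" using linear_diff[OF D_linear[OF one_P]] by simp
 hence "norm (?D v - v) = 0" using D_norm[OF one_P, of "?D v - v"] by simp
 thus ?thesis by simp
qed

lemma pinv_mult: "p \<in> P \<Longrightarrow> pinv p \<otimes>\<^bsub>PG C\<^esub> p = \<one>\<^bsub>PG C\<^esub>" "p \<in> P \<Longrightarrow> p \<otimes>\<^bsub>PG C\<^esub> pinv p = \<one>\<^bsub>PG C\<^esub>"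
 using grp by (simp_all add: group.l_inv group.r_inv)

lemma rot_inv:
 assumes p: "p \<in> P"
 shows "rot C (pinv p) *v (rot C p *v r) = r" "rot C p *v (rot C (pinv p) *v r) = r"
proof -
 have "rot C (pinv p) ** rot C p = mat 1" "rot C p ** rot C (pinv p) = mat 1"
  using rot_mult[OF pinv_P[OF p] p] rot_mult[OF p pinv_P[OF p]] unfolding pinv_mult[OF p] rot_one by simp_all
 thus "rot C (pinv p) *v (rot C p *v r) = r" "rot C p *v (rot C (pinv p) *v r) = r"
  unfolding matrix_vector_mul_assoc by simp_all
qed

lemma trs_inv: "p \<in> P \<Longrightarrow> trs C (pinv p) = trs C p"
 using trs_mult[of "pinv p" p] trs_pm[of p] by (auto simp: pinv_mult)

lemma rot_inner: "p \<in> P \<Longrightarrow> (rot C p *v u) \<bullet> (rot C p *v v) = u \<bullet> v"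
 using rot_orth[of p] orthogonal_transformation_matrix[of "(*v) (rot C p)"]
 by (simp add: orthogonal_transformation_def)

lemma rot_inner_inv: "p \<in> P \<Longrightarrow> u \<bullet> (rot C (pinv p) *v v) = (rot C p *v u) \<bullet> v"
 using rot_inner[of p u "rot C (pinv p) *v v"] by (simp add: rot_inv)

lemma rot_L: "p \<in> P \<Longrightarrow> R \<in> BL C \<Longrightarrow> rot C p *v R \<in> BL C"
 using rot_BL[of p] by blast

lemma BL_add: "u \<in> BL C \<Longrightarrow> v \<in> BL C \<Longrightarrow> u + v \<in> BL C"
 and BL_diff: "u \<in> BL C \<Longrightarrow> v \<in> BL C \<Longrightarrow> u - v \<in> BL C"
 and BL_minus: "u \<in> BL C \<Longrightarrow> - u \<in> BL C"
 and BL_zero [simp]: "0 \<in> BL C"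
 by (simp_all add: BL_eq cell.L_add cell.L_diff cell.L_minus cell.L_zero)

lemma RL_add: "u \<in> RL C \<Longrightarrow> v \<in> RL C \<Longrightarrow> u + v \<in> RL C"
 and RL_minus: "u \<in> RL C \<Longrightarrow> - u \<in> RL C"
 by (simp_all add: RL_eq bz.L_add bz.L_minus)

lemma sg_group: "group (SG)"
proof (rule groupI)
 fix x y z assume x: "x \<in> carrier (SG)" and y: "y \<in> carrier (SG)"
 thus "x \<otimes>\<^bsub>SG\<^esub> y \<in> carrier (SG)"
  by (auto simp: space_group_def intro!: BL_add rot_L)
 assume z: "z \<in> carrier (SG)"
 show "x \<otimes>\<^bsub>SG\<^esub> y \<otimes>\<^bsub>SG\<^esub> z = x \<otimes>\<^bsub>SG\<^esub> (y \<otimes>\<^bsub>SG\<^esub> z)"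
  using x y z group.is_monoid[OF grp]
  by (auto simp: space_group_def rot_mult monoid.m_assoc matrix_vector_mul_assoc[symmetric] matrix_vector_right_distrib)
next
 show "\<one>\<^bsub>SG\<^esub> \<in> carrier (SG)" by (simp add: space_group_def)
 fix x assume x: "x \<in> carrier (SG)"
 thus "\<one>\<^bsub>SG\<^esub> \<otimes>\<^bsub>SG\<^esub> x = x"
  using group.is_monoid[OF grp] by (auto simp: space_group_def)
 obtain p R where pR: "x = (p, R)" "p \<in> P" "R \<in> BL C" using x by (auto simp: space_group_def)
 show "\<exists>y\<in>carrier (SG). y \<otimes>\<^bsub>SG\<^esub> x = \<one>\<^bsub>SG\<^esub>"
  by (rule bexI[of _ "(pinv p, - (rot C (pinv p) *v R))"])
    (use pR in \<open>auto simp: space_group_def pinv_mult BL_minus rot_L\<close>)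
qed

lemma sg_inv:
 assumes "p \<in> P" "R \<in> BL C" shows "inv\<^bsub>SG\<^esub> (p, R) = (pinv p, - (rot C (pinv p) *v R))"
 by (rule group.inv_equality[OF sg_group])
   (use assms in \<open>auto simp: space_group_def pinv_mult BL_minus rot_L\<close>)

text \<open>The point group part of \<open>ghat\<close>. Translations act on Bloch functions by
  phases, so in terms of Bloch functions the symmetry conditions concern \<open>gh\<close>.\<close>

definition gh :: "'p \<Rightarrow> ('d, 'v) wavefun \<Rightarrow> ('d, 'v) wavefun" where
 "gh p f = (\<lambda>r i. Dop C p (f (rot C (pinv p) *v r) i))"

lemma ghat_gh:
 assumes "p \<in> P" "R \<in> BL C" shows "ghat C (p, R) f = (\<lambda>r. gh p f (r - R))"
 unfolding ghat_def sg_inv[OF assms] gh_def act_def by (simp add: matrix_vector_mult_diff_distrib)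

lemma ghat_0: "p \<in> P \<Longrightarrow> ghat C (p, 0) f = gh p f"
 by (simp add: ghat_gh)

text \<open>The action on wavevectors: time reversal conjugates the Bloch phase and so reverses
  \<open>k\<close>.\<close>

definition spr :: "'p \<Rightarrow> real ^ 'd ^ 'd" where "spr p = trs C p *\<^sub>R rot C p"

lemma spr_mult_vec: "spr p *v k = trs C p *\<^sub>R (rot C p *v k)"
 by (simp add: spr_def scaleR_matrix_vector_assoc)

lemma trs_sq: "p \<in> P \<Longrightarrow> trs C p * trs C p = 1"
 using trs_pm[of p] by auto

lemma spr_mult: "q \<in> P \<Longrightarrow> p \<in> P \<Longrightarrow> spr (q \<otimes>\<^bsub>PG C\<^esub> p) *v k = spr q *v (spr p *v k)"
 by (simp add: spr_mult_vec trs_mult rot_mult matrix_vector_mul_assoc[symmetric] matrix_vector_mult_scaleR)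

lemma spr_inv: "p \<in> P \<Longrightarrow> spr (pinv p) *v (spr p *v k) = k" "p \<in> P \<Longrightarrow> spr p *v (spr (pinv p) *v k) = k"
 by (simp_all add: spr_mult_vec trs_inv rot_inv matrix_vector_mult_scaleR trs_sq)

lemma spr_inner: "p \<in> P \<Longrightarrow> (spr p *v k) \<bullet> (rot C p *v R) = trs C p * (k \<bullet> R)"
 by (simp add: spr_mult_vec rot_inner)

lemma spr_orth: assumes p: "p \<in> P" shows "orthogonal_matrix (spr p)"
proof -
 have "(spr p *v u) \<bullet> (spr p *v v) = u \<bullet> v" for u v
  using trs_sq[OF p] by (simp add: spr_mult_vec rot_inner[OF p] flip: mult.assoc)
 hence "orthogonal_transformation ((*v) (spr p))"
  by (simp add: orthogonal_transformation_def)
 thus ?thesis by (simp add: orthogonal_transformation_matrix)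
qed

lemma spr_RL: "p \<in> P \<Longrightarrow> K \<in> RL C \<Longrightarrow> spr p *v K \<in> RL C"
proof -
 assume p: "p \<in> P" and K: "K \<in> RL C"
 have "\<exists>n::int. (spr p *v K) \<bullet> R = 2 * pi * of_int n" if R: "R \<in> BL C" for R
 proof -
  obtain n :: int where "K \<bullet> (rot C (pinv p) *v R) = 2 * pi * of_int n"
   using K rot_L[OF pinv_P[OF p] R] by (auto simp: RL_def)
  moreover have "(spr p *v K) \<bullet> R = trs C p * (K \<bullet> (rot C (pinv p) *v R))"
   using spr_inner[OF p, of K "rot C (pinv p) *v R"] by (simp add: rot_inv p)
  ultimately have "(spr p *v K) \<bullet> R = 2 * pi * of_int n \<or> (spr p *v K) \<bullet> R = 2 * pi * of_int (- n)"
   using trs_pm[OF p] by auto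
  thus ?thesis by blast
 qed
 thus ?thesis by (simp add: RL_def)
qed

lemma spr_RL_image: assumes p: "p \<in> P" shows "(\<lambda>K. spr p *v K) ` RL C = RL C"
proof (intro equalityI subsetI)
 fix K assume "K \<in> RL C"
 thus "K \<in> (\<lambda>K. spr p *v K) ` RL C"
  using spr_inv(2)[OF p, of K] spr_RL[OF pinv_P[OF p]] by (metis image_eqI)
qed (use spr_RL[OF p] in auto)

lemma gh_scl: "p \<in> P \<Longrightarrow> gh p (scl c f) = scl (cj (trs C p) c) (gh p f)"
 by (simp add: gh_def scl_def fun_eq_iff D_scale)

lemma gh_diff: "p \<in> P \<Longrightarrow> gh p (f - g) = gh p f - gh p g"
 by (simp add: gh_def fun_eq_iff linear_diff[OF D_linear])

lemma gh_sum:
 fixes f :: "'i \<Rightarrow> ('d, 'v) wavefun"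
 shows "p \<in> P \<Longrightarrow> gh p (\<Sum>i\<in>I. f i) = (\<Sum>i\<in>I. gh p (f i))"
 by (rule ext, rule ext) (simp add: gh_def sum_fun_apply2 D_sum)

lemma gh_plane_wave: "p \<in> P \<Longrightarrow> gh p (plane_wave k f) = plane_wave (spr p *v k) (gh p f)"
 by (rule ext, rule ext)
   (simp add: gh_def plane_wave_def D_scale cj_cis[OF trs_pm] rot_inner_inv spr_mult_vec)

lemma gh_gh: "q \<in> P \<Longrightarrow> p \<in> P \<Longrightarrow> gh q (gh p f) = gh (q \<otimes>\<^bsub>PG C\<^esub> p) f"
 by (rule ext, rule ext)
   (simp add: gh_def D_mult group.inv_mult_group[OF grp] rot_mult matrix_vector_mul_assoc)

lemma gh_one: "gh \<one>\<^bsub>PG C\<^esub> f = f"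
 by (rule ext, rule ext) (simp add: gh_def group.is_monoid[OF grp] monoid.inv_one)

lemma gh_inv: "p \<in> P \<Longrightarrow> gh (pinv p) (gh p f) = f" "p \<in> P \<Longrightarrow> gh p (gh (pinv p) f) = f"
 by (simp_all add: gh_gh pinv_mult gh_one)

lemma gh_aeq: "p \<in> P \<Longrightarrow> f \<simeq> g \<Longrightarrow> gh p f \<simeq> gh p g"
 unfolding aeq_def gh_def
 by (drule AE_orthogonal_matrix[OF rot_orth[OF pinv_P], rotated]) (auto elim: eventually_mono)

lemma gh_wavefuns: "p \<in> P \<Longrightarrow> f \<in> wavefuns m \<Longrightarrow> gh p f \<in> wavefuns m"
proof -
 assume p: "p \<in> P" and f: "f \<in> wavefuns m"
 have "(\<lambda>r. f (rot C (pinv p) *v r) i) \<in> borel_measurable borel" for i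
  by (rule measurable_compose[OF _ wavefuns_measurable[OF f]])
    (use borel_measurable_matrix_vector[of "\<lambda>x. x" borel] in simp)
 thus ?thesis using p f by (auto simp: wavefuns_def gh_def intro!: D_measurable)
qed

lemma ghat_wavefuns: assumes "p \<in> P" "R \<in> BL C" "f \<in> wavefuns m" shows "ghat C (p, R) f \<in> wavefuns m"
proof -
 have "gh p f \<in> wavefuns m" by (rule gh_wavefuns[OF assms(1,3)])
 moreover have "(\<lambda>r. gh p f (r - R) i) \<in> borel_measurable borel" for i
  by (rule measurable_compose[OF _ wavefuns_measurable[OF calculation]]) simp
 ultimately show ?thesis unfolding ghat_gh[OF assms(1,2)] by (auto simp: wavefuns_def)
qed

lemma gh_LV: assumes p: "p \<in> P" and f: "f \<in> LV m" shows "gh p f \<in> LV m"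
proof -
 have fw: "f \<in> wavefuns m" using f by (simp add: LV_def)
 let ?B = "rot C (pinv p)"
 have "set_integrable lborel S (\<lambda>r. (norm (gh p f r i))\<^sup>2)" if S: "compact S" for S i
 proof -
  let ?S = "(\<lambda>r. ?B *v r) ` S"
  have cS: "compact ?S" by (rule compact_continuous_image[OF _ S]) (intro continuous_intros)
  let ?h = "\<lambda>r. indicator ?S r *\<^sub>R (norm (f r i))\<^sup>2"
  have "integrable lborel ?h"
   using f cS by (simp add: LV_def loc_sq_integrable_def set_integrable_def)
  hence "integrable (distr lborel borel ((*v) ?B)) ?h"
   by (subst distr_orthogonal_matrix[OF rot_orth[OF pinv_P[OF p]]])
  moreover have hm: "?h \<in> borel_measurable borel"
   using cS wavefuns_measurable[OF fw, of i] by (auto intro!: borel_measurable_indicator borel_measurable_scaleR simp: compact_imp_closed)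
  moreover have Bm: "(*v) ?B \<in> borel_measurable lborel"
   using borel_measurable_matrix_vector[of "\<lambda>x. x" lborel] by simp
  ultimately have "integrable lborel (\<lambda>r. ?h (?B *v r))" by (subst (asm) integrable_distr_eq) auto
  moreover have "(?B *v r \<in> ?S) = (r \<in> S)" for r using rot_inv(2)[OF p] by (metis (no_types, lifting) image_iff)
  ultimately show ?thesis unfolding set_integrable_def gh_def using p by (simp add: indicator_def)
 qed
 thus ?thesis using gh_wavefuns[OF p fw] by (simp add: LV_def loc_sq_integrable_def)
qed

lemma gh_bloch: assumes p: "p \<in> P" and f: "f \<in> Bl k" shows "gh p f \<in> Bl (spr p *v k)"
proof -
 let ?B = "rot C (pinv p)"
 have "(\<lambda>r. gh p f (r + R)) \<simeq> scl (cis ((spr p *v k) \<bullet> R)) (gh p f)" if R: "R \<in> BL C" for R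
 proof -
  have "(\<lambda>r. f (r + ?B *v R)) \<simeq> scl (cis (k \<bullet> (?B *v R))) f"
   using f rot_L[OF pinv_P[OF p] R] by (simp add: bloch_iff)
  from gh_aeq[OF p this] show ?thesis
   unfolding gh_scl[OF p] cj_cis[OF trs_pm[OF p]] rot_inner_inv[OF p]
   by (simp add: gh_def matrix_vector_right_distrib spr_mult_vec)
 qed
 thus ?thesis using gh_LV[OF p bloch_LV[OF f]] by (simp add: bloch_iff)
qed

text \<open>Both functions have the same wavevector, so the integrand is lattice periodic, and its
  integral over the cell survives a rotation that does not preserve the cell.\<close>

lemma inner_gh:
 assumes p: "p \<in> P" and f: "f \<in> Bl k" and g: "g \<in> Bl k"
 shows "inn (gh p f) (gh p g) = cj (trs C p) (inn f g)"
proof -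
 let ?B = "rot C (pinv p)"
 define \<phi> where "\<phi> r = (\<Sum>i<m. cdot (f r i) (g r i))" for r
 have [measurable]: "\<And>i. (\<lambda>r. f r i) \<in> borel_measurable borel" "\<And>i. (\<lambda>r. g r i) \<in> borel_measurable borel"
  using LV_measurable bloch_LV f g by blast+
 have \<phi>m: "\<phi> \<in> borel_measurable borel" unfolding \<phi>_def[abs_def] by measurable
 have "inn (gh p f) (gh p g) = (LINT r:cell.D|lborel. cj (trs C p) (\<phi> (?B *v r)))"
  unfolding inner_cell_def unit_cell_eq \<phi>_def gh_def cj_sum D_cdot[OF p] by simp
 also have "\<dots> = cj (trs C p) (LINT r:cell.D|lborel. \<phi> (?B *v r))"
  by (simp add: cj_def set_lebesgue_integral_def flip: Bochner_Integration.integral_cnj)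
 also have "(LINT r:cell.D|lborel. \<phi> (?B *v r)) = (LINT r:cell.D|lborel. \<phi> r)"
 proof (rule cell.cell_integral_invariant[OF rot_orth[OF pinv_P[OF p]] _ \<phi>m])
  show "(\<lambda>v. ?B *v v) ` cell.L = cell.L" using rot_BL[OF pinv_P[OF p]] by (simp add: BL_eq)
  fix K assume K: "K \<in> cell.L"
  have "AE r in lborel. f (r + K) = scl (cis (k \<bullet> K)) f r" "AE r in lborel. g (r + K) = scl (cis (k \<bullet> K)) g r"
   using f g K by (simp_all add: bloch_iff BL_eq aeq_def)
  thus "AE r in lborel. \<phi> (r + K) = \<phi> r"
   by eventually_elim (simp add: \<phi>_def scl_def cdot_scale_left cdot_scale_right cis_cnj cis_mult flip: mult.assoc)
 qed
 also have "\<dots> = inn f g" by (simp add: inner_cell_def unit_cell_eq \<phi>_def)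
 finally show ?thesis .
qed

end

section \<open>Analytic sections\<close>

(* Coercion inference would eta-expand sums of wavefunctions. *)
declare [[coercion_enabled = false]]

lemma pserE:
 assumes "pser k0 r M f"
 obtains a where "(\<lambda>\<alpha>. norm (a \<alpha>) * r ^ wt \<alpha>) summable_on UNIV"
   "(\<Sum>\<^sub>\<infinity>\<alpha>. norm (a \<alpha>) * r ^ wt \<alpha>) \<le> M"
   "\<And>k. (\<forall>i. \<bar>k $ i - k0 $ i\<bar> \<le> r) \<Longrightarrow> ((\<lambda>\<alpha>. a \<alpha> * of_real (monomial \<alpha> (k - k0))) has_sum f k) UNIV"
 using assms unfolding pser_def by blast

text \<open>A finite set of exponents lies in a cube, over which the sum is a product of finite
  geometric sums, each at most 2.\<close>

lemma sum_weights_bounded: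
 assumes "finite (S :: ('d::finite \<Rightarrow> nat) set)" shows "(\<Sum>\<alpha>\<in>S. (1 / 2 :: real) ^ wt \<alpha>) \<le> 2 ^ CARD('d)"
proof -
 define n where "n = Max (insert 0 ((\<lambda>(\<alpha>, i). \<alpha> i) ` (S \<times> UNIV)))"
 have le: "\<alpha> i \<le> n" if "\<alpha> \<in> S" for \<alpha> i
  unfolding n_def by (rule Max_ge) (use assms that in \<open>auto intro!: image_eqI[of _ _ "(\<alpha>, i)"]\<close>)
 have "(\<Sum>\<alpha>\<in>S. (1 / 2 :: real) ^ wt \<alpha>) \<le> (\<Sum>\<alpha>\<in>PiE (UNIV::'d set) (\<lambda>_. {..n}). (1 / 2 :: real) ^ wt \<alpha>)"
  by (rule sum_mono2) (use le in \<open>auto intro: finite_PiE\<close>)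
 also have "\<dots> = (\<Sum>\<alpha>\<in>PiE (UNIV::'d set) (\<lambda>_. {..n}). \<Prod>i\<in>UNIV. (1 / 2 :: real) ^ \<alpha> i)" by (simp add: power_sum)
 also have "\<dots> = (\<Prod>i\<in>(UNIV::'d set). \<Sum>j\<le>n. (1 / 2 :: real) ^ j)" by (rule prod_sum_PiE[symmetric]) auto
 also have "\<dots> \<le> (\<Prod>i\<in>(UNIV::'d set). 2)"
 proof (rule prod_mono)
  fix i :: 'd
  have "(\<Sum>j\<le>n. (1 / 2 :: real) ^ j) = (1 - (1/2) ^ Suc n) / (1 - 1/2)" by (subst sum_gp0) simp
  moreover have "0 \<le> (\<Sum>j\<le>n. (1 / 2 :: real) ^ j)" by (rule sum_nonneg) simp
  ultimately show "0 \<le> (\<Sum>j\<le>n. (1 / 2 :: real) ^ j) \<and> (\<Sum>j\<le>n. (1 / 2 :: real) ^ j) \<le> 2"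
   by simp
 qed
 finally show ?thesis by simp
qed

context mcr
begin

abbreviation "psum c S x \<equiv> \<Sum>\<alpha>\<in>S. scl (of_real (monomial \<alpha> x)) (c \<alpha>)"
abbreviation "finsets \<equiv> finite_subsets_at_top UNIV"

definition avec_at :: "real ^ 'd \<Rightarrow> (real ^ 'd \<Rightarrow> ('d, 'v) wavefun) \<Rightarrow> bool" where
 "avec_at k0 F \<longleftrightarrow> (\<exists>\<rho>>0. \<exists>c. (\<forall>\<alpha>. c \<alpha> \<in> Bl 0) \<and>
   (\<forall>k. (\<forall>i. \<bar>k $ i - k0 $ i\<bar> < \<rho>) \<longrightarrow>
    ((\<lambda>S. nm (F k - psum c S (k - k0))) \<longlongrightarrow> 0)
     finsets))"

lemma analytic_vectors_iff: "analytic_vectors C m F \<longleftrightarrow> (\<forall>k0. avec_at k0 F)"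
 unfolding analytic_vectors_def avec_at_def ..

text \<open>\<open>avec_at\<close> speaks of convergence of the partial sums on an open box. Here
  the norms of the coefficients are in addition summable with weights on a closed box, which
  rearrangements require.\<close>

definition vser :: "real ^ 'd \<Rightarrow> real \<Rightarrow> (('d \<Rightarrow> nat) \<Rightarrow> ('d, 'v) wavefun) \<Rightarrow> (real ^ 'd \<Rightarrow> ('d, 'v) wavefun) \<Rightarrow> bool" where
 "vser k0 r c F \<longleftrightarrow> 0 < r \<and> (\<forall>\<alpha>. c \<alpha> \<in> Bl 0) \<and>
   (\<lambda>\<alpha>. nm (c \<alpha>) * r ^ wt \<alpha>) summable_on UNIV \<and>
   (\<forall>k. (\<forall>i. \<bar>k $ i - k0 $ i\<bar> \<le> r) \<longrightarrow>
    ((\<lambda>S. nm (F k - psum c S (k - k0))) \<longlongrightarrow> 0) finsets)"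

lemma psum_bloch: "(\<And>\<alpha>. c \<alpha> \<in> Bl 0) \<Longrightarrow> psum c S x \<in> Bl 0"
 by (intro bloch_sum bloch_scl)

lemma vser_smaller: assumes v: "vser k0 r c F" and r': "0 < r'" "r' \<le> r" shows "vser k0 r' c F"
proof -
 have nn: "0 \<le> nm (c \<alpha>)" for \<alpha>
  using v bloch_LV nrm_ge0 unfolding vser_def by blast
 have "(\<lambda>\<alpha>. nm (c \<alpha>) * r' ^ wt \<alpha>) summable_on UNIV"
 proof (rule summable_on_comparison_test)
  show "(\<lambda>\<alpha>. nm (c \<alpha>) * r ^ wt \<alpha>) summable_on UNIV" using v by (simp add: vser_def)
 qed (use nn r' in \<open>auto intro!: mult_left_mono power_mono\<close>)
 moreover have "\<bar>k $ i - k0 $ i\<bar> \<le> r" if "\<forall>i. \<bar>k $ i - k0 $ i\<bar> \<le> r'" for k i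
  using that r'(2) order_trans by blast
 ultimately show ?thesis using v r' unfolding vser_def by blast
qed

text \<open>Abel's lemma: convergence at the diagonal point \<open>k1\<close>, where every monomial
  is a power of \<open>\<rho> / 2\<close>, bounds the terms; at half that distance they are
  dominated by a product of geometric series.\<close>

lemma avec_at_vser:
 assumes F: "avec_at k0 F" and FL: "\<And>k. F k \<in> LV m"
 obtains r c where "vser k0 r c F"
proof -
 obtain \<rho> c where \<rho>: "\<rho> > 0" and c: "\<And>\<alpha>. c \<alpha> \<in> Bl 0"
  and lim: "\<And>k. (\<forall>i. \<bar>k $ i - k0 $ i\<bar> < \<rho>) \<Longrightarrow>
    ((\<lambda>S. nm (F k - psum c S (k - k0))) \<longlongrightarrow> 0) finsets"
  using F unfolding avec_at_def by blast
 have cL: "c \<alpha> \<in> LV m" for \<alpha> using bloch_LV[OF c] .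
 have pL: "psum c S x \<in> LV m" for S x using bloch_LV[OF psum_bloch[OF c]] .
 define k1 where "k1 = k0 + (\<chi> i. \<rho> / 2)"
 have mon: "monomial \<alpha> (k1 - k0) = (\<rho> / 2) ^ wt \<alpha>" for \<alpha>
  by (simp add: k1_def monomial_def power_sum)
 have "\<forall>\<^sub>F S in finsets. nm (F k1 - psum c S (k1 - k0)) < 1"
  by (rule order_tendstoD(2)[OF lim]) (use \<rho> in \<open>auto simp: k1_def\<close>)
 then obtain X where X: "finite X" "\<And>S. finite S \<Longrightarrow> X \<subseteq> S \<Longrightarrow> nm (F k1 - psum c S (k1 - k0)) < 1"
  unfolding eventually_finite_subsets_at_top by auto
 \<comment> \<open>A term outside \<open>X\<close> is the difference of two remainders of norm less
   than 1, hence the 2; a term with index in \<open>X\<close> is bounded by the sum over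
   \<open>X\<close>.\<close>
 define B where "B = 2 + (\<Sum>\<alpha>\<in>X. nm (c \<alpha>) * (\<rho> / 2) ^ wt \<alpha>)"
 have nn: "0 \<le> nm (c \<alpha>) * (\<rho> / 2) ^ wt \<alpha>" for \<alpha>
  using nrm_ge0[OF cL] \<rho> by simp
 have bd: "nm (c \<alpha>) * (\<rho> / 2) ^ wt \<alpha> \<le> B" for \<alpha>
 proof (cases "\<alpha> \<in> X")
  case True
  thus ?thesis unfolding B_def
   using member_le_sum[of \<alpha> X "\<lambda>\<alpha>. nm (c \<alpha>) * (\<rho> / 2) ^ wt \<alpha>"] nn X(1) by simp
 next
  case False
  have "psum c (insert \<alpha> X) (k1 - k0) - psum c X (k1 - k0) = scl (of_real ((\<rho> / 2) ^ wt \<alpha>)) (c \<alpha>)"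
   using False X(1) by (subst sum.insert) (auto simp: mon)
  hence eq: "scl (of_real ((\<rho> / 2) ^ wt \<alpha>)) (c \<alpha>)
    = (F k1 - psum c X (k1 - k0)) - (F k1 - psum c (insert \<alpha> X) (k1 - k0))" by simp
  have "nm (c \<alpha>) * (\<rho> / 2) ^ wt \<alpha> = nm (scl (of_real ((\<rho> / 2) ^ wt \<alpha>)) (c \<alpha>))"
   using \<rho> by (subst nrm_smul[OF cL]) (simp add: norm_power mult.commute)
  also have "\<dots> \<le> nm (F k1 - psum c X (k1 - k0)) + nm (F k1 - psum c (insert \<alpha> X) (k1 - k0))"
   unfolding eq by (intro nrm_diff diff_mem FL pL)
  also have "\<dots> \<le> 1 + 1" using X(2)[of X] X(2)[of "insert \<alpha> X"] X(1) by (intro add_mono less_imp_le) auto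
  also have "\<dots> \<le> B" unfolding B_def by (simp add: sum_nonneg nn)
  finally show ?thesis .
 qed
 define r where "r = \<rho> / 4"
 have r: "0 < r" using \<rho> by (simp add: r_def)
 have tm: "nm (c \<alpha>) * r ^ wt \<alpha> \<le> B * (1 / 2) ^ wt \<alpha>" for \<alpha>
 proof -
  have "r ^ wt \<alpha> = (\<rho> / 2) ^ wt \<alpha> * (1 / 2) ^ wt \<alpha>"
   by (simp add: r_def power_mult_distrib[symmetric])
  thus ?thesis using mult_right_mono[OF bd[of \<alpha>], of "(1 / 2) ^ wt \<alpha>"] by (simp add: mult.assoc)
 qed
 have B0: "0 \<le> B" unfolding B_def using nn by (simp add: sum_nonneg)
 have "(\<lambda>\<alpha>. nm (c \<alpha>) * r ^ wt \<alpha>) summable_on UNIV"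
 proof (rule nonneg_bdd_above_summable_on)
  show "bdd_above (sum (\<lambda>\<alpha>. nm (c \<alpha>) * r ^ wt \<alpha>) ` {F. F \<subseteq> UNIV \<and> finite F})"
  proof (rule bdd_aboveI2)
   fix S :: "('d \<Rightarrow> nat) set" assume "S \<in> {F. F \<subseteq> UNIV \<and> finite F}"
   hence S: "finite S" by simp
   have "(\<Sum>\<alpha>\<in>S. nm (c \<alpha>) * r ^ wt \<alpha>) \<le> (\<Sum>\<alpha>\<in>S. B * (1 / 2) ^ wt \<alpha>)"
    by (intro sum_mono tm)
   also have "\<dots> = B * (\<Sum>\<alpha>\<in>S. (1 / 2) ^ wt \<alpha>)" by (simp only: sum_distrib_left)
   also have "\<dots> \<le> B * 2 ^ CARD('d)" by (intro mult_left_mono sum_weights_bounded S B0)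
   finally show "(\<Sum>\<alpha>\<in>S. nm (c \<alpha>) * r ^ wt \<alpha>) \<le> B * 2 ^ CARD('d)" .
  qed
 qed (use nrm_ge0[OF cL] r in auto)
 moreover have "\<forall>i. \<bar>k $ i - k0 $ i\<bar> < \<rho>" if "\<forall>i. \<bar>k $ i - k0 $ i\<bar> \<le> r" for k
 proof
  fix i show "\<bar>k $ i - k0 $ i\<bar> < \<rho>" using spec[OF that, of i] \<rho> by (simp add: r_def)
 qed
 ultimately have "vser k0 r c F" unfolding vser_def using r c lim by blast
 thus ?thesis using that by blast
qed

lemma vser_inner:
 assumes F: "vser k0 r c F" and FL: "\<And>k. F k \<in> LV m" and v: "v \<in> LV m"
  and k: "\<And>i. \<bar>k $ i - k0 $ i\<bar> \<le> r"
 shows "((\<lambda>\<alpha>. inn v (c \<alpha>) * of_real (monomial \<alpha> (k - k0))) has_sum inn v (F k)) UNIV"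
proof -
 have c: "c \<alpha> \<in> Bl 0" for \<alpha> using F by (simp add: vser_def)
 have cL: "c \<alpha> \<in> LV m" for \<alpha> using bloch_LV[OF c] .
 have pL: "psum c S x \<in> LV m" for S x using bloch_LV[OF psum_bloch[OF c]] .
 have lim: "((\<lambda>S. nm v * nm (F k - psum c S (k - k0))) \<longlongrightarrow> nm v * 0) finsets"
  using F k by (intro tendsto_mult_left) (simp add: vser_def)
 have "((\<lambda>S. inn v (F k) - inn v (psum c S (k - k0))) \<longlongrightarrow> 0) finsets"
 proof (rule Lim_null_comparison[OF _ lim[simplified]], rule always_eventually, rule allI)
  fix S
  show "norm (inn v (F k) - inn v (psum c S (k - k0)))
    \<le> nm v * nm (F k - psum c S (k - k0))"
   using cauchy_schwarz[OF v diff_mem[OF FL pL], of k "k - k0" S] by (simp add: ip_diff v FL pL)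
 qed
 hence "((\<lambda>S. inn v (F k) - (inn v (F k) - inn v (psum c S (k - k0)))) \<longlongrightarrow> inn v (F k) - 0) finsets"
  by (intro tendsto_diff tendsto_const)
 moreover have "inn v (psum c S (k - k0)) = (\<Sum>\<alpha>\<in>S. inn v (c \<alpha>) * of_real (monomial \<alpha> (k - k0)))" for S
  by (subst ip_sum[OF v LV_scl[OF cL]]) (simp add: ip_smul v cL mult.commute)
 ultimately show ?thesis by (simp add: has_sum_def)
qed

text \<open>The bound is proportional to \<open>nm v\<close>, which makes a second summation, over
  the coefficients of another series, possible in \<open>avec_inner\<close>.\<close>

lemma vser_inner_pser:
 assumes F: "vser k0 r c F" and FL: "\<And>k. F k \<in> LV m" and v: "v \<in> LV m"
 shows "pser k0 r (nm v * (\<Sum>\<^sub>\<infinity>\<alpha>. nm (c \<alpha>) * r ^ wt \<alpha>)) (\<lambda>k. inn v (F k))"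
proof (rule pser_family[where e = "\<lambda>\<alpha>. \<alpha>" and I = UNIV and b = "\<lambda>\<alpha>. inn v (c \<alpha>)"])
 show r: "0 < r" using F by (simp add: vser_def)
 have cL: "c \<alpha> \<in> LV m" for \<alpha> using F bloch_LV[of "c \<alpha>" 0] by (simp add: vser_def)
 have sm: "(\<lambda>\<alpha>. nm (c \<alpha>) * r ^ wt \<alpha>) summable_on UNIV" using F by (simp add: vser_def)
 have sm2: "(\<lambda>\<alpha>. nm v * (nm (c \<alpha>) * r ^ wt \<alpha>)) summable_on UNIV"
  by (rule summable_on_cmult_right[OF sm])
 have le: "cmod (inn v (c \<alpha>)) * r ^ wt \<alpha> \<le> nm v * (nm (c \<alpha>) * r ^ wt \<alpha>)" for \<alpha>
  using mult_right_mono[OF cauchy_schwarz[OF v cL], of "r ^ wt \<alpha>" \<alpha>] r by (simp add: mult.assoc)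
 show sm1: "(\<lambda>\<alpha>. cmod (inn v (c \<alpha>)) * r ^ wt \<alpha>) summable_on UNIV"
  by (rule summable_on_comparison_test[OF sm2]) (use le r in auto)
 show "(\<Sum>\<^sub>\<infinity>\<alpha>. cmod (inn v (c \<alpha>)) * r ^ wt \<alpha>)
   \<le> nm v * (\<Sum>\<^sub>\<infinity>\<alpha>. nm (c \<alpha>) * r ^ wt \<alpha>)"
  using infsum_mono[OF sm1 sm2 le] by (simp add: infsum_cmult_right')
qed (rule vser_inner[OF F FL v])

lemma vser_common:
 assumes "vser k0 r c F" "vser k0 s d G"
 obtains t where "vser k0 t c F" "vser k0 t d G" "t \<le> r" "t \<le> s" "0 < t"
 using assms vser_smaller[of k0 r c F "min r s"] vser_smaller[of k0 s d G "min r s"]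
 by (auto simp: vser_def[of k0 r c F] vser_def[of k0 s d G] intro!: that[of "min r s"])

text \<open>The series of \<open>G\<close> is summed last: each of its terms pairs a fixed vector
  with \<open>F\<close>, which is analytic with a bound proportional to the norm of that
  vector.\<close>

lemma avec_inner:
 assumes F: "avec_at k0 F" "\<And>k. F k \<in> LV m" and G: "avec_at k0 G" "\<And>k. G k \<in> LV m"
 shows "ran_at k0 (\<lambda>k. inn (F k) (G k))"
proof -
 obtain r c s d where "vser k0 r c F" "vser k0 s d G"
  using avec_at_vser[OF F] avec_at_vser[OF G] by metis
 then obtain t where c: "vser k0 t c F" and d: "vser k0 t d G" and t: "0 < t" by (rule vser_common)
 have dL: "d \<alpha> \<in> LV m" for \<alpha> using d bloch_LV[of "d \<alpha>" 0] by (simp add: vser_def)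
 let ?M = "\<Sum>\<^sub>\<infinity>\<alpha>. nm (c \<alpha>) * t ^ wt \<alpha>"
 have sm: "(\<lambda>\<alpha>. nm (d \<alpha>) * t ^ wt \<alpha>) summable_on UNIV" using d by (simp add: vser_def)
 have mon: "pser k0 t (t ^ wt \<beta>) (\<lambda>k. of_real (monomial \<beta> (k - k0)))" for \<beta> :: "'d \<Rightarrow> nat"
 proof -
  have "pser k0 t (\<Prod>i\<in>UNIV. t ^ \<beta> i) (\<lambda>k. \<Prod>i\<in>UNIV. of_real (k $ i - k0 $ i) ^ \<beta> i)"
   by (intro pser_prod pser_power pser_coord t) auto
  thus ?thesis by (simp add: monomial_def power_sum)
 qed
 have "pser k0 t (\<Sum>\<^sub>\<infinity>\<beta>. nm (d \<beta>) * t ^ wt \<beta> * ?M) (\<lambda>k. inn (F k) (G k))"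
 proof (rule pser_normal_sum[OF t])
  show "(\<lambda>\<beta>. nm (d \<beta>) * t ^ wt \<beta> * ?M) summable_on UNIV"
   by (rule summable_on_cmult_left[OF sm])
  fix \<beta> :: "'d \<Rightarrow> nat"
  have "pser k0 t (nm (d \<beta>) * ?M * t ^ wt \<beta>)
    (\<lambda>k. cnj (inn (d \<beta>) (F k)) * of_real (monomial \<beta> (k - k0)))"
   by (intro pser_mult pser_cnj mon vser_inner_pser[OF c F(2) dL])
  moreover have "cnj (inn (d \<beta>) (F k)) = inn (F k) (d \<beta>)" for k
   using ip_cnj[OF dL F(2)] by simp
  ultimately show "pser k0 t (nm (d \<beta>) * t ^ wt \<beta> * ?M)
    (\<lambda>k. inn (F k) (d \<beta>) * of_real (monomial \<beta> (k - k0)))"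
   by (simp add: mult_ac)
 next
  fix k assume "\<And>i. \<bar>k $ i - k0 $ i\<bar> \<le> t"
  thus "((\<lambda>\<beta>. inn (F k) (d \<beta>) * of_real (monomial \<beta> (k - k0))) has_sum inn (F k) (G k)) UNIV"
   by (rule vser_inner[OF d G(2) F(2)])
 qed
 thus ?thesis by (auto simp: ran_at_def)
qed

lemma avec_at_const: assumes v: "v \<in> Bl 0" shows "avec_at k0 (\<lambda>_. v)"
proof -
 define c where "c \<alpha> = (if \<alpha> = (\<lambda>_. 0) then v else 0)" for \<alpha> :: "'d \<Rightarrow> nat"
 have "((\<lambda>S. nm (v - psum c S (k - k0))) \<longlongrightarrow> 0)
   finsets" for k
 proof -
  have "v - psum c S (k - k0) = 0" if "finite S" "{\<lambda>_. 0} \<subseteq> S" for S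
  proof -
   have "(psum c S (k - k0))
     = (psum c {\<lambda>_. 0} (k - k0))"
    by (rule sum.mono_neutral_right) (use that in \<open>auto simp: c_def\<close>)
   thus ?thesis by (simp add: c_def)
  qed
  hence "\<forall>\<^sub>F S in finsets. nm
    (v - psum c S (k - k0)) = 0"
   unfolding eventually_finite_subsets_at_top
   by (intro exI[of _ "{\<lambda>_. 0}"] conjI allI impI) (auto simp only: nrm_zero finite.intros subset_UNIV)
  thus ?thesis by (rule tendsto_eventually)
 qed
 moreover have "c \<alpha> \<in> Bl 0" for \<alpha> using v bloch_zero by (simp add: c_def)
 ultimately show ?thesis unfolding avec_at_def by (intro exI[of _ 1]) auto
qed

lemma avec_at_add:
 assumes F: "avec_at k0 F" "\<And>k. F k \<in> LV m" and G: "avec_at k0 G" "\<And>k. G k \<in> LV m"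
 shows "avec_at k0 (\<lambda>k. F k + G k)"
proof -
 obtain r c s d where "vser k0 r c F" "vser k0 s d G"
  using avec_at_vser[OF F] avec_at_vser[OF G] by metis
 then obtain t where c: "vser k0 t c F" and d: "vser k0 t d G" and t: "0 < t" by (rule vser_common)
 have cb: "c \<alpha> \<in> Bl 0" "d \<alpha> \<in> Bl 0" for \<alpha> using c d by (simp_all add: vser_def)
 have pL: "psum c S x \<in> LV m" "psum d S x \<in> LV m" for S x
  using bloch_LV[OF psum_bloch] cb by blast+
 show ?thesis unfolding avec_at_def
 proof (intro exI[of _ t] exI[of _ "\<lambda>\<alpha>. c \<alpha> + d \<alpha>"] conjI allI impI)
  fix k assume k: "\<forall>i. \<bar>k $ i - k0 $ i\<bar> < t"
  hence k': "\<forall>i. \<bar>k $ i - k0 $ i\<bar> \<le> t" by (simp add: less_imp_le)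
  have eq: "F k + G k - psum (\<lambda>\<alpha>. c \<alpha> + d \<alpha>) S (k - k0)
    = (F k - psum c S (k - k0)) + (G k - psum d S (k - k0))" for S
   by (simp add: scl_add_right sum.distrib)
  have lim: "((\<lambda>S. nm (F k - psum c S (k - k0)) + nm (G k - psum d S (k - k0))) \<longlongrightarrow> 0 + 0)
    finsets"
   using c d k' by (intro tendsto_add) (simp_all add: vser_def)
  show "((\<lambda>S. nm (F k + G k - psum (\<lambda>\<alpha>. c \<alpha> + d \<alpha>) S (k - k0))) \<longlongrightarrow> 0)
    finsets"
   unfolding eq
  proof (rule Lim_null_comparison[OF _ lim[simplified]], rule always_eventually, rule allI)
   fix S
   have "F k - psum c S (k - k0) \<in> LV m" "G k - psum d S (k - k0) \<in> LV m"
    by (intro diff_mem F(2) G(2) pL)+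
   thus "norm (nm (F k - psum c S (k - k0) + (G k - psum d S (k - k0))))
     \<le> nm (F k - psum c S (k - k0)) + nm (G k - psum d S (k - k0))"
    using nrm_triangle nrm_ge0 add_mem by simp
  qed
 qed (use t cb bloch_add in auto)
qed

lemma avec_at_sum:
 assumes "finite J" "\<And>j. j \<in> J \<Longrightarrow> avec_at k0 (F j)" "\<And>j k. j \<in> J \<Longrightarrow> F j k \<in> LV m"
 shows "avec_at k0 (\<lambda>k. \<Sum>j\<in>J. F j k)"
 using assms
proof (induction J rule: finite_induct)
 case empty
 show ?case unfolding sum.empty by (rule avec_at_const[OF bloch_zero])
next
 case (insert j J)
 have "avec_at k0 (\<lambda>k. F j k + (\<Sum>j\<in>J. F j k))"
  by (rule avec_at_add) (use insert in \<open>auto intro!: sum_mem\<close>)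
 thus ?case unfolding sum.insert[OF insert(1,2)] .
qed

text \<open>Norm convergence of the product series is not obtained by rearranging in the function
  space. The identity is first tested against arbitrary vectors, where it concerns complex series;
  then the test vector is taken to be the remainder itself.\<close>

lemma avec_at_scale:
 assumes f: "ran_at k0 f" and F: "avec_at k0 F" "\<And>k. F k \<in> LV m"
 shows "avec_at k0 (\<lambda>k. scl (f k) (F k))"
proof -
 obtain r0 c where c0: "vser k0 r0 c F" using avec_at_vser[OF F] by metis
 obtain r1 M where p: "pser k0 r1 M f" using f by (auto simp: ran_at_def)
 define r where "r = min r0 r1"
 have r: "0 < r" "r \<le> r0" "r \<le> r1" using c0 pser_pos[OF p] by (auto simp: r_def vser_def)
 have cv: "vser k0 r c F" by (rule vser_smaller[OF c0 r(1,2)])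
 obtain a where a: "(\<lambda>\<alpha>. norm (a \<alpha>) * r ^ wt \<alpha>) summable_on UNIV"
   "\<And>k. (\<forall>i. \<bar>k $ i - k0 $ i\<bar> \<le> r) \<Longrightarrow> ((\<lambda>\<alpha>. a \<alpha> * of_real (monomial \<alpha> (k - k0))) has_sum f k) UNIV"
  by (rule pserE[OF pser_smaller(1)[OF p r(1,3)]]) blast
 have cb: "c \<alpha> \<in> Bl 0" for \<alpha> using cv by (simp add: vser_def)
 have cL: "c \<alpha> \<in> LV m" for \<alpha> using bloch_LV[OF cb] .
 define ad :: "('d \<Rightarrow> nat) \<times> ('d \<Rightarrow> nat) \<Rightarrow> 'd \<Rightarrow> nat" where "ad x = (\<lambda>i. fst x i + snd x i)" for x
 \<comment> \<open>The Cauchy product: \<open>Q \<gamma>\<close> is the finite set of pairs of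
   exponents with sum \<open>\<gamma>\<close>.\<close>
 define Q where "Q \<gamma> = {x. ad x = \<gamma>}" for \<gamma>
 have finQ: "finite (Q \<gamma>)" for \<gamma>
 proof (rule finite_subset)
  let ?B = "PiE UNIV (\<lambda>i. {..\<gamma> i}) :: ('d \<Rightarrow> nat) set"
  show "Q \<gamma> \<subseteq> ?B \<times> ?B" by (auto simp: Q_def ad_def)
  show "finite (?B \<times> ?B)" by (intro finite_cartesian_product finite_PiE) auto
 qed
 have bij: "bij_betw snd (Sigma UNIV Q) UNIV" unfolding bij_betw_def inj_on_def Q_def by force
 define d where "d \<gamma> = (\<Sum>x\<in>Q \<gamma>. scl (a (fst x)) (c (snd x)))" for \<gamma>
 have db: "d \<gamma> \<in> Bl 0" for \<gamma> unfolding d_def by (intro bloch_sum bloch_scl cb)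
 have dL: "d \<gamma> \<in> LV m" for \<gamma> using bloch_LV[OF db] .
 define T where "T x = norm (a (fst x)) * r ^ wt (fst x) * (nm (c (snd x)) * r ^ wt (snd x))" for x
 have T0: "0 \<le> T x" for x using r nrm_ge0[OF cL] by (simp add: T_def)
 have TQ: "T x = norm (a (fst x)) * nm (c (snd x)) * r ^ wt \<gamma>" if "x \<in> Q \<gamma>" for x \<gamma>
  using that by (auto simp: T_def Q_def ad_def sum.distrib power_add)
 have cs: "(\<lambda>\<beta>. nm (c \<beta>) * r ^ wt \<beta>) summable_on UNIV" using cv by (simp add: vser_def)
 have Ts: "T summable_on Sigma UNIV (\<lambda>_. UNIV)"
 proof (rule summable_on_SigmaI)
  show "((\<lambda>\<beta>. T (\<alpha>, \<beta>)) has_sum (norm (a \<alpha>) * r ^ wt \<alpha>) * (\<Sum>\<^sub>\<infinity>\<beta>. nm (c \<beta>) * r ^ wt \<beta>)) UNIV" for \<alpha>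
   unfolding T_def fst_conv snd_conv by (intro has_sum_cmult_right has_sum_infsum cs)
 qed (use T0 in \<open>auto intro!: summable_on_cmult_left a(1)\<close>)
 define t where "t \<gamma> = (\<Sum>x\<in>Q \<gamma>. T x)" for \<gamma>
 have ts: "t summable_on UNIV"
 proof -
  have "(\<lambda>(\<gamma>, x). T x) summable_on Sigma UNIV Q"
   using summable_on_reindex_bij_betw[OF bij, of T] Ts by (simp add: case_prod_unfold)
  from summable_on_Sigma_banach[OF this] show ?thesis by (simp add: t_def[abs_def] finQ)
 qed
 have nd: "nm (d \<gamma>) * r ^ wt \<gamma> \<le> t \<gamma>" for \<gamma>
 proof -
  have "nm (d \<gamma>) \<le> (\<Sum>x\<in>Q \<gamma>. norm (a (fst x)) * nm (c (snd x)))"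
   unfolding d_def by (rule order_trans[OF nrm_sum[OF finQ]]) (simp_all add: LV_scl cL nrm_smul)
  from mult_right_mono[OF this, of "r ^ wt \<gamma>"] show ?thesis using r by (simp add: t_def TQ sum_distrib_right)
 qed
 have weak: "((\<lambda>\<gamma>. inn v (d \<gamma>) * of_real (monomial \<gamma> (k - k0))) has_sum f k * inn v (F k)) UNIV"
  if v: "v \<in> LV m" and k: "\<forall>i. \<bar>k $ i - k0 $ i\<bar> \<le> r" for v k
 proof -
  let ?x = "\<lambda>\<alpha>. complex_of_real (monomial \<alpha> (k - k0))"
  define W where "W x = (a (fst x) * ?x (fst x)) * (inn v (c (snd x)) * ?x (snd x))" for x
  have WT: "norm (W x) \<le> nm v * T x" for x
  proof -
   have "norm (W x) \<le> (norm (a (fst x)) * r ^ wt (fst x)) * ((nm v * nm (c (snd x))) * r ^ wt (snd x))"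
    unfolding W_def norm_mult norm_of_real real_norm_def
    by (intro mult_mono mult_nonneg_nonneg abs_monomial_le cauchy_schwarz[OF v cL] nrm_ge0 v cL) (use k r in auto)
   thus ?thesis by (simp add: T_def mult_ac)
  qed
  have "(W has_sum f k * inn v (F k)) (Sigma UNIV (\<lambda>_. UNIV))"
  proof (rule has_sum_SigmaI)
   show "((\<lambda>\<beta>. W (\<alpha>, \<beta>)) has_sum (a \<alpha> * ?x \<alpha>) * inn v (F k)) UNIV" for \<alpha>
    unfolding W_def fst_conv snd_conv by (rule has_sum_cmult_right[OF vser_inner[OF cv F(2) v]]) (use k in blast)
   show "((\<lambda>\<alpha>. a \<alpha> * ?x \<alpha> * inn v (F k)) has_sum f k * inn v (F k)) UNIV"
    by (rule has_sum_cmult_left[OF a(2)[OF k]])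
   show "W summable_on Sigma UNIV (\<lambda>_. UNIV)"
    by (rule abs_summable_summable, rule summable_on_comparison_test[OF summable_on_cmult_right[OF Ts]]) (use WT in auto)
  qed
  hence "((\<lambda>x. W (snd x)) has_sum f k * inn v (F k)) (Sigma UNIV Q)"
   using has_sum_reindex_bij_betw[OF bij, of W] by simp
  thus ?thesis
  proof (rule has_sum_Sigma'[where B = Q])
   fix \<gamma>
   have "(\<Sum>x\<in>Q \<gamma>. W x) = inn v (d \<gamma>) * ?x \<gamma>"
    unfolding d_def ip_sum[OF v LV_scl[OF cL]] sum_distrib_right ip_smul[OF v cL]
    by (intro sum.cong refl) (auto simp: W_def Q_def ad_def monomial_add)
   thus "((\<lambda>x. W (snd (\<gamma>, x))) has_sum inn v (d \<gamma>) * ?x \<gamma>) (Q \<gamma>)"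
    using has_sum_finite[OF finQ, of W \<gamma>] by simp
  qed
 qed
 show ?thesis unfolding avec_at_def
 proof (intro exI[of _ r] exI[of _ d] conjI allI impI)
  fix k assume "\<forall>i. \<bar>k $ i - k0 $ i\<bar> < r"
  hence k: "\<forall>i. \<bar>k $ i - k0 $ i\<bar> \<le> r" by (simp add: less_imp_le)
  let ?x = "\<lambda>\<alpha>. complex_of_real (monomial \<alpha> (k - k0))"
  define g where "g S = scl (f k) (F k) - psum d S (k - k0)" for S
  have le: "norm (nm (g S)) \<le> infsum t UNIV - sum t S" if S: "finite S" for S
  proof -
   let ?v = "g S"
   have L: "?v \<in> LV m" unfolding g_def by (intro diff_mem sum_mem LV_scl F(2) dL)
   let ?h = "\<lambda>\<gamma>. inn ?v (d \<gamma>) * ?x \<gamma>"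
   \<comment> \<open>With the remainder \<open>?v\<close> as test vector, its square norm is a tail
     of the scalar series, at most \<open>nm ?v\<close> times the tail of \<open>t\<close>.
     Cancelling \<open>nm ?v\<close> bounds the remainder by that tail.\<close>
   have "inn ?v ?v = f k * inn ?v (F k) - sum ?h S"
    by (subst (2) g_def, subst ip_diff[OF L LV_scl[OF F(2)] sum_mem[OF LV_scl[OF dL]]], subst ip_sum[OF L LV_scl[OF dL]])
      (simp add: ip_smul[OF L F(2)] ip_smul[OF L dL] mult.commute)
   hence "(?h has_sum inn ?v ?v) (UNIV - S)"
    using has_sum_Diff[OF weak[OF L k] has_sum_finite[OF S]] by simp
   moreover have "((\<lambda>\<gamma>. nm ?v * t \<gamma>) has_sum nm ?v * (infsum t UNIV - sum t S)) (UNIV - S)"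
    by (intro has_sum_cmult_right has_sum_Diff has_sum_infsum ts has_sum_finite S) simp
   moreover have "norm (?h \<gamma>) \<le> nm ?v * t \<gamma>" for \<gamma>
   proof -
    have "norm (?h \<gamma>) \<le> (nm ?v * nm (d \<gamma>)) * r ^ wt \<gamma>"
     unfolding norm_mult norm_of_real
     by (intro mult_mono mult_nonneg_nonneg abs_monomial_le cauchy_schwarz[OF L dL] nrm_ge0 L dL) (use k r in auto)
    also have "\<dots> \<le> nm ?v * t \<gamma>"
     using mult_left_mono[OF nd nrm_ge0[OF L]] by (simp add: mult.assoc)
    finally show ?thesis .
   qed
   ultimately have "norm (inn ?v ?v) \<le> nm ?v * (infsum t UNIV - sum t S)"
    by (rule norm_infsum_le)
   hence "nm ?v * nm ?v \<le> nm ?v * (infsum t UNIV - sum t S)"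
    unfolding ip_self[OF L] by (simp add: power2_eq_square norm_mult)
   moreover have "sum t S \<le> infsum t UNIV" using ts S T0 by (intro finite_sum_le_infsum) (auto simp: t_def sum_nonneg)
   ultimately show ?thesis using nrm_ge0[OF L] by (cases "nm ?v = 0") auto
  qed
  have "((\<lambda>S. infsum t UNIV - sum t S) \<longlongrightarrow> infsum t UNIV - infsum t UNIV) finsets"
   using has_sum_infsum[OF ts] unfolding has_sum_def by (intro tendsto_diff tendsto_const)
  thus "((\<lambda>S. nm (scl (f k) (F k) - psum d S (k - k0))) \<longlongrightarrow> 0) finsets"
   unfolding g_def[symmetric]
   by (intro Lim_null_comparison[OF eventually_mono[OF eventually_finite_subsets_at_top_weakI le]]) auto
 qed (use r db in auto)
qed

subsection \<open>Analytic periodic sections and functions\<close>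

definition rper :: "(real ^ 'd \<Rightarrow> complex) \<Rightarrow> bool" where
 "rper f \<longleftrightarrow> (\<forall>k. ran_at k f) \<and> (\<forall>k. \<forall>K\<in>RL C. f (k + K) = f k)"

text \<open>What \<open>analytic_periodic_frame\<close> asks of a single member of the frame,
  together with its Bloch condition; see \<open>apf_iff\<close>.\<close>

definition gsec :: "(real ^ 'd \<Rightarrow> ('d, 'v) wavefun) \<Rightarrow> bool" where
 "gsec \<psi> \<longleftrightarrow> (\<forall>k. \<psi> k \<in> Bl k) \<and> (\<forall>k0. avec_at k0 (\<lambda>k. plane_wave (- k) (\<psi> k))) \<and>
   (\<forall>k. \<forall>K\<in>RL C. \<psi> (k + K) \<simeq> \<psi> k) \<and> (\<forall>i. (\<lambda>x. \<psi> (fst x) (snd x) i) \<in> borel_measurable borel)"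

lemma gsec_bloch: "gsec \<psi> \<Longrightarrow> \<psi> k \<in> Bl k"
 and gsec_avec: "gsec \<psi> \<Longrightarrow> avec_at k0 (\<lambda>k. plane_wave (- k) (\<psi> k))"
 and gsec_per: "gsec \<psi> \<Longrightarrow> K \<in> RL C \<Longrightarrow> \<psi> (k + K) \<simeq> \<psi> k"
 and gsec_meas: "gsec \<psi> \<Longrightarrow> (\<lambda>x. \<psi> (fst x) (snd x) i) \<in> borel_measurable borel"
 by (simp_all add: gsec_def)

lemma gsec_LV: "gsec \<psi> \<Longrightarrow> \<psi> k \<in> LV m"
 using gsec_bloch bloch_LV by blast

lemma rper_ran: "rper f \<Longrightarrow> ran_at k f" and rper_per: "rper f \<Longrightarrow> K \<in> RL C \<Longrightarrow> f (k + K) = f k"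
 by (simp_all add: rper_def)

lemma rper_const [simp]: "rper (\<lambda>_. c)"
 by (simp add: rper_def)

lemma rper_sum: "finite I \<Longrightarrow> (\<And>i. i \<in> I \<Longrightarrow> rper (f i)) \<Longrightarrow> rper (\<lambda>k. \<Sum>i\<in>I. f i k)"
 by (auto simp: rper_def intro!: ran_at_sum)

lemma rper_mult: "rper f \<Longrightarrow> rper g \<Longrightarrow> rper (\<lambda>k. f k * g k)"
 by (auto simp: rper_def intro: ran_at_mult)

lemma rper_cnj: "rper f \<Longrightarrow> rper (\<lambda>k. cnj (f k))"
 by (auto simp: rper_def intro: ran_at_cnj)

lemma rper_add: "rper f \<Longrightarrow> rper g \<Longrightarrow> rper (\<lambda>k. f k + g k)"
 by (auto simp: rper_def intro: ran_at_add)

lemma rper_minus: "rper f \<Longrightarrow> rper (\<lambda>k. - f k)"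
 by (auto simp: rper_def intro: ran_at_minus)

lemma rper_inverse: "rper f \<Longrightarrow> (\<And>k. f k \<noteq> 0) \<Longrightarrow> rper (\<lambda>k. inverse (f k))"
 by (auto simp: rper_def intro: ran_at_inverse)

lemma rper_continuous: "rper f \<Longrightarrow> continuous_on S f"
 by (rule ran_continuous_on) (rule rper_ran)

lemma gsec_inner:
 assumes f: "gsec \<phi>" and g: "gsec \<psi>" shows "rper (\<lambda>k. inn (\<phi> k) (\<psi> k))"
proof -
 have "ran_at k0 (\<lambda>k. inn (plane_wave (- k) (\<phi> k)) (plane_wave (- k) (\<psi> k)))" for k0
  by (rule avec_inner) (use f g in \<open>auto intro: gsec_avec LV_plane_wave gsec_LV\<close>)
 moreover have "inn (\<phi> (k + K)) (\<psi> (k + K)) = inn (\<phi> k) (\<psi> k)" if "K \<in> RL C" for k K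
  by (rule inner_aeq) (use f g that in \<open>auto intro: gsec_LV gsec_per\<close>)
 ultimately show ?thesis by (simp add: rper_def)
qed

lemma gsec_sum:
 assumes J: "finite J" and f: "\<And>j. j \<in> J \<Longrightarrow> rper (f j)" and \<psi>: "\<And>j. j \<in> J \<Longrightarrow> gsec (\<psi> j)"
 shows "gsec (\<lambda>k. \<Sum>j\<in>J. scl (f j k) (\<psi> j k))"
 unfolding gsec_def
proof (intro conjI allI ballI)
 fix k K i k0
 show "(\<Sum>j\<in>J. scl (f j k) (\<psi> j k)) \<in> Bl k"
  by (intro bloch_sum bloch_scl gsec_bloch \<psi>)
 have L: "plane_wave (- k) (\<psi> j k) \<in> LV m" if "j \<in> J" for j k
  by (rule LV_plane_wave[OF gsec_LV[OF \<psi>[OF that]]])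
 have "avec_at k0 (\<lambda>k. \<Sum>j\<in>J. scl (f j k) (plane_wave (- k) (\<psi> j k)))"
 proof (rule avec_at_sum[OF J])
  fix j assume j: "j \<in> J"
  show "avec_at k0 (\<lambda>k. scl (f j k) (plane_wave (- k) (\<psi> j k)))"
   by (rule avec_at_scale[OF rper_ran[OF f[OF j]] gsec_avec[OF \<psi>[OF j]] L[OF j]])
  show "scl (f j k) (plane_wave (- k) (\<psi> j k)) \<in> LV m" for k by (rule LV_scl[OF L[OF j]])
 qed
 moreover have "(\<lambda>k. plane_wave (- k) (\<Sum>j\<in>J. scl (f j k) (\<psi> j k))) = (\<lambda>k. \<Sum>j\<in>J. scl (f j k) (plane_wave (- k) (\<psi> j k)))"
  by (rule ext) (simp only: plane_wave_sum plane_wave_scl)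
 ultimately show "avec_at k0 (\<lambda>k. plane_wave (- k) (\<Sum>j\<in>J. scl (f j k) (\<psi> j k)))" by simp
 show "(\<Sum>j\<in>J. scl (f j (k + K)) (\<psi> j (k + K))) \<simeq> (\<Sum>j\<in>J. scl (f j k) (\<psi> j k))" if K: "K \<in> RL C"
 proof (rule aeq_sum)
  fix j assume j: "j \<in> J"
  show "scl (f j (k + K)) (\<psi> j (k + K)) \<simeq> scl (f j k) (\<psi> j k)"
   unfolding rper_per[OF f[OF j] K] by (rule aeq_scl[OF gsec_per[OF \<psi>[OF j] K]])
 qed
 have "(\<lambda>x. f j (fst x)) \<in> borel_measurable (borel :: ((real ^ 'd) \<times> (real ^ 'd)) measure)" if "j \<in> J" for j
  by (rule borel_measurable_continuous_onI) (intro continuous_on_compose2[OF rper_continuous[OF f[OF that], of UNIV]] continuous_intros, auto)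
 thus "(\<lambda>x. (\<Sum>j\<in>J. scl (f j (fst x)) (\<psi> j (fst x))) (snd x) i) \<in> borel_measurable borel"
  unfolding sum_fun_apply2 scl_def
  by (intro borel_measurable_sum measurable_scale_cvec gsec_meas \<psi>)
qed

lemma gsec_scale: "rper f \<Longrightarrow> gsec \<psi> \<Longrightarrow> gsec (\<lambda>k. scl (f k) (\<psi> k))"
 using gsec_sum[of "{()}" "\<lambda>_. f" "\<lambda>_. \<psi>"] by simp

lemma apf_iff:
 "apf E J \<psi> \<longleftrightarrow>
   (\<forall>k. onb k J (\<lambda>j. \<psi> j k) (E k)) \<and> (\<forall>j\<in>J. gsec (\<psi> j))"
proof -
 have b: "\<psi> j k \<in> Bl k" if "\<forall>k. onb k J (\<lambda>j. \<psi> j k) (E k)" "j \<in> J" for j k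
  using onb_bloch[OF spec[OF that(1), of k] that(2)] .
 show ?thesis
 proof
  assume a: "apf E J \<psi>"
  hence o: "\<forall>k. onb k J (\<lambda>j. \<psi> j k) (E k)"
   unfolding analytic_periodic_frame_def by (rule conjunct1)
  moreover have "gsec (\<psi> j)" if "j \<in> J" for j
   unfolding gsec_def analytic_vectors_iff[symmetric] using a that b[OF o that]
   unfolding analytic_periodic_frame_def by blast
  ultimately show "(\<forall>k. onb k J (\<lambda>j. \<psi> j k) (E k)) \<and> (\<forall>j\<in>J. gsec (\<psi> j))" by blast
 next
  assume a: "(\<forall>k. onb k J (\<lambda>j. \<psi> j k) (E k)) \<and> (\<forall>j\<in>J. gsec (\<psi> j))"
  have "analytic_vectors C m (\<lambda>k. plane_wave (- k) (\<psi> j k)) \<and> (\<forall>k. \<forall>K\<in>RL C. \<psi> j (k + K) \<simeq> \<psi> j k) \<and>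
    (\<forall>i. (\<lambda>x. \<psi> j (fst x) (snd x) i) \<in> borel_measurable borel)" if "j \<in> J" for j
   using bspec[OF conjunct2[OF a] that] unfolding gsec_def analytic_vectors_iff by (elim conjE) (intro conjI)
  thus "apf E J \<psi>"
   unfolding analytic_periodic_frame_def using conjunct1[OF a] by blast
 qed
qed

end

section \<open>Spans and Householder maps\<close>

context semi_inner
begin

text \<open>The span as a double orthogonal complement. In this form stability under linear
  combinations, transitivity and independence of the representative become immediate in the lemmas
  below.\<close>

lemma res_null_iff:
 assumes e: "ons I e" and x: "x \<in> V"
 shows "nrm (res I e x) = 0 \<longleftrightarrow> (\<forall>y\<in>V. (\<forall>i\<in>I. ip (e i) y = 0) \<longrightarrow> ip x y = 0)"
proof
 have eV: "\<And>i. i \<in> I \<Longrightarrow> e i \<in> V" using e by (simp add: ons_def)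
 have sV: "(\<Sum>i\<in>I. ip (e i) x \<odot> e i) \<in> V" by (intro sum_mem smul_mem eV)
 show "\<forall>y\<in>V. (\<forall>i\<in>I. ip (e i) y = 0) \<longrightarrow> ip x y = 0" if n: "nrm (res I e x) = 0"
 proof (intro ballI impI)
  fix y assume y: "y \<in> V" "\<forall>i\<in>I. ip (e i) y = 0"
  have "ip y x = ip y (\<Sum>i\<in>I. ip (e i) x \<odot> e i)"
   by (rule ip_cong_null[OF y(1) x sV]) (use n in \<open>simp add: res_def\<close>)
  also have "\<dots> = (\<Sum>i\<in>I. ip (e i) x * ip y (e i))"
   by (subst ip_sum[OF y(1)]) (simp_all add: smul_mem eV ip_smul y(1))
  also have "\<dots> = 0" 
 proof (rule sum.neutral, rule ballI)
  fix i assume "i \<in> I"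
  thus "ip (e i) x * ip y (e i) = 0" using ip_cnj[OF eV y(1), of i] y(2) by simp
 qed
  finally show "ip x y = 0" using ip_cnj[OF y(1) x] by simp
 qed
 assume a: "\<forall>y\<in>V. (\<forall>i\<in>I. ip (e i) y = 0) \<longrightarrow> ip x y = 0"
 have r: "res I e x \<in> V" by (rule res_mem[OF e x])
 have 1: "ip x (res I e x) = 0" using a r ip_ons_res[OF e _ x] by blast
 have "ip (\<Sum>i\<in>I. ip (e i) x \<odot> e i) (res I e x) = 0"
  by (subst ip_sum_left[OF r]) (auto simp: smul_mem eV ip_smul_left r ip_ons_res[OF e _ x])
 hence "ip (x - (\<Sum>i\<in>I. ip (e i) x \<odot> e i)) (res I e x) = 0"
  using 1 ip_diff_left[OF r x sV] by simp
 hence "ip (res I e x) (res I e x) = 0" by (simp only: res_def)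
 thus "nrm (res I e x) = 0" by (simp add: nrm_def)
qed

lemma res_null_sum:
 assumes e: "ons I e" and x: "\<And>j. j \<in> J \<Longrightarrow> x j \<in> V" "\<And>j. j \<in> J \<Longrightarrow> nrm (res I e (x j)) = 0"
 shows "nrm (res I e (\<Sum>j\<in>J. c j \<odot> x j)) = 0"
proof (subst res_null_iff[OF e sum_mem[OF smul_mem[OF x(1)]]], assumption, intro ballI impI)
 fix y assume y: "y \<in> V" "\<forall>i\<in>I. ip (e i) y = 0"
 have "ip (x j) y = 0" if "j \<in> J" for j using res_null_iff[OF e x(1)[OF that]] x(2)[OF that] y by blast
 thus "ip (\<Sum>j\<in>J. c j \<odot> x j) y = 0"
  using y x(1) by (subst ip_sum_left) (auto simp: smul_mem ip_smul_left)
qed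

lemma res_null_trans:
 assumes e: "ons I e" and f: "ons J f" and ef: "\<And>i. i \<in> I \<Longrightarrow> nrm (res J f (e i)) = 0"
  and x: "x \<in> V" "nrm (res I e x) = 0"
 shows "nrm (res J f x) = 0"
proof (subst res_null_iff[OF f x(1)], intro ballI impI)
 fix y assume y: "y \<in> V" "\<forall>j\<in>J. ip (f j) y = 0"
 have eV: "\<And>i. i \<in> I \<Longrightarrow> e i \<in> V" using e by (simp add: ons_def)
 have "\<forall>i\<in>I. ip (e i) y = 0" using res_null_iff[OF f eV] ef y by blast
 thus "ip x y = 0" using res_null_iff[OF e x(1)] x(2) y(1) by blast
qed

lemma res_null_basis:
 assumes e: "ons I e" and i: "i \<in> I" shows "nrm (res I e (e i)) = 0"
proof -
 have "e i \<in> V" using e i by (simp add: ons_def)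
 thus ?thesis using res_null_iff[OF e] i by blast
qed

lemma res_null_add:
 assumes e: "ons I e" and x: "x \<in> V" "nrm (res I e x) = 0" and y: "y \<in> V" "nrm (res I e y) = 0"
 shows "nrm (res I e (x + y)) = 0"
 using x y res_null_iff[OF e] by (simp add: add_mem ip_add_left)

lemma res_null_cong:
 assumes e: "ons I e" and x: "x \<in> V" "nrm (res I e x) = 0" and y: "y \<in> V" "nrm (y - x) = 0"
 shows "nrm (res I e y) = 0"
proof (subst res_null_iff[OF e y(1)], intro ballI impI)
 fix z assume z: "z \<in> V" "\<forall>i\<in>I. ip (e i) z = 0"
 have "ip z y = ip z x" by (rule ip_cong_null[OF z(1) y(1) x(1) y(2)])
 also have "ip z x = cnj (ip x z)" by (rule ip_cnj[OF x(1) z(1)])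
 also have "ip x z = 0" using x z res_null_iff[OF e x(1)] by blast
 finally show "ip y z = 0" using ip_cnj[OF z(1) y(1)] by simp
qed

lemma ons_reindex: "ons J e \<Longrightarrow> bij_betw h I J \<Longrightarrow> ons I (\<lambda>i. e (h i))"
 unfolding ons_def using bij_betw_finite[of h I J] bij_betwE[of h I J] bij_betw_imp_inj_on[of h I J]
 by (auto simp: inj_on_eq_iff)

text \<open>
 \<open>hh x y\<close> is the unitary map \<open>1 + w w\<^sup>*/(w\<^sup>* x)\<close>, \<open>w = y - x\<close>, which takes the unit vector \<open>x\<close>
 to the unit vector \<open>y\<close>.
\<close>

definition hh :: "'a \<Rightarrow> 'a \<Rightarrow> 'a \<Rightarrow> 'a" where
 "hh x y z = z + (ip (y - x) z / ip (y - x) x) \<odot> (y - x)"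

lemma hh_ip:
 assumes x: "x \<in> V" "ip x x = 1" and y: "y \<in> V" "ip y y = 1" and c: "ip (y - x) x \<noteq> 0"
  and a: "a \<in> V" and b: "b \<in> V"
 shows "ip (hh x y a) (hh x y b) = ip a b"
proof -
 define w where "w = y - x"
 have w: "w \<in> V" unfolding w_def by (intro diff_mem x y)
 define g where "g = ip w x"
 \<comment> \<open>Compares the square norms of \<open>x\<close> and of \<open>y = x + w\<close>,
   both 1; this cancels the extra terms in the expansion below.\<close>
 have gw: "g + cnj g + ip w w = 0"
  unfolding g_def w_def using x y ip_cnj[OF x(1) y(1)] by (simp add: ip_diff ip_diff_left diff_mem)
 have g: "g \<noteq> 0" using c by (simp add: g_def w_def)
 define \<alpha> \<beta> where "\<alpha> = ip w a / g" and "\<beta> = ip w b / g"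
 have 1: "ip w b = \<beta> * g" "ip a w = cnj \<alpha> * cnj g"
  using g ip_cnj[OF w a] by (simp_all add: \<alpha>_def \<beta>_def)
 have "ip (hh x y a) (hh x y b) = ip (a + \<alpha> \<odot> w) (b + \<beta> \<odot> w)"
  by (simp only: hh_def w_def[symmetric] g_def[symmetric] \<alpha>_def[symmetric] \<beta>_def[symmetric])
 also have "\<dots> = ip a b + \<beta> * ip a w + cnj \<alpha> * ip w b + cnj \<alpha> * \<beta> * ip w w"
  using a b w by (simp add: ip_add ip_add_left smul_mem add_mem ip_smul ip_smul_left algebra_simps)
 also have "\<dots> = ip a b + cnj \<alpha> * \<beta> * (g + cnj g + ip w w)" unfolding 1 by (simp add: algebra_simps)
 finally show ?thesis using gw by simp
qed

end

section \<open>Completing a unit column to a unitary matrix\<close>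

text \<open>The domain is embedded in a hyperplane of the codomain, which is a null set, and
  \<open>F\<close> composed with a linear left inverse of the embedding is still locally Lipschitz.
  Such maps of a space into itself preserve null sets.\<close>

lemma lipschitz_image_negligible:
 fixes F :: "'a::euclidean_space \<Rightarrow> 'b::euclidean_space"
 assumes dim: "DIM('a) < DIM('b)"
  and lip: "\<And>x. \<exists>T B. open T \<and> x \<in> T \<and> (\<forall>y\<in>T. norm (F y - F x) \<le> B * norm (y - x))"
 shows "negligible (range F)"
proof -
 obtain f :: "'a \<times> real \<Rightarrow> 'b" and g :: "'b \<Rightarrow> 'a \<times> real" and j :: 'b where
  fg: "linear f" "linear g" "\<And>z. g (f z) = z" "j \<in> Basis" "\<And>x. f (x, 0) \<bullet> j = 0"
  using lowerdim_embeddings[OF dim] by blast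
 let ?S = "{y. y \<bullet> j = 0} :: 'b set" and ?G = "\<lambda>y. F (fst (g y))"
 obtain K where K: "K > 0" "\<And>y. norm (g y) \<le> norm y * K"
  using bounded_linear.pos_bounded[of g] fg(2) by (auto simp: linear_conv_bounded_linear)
 have "negligible (?G ` ?S)"
 proof (rule negligible_locally_Lipschitz_image)
  show "negligible ?S" using negligible_standard_hyperplane[OF fg(4), of 0] by simp
  fix x assume "x \<in> ?S"
  obtain T B where T: "open T" "fst (g x) \<in> T" "\<And>y. y \<in> T \<Longrightarrow> norm (F y - F (fst (g x))) \<le> B * norm (y - fst (g x))"
   using lip[of "fst (g x)"] by blast
  have "continuous_on UNIV (\<lambda>y. fst (g y))"
   using fg(2) by (intro continuous_on_fst linear_continuous_on) (simp add: linear_conv_bounded_linear)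
  hence "open ((\<lambda>y. fst (g y)) -` T)" using T(1) by (rule open_vimage[rotated])
  moreover have "norm (?G y - ?G x) \<le> (\<bar>B\<bar> * K) * norm (y - x)" if "fst (g y) \<in> T" for y
  proof -
   have "norm (?G y - ?G x) \<le> B * norm (fst (g y) - fst (g x))" by (rule T(3)[OF that])
   also have "\<dots> \<le> \<bar>B\<bar> * norm (fst (g y) - fst (g x))" by (intro mult_right_mono) auto
   also have "\<dots> \<le> \<bar>B\<bar> * norm (g (y - x))"
   proof (rule mult_left_mono)
    have "fst (g y) - fst (g x) = fst (g (y - x))" by (simp add: linear_diff[OF fg(2)])
    thus "norm (fst (g y) - fst (g x)) \<le> norm (g (y - x))" by (metis norm_fst_le prod.collapse)
   qed simp
   also have "\<dots> \<le> \<bar>B\<bar> * (norm (y - x) * K)" by (intro mult_left_mono K(2)) auto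
   finally show ?thesis by (simp add: mult_ac)
  qed
  ultimately show "\<exists>T B. open T \<and> x \<in> T \<and> (\<forall>y\<in>?S \<inter> T. norm (?G y - ?G x) \<le> B * norm (y - x))"
   using T(2) by (intro exI[of _ "(\<lambda>y. fst (g y)) -` T"] exI[of _ "\<bar>B\<bar> * K"]) auto
 qed simp
 moreover have "range F \<subseteq> ?G ` ?S"
 proof
  fix z assume "z \<in> range F"
  then obtain x where "z = F x" by blast
  hence "z = ?G (f (x, 0))" by (simp add: fg(3))
  thus "z \<in> ?G ` ?S" using fg(5) by blast
 qed
 ultimately show ?thesis by (rule negligible_subset)
qed

text \<open>The radial parameter \<open>t\<close> replaces the unit sphere by its ambient space: a
  cone with at most \<open>3 + 1\<close> parameters is a null set in the six real dimensions of
  \<open>complex \<times> complex \<times> complex\<close>, and no measure on the sphere has to be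
  introduced.\<close>

lemma cone_negligible:
 fixes u :: "nat \<Rightarrow> real ^ 'd::finite \<Rightarrow> complex"
 assumes d: "CARD('d) \<le> 3" and u: "\<And>i k. i < 3 \<Longrightarrow> ran_at k (u i)"
 shows "negligible (range (\<lambda>(k, t). (t *\<^sub>R u 0 k, t *\<^sub>R u 1 k, t *\<^sub>R u 2 k)))"
proof (rule lipschitz_image_negligible)
 let ?F = "\<lambda>(k, t). (t *\<^sub>R u 0 k, t *\<^sub>R u 1 k, t *\<^sub>R u 2 k)"
 have "DIM((real ^ 'd) \<times> real) \<le> 4" using d by simp
 thus "DIM((real ^ 'd) \<times> real) < DIM(complex \<times> complex \<times> complex)" by simp
 fix x :: "(real ^ 'd) \<times> real"
 obtain k0 t0 where x: "x = (k0, t0)" by (cases x)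
 have "\<exists>r B. 0 < r \<and> 0 \<le> B \<and> (\<forall>k. norm (k - k0) < r \<longrightarrow> cmod (u i k - u i k0) \<le> B * norm (k - k0))" if i: "i < 3" for i
 proof -
  obtain r B where "0 < r" "\<And>k. norm (k - k0) < r \<Longrightarrow> cmod (u i k - u i k0) \<le> B * norm (k - k0)"
   using ran_at_lipschitz[OF u[OF i]] by blast
  thus ?thesis
   by (intro exI[of _ r] exI[of _ "\<bar>B\<bar>"]) (auto intro: order_trans[OF _ mult_right_mono[OF abs_ge_self]])
 qed
 then obtain r B where rB: "\<And>i. i < 3 \<Longrightarrow> 0 < r i" "\<And>i. i < 3 \<Longrightarrow> 0 \<le> B i"
   "\<And>i k. i < 3 \<Longrightarrow> norm (k - k0) < r i \<Longrightarrow> cmod (u i k - u i k0) \<le> B i * norm (k - k0)"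
  by metis
 \<comment> \<open>\<open>R \<le> 1\<close> keeps
   \<open>\<bar>t\<bar> \<le> \<bar>t0\<bar> + 1\<close>, so that the Lipschitz constants
   \<open>M i\<close> do not depend on \<open>t\<close>.\<close>
 define R where "R = min 1 (min (r 0) (min (r 1) (r 2)))"
 define M where "M i = (\<bar>t0\<bar> + 1) * B i + cmod (u i k0)" for i
 have M0: "0 \<le> M i" if "i < 3" for i using rB(2)[OF that] by (simp add: M_def)
 have R: "0 < R" "R \<le> 1" "R \<le> r 0" "R \<le> r 1" "R \<le> r 2" using rB(1) by (auto simp: R_def)
 have est: "cmod (t *\<^sub>R u i k - t0 *\<^sub>R u i k0) \<le> M i * norm ((k, t) - (k0, t0))"
  if i: "i < 3" and n: "norm ((k, t) - (k0, t0)) < R" for i k t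
 proof -
  let ?n = "norm ((k, t) - (k0, t0))"
  have nk: "norm (k - k0) \<le> ?n" and nt: "\<bar>t - t0\<bar> \<le> ?n"
   using norm_fst_le[of "k - k0" "t - t0"] norm_snd_le[of "t - t0" "k - k0"] by simp_all
  have t: "\<bar>t\<bar> \<le> \<bar>t0\<bar> + 1" using nt n R(2) by linarith
  have "i = 0 \<or> i = 1 \<or> i = 2" using i by auto
  hence "norm (k - k0) < r i" using nk n R by auto
  hence 1: "cmod (u i k - u i k0) \<le> B i * ?n"
   using rB(3)[OF i] mult_left_mono[OF nk rB(2)[OF i]] order_trans by blast
  have "t *\<^sub>R u i k - t0 *\<^sub>R u i k0 = t *\<^sub>R (u i k - u i k0) + (t - t0) *\<^sub>R u i k0"
   by (simp add: algebra_simps)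
  hence "cmod (t *\<^sub>R u i k - t0 *\<^sub>R u i k0) \<le> \<bar>t\<bar> * cmod (u i k - u i k0) + \<bar>t - t0\<bar> * cmod (u i k0)"
   using norm_triangle_ineq[of "t *\<^sub>R (u i k - u i k0)" "(t - t0) *\<^sub>R u i k0"] by simp
  also have "\<dots> \<le> (\<bar>t0\<bar> + 1) * (B i * ?n) + ?n * cmod (u i k0)"
   using t 1 nt rB(2)[OF i] by (intro add_mono mult_mono) auto
  finally show ?thesis by (simp add: M_def algebra_simps)
 qed
 show "\<exists>T B. open T \<and> x \<in> T \<and> (\<forall>y\<in>T. norm (?F y - ?F x) \<le> B * norm (y - x))"
 proof (intro exI[of _ "ball x R"] exI[of _ "M 0 + (M 1 + M 2)"] conjI ballI)
  fix y assume y: "y \<in> ball x R"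
  obtain k t where kt: "y = (k, t)" by (cases y)
  have n: "norm ((k, t) - (k0, t0)) < R" using y by (simp only: x kt mem_ball dist_norm norm_minus_commute)
  have "norm (?F y - ?F x) \<le> cmod (t *\<^sub>R u 0 k - t0 *\<^sub>R u 0 k0)
    + norm (t *\<^sub>R u 1 k - t0 *\<^sub>R u 1 k0, t *\<^sub>R u 2 k - t0 *\<^sub>R u 2 k0)"
   unfolding kt x by (simp add: norm_Pair_le)
  also have "\<dots> \<le> cmod (t *\<^sub>R u 0 k - t0 *\<^sub>R u 0 k0) + (cmod (t *\<^sub>R u 1 k - t0 *\<^sub>R u 1 k0) + cmod (t *\<^sub>R u 2 k - t0 *\<^sub>R u 2 k0))"
   by (intro add_left_mono norm_Pair_le)
  also have "\<dots> \<le> M 0 * norm ((k, t) - (k0, t0)) + (M 1 * norm ((k, t) - (k0, t0)) + M 2 * norm ((k, t) - (k0, t0)))"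
   by (intro add_mono est n) auto
  finally show "norm (?F y - ?F x) \<le> (M 0 + (M 1 + M 2)) * norm (y - x)" by (simp only: x kt distrib_right)
 qed (use R in auto)
qed

text \<open>A point off both cones, normalised and padded with zeros, is missed already in its first
  three entries. The constant column \<open>e\<close> is avoided too, so that the unitary map taking
  it to \<open>v\<close> has a nonzero denominator in \<open>unitary_completion\<close>.\<close>

lemma unit_vector_missed:
 fixes u :: "nat \<Rightarrow> real ^ 'd::finite \<Rightarrow> complex"
 assumes d: "CARD('d) \<le> 3" and n: "3 \<le> n" and u: "\<And>i k. i < n \<Longrightarrow> ran_at k (u i)"
 shows "\<exists>v. (\<Sum>i<n. cnj (v i) * v i) = 1 \<and> (\<forall>k. \<exists>i<n. u i k \<noteq> v i) \<and> (\<exists>i<n. v i \<noteq> (if i = 0 then 1 else 0))"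
proof -
 define e where "e i k = (if i = 0 then 1 else 0 :: complex)" for i :: nat and k :: "real ^ 'd"
 let ?F = "\<lambda>u (k :: real ^ 'd, t). (t *\<^sub>R u 0 k, t *\<^sub>R u 1 k, t *\<^sub>R u 2 k) :: complex \<times> complex \<times> complex"
 have "negligible (range (?F u))" by (rule cone_negligible[OF d u]) (use n in simp)
 moreover have "negligible (range (?F e))" by (rule cone_negligible[OF d]) (simp add: e_def)
 ultimately have "negligible (range (?F u) \<union> range (?F e))" by (rule negligible_Un)
 hence "range (?F u) \<union> range (?F e) \<noteq> UNIV"
  using non_negligible_UNIV by metis
 then obtain z where z: "z \<notin> range (?F u)" "z \<notin> range (?F e)" by blast
 obtain z0 z1 z2 where z3: "z = (z0, z1, z2)" by (cases z)
 define s where "s = (cmod z0)\<^sup>2 + ((cmod z1)\<^sup>2 + (cmod z2)\<^sup>2)"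
 have "z \<noteq> 0"
 proof
  assume "z = 0"
  hence "z = ?F u (0, 0)" by (simp add: zero_prod_def)
  thus False using z(1) by blast
 qed
 hence s: "s > 0" unfolding s_def z3 zero_prod_def
  by (auto simp: add_nonneg_eq_0_iff less_le)
 define v where "v i = (if i = 0 then z0 / of_real (sqrt s) else if i = 1 then z1 / of_real (sqrt s) else if i = 2 then z2 / of_real (sqrt s) else 0)" for i :: nat
 have sub: "{0, 1, 2} \<subseteq> {..<n}" using n by auto
 have "(\<Sum>i<n. cnj (v i) * v i) = (\<Sum>i\<in>{0, 1, 2}. cnj (v i) * v i)"
  by (rule sum.mono_neutral_right) (use sub in \<open>auto simp: v_def\<close>)
 also have "\<dots> = complex_of_real (s / s)"
 proof -
  have "cnj (z / of_real (sqrt s)) * (z / of_real (sqrt s)) = of_real ((cmod z)\<^sup>2 / s)" for z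
   unfolding mult_cnj_cmod using s
   by (simp add: norm_divide power_divide flip: of_real_power)
  hence "(\<Sum>i\<in>{0, 1, 2}. cnj (v i) * v i)
    = of_real ((cmod z0)\<^sup>2 / s) + (of_real ((cmod z1)\<^sup>2 / s) + of_real ((cmod z2)\<^sup>2 / s))"
   by (simp add: v_def)
  also have "\<dots> = of_real ((cmod z0)\<^sup>2 / s + ((cmod z1)\<^sup>2 / s + (cmod z2)\<^sup>2 / s))" by (simp only: of_real_add)
  also have "(cmod z0)\<^sup>2 / s + ((cmod z1)\<^sup>2 / s + (cmod z2)\<^sup>2 / s) = s / s"
   by (simp only: s_def add_divide_distrib)
  finally show ?thesis .
 qed
 finally have 1: "(\<Sum>i<n. cnj (v i) * v i) = 1" using s by simp
 have miss: "\<exists>i<n. f i k \<noteq> v i" if f: "z \<notin> range (?F f)" for f k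
 proof (rule ccontr)
  assume "\<not> ?thesis"
  hence "f 0 k = v 0" "f 1 k = v 1" "f 2 k = v 2" using n by auto
  hence "z = ?F f (k, sqrt s)" using s by (simp add: v_def z3 scaleR_conv_of_real)
  thus False using f by blast
 qed
 have "\<exists>i<n. v i \<noteq> (if i = 0 then 1 else 0)" using miss[OF z(2), of 0] unfolding e_def by metis
 with 1 miss[OF z(1)] show ?thesis by blast
qed

text \<open>Columns are functions on the naturals whose entries from \<open>n\<close> on do not
  contribute, which a semidefinite form tolerates. This makes \<open>hh\<close> available for
  columns.\<close>

lemma vec_semi_inner:
 "semi_inner (UNIV :: (nat \<Rightarrow> complex) set) (\<lambda>c x i. c * x i) (\<lambda>x y. \<Sum>i<n. cnj (x i) * y i)"
proof
 fix x y z :: "nat \<Rightarrow> complex" and c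
 show "- x = (\<lambda>i. (- 1) * x i)" by (simp add: fun_eq_iff)
 show "(\<Sum>i<n. cnj (x i) * (y + z) i) = (\<Sum>i<n. cnj (x i) * y i) + (\<Sum>i<n. cnj (x i) * z i)"
  by (simp add: algebra_simps sum.distrib)
 show "(\<Sum>i<n. cnj (x i) * (c * y i)) = c * (\<Sum>i<n. cnj (x i) * y i)"
  by (simp add: sum_distrib_left mult_ac)
 show "(\<Sum>i<n. cnj (y i) * x i) = cnj (\<Sum>i<n. cnj (x i) * y i)"
  by (simp add: mult.commute)
 show "0 \<le> Re (\<Sum>i<n. cnj (x i) * x i)"
  by (simp add: sum_nonneg)
qed auto

context mcr
begin

text \<open>For \<open>n \<ge> 3\<close> two maps of the form \<open>hh\<close> are composed: a
  constant one takes the standard basis to \<open>v\<close> and an orthonormal basis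
  \<open>b\<close> of its complement; a second one, analytic in \<open>k\<close>, takes
  \<open>v\<close> to the given column and hence \<open>b\<close> to a basis of the complement of
  that column.\<close>

lemma unitary_completion:
 fixes u :: "nat \<Rightarrow> real ^ 'd \<Rightarrow> complex"
 assumes d: "CARD('d) \<le> 3" and u: "\<And>i. i < n \<Longrightarrow> rper (u i)"
  and unit: "\<And>k. (\<Sum>i<n. cnj (u i k) * u i k) = 1"
 obtains q where "\<And>l i. l < n - 1 \<Longrightarrow> i < n \<Longrightarrow> rper (q l i)"
  "\<And>l l' k. l < n - 1 \<Longrightarrow> l' < n - 1 \<Longrightarrow> (\<Sum>i<n. cnj (q l i k) * q l' i k) = (if l = l' then 1 else 0)"
  "\<And>l k. l < n - 1 \<Longrightarrow> (\<Sum>i<n. cnj (q l i k) * u i k) = 0"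
proof -
 consider "n \<le> 1" | "n = 2" | "3 \<le> n" by linarith
 thus ?thesis
 proof cases
  case 1
  thus ?thesis by (intro that[of "\<lambda>_ _ _. 0"]) auto
 next
  case 2
  have two: "{..<2::nat} = {0, 1}" by auto
  \<comment> \<open>Only the column \<open>l = 0\<close> is wanted, the vector orthogonal to
    \<open>u\<close> from the quaternion structure of \<open>\<complex>\<close> squared; as the
    complement is one-dimensional, no choice of a missed point is involved.\<close>
  define q where "q l i k = (if i = 0 then - cnj (u 1 k) else cnj (u 0 k))" for l i :: nat and k
  show ?thesis
  proof (rule that[of q])
   show "rper (q l i)" if "l < n - 1" "i < n" for l i
   proof (cases "i = 0")
    case True
    hence "q l i = (\<lambda>k. - cnj (u 1 k))" by (simp add: q_def fun_eq_iff)
    thus ?thesis using rper_minus[OF rper_cnj[OF u[of 1]]] 2 by simp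
   next
    case False
    hence "q l i = (\<lambda>k. cnj (u 0 k))" by (simp add: q_def fun_eq_iff)
    thus ?thesis using rper_cnj[OF u[of 0]] 2 by simp
   qed
   show "(\<Sum>i<n. cnj (q l i k) * q l' i k) = (if l = l' then 1 else 0)" if "l < n - 1" "l' < n - 1" for l l' k
    using unit[of k] that 2 by (simp add: two q_def algebra_simps)
   show "(\<Sum>i<n. cnj (q l i k) * u i k) = 0" if "l < n - 1" for l k
    using 2 by (simp add: two q_def algebra_simps)
  qed
 next
  case 3
  interpret cn: semi_inner "UNIV :: (nat \<Rightarrow> complex) set" "\<lambda>c x i. c * x i" "\<lambda>x y. \<Sum>i<n. cnj (x i) * y i"
   by (rule vec_semi_inner)
  let ?ip = "\<lambda>x y. \<Sum>i<n. cnj (x i :: complex) * y i"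
  have ur: "\<And>i k. i < n \<Longrightarrow> ran_at k (u i)" by (rule rper_ran[OF u])
  from unit_vector_missed[OF d 3 ur] obtain v where
   vv: "?ip v v = 1 \<and> (\<forall>k. \<exists>i<n. u i k \<noteq> v i) \<and> (\<exists>i<n. v i \<noteq> (if i = 0 then 1 else 0))" ..
  hence v: "?ip v v = 1" "\<And>k. \<exists>i<n. u i k \<noteq> v i" "\<exists>i<n. v i \<noteq> (if i = 0 then 1 else 0)"
   by blast+
  define e where "e l i = (if i = l then 1 else 0 :: complex)" for l i :: nat
  have ee: "?ip (e l) (e l') = (if l = l' then 1 else 0)" if "l < n" for l l'
  proof -
   have "?ip (e l) (e l') = (\<Sum>i<n. if i = l then e l' i else 0)"
    by (intro sum.cong) (auto simp: e_def)
   thus ?thesis using that by (simp add: e_def)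
  qed
  \<comment> \<open>The equality case of Cauchy-Schwarz: a vanishing denominator means
    \<open><y, x> = 1\<close>, and unit vectors with that inner product coincide in their first
    \<open>n\<close> entries.\<close>
  have ne0: "?ip (y - x) x \<noteq> 0" if x: "?ip x x = 1" and y: "?ip y y = 1" and xy: "\<exists>i<n. y i \<noteq> x i" for x y :: "nat \<Rightarrow> complex"
  proof
   assume c: "?ip (y - x) x = 0"
   hence yx: "?ip y x = 1" using x by (simp add: algebra_simps sum_subtractf)
   moreover have "?ip x y = cnj (?ip y x)" by (simp add: mult.commute)
   ultimately have "?ip x y = 1" by simp
   have "?ip (y - x) (y - x) = ?ip y y - ?ip y x - ?ip x y + ?ip x x"
    by (simp only: cn.ip_diff[OF UNIV_I UNIV_I UNIV_I] cn.ip_diff_left[OF UNIV_I UNIV_I UNIV_I])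
      (simp only: algebra_simps)
   hence "?ip (y - x) (y - x) = 0" using x y yx \<open>?ip x y = 1\<close> by simp
   hence "complex_of_real (\<Sum>i<n. (cmod (y i - x i))\<^sup>2) = 0"
    by (simp only: of_real_sum of_real_power minus_apply mult_cnj_cmod)
   hence "(\<Sum>i<n. (cmod (y i - x i))\<^sup>2) = 0" by (simp only: of_real_eq_0_iff)
   hence "\<forall>i\<in>{..<n}. (cmod (y i - x i))\<^sup>2 = 0" by (subst (asm) sum_nonneg_eq_0_iff) simp_all
   hence "y i = x i" if "i < n" for i using bspec[of "{..<n}" _ i] that by simp
   thus False using xy by blast
  qed
  have hx: "cn.hh x y x = y" if "?ip (y - x) x \<noteq> 0" for x y
   using that unfolding cn.hh_def by (simp add: fun_eq_iff)
  have c0: "?ip (v - e 0) (e 0) \<noteq> 0" by (rule ne0) (use v ee[of 0 0] 3 in \<open>auto simp: e_def\<close>)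
  define b where "b l = cn.hh (e 0) v (e (Suc l))" for l
  have bb: "?ip (b l) (b l') = (if l = l' then 1 else 0)" if "l < n - 1" for l l'
   unfolding b_def using cn.hh_ip[of "e 0" v "e (Suc l)" "e (Suc l')"] v(1) c0 ee[of 0 0] ee[of "Suc l" "Suc l'"] that by simp
  have bv: "?ip (b l) v = 0" if "l < n - 1" for l
   using cn.hh_ip[of "e 0" v "e (Suc l)" "e 0"] v(1) c0 ee[of 0 0] ee[of "Suc l" 0] that hx[OF c0] by (simp add: b_def)
  define uu where "uu k = (\<lambda>i. u i k)" for k
  have cu: "?ip (uu k - v) v \<noteq> 0" for k by (rule ne0) (use v unit in \<open>auto simp: uu_def\<close>)
  define q where "q l i k = cn.hh v (uu k) (b l) i" for l i k
  have qe: "q l i k = b l i + (\<Sum>j<n. cnj (u j k - v j) * b l j) * inverse (\<Sum>j<n. cnj (u j k - v j) * v j) * (u i k - v i)" for l i k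
   unfolding q_def cn.hh_def uu_def by (simp add: divide_inverse)
  show ?thesis
  proof (rule that[of q])
   fix l i assume l: "l < n - 1" and i: "i < n"
   have r: "rper (\<lambda>k. u j k - v j)" if "j < n" for j
    using rper_add[OF u[OF that] rper_const[of "- v j"]] by simp
   have r2: "rper (\<lambda>k. \<Sum>j<n. cnj (u j k - v j) * w j)" for w
    by (intro rper_sum rper_mult rper_cnj r) auto
   show "rper (q l i)" unfolding qe[abs_def]
    by (intro rper_add rper_const rper_mult rper_inverse r r2 i) (use cu in \<open>simp_all add: uu_def\<close>)
  next
   fix l l' k assume "l < n - 1" "l' < n - 1"
   thus "(\<Sum>i<n. cnj (q l i k) * q l' i k) = (if l = l' then 1 else 0)"
    using cn.hh_ip[of v "uu k" "b l" "b l'"] v(1) cu[of k] unit[of k] bb[of l l'] by (simp add: q_def uu_def)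
  next
   fix l k assume l: "l < n - 1"
   have "?ip (cn.hh v (uu k) (b l)) (cn.hh v (uu k) v) = ?ip (b l) v"
    using cn.hh_ip[of v "uu k" "b l" v] v(1) cu[of k] unit[of k] by (simp add: uu_def)
   thus "(\<Sum>i<n. cnj (q l i k) * u i k) = 0"
    unfolding hx[OF cu] bv[OF l] by (simp add: q_def uu_def)
  qed
 qed
qed

text \<open>Induction on the number of vectors split off. The next one, \<open>b t\<close>, lies in
  the span of the remaining frame \<open>f\<close>; its coefficients form the unit column for
  \<open>unitary_completion\<close>, whose columns \<open>q\<close> combine \<open>f\<close> into a
  frame with one member less.\<close>

lemma frame_complement:
 fixes N t :: nat and e b :: "nat \<Rightarrow> real ^ 'd \<Rightarrow> ('d, 'v) wavefun"
 assumes d: "CARD('d) \<le> 3"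
  and e: "\<And>i. i < N \<Longrightarrow> gsec (e i)" "\<And>k. ons {..<N} (\<lambda>i. e i k)"
  and b: "\<And>l. l < t \<Longrightarrow> gsec (b l)" "\<And>k. ons {..<t} (\<lambda>l. b l k)"
  and be: "\<And>l k. l < t \<Longrightarrow> nm (res {..<N} (\<lambda>i. e i k) (b l k)) = 0"
 shows "\<exists>f. (\<forall>i<N - t. gsec (f i)) \<and> (\<forall>k. ons {..<N - t} (\<lambda>i. f i k)) \<and>
   (\<forall>i<N - t. \<forall>k. nm (res {..<N} (\<lambda>i. e i k) (f i k)) = 0) \<and>
   (\<forall>i<N - t. \<forall>l<t. \<forall>k. inn (f i k) (b l k) = 0)"
 using b be
proof (induction t)
 case 0
 thus ?case using e res_null_basis[OF e(2)] by (intro exI[of _ e]) auto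
next
 case (Suc t)
 have bo: "ons {..<t} (\<lambda>l. b l k)" for k using Suc.prems(2)[of k] by (auto simp: ons_def)
 obtain f where f: "\<And>i. i < N - t \<Longrightarrow> gsec (f i)" "\<And>k. ons {..<N - t} (\<lambda>i. f i k)"
   "\<And>i k. i < N - t \<Longrightarrow> nm (res {..<N} (\<lambda>i. e i k) (f i k)) = 0"
   "\<And>i l k. i < N - t \<Longrightarrow> l < t \<Longrightarrow> inn (f i k) (b l k) = 0"
  using Suc.IH[OF _ bo] Suc.prems(1,3) by (metis less_Suc_eq)
 have bL: "b l k \<in> LV m" if "l < Suc t" for l k by (rule gsec_LV[OF Suc.prems(1)[OF that]])
 have fL: "f i k \<in> LV m" if "i < N - t" for i k by (rule gsec_LV[OF f(1)[OF that]])
 have fb: "inn (b l k) (f i k) = 0" if "i < N - t" "l < t" for i l k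
  using f(4)[OF that] ip_cnj[OF fL[OF that(1)] bL[of l]] that by simp
 define u where "u i k = inn (f i k) (b t k)" for i k
 have urp: "rper (u i)" if "i < N - t" for i
  unfolding u_def[abs_def] by (rule gsec_inner[OF f(1)[OF that] Suc.prems(1)]) simp
 have tN: "t \<le> N"
  using ons_card_le(1)[OF e(2) bo] Suc.prems(3) by (metis card_lessThan less_SucI lessThan_iff)
 have unit: "(\<Sum>i<N - t. cnj (u i k) * u i k) = 1" for k
 proof -
  \<comment> \<open>The vectors already split off and the remaining frame are orthonormal and of the
    right number, so they span the same space as \<open>e\<close>. Parseval for \<open>b t\<close>
    then leaves its coefficients along \<open>f\<close>.\<close>
  define g where "g i = (if i < t then b i k else f (i - t) k)" for i
  have go: "ons {..<N} g" unfolding ons_def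
  proof (intro conjI ballI)
   fix i j assume ij: "i \<in> {..<N}" "j \<in> {..<N}"
   show "g i \<in> LV m" using ij tN bL fL by (simp add: g_def)
   have "inn (b i' k) (b j' k) = (if i' = j' then 1 else 0)" if "i' < t" "j' < t" for i' j'
    using bo[of k] that by (simp add: ons_def)
   moreover have "inn (f i' k) (f j' k) = (if i' = j' then 1 else 0)" if "i' < N - t" "j' < N - t" for i' j'
    using f(2)[of k] that by (simp add: ons_def)
   ultimately show "inn (g i) (g j) = (if i = j then 1 else 0)"
    using ij tN f(4) fb by (auto simp: g_def)
  qed simp
  have ge: "nm (res {..<N} (\<lambda>i. e i k) (g i)) = 0" if "i \<in> {..<N}" for i
   using that tN f(3) Suc.prems(3) by (simp add: g_def)
  have eg: "nm (res {..<N} g (e i k)) = 0" if "i \<in> {..<N}" for i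
   by (rule ons_card_le(2)[OF e(2) go ge _ that]) simp_all
  have "nm (res {..<N} g (b t k)) = 0"
   by (rule res_null_trans[OF e(2)[of k] go eg bL Suc.prems(3)]) simp_all
  hence "(nm (b t k))\<^sup>2 = (\<Sum>i<N. (cmod (inn (g i) (b t k)))\<^sup>2)"
   using nrm_res[OF go bL, of t k] by simp
  moreover have "nm (b t k) = 1" using nrm_ons[OF Suc.prems(2)[of k], of t] by simp
  moreover have "(\<Sum>i<N. (cmod (inn (g i) (b t k)))\<^sup>2) = (\<Sum>i<N - t. (cmod (u i k))\<^sup>2)"
  proof -
   have "(\<Sum>i<N. (cmod (inn (g i) (b t k)))\<^sup>2) = (\<Sum>i\<in>{t..<N}. (cmod (inn (g i) (b t k)))\<^sup>2)"
   proof (rule sum.mono_neutral_right)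
    have "inn (b i k) (b t k) = 0" if "i < t" for i
     using Suc.prems(2)[of k] that by (simp add: ons_def)
    thus "\<forall>i\<in>{..<N} - {t..<N}. (cmod (inn (g i) (b t k)))\<^sup>2 = 0" by (auto simp: g_def)
   qed auto
   also have "\<dots> = (\<Sum>i<N - t. (cmod (u i k))\<^sup>2)"
    by (rule sum.reindex_bij_witness[of _ "\<lambda>i. i + t" "\<lambda>i. i - t"]) (auto simp: g_def u_def)
   finally show ?thesis .
  qed
  ultimately have "complex_of_real (\<Sum>i<N - t. (cmod (u i k))\<^sup>2) = 1" by simp
  thus ?thesis by (simp add: mult_cnj_cmod)
 qed
 obtain q where q: "\<And>l i. l < N - t - 1 \<Longrightarrow> i < N - t \<Longrightarrow> rper (q l i)"
  "\<And>l l' k. l < N - t - 1 \<Longrightarrow> l' < N - t - 1 \<Longrightarrow> (\<Sum>i<N - t. cnj (q l i k) * q l' i k) = (if l = l' then 1 else 0)"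
  "\<And>l k. l < N - t - 1 \<Longrightarrow> (\<Sum>i<N - t. cnj (q l i k) * u i k) = 0"
  using unitary_completion[OF d urp unit] by blast
 define f' where "f' l k = (\<Sum>i<N - t. scl (q l i k) (f i k))" for l k
 have 1: "gsec (f' l)" if "l < N - Suc t" for l
  unfolding f'_def[abs_def] by (rule gsec_sum) (use that q(1) f(1) in auto)
 have 2: "ons {..<N - Suc t} (\<lambda>l. f' l k)" for k
  unfolding ons_def
 proof (intro conjI ballI)
  fix l l' assume l: "l \<in> {..<N - Suc t}" "l' \<in> {..<N - Suc t}"
  show "f' l k \<in> LV m" using gsec_LV[OF 1] l by simp
  show "inn (f' l k) (f' l' k) = (if l = l' then 1 else 0)"
   unfolding f'_def ip_ons_sums[OF f(2)] using q(2)[of l l' k] l by simp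
 qed simp
 have 3: "nm (res {..<N} (\<lambda>i. e i k) (f' l k)) = 0" for l k
  unfolding f'_def by (rule res_null_sum[OF e(2)]) (use fL f(3) in auto)
 have 4: "inn (f' l k) (b j k) = 0" if l: "l < N - Suc t" and j: "j < Suc t" for l j k
 proof -
  have "inn (f' l k) (b j k) = (\<Sum>i<N - t. cnj (q l i k) * inn (f i k) (b j k))"
   unfolding f'_def by (subst ip_sum_left[OF bL[OF j]]) (simp_all add: fL LV_scl ip_smul_left bL[OF j])
  also have "\<dots> = 0"
  proof (cases "j = t")
   case True
   thus ?thesis using q(3)[of l k] l by (simp add: u_def)
  next
   case False
   thus ?thesis using f(4) j by (intro sum.neutral) simp
  qed
  finally show ?thesis .
 qed
 show ?case using 1 2 3 4 by (intro exI[of _ f']) blast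
qed

end

section \<open>Fibres and orthogonal splittings\<close>

context mcr
begin

lemma onb_mem: "onb k J \<psi> V \<Longrightarrow> f \<in> V \<longleftrightarrow> f \<in> Bl k \<and> nm (res J \<psi> f) = 0"
 by (simp add: onb_iff)

lemma onb_basis_mem: "onb k J \<psi> V \<Longrightarrow> j \<in> J \<Longrightarrow> \<psi> j \<in> V"
 using onb_mem[of k J \<psi> V "\<psi> j"] onb_bloch[of k J \<psi> V j] res_null_basis[OF onb_ons, of k J \<psi> V j] by blast

lemma onb_sum_mem:
 assumes "onb k J \<psi> V" shows "(\<Sum>j\<in>J. scl (c j) (\<psi> j)) \<in> V"
 unfolding onb_mem[OF assms]
 by (intro conjI bloch_sum bloch_scl res_null_sum res_null_basis onb_ons[OF assms] onb_bloch[OF assms]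
   bloch_LV[of _ k])

lemma onb_aeq_expand:
 assumes "onb k J \<psi> V" "f \<in> V"
 shows "f \<simeq> (\<Sum>j\<in>J. scl (inn (\<psi> j) f) (\<psi> j))"
proof -
 have "f \<in> Bl k" "nm (res J \<psi> f) = 0" using onb_mem[OF assms(1)] assms(2) by blast+
 moreover have "(\<Sum>j\<in>J. scl (inn (\<psi> j) f) (\<psi> j)) \<in> Bl k"
  using onb_bloch[OF assms(1)] by (intro bloch_sum bloch_scl)
 ultimately show ?thesis using aeq_iff by (simp add: res_def)
qed

lemma band_onb:
 assumes "band C m N E" obtains \<psi> where "onb k {..<N} \<psi> (E k)"
 using assms unfolding band_def by blast

lemma band_bloch: "band C m N E \<Longrightarrow> f \<in> E k \<Longrightarrow> f \<in> Bl k"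
 by (metis band_onb onb_mem)

lemma band_aeq:
 assumes E: "band C m N E" and f: "f \<in> E k" and g: "g \<in> Bl k" and fg: "f \<simeq> g"
 shows "g \<in> E k"
proof -
 obtain \<psi> where o: "onb k {..<N} \<psi> (E k)" using band_onb[OF E] .
 have fb: "f \<in> Bl k" "nm (res {..<N} \<psi> f) = 0" using onb_mem[OF o] f by blast+
 have "nm (g - f) = 0" using aeq_iff[OF g fb(1)] aeq_sym[OF fg] by blast
 thus ?thesis
  using res_null_cong[OF onb_ons[OF o] bloch_LV[OF fb(1)] fb(2) bloch_LV[OF g]] onb_mem[OF o] g by blast
qed

lemma band_scl: assumes E: "band C m N E" and f: "f \<in> E k" shows "scl c f \<in> E k"
proof -
 obtain \<psi> where o: "onb k {..<N} \<psi> (E k)" using band_onb[OF E] .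
 have "f \<in> Bl k" "nm (res {..<N} \<psi> f) = 0" using onb_mem[OF o] f by blast+
 thus ?thesis
  using res_null_sum[OF onb_ons[OF o], of "{()}" "\<lambda>_. f" "\<lambda>_. c"] bloch_LV unfolding onb_mem[OF o] by (auto simp: bloch_scl)
qed

lemma band_zero: assumes E: "band C m N E" shows "0 \<in> E k"
proof -
 obtain \<psi> where o: "onb k {..<N} \<psi> (E k)" using band_onb[OF E] .
 show ?thesis using onb_sum_mem[OF o, of "\<lambda>_. 0"] by simp
qed

lemma band_symm:
 assumes "band C m N E" "p \<in> P" shows "gh p ` E k = E (spr p *v k)"
proof -
 have "(p, 0) \<in> carrier (SG)" using assms(2) by (simp add: space_group_def)
 hence "ghat C (p, 0) ` E k = E (trs C (fst (p, 0 :: real ^ 'd)) *\<^sub>R (rot C (fst (p, 0 :: real ^ 'd)) *v k))"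
  using assms(1) unfolding band_def by blast
 thus ?thesis by (simp add: ghat_0 assms(2) spr_mult_vec image_def)
qed

lemma band_gh: "band C m N E \<Longrightarrow> p \<in> P \<Longrightarrow> f \<in> E k \<Longrightarrow> gh p f \<in> E (spr p *v k)"
 using band_symm by blast

lemma band_RL: "band C m N E \<Longrightarrow> K \<in> RL C \<Longrightarrow> E (k + K) = E k"
 unfolding band_def by blast

lemma onb_card:
 assumes "onb k J \<psi> V" "onb k I \<phi> V" shows "card I = card J"
 using ons_card_le(1)[OF onb_ons[OF assms(1)] onb_ons[OF assms(2)]] ons_card_le(1)[OF onb_ons[OF assms(2)] onb_ons[OF assms(1)]]
  onb_basis_mem onb_mem assms by (metis le_antisym)

text \<open>The equality case of \<open>ons_card_le\<close>: orthonormal vectors of the right number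
  exhaust the fibre.\<close>

lemma onb_of_ons:
 assumes V: "onb k J \<psi> V" and e: "ons I e" "\<And>i. i \<in> I \<Longrightarrow> e i \<in> V" and c: "card I = card J"
 shows "onb k I e V"
proof -
 have b: "e i \<in> Bl k" if "i \<in> I" for i using e(2)[OF that] onb_mem[OF V] by blast
 have er: "nm (res J \<psi> (e i)) = 0" if "i \<in> I" for i using e(2)[OF that] onb_mem[OF V] by blast
 have \<psi>r: "nm (res I e (\<psi> j)) = 0" if "j \<in> J" for j
  by (rule ons_card_le(2)[OF onb_ons[OF V] e(1) er c that])
 have "V = {f \<in> Bl k. nm (res I e f) = 0}"
 proof (rule Set.set_eqI)
  fix f
  show "f \<in> V \<longleftrightarrow> f \<in> {f \<in> Bl k. nm (res I e f) = 0}"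
   using res_null_trans[OF onb_ons[OF V] e(1) \<psi>r, of f] res_null_trans[OF e(1) onb_ons[OF V] er, of f]
    bloch_LV[of f k] unfolding onb_mem[OF V] by blast
 qed
 with e(1) b show ?thesis unfolding onb_iff by blast
qed

lemma splits_two:
 assumes "splits_into C m E [S, T]"
 shows "f \<in> S k \<Longrightarrow> g \<in> T k \<Longrightarrow> inn f g = 0"
  and "f \<in> E k \<longleftrightarrow> f \<in> Bl k \<and> (\<exists>g\<in>S k. \<exists>h\<in>T k. f \<simeq> g + h)"
proof -
 have s: "(\<Sum>j<2. h j) = h 0 + h (1::nat)" for h :: "nat \<Rightarrow> ('d, 'v) wavefun"
  by (simp add: numeral_2_eq_2 sum.lessThan_Suc)
 have a: "\<forall>i<2. \<forall>j<2. i \<noteq> j \<longrightarrow> (\<forall>f\<in>([S, T] ! i) k. \<forall>g\<in>([S, T] ! j) k. inn f g = 0)"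
  and b: "E k = {f \<in> Bl k. \<exists>h. (\<forall>j<2. h j \<in> ([S, T] ! j) k) \<and> f \<simeq> (\<Sum>j<2. h j)}"
  using assms unfolding splits_into_def by (simp_all add: numeral_2_eq_2)
 show "f \<in> S k \<Longrightarrow> g \<in> T k \<Longrightarrow> inn f g = 0" using a[rule_format, of 0 1] by simp
 have "(\<exists>h. (\<forall>j<2. h j \<in> ([S, T] ! j) k) \<and> f \<simeq> (\<Sum>j<2. h j)) \<longleftrightarrow> (\<exists>g\<in>S k. \<exists>h\<in>T k. f \<simeq> g + h)"
 proof
  assume "\<exists>h. (\<forall>j<2. h j \<in> ([S, T] ! j) k) \<and> f \<simeq> (\<Sum>j<2. h j)"
  then obtain h where h: "\<And>j. j < 2 \<Longrightarrow> h j \<in> ([S, T] ! j) k" "f \<simeq> (\<Sum>j<2. h j)" by blast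
  have "h 0 \<in> S k" "h 1 \<in> T k" using h(1)[of 0] h(1)[of 1] by simp_all
  thus "\<exists>g\<in>S k. \<exists>h\<in>T k. f \<simeq> g + h" using h(2) unfolding s by blast
 next
  assume "\<exists>g\<in>S k. \<exists>h\<in>T k. f \<simeq> g + h"
  then obtain g h where gh: "g \<in> S k" "h \<in> T k" "f \<simeq> g + h" by blast
  define x where "x j = (if j = 0 then g else h)" for j :: nat
  have "x j \<in> ([S, T] ! j) k" if "j < 2" for j
   using that gh(1,2) by (cases j) (auto simp: x_def less_2_cases_iff)
  moreover have "f \<simeq> (\<Sum>j<2. x j)" unfolding s using gh(3) by (simp add: x_def)
  ultimately show "\<exists>h. (\<forall>j<2. h j \<in> ([S, T] ! j) k) \<and> f \<simeq> (\<Sum>j<2. h j)" by blast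
 qed
 thus "f \<in> E k \<longleftrightarrow> f \<in> Bl k \<and> (\<exists>g\<in>S k. \<exists>h\<in>T k. f \<simeq> g + h)" unfolding b by simp
qed

lemma splits_sub:
 assumes sp: "splits_into C m E [S, T]" and S: "band C m M S" and T: "band C m N T"
 shows "f \<in> S k \<Longrightarrow> f \<in> E k" and "f \<in> T k \<Longrightarrow> f \<in> E k"
proof -
 show "f \<in> S k \<Longrightarrow> f \<in> E k"
  unfolding splits_two(2)[OF sp] using band_zero[OF T, of k] band_bloch[OF S]
  by (intro conjI bexI[of _ f] bexI[of _ 0]) auto
 show "f \<in> T k \<Longrightarrow> f \<in> E k"
  unfolding splits_two(2)[OF sp] using band_zero[OF S, of k] band_bloch[OF T]
  by (intro conjI bexI[of _ 0] bexI[of _ f]) auto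
qed

lemma ons_union:
 fixes M N :: nat
 assumes e: "ons {..<M} e" and f: "ons {..<N} f" and ef: "\<And>i j. i < M \<Longrightarrow> j < N \<Longrightarrow> inn (e i) (f j) = 0"
 shows "ons {..<M + N} (\<lambda>i. if i < M then e i else f (i - M))"
 unfolding ons_def
proof (intro conjI ballI)
 fix i j assume ij: "i \<in> {..<M + N}" "j \<in> {..<M + N}"
 have V: "e i' \<in> LV m" "f j' \<in> LV m" if "i' < M" "j' < N" for i' j' using e f that by (auto simp: ons_def)
 have fe: "inn (f j') (e i') = 0" if "i' < M" "j' < N" for i' j'
  using ef[OF that] ip_cnj[OF V[OF that]] by simp
 show "(if i < M then e i else f (i - M)) \<in> LV m" using ij e f by (auto simp: ons_def)
 show "inn (if i < M then e i else f (i - M)) (if j < M then e j else f (j - M)) = (if i = j then 1 else 0)"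
  using ij e f ef fe by (auto simp: ons_def)
qed simp

text \<open>Bases of the two parts, put together, are an orthonormal system in the fibre of
  \<open>E\<close> at 0 that also spans it; one fibre suffices to compare ranks.\<close>

lemma splits_rank:
 assumes sp: "splits_into C m E [S, T]" and E: "band C m N E" and S: "band C m N1 S" and T: "band C m N2 T"
 shows "N = N1 + N2"
proof -
 obtain \<psi> where o: "onb 0 {..<N} \<psi> (E 0)" using band_onb[OF E] .
 obtain e where e: "onb 0 {..<N1} e (S 0)" using band_onb[OF S] .
 obtain f where f: "onb 0 {..<N2} f (T 0)" using band_onb[OF T] .
 define g where "g i = (if i < N1 then e i else f (i - N1))" for i
 have go: "ons {..<N1 + N2} g" unfolding g_def[abs_def]
  by (rule ons_union[OF onb_ons[OF e] onb_ons[OF f]])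
    (use splits_two(1)[OF sp onb_basis_mem[OF e] onb_basis_mem[OF f]] in simp)
 have gE: "nm (res {..<N} \<psi> (g i)) = 0" if "i \<in> {..<N1 + N2}" for i
  using splits_sub(1)[OF sp S T onb_basis_mem[OF e, of i]] splits_sub(2)[OF sp S T onb_basis_mem[OF f, of "i - N1"]]
   that onb_mem[OF o] by (cases "i < N1") (simp_all add: g_def)
 have 1: "N1 + N2 \<le> N" using ons_card_le(1)[OF onb_ons[OF o] go gE] by simp
 have sub: "nm (res {..<N1 + N2} g x) = 0" if "x \<in> S 0 \<or> x \<in> T 0" for x
 proof -
  have "x \<in> LV m" using that band_bloch[OF S] band_bloch[OF T] bloch_LV by blast
  moreover have "nm (res {..<N1 + N2} g (e i)) = 0" if "i \<in> {..<N1}" for i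
   using res_null_basis[OF go, of i] that by (simp add: g_def)
  moreover have "nm (res {..<N1 + N2} g (f i)) = 0" if "i \<in> {..<N2}" for i
   using res_null_basis[OF go, of "N1 + i"] that by (simp add: g_def)
  ultimately show ?thesis using res_null_trans[OF onb_ons[OF e] go] res_null_trans[OF onb_ons[OF f] go] that
    onb_mem[OF e] onb_mem[OF f] by blast
 qed
 have "nm (res {..<N1 + N2} g (\<psi> i)) = 0" if i: "i \<in> {..<N}" for i
 proof -
  have \<psi>E: "\<psi> i \<in> E 0" by (rule onb_basis_mem[OF o i])
  then obtain x y where xy: "x \<in> S 0" "y \<in> T 0" "\<psi> i \<simeq> x + y" using splits_two(2)[OF sp] by blast
  have xb: "x \<in> Bl 0" "y \<in> Bl 0" using xy band_bloch[OF S] band_bloch[OF T] by blast+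
  have "nm (\<psi> i - (x + y)) = 0"
   using aeq_iff[OF band_bloch[OF E \<psi>E] bloch_add[OF xb]] xy(3) by blast
  thus ?thesis
   using res_null_cong[OF go _ _ _ , of "x + y" "\<psi> i"] res_null_add[OF go, of x y] sub xy xb bloch_LV
    band_bloch[OF E \<psi>E] by (metis bloch_add)
 qed
 hence "N \<le> N1 + N2" using ons_card_le(1)[OF go onb_ons[OF o]] by simp
 with 1 show ?thesis by simp
qed

text \<open>Frames of band representations are indexed by pairs; the rank of the band fixes the
  number of members, so initial segments of the naturals can be used instead.\<close>

lemma apf_reindex:
 assumes "apf E J \<psi>" and N: "band C m N E"
 obtains e where "\<And>i. i < N \<Longrightarrow> gsec (e i)" "\<And>k. onb k {..<N} (\<lambda>i. e i k) (E k)"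
proof -
 have o: "\<And>k. onb k J (\<lambda>j. \<psi> j k) (E k)" and g: "\<And>j. j \<in> J \<Longrightarrow> gsec (\<psi> j)"
  using assms(1) unfolding apf_iff by blast+
 obtain \<phi> where "onb 0 {..<N} \<phi> (E 0)" using band_onb[OF N] .
 from onb_card[OF this o] have c: "card J = N" by simp
 have "finite J" using onb_ons[OF o] by (simp add: ons_def)
 then obtain h where h: "bij_betw h {..<N} J" using ex_bij_betw_nat_finite[of J] c by (auto simp: atLeast0LessThan)
 show ?thesis
 proof (rule that[of "\<lambda>i. \<psi> (h i)"])
  show "gsec (\<psi> (h i))" if "i < N" for i using g bij_betwE[OF h] that by blast
  show "onb k {..<N} (\<lambda>i. \<psi> (h i) k) (E k)" for k
  proof (rule onb_of_ons[OF o ons_reindex[OF onb_ons[OF o] h]])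
   show "\<psi> (h i) k \<in> E k" if "i \<in> {..<N}" for i
    using onb_basis_mem[OF o] bij_betwE[OF h] that by blast
  qed (simp add: c)
 qed
qed

section \<open>The complement of a band with an analytic frame\<close>

lemma complement_localizable:
 assumes d: "CARD('d) \<le> 3" and sp: "splits_into C m E [S, T]"
  and E: "band C m N E" and S: "band C m N1 S" and T: "band C m N2 T"
  and Ef: "apf E I \<psi>" and Sf: "apf S J \<phi>"
 shows "localizable C m T"
proof -
 obtain e where e: "\<And>i. i < N \<Longrightarrow> gsec (e i)" "\<And>k. onb k {..<N} (\<lambda>i. e i k) (E k)"
  using apf_reindex[OF Ef E] by blast
 obtain b where b: "\<And>i. i < N1 \<Longrightarrow> gsec (b i)" "\<And>k. onb k {..<N1} (\<lambda>i. b i k) (S k)"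
  using apf_reindex[OF Sf S] by blast
 have be: "nm (res {..<N} (\<lambda>i. e i k) (b l k)) = 0" if "l < N1" for l k
  using splits_sub(1)[OF sp S T onb_basis_mem[OF b(2)[of k], of l]] that onb_mem[OF e(2)[of k]] by simp
 obtain f where f: "\<And>i. i < N - N1 \<Longrightarrow> gsec (f i)" "\<And>k. ons {..<N - N1} (\<lambda>i. f i k)"
   "\<And>i k. i < N - N1 \<Longrightarrow> nm (res {..<N} (\<lambda>i. e i k) (f i k)) = 0"
   "\<And>i l k. i < N - N1 \<Longrightarrow> l < N1 \<Longrightarrow> inn (f i k) (b l k) = 0"
  using frame_complement[OF d e(1) onb_ons[OF e(2)] b(1) onb_ons[OF b(2)] be] by blast
 have N2: "N - N1 = N2" using splits_rank[OF sp E S T] by simp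
 \<comment> \<open>\<open>f i k\<close> splits into \<open>g\<close> in \<open>S\<close> and
   \<open>h\<close> in \<open>T\<close>. Orthogonality to the frame \<open>b\<close> of
   \<open>S\<close> annihilates all coefficients of \<open>g\<close>, so \<open>f i k\<close> agrees
   with \<open>h\<close> almost everywhere.\<close>
 have fT: "f i k \<in> T k" if i: "i < N2" for i k
 proof -
  have fb: "f i k \<in> Bl k" using gsec_bloch[OF f(1)] i N2 by simp
  hence "f i k \<in> E k" using onb_mem[OF e(2)] f(3) i N2 by simp
  then obtain g h where gh: "g \<in> S k" "h \<in> T k" "f i k \<simeq> g + h" using splits_two(2)[OF sp] by blast
  have ghb: "g \<in> Bl k" "h \<in> Bl k" using gh band_bloch[OF S] band_bloch[OF T] by blast+
  note L = bloch_LV[OF ghb(1)] bloch_LV[OF ghb(2)] bloch_LV[OF fb]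
  have "inn (b l k) g = 0" if l: "l < N1" for l
  proof -
   have bL: "b l k \<in> LV m" using gsec_LV[OF b(1)[OF l]] .
   have "inn (b l k) (f i k) = inn (b l k) (g + h)"
    by (rule inner_aeq[OF bL L(3) bL add_mem[OF L(1,2)] aeq_refl gh(3)])
   also have "\<dots> = inn (b l k) g + inn (b l k) h" by (rule ip_add[OF bL L(1,2)])
   also have "inn (b l k) h = 0"
    using splits_two(1)[OF sp onb_basis_mem[OF b(2)[of k], of l] gh(2)] l by simp
   finally show ?thesis using f(4)[of i l k] i N2 l ip_cnj[OF L(3) bL] by simp
  qed
  hence "(\<Sum>l<N1. (cmod (inn (b l k) g))\<^sup>2) = 0" by simp
  moreover have "nm (res {..<N1} (\<lambda>l. b l k) g) = 0" using onb_mem[OF b(2)] gh(1) by blast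
  ultimately have "nm g = 0" using nrm_res[OF onb_ons[OF b(2)] L(1), of k] by simp
  hence "g \<simeq> 0" by (rule norm_zero_aeq[OF ghb(1)])
  hence "h \<simeq> f i k" using aeq_trans[OF gh(3) aeq_add[OF _ aeq_refl]] aeq_sym by fastforce
  thus ?thesis using band_aeq[OF T gh(2) fb] by blast
 qed
 have "onb k {..<N2} (\<lambda>i. f i k) (T k)" for k
 proof -
  obtain \<xi> where "onb k {..<N2} \<xi> (T k)" using band_onb[OF T] .
  thus ?thesis by (rule onb_of_ons) (use f(2)[of k] fT N2 in auto)
 qed
 hence "apf T {..<N2} f" unfolding apf_iff using f(1) N2 by simp
 thus ?thesis unfolding localizable_def using T by blast
qed

end

section \<open>Trigonometric polynomials on the Brillouin torus\<close>

context mcr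
begin

inductive trig :: "(real ^ 'd \<Rightarrow> complex) \<Rightarrow> bool" where
 trig_cis: "R \<in> BL C \<Longrightarrow> trig (\<lambda>k. c * cis (k \<bullet> R))"
| trig_add: "trig f \<Longrightarrow> trig g \<Longrightarrow> trig (\<lambda>k. f k + g k)"

lemma cis_RL: "K \<in> RL C \<Longrightarrow> R \<in> BL C \<Longrightarrow> cis (K \<bullet> R) = 1"
proof -
 assume "K \<in> RL C" "R \<in> BL C"
 then obtain n :: int where "K \<bullet> R = 2 * pi * of_int n" by (auto simp: RL_def)
 moreover have "cis (2 * pi * of_int n) = 1" by (rule cis_multiple_2pi) simp
 ultimately show ?thesis by simp
qed

lemma rper_cis: "R \<in> BL C \<Longrightarrow> rper (\<lambda>k. cis (k \<bullet> R))"
 unfolding rper_def by (auto intro!: ran_at_cis ran_at_inner simp: inner_add_left cis_mult[symmetric] cis_RL)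

lemma trig_rper: "trig t \<Longrightarrow> rper t"
 by (induction rule: trig.induct) (auto intro: rper_add rper_mult rper_cis)

lemma trig_const: "trig (\<lambda>_. c)"
 using trig_cis[OF BL_zero, of c] by simp

lemma trig_mult_cis: "trig t \<Longrightarrow> R \<in> BL C \<Longrightarrow> trig (\<lambda>k. c * cis (k \<bullet> R) * t k)"
proof (induction rule: trig.induct)
 case (trig_cis R' d)
 have "trig (\<lambda>k. (c * d) * cis (k \<bullet> (R + R')))" by (rule trig.trig_cis) (intro BL_add trig_cis)
 thus ?case by (simp add: inner_add_right cis_mult[symmetric] mult_ac)
next
 case (trig_add f g)
 thus ?case using trig.trig_add by (simp add: distrib_left)
qed

lemma trig_mult: "trig s \<Longrightarrow> trig t \<Longrightarrow> trig (\<lambda>k. s k * t k)"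
proof (induction rule: trig.induct)
 case (trig_cis R c)
 thus ?case using trig_mult_cis by simp
next
 case (trig_add f g)
 thus ?case using trig.trig_add by (simp add: distrib_right)
qed

lemma trig_sum: "finite I \<Longrightarrow> (\<And>i. i \<in> I \<Longrightarrow> trig (f i)) \<Longrightarrow> trig (\<lambda>k. \<Sum>i\<in>I. f i k)"
 by (induction I rule: finite_induct) (auto intro: trig_const trig_add)

text \<open>Embeds the Brillouin torus as a compact subset of \<open>complex ^ 'd\<close>, where the
  Stone-Weierstrass theorem for polynomial functions applies.\<close>

definition tz :: "real ^ 'd \<Rightarrow> complex ^ 'd" where "tz k = (\<chi> j. cis (k \<bullet> prim C j))"

lemma tz_continuous: "continuous_on S tz"
 unfolding tz_def[abs_def] by (intro continuous_intros)

lemma tz_eq_iff: "tz k = tz k' \<longleftrightarrow> k - k' \<in> RL C"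
proof
 assume eq: "tz k = tz k'"
 have "(k - k') \<bullet> ((1 / (2 * pi)) *\<^sub>R prim C j) \<in> \<int>" for j
 proof -
  have "cis (k \<bullet> prim C j) = cis (k' \<bullet> prim C j)" using eq by (simp add: tz_def vec_eq_iff)
  hence "cis ((k - k') \<bullet> prim C j) = 1"
   by (simp add: inner_diff_left cis_divide[symmetric])
  hence "cos ((k - k') \<bullet> prim C j) = 1" by (metis cis.sel(1) one_complex.sel(1))
  then obtain n :: int where "(k - k') \<bullet> prim C j = of_int n * 2 * pi"
   using cos_one_2pi_int by blast
  thus ?thesis by simp
 qed
 thus "k - k' \<in> RL C" unfolding RL_eq bz.L_def by blast
next
 assume K: "k - k' \<in> RL C"
 have "cis (k \<bullet> prim C j) = cis (k' \<bullet> prim C j)" for j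
 proof -
  have "cis ((k - k') \<bullet> prim C j) = 1"
   by (rule cis_RL[OF K]) (use cell.L_basis in \<open>simp add: BL_eq\<close>)
  thus ?thesis by (simp add: inner_diff_left cis_divide[symmetric])
 qed
 thus "tz k = tz k'" by (simp add: tz_def)
qed

lemma tz_cell: "range tz = tz ` closure bz.D"
proof (intro equalityI subsetI)
 fix z assume "z \<in> range tz"
 then obtain k where "z = tz k" by blast
 moreover have "tz k = tz (k - bz.fl k)" unfolding tz_eq_iff using bz.fl_L by (simp add: RL_eq)
 moreover have "k - bz.fl k \<in> closure bz.D" using bz.fl_D closure_subset by blast
 ultimately show "z \<in> tz ` closure bz.D" by blast
qed auto

text \<open>The real coordinates on the embedded torus are cosines and sines of
  \<open>k \<bullet> prim C j\<close>, hence combinations of the characters of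
  \<open>prim C j\<close> and of its negative; products and sums stay trigonometric.\<close>

lemma trig_real_polynomial:
 assumes "real_polynomial_function h" shows "trig (\<lambda>k. of_real (h (tz k)))"
 using assms
proof (induction rule: real_polynomial_function.induct)
 case (linear h)
 hence lin: "linear h" by (simp add: bounded_linear.linear)
 have expand: "z = (\<Sum>j\<in>UNIV. Re (z $ j) *\<^sub>R axis j 1 + Im (z $ j) *\<^sub>R axis j \<i>)" for z :: "complex ^ 'd"
  by (simp add: vec_eq_iff axis_def if_distrib[of "\<lambda>x. _ *\<^sub>R x"] sum.distrib complex_eq_iff
    if_distrib[of Re] if_distrib[of Im] cong: if_cong)
 have hz: "h z = (\<Sum>j\<in>UNIV. Re (z $ j) * h (axis j 1) + Im (z $ j) * h (axis j \<i>))" for z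
  by (subst (1) expand) (simp add: linear_sum[OF lin] linear_add[OF lin] linear_cmul[OF lin])
 have h: "complex_of_real (h (tz k)) = (\<Sum>j\<in>UNIV. of_real (cos (k \<bullet> prim C j)) * of_real (h (axis j 1))
   + of_real (sin (k \<bullet> prim C j)) * of_real (h (axis j \<i>)))" for k
  by (subst hz) (simp add: tz_def)
 have cs: "complex_of_real (cos (k \<bullet> v)) = 1 / 2 * cis (k \<bullet> v) + 1 / 2 * cis (k \<bullet> (- v))"
  "complex_of_real (sin (k \<bullet> v)) = (- \<i> / 2) * cis (k \<bullet> v) + (\<i> / 2) * cis (k \<bullet> (- v))" for k v :: "real ^ 'd"
  by (simp_all add: complex_eq_iff)
 have pb: "prim C j \<in> BL C" "- prim C j \<in> BL C" for j
  using cell.L_basis cell.L_minus by (simp_all add: BL_eq)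
 have c: "trig (\<lambda>k. of_real (cos (k \<bullet> prim C j)))" for j
  unfolding cs by (rule trig_add[OF trig_cis[OF pb(1)] trig_cis[OF pb(2)]])
 have s: "trig (\<lambda>k. of_real (sin (k \<bullet> prim C j)))" for j
  unfolding cs by (rule trig_add[OF trig_cis[OF pb(1)] trig_cis[OF pb(2)]])
 show ?case unfolding h by (intro trig_sum trig_add trig_mult c s trig_const) simp
next
 case (const c) show ?case by (rule trig_const)
next
 case (add f g) thus ?case using trig_add by simp
next
 case (mult f g) thus ?case using trig_mult by simp
qed

lemma trig_approx:
 fixes f :: "real ^ 'd \<Rightarrow> complex"
 assumes f: "continuous_on UNIV f" and per: "\<And>k K. K \<in> RL C \<Longrightarrow> f (k + K) = f k" and e: "0 < e"
 obtains t where "trig t" "\<And>k. cmod (f k - t k) < e"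
proof -
 let ?K = "closure bz.D"
 have K: "compact ?K" using bz.D_bounded by simp
 have T: "compact (range tz)" unfolding tz_cell by (rule compact_continuous_image[OF tz_continuous K])
 \<comment> \<open>\<open>f\<close> factors through the torus. The factor is continuous because
   \<open>tz\<close>, restricted to the compact closure of the cell, is a closed map onto its
   range.\<close>
 define F where "F z = f (SOME k. tz k = z)" for z
 have F: "F (tz k) = f k" for k
 proof -
  have "tz (SOME k'. tz k' = tz k) = tz k" by (rule someI[of _ k]) simp
  hence "(SOME k'. tz k' = tz k) - k \<in> RL C" by (simp add: tz_eq_iff)
  from per[OF this, of k] show ?thesis by (simp add: F_def)
 qed
 have "continuous_on (range tz) F"
  unfolding continuous_on_closed_invariant
 proof (intro allI impI)
  fix B :: "complex set" assume B: "closed B"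
  have "closed (f -` B)" using f B by (simp add: continuous_closed_vimage continuous_on_eq_continuous_at)
  hence "compact (?K \<inter> f -` B)" using K by (rule compact_Int_closed[rotated])
  hence "closed (tz ` (?K \<inter> f -` B))"
   by (intro compact_imp_closed compact_continuous_image[OF tz_continuous])
  moreover have "tz ` (?K \<inter> f -` B) \<inter> range tz = F -` B \<inter> range tz"
  proof (intro equalityI subsetI)
   fix z assume z: "z \<in> F -` B \<inter> range tz"
   then obtain k where k: "z = tz k" "k \<in> ?K" unfolding tz_cell by blast
   thus "z \<in> tz ` (?K \<inter> f -` B) \<inter> range tz" using z F by auto
  next
   fix z assume "z \<in> tz ` (?K \<inter> f -` B) \<inter> range tz"
   then obtain a where "z = tz a" "f a \<in> B" by blast
   thus "z \<in> F -` B \<inter> range tz" using F by simp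
  qed
  ultimately show "\<exists>A. closed A \<and> A \<inter> range tz = F -` B \<inter> range tz" by blast
 qed
 from Stone_Weierstrass_polynomial_function[OF T this e] obtain g where
  g: "polynomial_function g" "\<And>z. z \<in> range tz \<Longrightarrow> norm (F z - g z) < e" by blast
 have "real_polynomial_function (Re \<circ> g)" "real_polynomial_function (Im \<circ> g)"
  using g(1) unfolding polynomial_function_def by (auto intro: bounded_linear_Re bounded_linear_Im)
 hence "trig (\<lambda>k. of_real ((Re \<circ> g) (tz k)) + \<i> * of_real ((Im \<circ> g) (tz k)))"
  by (intro trig_add trig_mult trig_const trig_real_polynomial)
 moreover have "of_real ((Re \<circ> g) (tz k)) + \<i> * of_real ((Im \<circ> g) (tz k)) = g (tz k)" for k
  by (simp add: complex_eq_iff)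
 moreover have "cmod (f k - g (tz k)) < e" for k using g(2)[of "tz k"] F[of k] by simp
 ultimately show ?thesis using that[of "\<lambda>k. g (tz k)"] by simp
qed

subsection \<open>Uniqueness of Fourier coefficients\<close>

lemma infdist_shift:
 fixes A :: "(real ^ 'd) set"
 assumes "(\<lambda>a. a + t) ` A = A" shows "infdist (x + t) A = infdist x A"
proof -
 have "(\<lambda>a. dist (x + t) a) ` A = (\<lambda>a. dist x a) ` A"
 proof -
  have "(\<lambda>a. dist (x + t) a) ` A = (\<lambda>a. dist (x + t) a) ` ((\<lambda>a. a + t) ` A)" by (simp only: assms)
  also have "\<dots> = (\<lambda>a. dist x a) ` A" by (simp add: image_image)
  finally show ?thesis .
 qed
 thus ?thesis unfolding infdist_def by simp
qed

text \<open>The integral against \<open>h\<close> vanishes in turn for trigonometric polynomials,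
  for continuous periodic functions by uniform approximation, for indicators of open sets by
  dominated convergence, and for indicators of Borel sets by a Dynkin argument.\<close>

lemma fourier_unique:
 fixes h :: "real ^ 'd \<Rightarrow> complex"
 assumes h: "set_integrable lborel bz.D h"
  and zero: "\<And>R. R \<in> BL C \<Longrightarrow> (LINT k:bz.D|lborel. cis (- (k \<bullet> R)) * h k) = 0"
 shows "AE k in lborel. k \<in> bz.D \<longrightarrow> h k = 0"
proof -
 let ?b = "\<lambda>i. (1 / (2 * pi)) *\<^sub>R prim C i"
 define H where "H k = indicator bz.D k *\<^sub>R h k" for k
 have Hi: "integrable lborel H" using h by (simp add: set_integrable_def H_def[abs_def])
 have [measurable]: "H \<in> borel_measurable borel" using Hi by simp
 have tH: "integrable lborel (\<lambda>k. f k * H k)" if f: "f \<in> borel_measurable borel" "\<And>k. cmod (f k) \<le> B" for f B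
 proof (rule Bochner_Integration.integrable_bound)
  show "integrable lborel (\<lambda>k. B * norm (H k))" using Hi by simp
  have "0 \<le> B" using f(2)[of 0] norm_ge_zero order_trans by blast
  thus "AE k in lborel. norm (f k * H k) \<le> norm (B * norm (H k))"
   using f(2) by (auto simp: norm_mult abs_mult intro!: mult_right_mono)
 qed (use f(1) in measurable)
 have trig_bd: "\<exists>B. \<forall>k. cmod (t k) \<le> B" if "trig t" for t
  using that
 proof (induction rule: trig.induct)
  case (trig_cis R c) thus ?case by (auto simp: norm_mult)
 next
  case (trig_add f g)
  then obtain A B where "\<forall>k. cmod (f k) \<le> A" "\<forall>k. cmod (g k) \<le> B" by blast
  thus ?case by (intro exI[of _ "A + B"]) (auto intro: norm_triangle_le add_mono)
 qed
 have trig_m: "t \<in> borel_measurable borel" if "trig t" for t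
  by (rule borel_measurable_continuous_onI) (rule rper_continuous[OF trig_rper[OF that]])
 have 1: "(\<integral>k. t k * H k \<partial>lborel) = 0" if "trig t" for t
  using that
 proof (induction rule: trig.induct)
  case (trig_cis R c)
  have "(\<integral>k. c * cis (k \<bullet> R) * H k \<partial>lborel) = c * (\<integral>k. cis (k \<bullet> R) * H k \<partial>lborel)"
   by (simp add: mult.assoc)
  also have "(\<integral>k. cis (k \<bullet> R) * H k \<partial>lborel) = (LINT k:bz.D|lborel. cis (- (k \<bullet> (- R))) * h k)"
   by (simp add: set_lebesgue_integral_def H_def)
  also have "\<dots> = 0" by (rule zero[OF BL_minus[OF trig_cis]])
  finally show ?case by simp
 next
  case (trig_add f g)
  obtain A B where "\<And>k. cmod (f k) \<le> A" "\<And>k. cmod (g k) \<le> B" using trig_bd trig_add by meson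
  hence "integrable lborel (\<lambda>k. f k * H k)" "integrable lborel (\<lambda>k. g k * H k)"
   using tH trig_m trig_add by blast+
  thus ?case using trig_add by (simp add: distrib_right)
 qed
 have 2: "(\<integral>k. f k * H k \<partial>lborel) = 0"
  if f: "continuous_on UNIV f" "\<And>k K. K \<in> RL C \<Longrightarrow> f (k + K) = f k" "\<And>k. cmod (f k) \<le> B" for f B
 proof -
  have fm: "f \<in> borel_measurable borel" by (rule borel_measurable_continuous_onI[OF f(1)])
  define J where "J = (\<integral>k. norm (H k) \<partial>lborel)"
  have J0: "0 \<le> J" by (simp add: J_def)
  have le: "cmod (\<integral>k. f k * H k \<partial>lborel) \<le> e * J" if e: "0 < e" for e
  proof -
   obtain t where t: "trig t" "\<And>k. cmod (f k - t k) < e" using trig_approx[OF f(1,2) e] by blast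
   obtain A where A: "\<And>k. cmod (t k) \<le> A" using trig_bd[OF t(1)] by blast
   have "(\<integral>k. (f k - t k) * H k \<partial>lborel) = (\<integral>k. f k * H k \<partial>lborel)"
    using tH[OF fm f(3)] tH[OF trig_m[OF t(1)] A] 1[OF t(1)] by (simp add: left_diff_distrib)
   moreover have "cmod (\<integral>k. (f k - t k) * H k \<partial>lborel) \<le> (\<integral>k. e * norm (H k) \<partial>lborel)"
   proof (rule order_trans[OF integral_norm_bound integral_mono])
    show "integrable lborel (\<lambda>k. norm ((f k - t k) * H k))"
     using tH[OF fm f(3)] tH[OF trig_m[OF t(1)] A] by (intro integrable_norm) (simp add: left_diff_distrib)
    show "integrable lborel (\<lambda>k. e * norm (H k))" using Hi by simp
    show "norm ((f k - t k) * H k) \<le> e * norm (H k)" for k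
     using less_imp_le[OF t(2)[of k]] by (auto simp: norm_mult intro: mult_right_mono)
   qed
   ultimately show ?thesis using Hi by (simp add: J_def)
  qed
  have "cmod (\<integral>k. f k * H k \<partial>lborel) \<le> 0"
  proof (rule field_le_epsilon)
   fix e :: real assume e: "0 < e"
   have "cmod (\<integral>k. f k * H k \<partial>lborel) \<le> e / (J + 1) * J" by (rule le) (use e J0 in simp)
   also have "\<dots> \<le> e" using e J0 by (simp add: divide_simps)
   finally show "cmod (\<integral>k. f k * H k \<partial>lborel) \<le> 0 + e" by simp
  qed
  thus ?thesis by simp
 qed
 \<comment> \<open>The open cell differs from \<open>bz.D\<close> by a null set. An open set
   \<open>A\<close> can be cut down to \<open>A \<inter> D0\<close> and repeated periodically: the
   result is open, and the integral of \<open>H\<close> over it is the one over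
   \<open>A\<close>.\<close>
 define D0 where "D0 = {v. \<forall>i. 0 < v \<bullet> ?b i \<and> v \<bullet> ?b i < 1}"
 have D0: "open D0"
 proof -
  have "D0 = (\<Inter>i. {v. 0 < v \<bullet> ?b i \<and> v \<bullet> ?b i < 1})"
   by (auto simp: D0_def)
  moreover have "open \<dots>" by (intro open_INT ballI open_Collect_conj open_Collect_less continuous_intros) simp
  ultimately show ?thesis by simp
 qed
 have D0D: "D0 \<subseteq> bz.D" unfolding D0_def bz.D_def by (auto simp: less_imp_le)
 have AE0: "AE v in lborel. v \<in> bz.D \<longrightarrow> v \<in> D0"
 proof -
  have "AE v in lborel. v \<bullet> ?b i \<noteq> 0" for i
  proof -
   have "prim C i \<noteq> 0" using bz.dual[of i i] by auto
   hence "negligible {v. ?b i \<bullet> v = 0}"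
    by (intro negligible_hyperplane) simp
   hence "{v. v \<bullet> ?b i = 0} \<in> null_sets lebesgue"
    by (simp add: negligible_iff_null_sets inner_commute)
   moreover have "{v. v \<bullet> ?b i = 0} \<in> sets borel"
    by measurable
   ultimately have "{v. v \<bullet> ?b i = 0} \<in> null_sets lborel"
    by (simp add: null_sets_def)
   from AE_not_in[OF this] show ?thesis by simp
  qed
  hence "AE v in lborel. \<forall>i. v \<bullet> ?b i \<noteq> 0" by (subst AE_all_countable) blast
  thus ?thesis by eventually_elim (auto simp: D0_def bz.D_def less_le)
 qed
 have 3: "(LINT k:A|lborel. H k) = 0" if A: "open A" for A
 proof -
  define U where "U = (\<Union>K\<in>bz.L. (\<lambda>v. v + K) ` (A \<inter> D0))"
  have U: "open U" unfolding U_def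
  proof (intro open_UN ballI)
   fix K
   have "(\<lambda>v. v + K) ` (A \<inter> D0) = (\<lambda>v. K + v) ` (A \<inter> D0)" by (simp add: add.commute)
   thus "open ((\<lambda>v. v + K) ` (A \<inter> D0))" using A D0 by (simp add: open_translation open_Int)
  qed
  have Ush: "(\<lambda>v. v + K) ` (- U) = - U" if K: "K \<in> bz.L" for K
  proof -
   have sh: "v + K' \<in> U" if "v \<in> U" "K' \<in> bz.L" for v K'
   proof -
    obtain a K1 where "K1 \<in> bz.L" "a \<in> A \<inter> D0" "v = a + K1" using \<open>v \<in> U\<close> by (auto simp: U_def)
    hence "v + K' = a + (K1 + K')" "K1 + K' \<in> bz.L" using bz.L_add \<open>K' \<in> bz.L\<close> by (auto simp: add.assoc)
    thus ?thesis using \<open>a \<in> A \<inter> D0\<close> unfolding U_def by blast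
   qed
   have "v + K \<in> U \<longleftrightarrow> v \<in> U" for v
    using sh[of v K] sh[of "v + K" "- K"] K bz.L_minus[OF K] by auto
   hence iff: "\<And>v. v + K \<in> - U \<longleftrightarrow> v \<in> - U" by simp
   show ?thesis
   proof (intro equalityI subsetI)
    fix x assume "x \<in> - U"
    hence "x - K \<in> - U" using iff[of "x - K"] by simp
    thus "x \<in> (\<lambda>v. v + K) ` (- U)" by (intro image_eqI[of _ _ "x - K"]) auto
   qed (use iff in auto)
  qed
  have UD: "k \<in> U \<longleftrightarrow> k \<in> A \<inter> D0" if k: "k \<in> bz.D" for k
  proof
   assume "k \<in> U"
   then obtain a K where aK: "K \<in> bz.L" "a \<in> A \<inter> D0" "k = a + K" by (auto simp: U_def)
   have "k = a" by (rule bz.D_unique) (use aK k D0D in auto)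
   thus "k \<in> A \<inter> D0" using aK by simp
  next
   assume "k \<in> A \<inter> D0"
   thus "k \<in> U" using bz.L_zero unfolding U_def by (intro UN_I[of 0]) auto
  qed
  show ?thesis
  proof (cases "U = UNIV")
   case True
   have "(\<integral>k. H k \<partial>lborel) = 0" using 2[of "\<lambda>_. 1" 1] by simp
   moreover have "(LINT k:A|lborel. H k) = (\<integral>k. H k \<partial>lborel)"
    unfolding set_lebesgue_integral_def
   proof (rule Bochner_Integration.integral_cong[OF refl])
    fix k show "indicator A k *\<^sub>R H k = H k" using UD[of k] True by (cases "k \<in> bz.D") (auto simp: H_def)
   qed
   ultimately show ?thesis by simp
  next
   case False
   hence ne: "- U \<noteq> {}" by auto
   \<comment> \<open>Continuous periodic functions that increase to the indicator of the periodic
     open set \<open>U\<close>.\<close>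
   define f where "f n k = complex_of_real (min 1 (of_nat n * infdist k (- U)))" for n k
   have fc: "continuous_on UNIV (f n)" for n unfolding f_def[abs_def] by (intro continuous_intros)
   have fp: "f n (k + K) = f n k" if "K \<in> RL C" for n k K
    unfolding f_def using infdist_shift[OF Ush] that by (simp add: RL_eq)
   have fb: "cmod (f n k) \<le> 1" for n k unfolding f_def norm_of_real by (simp add: infdist_nonneg)
   have f0: "(\<integral>k. f n k * H k \<partial>lborel) = 0" for n by (rule 2[OF fc fp fb])
   have flim: "(\<lambda>n. f n k) \<longlonglongrightarrow> of_real (indicator U k)" for k
   proof (cases "k \<in> U")
    case True
    have "k \<notin> - U" using True by simp
    hence pos: "0 < infdist k (- U)"
     using U ne by (metis closed_Compl in_closed_iff_infdist_zero infdist_nonneg less_le)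
    have "eventually (\<lambda>n. f n k = 1) sequentially"
    proof -
     obtain n0 where n0: "1 < of_nat n0 * infdist k (- U)" using reals_Archimedean3[OF pos] by blast
     have "f n k = 1" if "n0 \<le> n" for n
     proof -
      have "of_nat n0 * infdist k (- U) \<le> of_nat n * infdist k (- U)" using that pos by (intro mult_right_mono) auto
      thus ?thesis using n0 by (simp add: f_def min_def)
     qed
     thus ?thesis by (auto simp: eventually_sequentially)
    qed
    thus ?thesis using True by (simp add: tendsto_eventually)
   next
    case False
    hence "infdist k (- U) = 0" by simp
    thus ?thesis using False by (simp add: f_def)
   qed
   have "(\<lambda>n. \<integral>k. f n k * H k \<partial>lborel) \<longlonglongrightarrow> (\<integral>k. of_real (indicator U k) * H k \<partial>lborel)"
   proof (rule integral_dominated_convergence[where w = "\<lambda>k. norm (H k)"])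
    have Um: "U \<in> sets borel" using U by simp
    show "(\<lambda>k. of_real (indicator U k) * H k) \<in> borel_measurable lborel" using Um by measurable
    show "(\<lambda>k. f n k * H k) \<in> borel_measurable lborel" for n
     using borel_measurable_continuous_onI[OF fc[of n]] by measurable
    show "AE k in lborel. (\<lambda>n. f n k * H k) \<longlonglongrightarrow> of_real (indicator U k) * H k"
     by (intro AE_I2 tendsto_mult flim tendsto_const)
    show "AE k in lborel. norm (f n k * H k) \<le> norm (H k)" for n
     using fb[of n] by (auto simp: norm_mult intro!: mult_left_le_one_le)
   qed (use Hi in simp)
   hence z: "(\<integral>k. of_real (indicator U k) * H k \<partial>lborel) = 0"
    unfolding f0 using LIMSEQ_unique tendsto_const by blast
   have "(LINT k:A|lborel. H k) = (\<integral>k. of_real (indicator U k) * H k \<partial>lborel)"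
    unfolding set_lebesgue_integral_def
   proof (rule integral_cong_AE)
    show "AE k in lborel. indicator A k *\<^sub>R H k = of_real (indicator U k) * H k"
     using AE0
    proof eventually_elim
     case (elim k)
     thus ?case using UD[of k] by (cases "k \<in> bz.D") (auto simp: H_def indicator_def)
    qed
    have "A \<in> sets borel" "U \<in> sets borel" using A U by auto
    thus "(\<lambda>k. indicator A k *\<^sub>R H k) \<in> borel_measurable lborel"
     "(\<lambda>k. of_real (indicator U k) * H k) \<in> borel_measurable lborel" by measurable
   qed
   thus ?thesis using z by simp
  qed
 qed
 have Hset: "set_integrable lborel B H" if "B \<in> sets borel" for B
  using integrable_mult_indicator[of B lborel H] Hi that by (simp add: set_integrable_def)
 have 4: "(LINT k:B|lborel. H k) = 0" if B: "B \<in> sets borel" for B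
 proof -
  have "Int_stable {S :: (real ^ 'd) set. open S}" by (auto simp: Int_stable_def)
  moreover have "{S :: (real ^ 'd) set. open S} \<subseteq> Pow UNIV" by auto
  moreover have "B \<in> sigma_sets UNIV {S. open S}" using B by (simp add: borel_def)
  ultimately show ?thesis
  proof (induction rule: sigma_sets_induct_disjoint)
   case (basic A) thus ?case using 3 by simp
  next
   case empty show ?case by (simp add: set_lebesgue_integral_def)
  next
   case (compl A)
   have A: "A \<in> sets borel" using compl(1) by (simp add: borel_def)
   have "(LINT k:A \<union> (UNIV - A)|lborel. H k) = (LINT k:A|lborel. H k) + (LINT k:UNIV - A|lborel. H k)"
    by (rule set_integral_Un) (use A Hset in auto)
   moreover have "A \<union> (UNIV - A) = UNIV" by auto
   ultimately show ?case using 3[of UNIV] compl(2) by simp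
  next
   case (union A)
   have A: "A i \<in> sets borel" for i using union(2) by (auto simp: borel_def)
   have "(LINT k:(\<Union>i. A i)|lborel. H k) = (\<Sum>i. (LINT k:A i|lborel. H k))"
    by (rule lebesgue_integral_countable_add) (use A union(1) Hset in \<open>auto simp: disjoint_family_on_def\<close>)
   thus ?case using union(3) by simp
  qed
 qed
 have "AE k in lborel. H k = 0" by (rule sigma_finite_measure.density_zero[OF lborel.sigma_finite_measure_axioms Hi]) (simp add: 4)
 thus ?thesis by eventually_elim (auto simp: H_def)
qed

end

section \<open>Wannier functions\<close>

text \<open>Joint measurability in wavevector and position, which is what Fubini needs.\<close>

definition jm :: "(real ^ 'd::finite \<Rightarrow> ('d, 'v::finite) wavefun) \<Rightarrow> bool" where
 "jm F \<longleftrightarrow> (\<forall>i. (\<lambda>x. F (fst x) (snd x) i) \<in> borel_measurable borel)"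

lemma measurable_fst_borel [simp, measurable]:
  "fst \<in> borel_measurable (borel :: ('a::second_countable_topology \<times> 'b::second_countable_topology) measure)"
 and measurable_snd_borel [simp, measurable]:
  "snd \<in> borel_measurable (borel :: ('a::second_countable_topology \<times> 'b::second_countable_topology) measure)"
 by (auto intro!: borel_measurable_continuous_onI continuous_intros)

lemma jm_compose:
 assumes "jm F" "f \<in> borel_measurable M" "g \<in> borel_measurable M"
 shows "(\<lambda>x. F (f x) (g x) i) \<in> borel_measurable M"
proof -
 have "(\<lambda>x. (f x, g x)) \<in> borel_measurable M" using assms by (intro borel_measurable_Pair)
 from measurable_compose[OF this, of "\<lambda>x. F (fst x) (snd x) i" borel] show ?thesis
  using assms(1) by (simp add: jm_def)
qed

text \<open>Identities between sections hold for almost every \<open>r\<close> at each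
  \<open>k\<close>, whereas a Wannier integral at fixed \<open>r\<close> needs them for almost every
  \<open>k\<close>. The exceptional pairs form a measurable set, to which Fubini applies.\<close>

lemma AE_swap_iff:
 assumes F: "jm F" and G: "jm G"
 shows "(AE k in lborel. F k \<simeq> G k) \<longleftrightarrow> (AE r in lborel. AE k in lborel. F k r = G k r)"
proof -
 have "{x \<in> space (lborel \<Otimes>\<^sub>M lborel). F (fst x) (snd x) = G (fst x) (snd x)} \<in> sets (lborel \<Otimes>\<^sub>M lborel)"
 proof -
  have "{x \<in> space (lborel \<Otimes>\<^sub>M lborel). F (fst x) (snd x) i = G (fst x) (snd x) i} \<in> sets (lborel \<Otimes>\<^sub>M lborel)" for i
  proof -
   have "(\<lambda>x. F (fst x) (snd x) i) \<in> borel_measurable (lborel \<Otimes>\<^sub>M lborel)"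
    "(\<lambda>x. G (fst x) (snd x) i) \<in> borel_measurable (lborel \<Otimes>\<^sub>M lborel)"
    using F G by (auto intro!: jm_compose)
   hence "(\<lambda>x. F (fst x) (snd x) i - G (fst x) (snd x) i) \<in> borel_measurable (lborel \<Otimes>\<^sub>M lborel)"
    by (rule borel_measurable_diff)
   from measurable_sets[OF this, of "{0}"] show ?thesis by (simp add: vimage_def Int_def conj_commute)
  qed
  hence "{x \<in> space (lborel \<Otimes>\<^sub>M lborel). \<forall>i. F (fst x) (snd x) i = G (fst x) (snd x) i} \<in> sets (lborel \<Otimes>\<^sub>M lborel)"
   by (rule sets.sets_Collect_countable_All)
  thus ?thesis by (simp add: fun_eq_iff[of "F _ _"])
 qed
 from lborel_pair.AE_commute[OF this] show ?thesis by (simp add: aeq_def)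
qed

lemma AE_swap_aeq:
 assumes "jm F" "jm G" "AE k in lborel. F k \<simeq> G k"
 shows "AE r in lborel. AE k in lborel. F k r = G k r"
 using AE_swap_iff[OF assms(1,2)] assms(3) by (rule iffD1)

context mcr
begin

text \<open>The sections whose Wannier functions are given by convergent integrals.\<close>

definition nsec :: "(real ^ 'd \<Rightarrow> ('d, 'v) wavefun) \<Rightarrow> bool" where
 "nsec \<psi> \<longleftrightarrow> (\<forall>k. \<psi> k \<in> Bl k) \<and> (\<forall>k. \<forall>K\<in>RL C. \<psi> (k + K) \<simeq> \<psi> k) \<and> jm \<psi> \<and>
   (\<exists>B. \<forall>k. nm (\<psi> k) \<le> B)"

lemma nsec_bloch: "nsec \<psi> \<Longrightarrow> \<psi> k \<in> Bl k"
 and nsec_per: "nsec \<psi> \<Longrightarrow> K \<in> RL C \<Longrightarrow> \<psi> (k + K) \<simeq> \<psi> k"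
 and nsec_jm: "nsec \<psi> \<Longrightarrow> jm \<psi>"
 by (simp_all add: nsec_def)

lemma nsec_LV: "nsec \<psi> \<Longrightarrow> \<psi> k \<in> LV m"
 using nsec_bloch bloch_LV by blast

lemma gsec_nsec: "gsec \<psi> \<Longrightarrow> (\<And>k. nm (\<psi> k) = 1) \<Longrightarrow> nsec \<psi>"
 unfolding gsec_def nsec_def jm_def by (intro conjI exI[of _ 1]) auto

lemma norm_sq_cell:
 assumes f: "f \<in> LV m" and i: "i < m"
 shows "(\<integral>\<^sup>+r. indicator cell.D r * ennreal ((norm (f r i))\<^sup>2) \<partial>lborel) \<le> ennreal ((nm f)\<^sup>2)"
proof -
 let ?h = "\<lambda>r. indicator cell.D r *\<^sub>R (\<Sum>i<m. (norm (f r i))\<^sup>2)"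
 have eq: "indicator cell.D r *\<^sub>R (\<Sum>i<m. cdot (f r i) (f r i)) = complex_of_real (?h r)" for r
  by (simp add: cdot_self scaleR_conv_of_real)
 have "inn f f = of_real (\<integral>r. ?h r \<partial>lborel)"
  unfolding inner_cell_def set_lebesgue_integral_def unit_cell_eq eq by (rule integral_complex_of_real)
 hence n: "(nm f)\<^sup>2 = (\<integral>r. ?h r \<partial>lborel)" using ip_self[OF f] by (simp only: of_real_eq_iff)
 have int: "integrable lborel ?h"
  using inner_integrable[OF f f] unfolding set_integrable_def unit_cell_eq eq complex_of_real_integrable_eq .
 have "(\<integral>\<^sup>+r. indicator cell.D r * ennreal ((norm (f r i))\<^sup>2) \<partial>lborel) \<le> (\<integral>\<^sup>+r. ennreal (?h r) \<partial>lborel)"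
 proof (rule nn_integral_mono)
  fix r
  have "(norm (f r i))\<^sup>2 \<le> (\<Sum>i<m. (norm (f r i))\<^sup>2)" by (rule member_le_sum) (use i in auto)
  thus "indicator cell.D r * ennreal ((norm (f r i))\<^sup>2) \<le> ennreal (?h r)"
   by (auto simp: indicator_def intro: ennreal_leI)
 qed
 also have "\<dots> = ennreal (\<integral>r. ?h r \<partial>lborel)"
  by (rule nn_integral_eq_integral[OF int]) (simp add: sum_nonneg)
 finally show ?thesis using n by simp
qed

text \<open>The norms over a cell are bounded in \<open>k\<close>, so the section is square
  integrable over the product of Brillouin zone and cell, hence integrable in \<open>k\<close> for
  almost every \<open>r\<close> of the cell. The Bloch condition carries this to the other
  cells.\<close>

lemma nsec_integrable:
 assumes \<psi>: "nsec \<psi>"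
 shows "AE r in lborel. \<forall>i. set_integrable lborel bz.D (\<lambda>k. \<psi> k r i)"
proof -
 obtain B where B: "\<And>k. nm (\<psi> k) \<le> B" using \<psi> by (auto simp: nsec_def)
 note jm = nsec_jm[OF \<psi>]
 have km: "(\<lambda>k. \<psi> k r i) \<in> borel_measurable borel" for r i by (rule jm_compose[OF jm]) auto
 have "AE r in lborel. set_integrable lborel bz.D (\<lambda>k. \<psi> k r i)" for i
 proof (cases "i < m")
  case False
  hence "\<psi> k r i = 0" for k r using wavefuns_zero[of "\<psi> k" m i] nsec_LV[OF \<psi>, of k] by (simp add: LV_def)
  thus ?thesis by (simp add: set_integrable_def)
 next
  case i: True
  let ?g = "\<lambda>k r. indicator bz.D k * (indicator cell.D r * ennreal ((norm (\<psi> k r i))\<^sup>2))"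
  have gm: "(\<lambda>(k, r). ?g k r) \<in> borel_measurable (lborel \<Otimes>\<^sub>M lborel)"
  proof -
   have "(\<lambda>x. \<psi> (fst x) (snd x) i) \<in> borel_measurable (lborel \<Otimes>\<^sub>M lborel)" by (rule jm_compose[OF jm]) auto
   moreover have "(\<lambda>x. indicator bz.D (fst x) :: ennreal) \<in> borel_measurable (lborel \<Otimes>\<^sub>M lborel)"
    "(\<lambda>x. indicator cell.D (snd x) :: ennreal) \<in> borel_measurable (lborel \<Otimes>\<^sub>M lborel)"
    by (rule measurable_compose[OF measurable_fst], simp) (rule measurable_compose[OF measurable_snd], simp)
   ultimately show ?thesis unfolding case_prod_unfold by measurable
  qed
  have gk: "(\<lambda>k. ?g k r) \<in> borel_measurable borel" for r using km[of r i] by measurable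
  have "(\<integral>\<^sup>+r. \<integral>\<^sup>+k. ?g k r \<partial>lborel \<partial>lborel) = (\<integral>\<^sup>+k. \<integral>\<^sup>+r. ?g k r \<partial>lborel \<partial>lborel)"
   by (rule lborel_pair.Fubini'[OF gm])
  also have "\<dots> \<le> (\<integral>\<^sup>+k. indicator bz.D k * ennreal (B\<^sup>2) \<partial>lborel)"
  proof (rule nn_integral_mono)
   fix k
   have [measurable]: "(\<lambda>r. \<psi> k r i) \<in> borel_measurable borel" by (rule LV_measurable[OF nsec_LV[OF \<psi>]])
   have "(\<integral>\<^sup>+r. ?g k r \<partial>lborel) = indicator bz.D k * (\<integral>\<^sup>+r. indicator cell.D r * ennreal ((norm (\<psi> k r i))\<^sup>2) \<partial>lborel)"
    by (rule nn_integral_cmult) measurable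
   also have "\<dots> \<le> indicator bz.D k * ennreal ((nm (\<psi> k))\<^sup>2)"
    by (intro mult_left_mono norm_sq_cell nsec_LV[OF \<psi>] i) simp
   also have "\<dots> \<le> indicator bz.D k * ennreal (B\<^sup>2)"
    using B[of k] nrm_ge0[OF nsec_LV[OF \<psi>, of k]] by (intro mult_left_mono ennreal_leI power_mono) auto
   finally show "(\<integral>\<^sup>+r. ?g k r \<partial>lborel) \<le> indicator bz.D k * ennreal (B\<^sup>2)" .
  qed
  also have "\<dots> = emeasure lborel bz.D * ennreal (B\<^sup>2)" by (simp add: nn_integral_multc)
  also have "\<dots> < \<infinity>" using bz.D_finite by (simp add: ennreal_mult_less_top)
  finally have fin: "(\<integral>\<^sup>+r. \<integral>\<^sup>+k. ?g k r \<partial>lborel \<partial>lborel) < \<infinity>" .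
  have gm': "(\<lambda>r. \<integral>\<^sup>+k. ?g k r \<partial>lborel) \<in> borel_measurable lborel"
   using lborel.borel_measurable_nn_integral[of "\<lambda>r k. ?g k r" lborel] measurable_pair_swap[OF gm]
   by (simp add: case_prod_unfold)
  have "AE r in lborel. (\<integral>\<^sup>+k. ?g k r \<partial>lborel) \<noteq> \<infinity>"
   by (rule nn_integral_PInf_AE[OF gm']) (use fin in auto)
  hence "AE r in lborel. r \<in> cell.D \<longrightarrow> set_integrable lborel bz.D (\<lambda>k. \<psi> k r i)"
  proof eventually_elim
   case (elim r)
   show ?case
   proof
    assume r: "r \<in> cell.D"
    have m1: "(\<lambda>k. indicator bz.D k *\<^sub>R \<psi> k r i) \<in> borel_measurable lborel" using km[of r i] by measurable
    \<comment> \<open>The zone has finite measure, so \<open>x \<le> 1 + x * x\<close> turns square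
      integrability into integrability.\<close>
    have le: "ennreal (norm (indicator bz.D k *\<^sub>R \<psi> k r i)) \<le> indicator bz.D k + ?g k r" for k
    proof -
     have "x \<le> 1 + x\<^sup>2" for x :: real
      using zero_le_power2[of "x - 1 / 2"] by (simp add: power2_eq_square algebra_simps)
     hence "ennreal (norm (\<psi> k r i)) \<le> ennreal (1 + (norm (\<psi> k r i))\<^sup>2)" by (rule ennreal_leI)
     thus ?thesis using r by (auto simp: indicator_def ennreal_plus)
    qed
    have "(\<integral>\<^sup>+k. ennreal (norm (indicator bz.D k *\<^sub>R \<psi> k r i)) \<partial>lborel)
      \<le> (\<integral>\<^sup>+k. indicator bz.D k + ?g k r \<partial>lborel)" by (rule nn_integral_mono) (rule le)
    also have "\<dots> = emeasure lborel bz.D + (\<integral>\<^sup>+k. ?g k r \<partial>lborel)"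
     using gk[of r] by (subst nn_integral_add) auto
    also have "\<dots> < \<infinity>" using elim bz.D_finite by (simp add: less_top)
    finally show "set_integrable lborel bz.D (\<lambda>k. \<psi> k r i)"
     unfolding set_integrable_def using m1 by (intro integrableI_bounded)
   qed
  qed
  thus ?thesis
  proof (rule cell.AE_from_cell)
   fix R assume R: "R \<in> cell.L"
   have "AE k in lborel. (\<lambda>r. \<psi> k (r + R)) \<simeq> (\<lambda>r. scl (cis (k \<bullet> R)) (\<psi> k) r)"
    using nsec_bloch[OF \<psi>] R by (simp add: bloch_iff BL_eq)
   moreover have "jm (\<lambda>k r. \<psi> k (r + R))" unfolding jm_def by (auto intro!: jm_compose[OF jm])
   moreover have "jm (\<lambda>k r. scl (cis (k \<bullet> R)) (\<psi> k) r)" unfolding jm_def scl_def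
    by (intro allI measurable_scale_cvec jm_compose[OF jm] measurable_cis) auto
   ultimately have "AE r in lborel. AE k in lborel. \<psi> k (r + R) = scl (cis (k \<bullet> R)) (\<psi> k) r"
    by (intro AE_swap_aeq)
   thus "AE r in lborel. set_integrable lborel bz.D (\<lambda>k. \<psi> k r i) \<longrightarrow> set_integrable lborel bz.D (\<lambda>k. \<psi> k (r + R) i)"
   proof eventually_elim
    case (elim r)
    show ?case
    proof
     assume s: "set_integrable lborel bz.D (\<lambda>k. \<psi> k r i)"
     show "set_integrable lborel bz.D (\<lambda>k. \<psi> k (r + R) i)"
     proof (rule set_integrable_bound[OF s])
      show "set_borel_measurable lborel bz.D (\<lambda>k. \<psi> k (r + R) i)"
       unfolding set_borel_measurable_def using km[of "r + R" i] by measurable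
      show "AE k in lborel. k \<in> bz.D \<longrightarrow> norm (\<psi> k (r + R) i) \<le> norm (\<psi> k r i)"
       using elim by eventually_elim (simp add: scl_def norm_scale_cvec)
     qed
    qed
   qed
  qed
 qed
 thus ?thesis by (subst AE_all_countable) blast
qed

lemma nsec_integrable_cis:
 assumes "set_integrable lborel bz.D (\<lambda>k. \<psi> k r i)" and jm: "jm \<psi>"
 shows "set_integrable lborel bz.D (\<lambda>k. cis (- (k \<bullet> R)) *s \<psi> k r i)"
proof (rule set_integrable_bound[OF assms(1)])
 have "(\<lambda>k. \<psi> k r i) \<in> borel_measurable borel" by (rule jm_compose[OF jm]) auto
 thus "set_borel_measurable lborel bz.D (\<lambda>k. cis (- (k \<bullet> R)) *s \<psi> k r i)"
  unfolding set_borel_measurable_def by measurable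
qed (simp add: norm_scale_cvec)

lemma wannier_wavefuns:
 assumes jm: "jm \<psi>" and w: "\<And>k. \<psi> k \<in> wavefuns m" shows "wannier C \<psi> R \<in> wavefuns m"
proof -
 have "(\<lambda>r. LINT k:bz.D|lborel. cis (- (k \<bullet> R)) *s \<psi> k r i) \<in> borel_measurable borel" for i
 proof -
  have "(\<lambda>x. indicator bz.D (snd x) *\<^sub>R (cis (- (snd x \<bullet> R)) *s \<psi> (snd x) (fst x) i)) \<in> borel_measurable (borel \<Otimes>\<^sub>M lborel)"
  proof -
   have "(\<lambda>x. indicator bz.D (snd x) :: real) \<in> borel_measurable (borel \<Otimes>\<^sub>M lborel)"
    by (rule measurable_compose[OF measurable_snd]) simp
   moreover have "(\<lambda>x. \<psi> (snd x) (fst x) i) \<in> borel_measurable (borel \<Otimes>\<^sub>M lborel)"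
    by (rule jm_compose[OF jm]) auto
   ultimately show ?thesis by measurable
  qed
  thus ?thesis unfolding set_lebesgue_integral_def
   using lborel.borel_measurable_lebesgue_integral[of "\<lambda>r k. indicator bz.D k *\<^sub>R (cis (- (k \<bullet> R)) *s \<psi> k r i)" borel]
   by (simp add: case_prod_unfold)
 qed
 moreover have "\<psi> k r i = 0" if "i \<ge> m" for k r i using w[of k] wavefuns_zero that by blast
 ultimately show ?thesis
  by (auto simp: wavefuns_def wannier_def BZ_eq set_lebesgue_integral_def intro!: borel_measurable_scaleR)
qed

lemma nsec_wannier_wavefuns: "nsec \<psi> \<Longrightarrow> wannier C \<psi> R \<in> wavefuns m"
 using nsec_LV[of \<psi>] by (intro wannier_wavefuns nsec_jm) (simp_all add: LV_def)

text \<open>The Bloch condition for the displacement \<open>- T\<close> multiplies the integrand by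
  a phase, which adds \<open>T\<close> to the lattice vector in the Fourier integral.\<close>

lemma wannier_shift:
 assumes \<psi>: "nsec \<psi>" and T: "T \<in> BL C"
 shows "(\<lambda>r. wannier C \<psi> R (r - T)) \<simeq> wannier C \<psi> (R + T)"
proof -
 note jm = nsec_jm[OF \<psi>]
 have km: "(\<lambda>k. \<psi> k r i) \<in> borel_measurable borel" for r i by (rule jm_compose[OF jm]) auto
 have "AE k in lborel. (\<lambda>r. \<psi> k (r + (- T))) \<simeq> (\<lambda>r. scl (cis (k \<bullet> (- T))) (\<psi> k) r)"
  by (intro AE_I2) (use nsec_bloch[OF \<psi>] BL_minus[OF T] in \<open>unfold bloch_iff, blast\<close>)
 moreover have "jm (\<lambda>k r. \<psi> k (r + (- T)))" unfolding jm_def by (auto intro!: jm_compose[OF jm])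
 moreover have "jm (\<lambda>k r. scl (cis (k \<bullet> (- T))) (\<psi> k) r)" unfolding jm_def scl_def
  by (intro allI measurable_scale_cvec jm_compose[OF jm] measurable_cis) auto
 ultimately have "AE r in lborel. AE k in lborel. \<psi> k (r + (- T)) = scl (cis (k \<bullet> (- T))) (\<psi> k) r"
  by (intro AE_swap_aeq)
 thus ?thesis unfolding aeq_def
 proof eventually_elim
  case (elim r)
  have "(LINT k:bz.D|lborel. cis (- (k \<bullet> R)) *s \<psi> k (r - T) i) = (LINT k:bz.D|lborel. cis (- (k \<bullet> (R + T))) *s \<psi> k r i)" for i
  proof (rule set_lebesgue_integral_cong_AE)
   show "AE k\<in>bz.D in lborel. cis (- (k \<bullet> R)) *s \<psi> k (r - T) i = cis (- (k \<bullet> (R + T))) *s \<psi> k r i"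
    using elim by eventually_elim
     (simp add: scl_def vector_smult_assoc cis_mult inner_add_right)
   show "(\<lambda>k. cis (- (k \<bullet> R)) *s \<psi> k (r - T) i) \<in> borel_measurable lborel"
    "(\<lambda>k. cis (- (k \<bullet> (R + T))) *s \<psi> k r i) \<in> borel_measurable lborel"
    using km[of "r - T" i] km[of r i] by measurable
  qed simp
  thus ?case by (simp add: wannier_def BZ_eq)
 qed
qed

lemma cB_nonzero: "1 / sqrt (measure lborel bz.D) \<noteq> 0"
proof -
 have "measure lborel bz.D \<noteq> 0"
  using bz.D_not_null bz.D_finite by (simp add: measure_def enn2real_eq_0_iff)
 thus ?thesis by simp
qed

lemma cis_periodic: "K \<in> RL C \<Longrightarrow> R \<in> BL C \<Longrightarrow> cis (- ((k + K) \<bullet> R)) = cis (- (k \<bullet> R))"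
proof -
 assume "K \<in> RL C" "R \<in> BL C"
 hence "cis (- (K \<bullet> R)) = 1" using cis_RL[of K "- R"] by (simp add: BL_minus)
 moreover have "cis (- ((k + K) \<bullet> R)) = cis (- (k \<bullet> R)) * cis (- (K \<bullet> R))"
  by (simp add: inner_add_left cis_mult)
 ultimately show ?thesis by simp
qed

text \<open>The Bloch form of a combination of Wannier functions displaced by the lattice vector
  \<open>\<xi>\<close>: the displacement appears as the phase.\<close>

abbreviation "twisted n c p \<xi> \<phi> k \<equiv> \<Sum>\<beta><n::nat. scl (c \<beta> * cis (- ((spr p *v k) \<bullet> \<xi>))) (\<phi> \<beta> (spr p *v k))"

text \<open>\<open>Dop C p\<close> passes under the integral and conjugates the Fourier phase if
  \<open>p\<close> reverses time. The substitution of \<open>spr p *v k\<close> on the Brillouin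
  torus then turns the phase of \<open>R\<close> into that of \<open>rot C p *v R\<close>, and the
  twist adds \<open>\<xi>\<close>.\<close>

lemma wannier_covariant:
 fixes n :: nat and c :: "nat \<Rightarrow> complex"
 assumes p: "p \<in> P" and \<psi>: "nsec \<psi>" and \<phi>: "\<And>\<beta>. \<beta> < n \<Longrightarrow> nsec (\<phi> \<beta>)" and R: "R \<in> BL C" and \<xi>: "\<xi> \<in> BL C"
  and cov: "AE k in lborel. gh p (\<psi> k) \<simeq>
   twisted n c p \<xi> \<phi> k"
 shows "gh p (wannier C \<psi> R) \<simeq> (\<Sum>\<beta><n. scl (c \<beta>) (wannier C (\<phi> \<beta>) (rot C p *v R + \<xi>)))"
proof -
 let ?A = "spr p" and ?B = "rot C (pinv p)" and ?R = "rot C p *v R + \<xi>"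
 have R': "?R \<in> BL C" by (intro BL_add rot_L p R \<xi>)
 have Am: "(\<lambda>x. ?A *v f x) \<in> borel_measurable M" if "f \<in> borel_measurable M" for f :: "'z \<Rightarrow> real ^ 'd" and M
  by (rule borel_measurable_matrix_vector[OF that])
 have Bm: "(\<lambda>x. ?B *v f x) \<in> borel_measurable M" if "f \<in> borel_measurable M" for f :: "'z \<Rightarrow> real ^ 'd" and M
  by (rule borel_measurable_matrix_vector[OF that])
 note jm\<psi> = nsec_jm[OF \<psi>]
 have j1: "jm (\<lambda>k. gh p (\<psi> k))" unfolding jm_def gh_def
  by (intro allI D_measurable p jm_compose[OF jm\<psi>] Bm) auto
 have j2: "jm (\<lambda>k. \<Sum>\<beta><n. scl (c \<beta> * cis (- ((?A *v k) \<bullet> \<xi>))) (\<phi> \<beta> (?A *v k)))"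
  unfolding jm_def sum_fun_apply2 scl_def
  by (intro allI borel_measurable_sum measurable_scale_cvec jm_compose[OF nsec_jm[OF \<phi>]] Am borel_measurable_times
    measurable_cis borel_measurable_uminus borel_measurable_inner) auto
 have e1: "AE r in lborel. AE k in lborel. gh p (\<psi> k) r = (\<Sum>\<beta><n. scl (c \<beta> * cis (- ((?A *v k) \<bullet> \<xi>))) (\<phi> \<beta> (?A *v k))) r"
  by (rule AE_swap_aeq[OF j1 j2 cov])
 have "AE r in lborel. \<forall>i. set_integrable lborel bz.D (\<lambda>k. \<psi> k (?B *v r) i)"
  by (rule AE_orthogonal_matrix[OF rot_orth[OF pinv_P[OF p]] nsec_integrable[OF \<psi>]])
 moreover have "AE r in lborel. \<forall>\<beta>\<in>{..<n}. \<forall>i. set_integrable lborel bz.D (\<lambda>k. \<phi> \<beta> k r i)"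
  by (subst AE_ball_countable[OF countable_finite[OF finite_lessThan]]) (use nsec_integrable[OF \<phi>] in auto)
 moreover have "AE r in lborel. \<forall>\<beta>\<in>{..<n}. \<forall>K\<in>bz.L. AE k in lborel. \<phi> \<beta> (k + K) r = \<phi> \<beta> k r"
 proof (subst AE_ball_countable[OF countable_finite[OF finite_lessThan]], intro ballI, subst AE_ball_countable[OF bz.L_countable], intro ballI)
  fix \<beta> K assume \<beta>: "\<beta> \<in> {..<n}" and K: "K \<in> bz.L"
  hence j\<phi>: "jm (\<phi> \<beta>)" using nsec_jm[OF \<phi>] by simp
  have "AE k in lborel. \<phi> \<beta> (k + K) \<simeq> \<phi> \<beta> k" using nsec_per[OF \<phi>] \<beta> K by (simp add: RL_eq)
  moreover have "jm (\<lambda>k. \<phi> \<beta> (k + K))" unfolding jm_def by (auto intro!: jm_compose[OF j\<phi>])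
  ultimately show "AE r in lborel. AE k in lborel. \<phi> \<beta> (k + K) r = \<phi> \<beta> k r"
   using j\<phi> by (intro AE_swap_aeq)
 qed
 ultimately show ?thesis using e1 unfolding aeq_def
 proof eventually_elim
  case (elim r)
  have "gh p (wannier C \<psi> R) r i = (\<Sum>\<beta><n. scl (c \<beta>) (wannier C (\<phi> \<beta>) ?R)) r i" for i
  proof -
   let ?cB = "1 / sqrt (measure lborel bz.D)"
   define f where "f k = (\<Sum>\<beta><n. (c \<beta> * cis (- (k \<bullet> ?R))) *s \<phi> \<beta> k r i)" for k
   have km\<phi>: "(\<lambda>k. \<phi> \<beta> k r i) \<in> borel_measurable borel" if "\<beta> < n" for \<beta>
    by (rule jm_compose[OF nsec_jm[OF \<phi>[OF that]]]) auto
   have km\<psi>: "(\<lambda>k. \<psi> k (?B *v r) i) \<in> borel_measurable borel" by (rule jm_compose[OF jm\<psi>]) auto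
   have fm: "f \<in> borel_measurable borel" unfolding f_def[abs_def]
    by (intro borel_measurable_sum measurable_scale_cvec km\<phi> borel_measurable_times measurable_cis
      borel_measurable_uminus borel_measurable_inner) auto
   have int: "integrable lborel (\<lambda>k. indicator bz.D k *\<^sub>R (cis (- (k \<bullet> R)) *s \<psi> k (?B *v r) i))"
    using nsec_integrable_cis[OF spec[OF elim(1), of i] jm\<psi>, of R] by (simp add: set_integrable_def)
   have "gh p (wannier C \<psi> R) r i = Dop C p (?cB *\<^sub>R (LINT k:bz.D|lborel. cis (- (k \<bullet> R)) *s \<psi> k (?B *v r) i))"
    by (simp add: gh_def wannier_def BZ_eq)
   also have "\<dots> = ?cB *\<^sub>R Dop C p (LINT k:bz.D|lborel. cis (- (k \<bullet> R)) *s \<psi> k (?B *v r) i)"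
    by (rule linear_cmul[OF D_linear[OF p]])
   also have "Dop C p (LINT k:bz.D|lborel. cis (- (k \<bullet> R)) *s \<psi> k (?B *v r) i)
     = (LINT k:bz.D|lborel. Dop C p (cis (- (k \<bullet> R)) *s \<psi> k (?B *v r) i))"
    unfolding set_lebesgue_integral_def
    by (subst integral_bounded_linear[OF D_bounded_linear[OF p] int, symmetric])
      (simp add: linear_cmul[OF D_linear[OF p]])
   also have "\<dots> = (LINT k:bz.D|lborel. f (?A *v k))"
   proof (rule set_lebesgue_integral_cong_AE)
    show "AE k\<in>bz.D in lborel. Dop C p (cis (- (k \<bullet> R)) *s \<psi> k (?B *v r) i) = f (?A *v k)"
     using elim(4)
    proof eventually_elim
     case (elim k)
     have "Dop C p (cis (- (k \<bullet> R)) *s \<psi> k (?B *v r) i) = cis (trs C p * (- (k \<bullet> R))) *s gh p (\<psi> k) r i"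
      by (simp only: D_scale[OF p] cj_cis[OF trs_pm[OF p]] gh_def)
     also have "trs C p * (- (k \<bullet> R)) = - ((?A *v k) \<bullet> (rot C p *v R))" by (simp add: spr_inner[OF p])
     also have "cis (- ((?A *v k) \<bullet> (rot C p *v R))) *s gh p (\<psi> k) r i = f (?A *v k)"
      unfolding elim f_def sum_fun_apply2 scl_def
      by (simp add: sum_cmul[symmetric] vector_smult_assoc cis_mult inner_add_right mult.left_commute)
     finally show ?case by simp
    qed
    show "(\<lambda>k. Dop C p (cis (- (k \<bullet> R)) *s \<psi> k (?B *v r) i)) \<in> borel_measurable lborel"
     using km\<psi> by (intro D_measurable[OF p] measurable_scale_cvec measurable_cis
       borel_measurable_uminus borel_measurable_inner) auto
    show "(\<lambda>k. f (?A *v k)) \<in> borel_measurable lborel"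
     by (rule measurable_compose[OF _ fm]) (use Am[of "\<lambda>x. x" lborel] in simp)
   qed simp
   also have "\<dots> = (LINT k:bz.D|lborel. f k)"
   proof (rule bz.cell_integral_invariant[OF spr_orth[OF p] _ fm])
    show "(\<lambda>v. ?A *v v) ` bz.L = bz.L" using spr_RL_image[OF p] by (simp add: RL_eq)
    fix K assume K: "K \<in> bz.L"
    have "AE k in lborel. \<forall>\<beta>\<in>{..<n}. \<phi> \<beta> (k + K) r = \<phi> \<beta> k r"
     by (subst AE_ball_countable[OF countable_finite[OF finite_lessThan]]) (use elim(3) K in auto)
    thus "AE k in lborel. f (k + K) = f k"
    proof eventually_elim
     case (elim k)
     thus ?case unfolding f_def using K R' by (intro sum.cong) (auto simp: cis_periodic RL_eq)
    qed
   qed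
   also have "\<dots> = (\<Sum>\<beta><n. c \<beta> *s (LINT k:bz.D|lborel. cis (- (k \<bullet> ?R)) *s \<phi> \<beta> k r i))"
   proof -
    have bl: "bounded_linear (\<lambda>v :: complex ^ 'v. a *s v)" for a
     by (rule bounded_linear_intro[where K = "cmod a"])
       (simp_all add: vector_add_ldistrib norm_scale_cvec vec_eq_iff mult.commute)
    have i1: "integrable lborel (\<lambda>k. indicator bz.D k *\<^sub>R (cis (- (k \<bullet> ?R)) *s \<phi> \<beta> k r i))" if "\<beta> < n" for \<beta>
    proof -
     have "set_integrable lborel bz.D (\<lambda>k. \<phi> \<beta> k r i)" using elim(2) that by blast
     from nsec_integrable_cis[OF this nsec_jm[OF \<phi>[OF that]], of ?R] show ?thesis by (simp add: set_integrable_def)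
    qed
    have "(LINT k:bz.D|lborel. f k) = (\<integral>k. (\<Sum>\<beta><n. c \<beta> *s (indicator bz.D k *\<^sub>R (cis (- (k \<bullet> ?R)) *s \<phi> \<beta> k r i))) \<partial>lborel)"
     unfolding set_lebesgue_integral_def f_def scaleR_sum_right
     by (intro Bochner_Integration.integral_cong refl sum.cong) (simp add: indicator_def vector_smult_assoc)
    also have "\<dots> = (\<Sum>\<beta><n. \<integral>k. c \<beta> *s (indicator bz.D k *\<^sub>R (cis (- (k \<bullet> ?R)) *s \<phi> \<beta> k r i)) \<partial>lborel)"
     by (rule Bochner_Integration.integral_sum) (use integrable_bounded_linear[OF bl i1] in simp)
    also have "\<dots> = (\<Sum>\<beta><n. c \<beta> *s (LINT k:bz.D|lborel. cis (- (k \<bullet> ?R)) *s \<phi> \<beta> k r i))"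
     unfolding set_lebesgue_integral_def
     by (intro sum.cong refl integral_bounded_linear[OF bl i1]) simp
    finally show ?thesis .
   qed
   finally have "gh p (wannier C \<psi> R) r i = ?cB *\<^sub>R (\<Sum>\<beta><n. c \<beta> *s (LINT k:bz.D|lborel. cis (- (k \<bullet> ?R)) *s \<phi> \<beta> k r i))" .
   also have "\<dots> = (\<Sum>\<beta><n. c \<beta> *s (?cB *\<^sub>R (LINT k:bz.D|lborel. cis (- (k \<bullet> ?R)) *s \<phi> \<beta> k r i)))"
    unfolding scaleR_sum_right by (intro sum.cong refl) (simp add: vec_eq_iff)
   also have "\<dots> = (\<Sum>\<beta><n. scl (c \<beta>) (wannier C (\<phi> \<beta>) ?R)) r i"
    unfolding sum_fun_apply2 scl_def wannier_def BZ_eq ..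
   finally show ?thesis .
  qed
  thus ?case by (rule ext)
 qed
qed

lemma nsec_sum:
 fixes n :: nat and c :: "nat \<Rightarrow> complex"
 assumes \<phi>: "\<And>\<beta>. \<beta> < n \<Longrightarrow> nsec (\<phi> \<beta>)"
 shows "nsec (\<lambda>k. \<Sum>\<beta><n. scl (c \<beta>) (\<phi> \<beta> k))"
 unfolding nsec_def
proof (intro conjI allI ballI)
 show "(\<Sum>\<beta><n. scl (c \<beta>) (\<phi> \<beta> k)) \<in> Bl k" for k
  by (intro bloch_sum bloch_scl nsec_bloch \<phi>) simp
 show "(\<Sum>\<beta><n. scl (c \<beta>) (\<phi> \<beta> (k + K))) \<simeq> (\<Sum>\<beta><n. scl (c \<beta>) (\<phi> \<beta> k))" if "K \<in> RL C" for k K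
  by (intro aeq_sum aeq_scl nsec_per \<phi> that) simp
 show "jm (\<lambda>k. \<Sum>\<beta><n. scl (c \<beta>) (\<phi> \<beta> k))"
  unfolding jm_def sum_fun_apply2 scl_def
  by (intro allI borel_measurable_sum measurable_scale_cvec jm_compose[OF nsec_jm[OF \<phi>]]) auto
 have "\<forall>\<beta>\<in>{..<n}. \<exists>B. \<forall>k. nm (\<phi> \<beta> k) \<le> B" using \<phi> by (simp add: nsec_def)
 then obtain B where B: "\<And>\<beta> k. \<beta> < n \<Longrightarrow> nm (\<phi> \<beta> k) \<le> B \<beta>" unfolding bchoice_iff by auto
 have "nm (\<Sum>\<beta><n. scl (c \<beta>) (\<phi> \<beta> k)) \<le> (\<Sum>\<beta><n. cmod (c \<beta>) * B \<beta>)" for k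
 proof -
  have "nm (\<Sum>\<beta><n. scl (c \<beta>) (\<phi> \<beta> k)) \<le> (\<Sum>\<beta><n. nm (scl (c \<beta>) (\<phi> \<beta> k)))"
   by (rule nrm_sum) (simp_all add: LV_scl[OF nsec_LV[OF \<phi>]])
  also have "\<dots> \<le> (\<Sum>\<beta><n. cmod (c \<beta>) * B \<beta>)"
  proof (rule sum_mono)
   fix \<beta> assume "\<beta> \<in> {..<n}"
   hence \<beta>: "\<beta> < n" by simp
   show "nm (scl (c \<beta>) (\<phi> \<beta> k)) \<le> cmod (c \<beta>) * B \<beta>"
    unfolding nrm_smul[OF nsec_LV[OF \<phi>[OF \<beta>]]] by (rule mult_left_mono[OF B[OF \<beta>]]) simp
  qed
  finally show ?thesis .
 qed
 thus "\<exists>B. \<forall>k. nm (\<Sum>\<beta><n. scl (c \<beta>) (\<phi> \<beta> k)) \<le> B" by blast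
qed

lemma nsec_twist:
 assumes \<psi>: "nsec \<psi>" and R: "R \<in> BL C" shows "nsec (\<lambda>k. scl (cis (k \<bullet> R)) (\<psi> k))"
 unfolding nsec_def
proof (intro conjI allI ballI)
 show "scl (cis (k \<bullet> R)) (\<psi> k) \<in> Bl k" for k by (intro bloch_scl nsec_bloch \<psi>)
 show "scl (cis ((k + K) \<bullet> R)) (\<psi> (k + K)) \<simeq> scl (cis (k \<bullet> R)) (\<psi> k)" if K: "K \<in> RL C" for k K
  using rper_per[OF rper_cis[OF R] K, of k] by (simp add: aeq_scl nsec_per[OF \<psi> K])
 show "jm (\<lambda>k. scl (cis (k \<bullet> R)) (\<psi> k))"
  unfolding jm_def scl_def by (intro allI measurable_scale_cvec jm_compose[OF nsec_jm[OF \<psi>]] measurable_cis borel_measurable_inner) auto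
 obtain B where "\<And>k. nm (\<psi> k) \<le> B" using \<psi> by (auto simp: nsec_def)
 thus "\<exists>B. \<forall>k. nm (scl (cis (k \<bullet> R)) (\<psi> k)) \<le> B"
  by (intro exI[of _ B]) (simp add: nrm_smul nsec_LV[OF \<psi>])
qed

lemma norm_gh: "p \<in> P \<Longrightarrow> f \<in> Bl k \<Longrightarrow> nm (gh p f) = nm f"
 using inner_gh[of p f k f] by (simp add: norm_cell_def cj_def)

lemma nsec_gh:
 assumes p: "p \<in> P" and \<psi>: "nsec \<psi>" shows "nsec (\<lambda>k. gh p (\<psi> (spr (pinv p) *v k)))"
 unfolding nsec_def
proof (intro conjI allI ballI)
 show "gh p (\<psi> (spr (pinv p) *v k)) \<in> Bl k" for k
  using gh_bloch[OF p nsec_bloch[OF \<psi>], of "spr (pinv p) *v k"] by (simp add: spr_inv[OF p])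
 show "gh p (\<psi> (spr (pinv p) *v (k + K))) \<simeq> gh p (\<psi> (spr (pinv p) *v k))" if K: "K \<in> RL C" for k K
  unfolding matrix_vector_right_distrib by (intro gh_aeq p nsec_per[OF \<psi>] spr_RL pinv_P K)
 have Bm: "(\<lambda>x. B *v f x) \<in> borel_measurable M" if "f \<in> borel_measurable M" for f :: "'z \<Rightarrow> real ^ 'd" and M and B :: "real ^ 'd ^ 'd"
  by (rule borel_measurable_matrix_vector[OF that])
 show "jm (\<lambda>k. gh p (\<psi> (spr (pinv p) *v k)))"
  unfolding jm_def gh_def by (intro allI D_measurable p jm_compose[OF nsec_jm[OF \<psi>]] Bm) auto
 obtain B where "\<And>k. nm (\<psi> k) \<le> B" using \<psi> by (auto simp: nsec_def)
 thus "\<exists>B. \<forall>k. nm (gh p (\<psi> (spr (pinv p) *v k))) \<le> B"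
  by (intro exI[of _ B]) (simp add: norm_gh[OF p nsec_bloch[OF \<psi>]])
qed

lemma spr_one: "spr \<one>\<^bsub>PG C\<^esub> *v k = k"
 by (simp add: spr_mult_vec)

text \<open>\<open>wannier_covariant\<close> for the unit of the group and displacement 0.\<close>

lemma wannier_sum:
 fixes n :: nat and c :: "nat \<Rightarrow> complex"
 assumes \<phi>: "\<And>\<beta>. \<beta> < n \<Longrightarrow> nsec (\<phi> \<beta>)" and R: "R \<in> BL C"
 shows "wannier C (\<lambda>k. \<Sum>\<beta><n. scl (c \<beta>) (\<phi> \<beta> k)) R \<simeq> (\<Sum>\<beta><n. scl (c \<beta>) (wannier C (\<phi> \<beta>) R))"
proof -
 have "gh \<one>\<^bsub>PG C\<^esub> (wannier C (\<lambda>k. \<Sum>\<beta><n. scl (c \<beta>) (\<phi> \<beta> k)) R)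
   \<simeq> (\<Sum>\<beta><n. scl (c \<beta>) (wannier C (\<phi> \<beta>) (rot C \<one>\<^bsub>PG C\<^esub> *v R + 0)))"
  by (rule wannier_covariant[OF one_P nsec_sum[OF \<phi>] \<phi> R BL_zero]) (simp_all add: gh_one spr_one)
 thus ?thesis by (simp add: gh_one)
qed

text \<open>The Wannier functions for all lattice vectors are translates of one of them, so for
  almost every \<open>r\<close> all Fourier coefficients of the function of \<open>k\<close>
  vanish.\<close>

lemma wannier_zero:
 assumes \<delta>: "nsec \<delta>" and R': "R' \<in> BL C" and w: "wannier C \<delta> R' \<simeq> 0"
 shows "AE k in lborel. \<delta> k \<simeq> 0"
proof -
 note jm = nsec_jm[OF \<delta>]
 have "AE r in lborel. wannier C \<delta> R r = 0" if R: "R \<in> BL C" for R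
 proof -
  have "(\<lambda>r. wannier C \<delta> R' (r - (R - R'))) \<simeq> wannier C \<delta> (R' + (R - R'))"
   by (rule wannier_shift[OF \<delta> BL_diff[OF R R']])
  moreover have "(\<lambda>r. wannier C \<delta> R' (r - (R - R'))) \<simeq> (\<lambda>r. 0 (r - (R - R')))"
   using aeq_shift[OF w, of "- (R - R')"] by (simp only: diff_conv_add_uminus)
  moreover have "R' + (R - R') = R" by simp
  ultimately have "(\<lambda>r. wannier C \<delta> R' (r - (R - R'))) \<simeq> wannier C \<delta> R" by (simp only:)
  from aeq_trans[OF aeq_sym[OF this] \<open>_ \<simeq> (\<lambda>r. 0 (r - (R - R')))\<close>]
  show ?thesis by (simp add: aeq_def)
 qed
 hence "AE r in lborel. \<forall>R\<in>BL C. wannier C \<delta> R r = 0"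
  by (subst AE_ball_countable) (auto simp: BL_eq cell.L_countable)
 hence "AE r in lborel. AE k in lborel. k \<in> bz.D \<longrightarrow> \<delta> k r = 0"
  using nsec_integrable[OF \<delta>]
 proof eventually_elim
  case (elim r)
  have "AE k in lborel. k \<in> bz.D \<longrightarrow> \<delta> k r i $ j = 0" for i j
  proof (rule fourier_unique)
   have bl: "bounded_linear (\<lambda>v :: complex ^ 'v. v $ j)" by (rule bounded_linear_vec_nth)
   show "set_integrable lborel bz.D (\<lambda>k. \<delta> k r i $ j)"
    using integrable_bounded_linear[OF bl] elim(2) unfolding set_integrable_def by fastforce
   fix R assume R: "R \<in> BL C"
   have int: "integrable lborel (\<lambda>k. indicator bz.D k *\<^sub>R (cis (- (k \<bullet> R)) *s \<delta> k r i))"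
    using nsec_integrable_cis[OF spec[OF elim(2), of i] jm, of R] by (simp add: set_integrable_def)
   have "(1 / sqrt (measure lborel bz.D)) *\<^sub>R (LINT k:bz.D|lborel. cis (- (k \<bullet> R)) *s \<delta> k r i) = 0"
    using fun_cong[OF bspec[OF elim(1) R], of i] by (simp add: wannier_def BZ_eq)
   hence "(LINT k:bz.D|lborel. cis (- (k \<bullet> R)) *s \<delta> k r i) = 0" using cB_nonzero by (simp only: scaleR_eq_0_iff) auto
   hence "(LINT k:bz.D|lborel. cis (- (k \<bullet> R)) *s \<delta> k r i) $ j = 0" by simp
   thus "(LINT k:bz.D|lborel. cis (- (k \<bullet> R)) * \<delta> k r i $ j) = 0"
    unfolding set_lebesgue_integral_def
    by (subst (asm) integral_bounded_linear[OF bl int, symmetric]) simp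
  qed
  hence "AE k in lborel. \<forall>i. \<forall>j. k \<in> bz.D \<longrightarrow> \<delta> k r i $ j = 0"
   unfolding AE_all_countable by blast
  thus ?case by eventually_elim (auto simp: fun_eq_iff vec_eq_iff)
 qed
 hence "AE r in lborel. AE k in lborel. (\<lambda>i. indicator bz.D k *\<^sub>R \<delta> k r i) = 0"
  by eventually_elim (erule eventually_mono, auto simp: indicator_def fun_eq_iff)
 moreover have "jm (\<lambda>k r i. indicator bz.D k *\<^sub>R \<delta> k r i)"
 proof -
  have "(\<lambda>x. indicator bz.D (fst x) :: real) \<in> borel_measurable (borel :: ((real ^ 'd) \<times> (real ^ 'd)) measure)"
   by (rule measurable_compose[OF measurable_fst_borel]) simp
  thus ?thesis unfolding jm_def by (intro allI borel_measurable_scaleR jm_compose[OF jm]) auto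
 qed
 moreover have "jm (\<lambda>k r. 0 :: nat \<Rightarrow> complex ^ 'v)" by (simp add: jm_def)
 ultimately have "AE k in lborel. (\<lambda>r i. indicator bz.D k *\<^sub>R \<delta> k r i) \<simeq> (\<lambda>r. 0)"
  by (subst AE_swap_iff)
 hence "AE k in lborel. k \<in> bz.D \<longrightarrow> \<delta> k \<simeq> 0"
  by eventually_elim (auto simp: indicator_def aeq_def fun_eq_iff)
 thus ?thesis
 proof (rule bz.AE_from_cell)
  fix K assume "K \<in> bz.L"
  hence "\<delta> (k + K) \<simeq> \<delta> k" for k using nsec_per[OF \<delta>] by (simp add: RL_eq)
  thus "AE k in lborel. \<delta> k \<simeq> 0 \<longrightarrow> \<delta> (k + K) \<simeq> 0" using aeq_trans by (intro AE_I2) blast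
 qed
qed

text \<open>The image of the Wannier function under \<open>p\<close> is itself the Wannier function
  of a section, \<open>\<chi>'\<close>. The difference of \<open>\<chi>'\<close> and the combination
  of the \<open>\<phi> \<beta>\<close> has a vanishing Wannier function, so
  \<open>wannier_zero\<close> applies. This is the converse of
  \<open>wannier_covariant\<close>.\<close>

lemma bloch_covariant:
 fixes n :: nat and c :: "nat \<Rightarrow> complex"
 assumes p: "p \<in> P" and \<psi>: "nsec \<psi>" and \<phi>: "\<And>\<beta>. \<beta> < n \<Longrightarrow> nsec (\<phi> \<beta>)" and R: "R \<in> BL C" and R': "R' \<in> BL C"
  and cov: "gh p (wannier C \<psi> R) \<simeq> (\<Sum>\<beta><n. scl (c \<beta>) (wannier C (\<phi> \<beta>) R'))"
 shows "AE k in lborel. gh p (\<psi> k) \<simeq>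
   (\<Sum>\<beta><n. scl (c \<beta> * cis (- ((spr p *v k) \<bullet> (R' - rot C p *v R)))) (\<phi> \<beta> (spr p *v k)))"
proof -
 define \<xi> where "\<xi> = R' - rot C p *v R"
 have \<xi>: "\<xi> \<in> BL C" unfolding \<xi>_def by (intro BL_diff R' rot_L p R)
 define \<chi>' where "\<chi>' k = scl (cis (k \<bullet> \<xi>)) (gh p (\<psi> (spr (pinv p) *v k)))" for k
 have \<chi>: "nsec \<chi>'" unfolding \<chi>'_def[abs_def] by (rule nsec_twist[OF nsec_gh[OF p \<psi>] \<xi>])
 have "gh p (wannier C \<psi> R) \<simeq> (\<Sum>\<beta><Suc 0. scl 1 (wannier C \<chi>' (rot C p *v R + \<xi>)))"
 proof (rule wannier_covariant[OF p \<psi> \<chi> R \<xi>])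
  show "AE k in lborel. gh p (\<psi> k) \<simeq> (\<Sum>\<beta><Suc 0. scl (1 * cis (- ((spr p *v k) \<bullet> \<xi>))) (\<chi>' (spr p *v k)))"
   by (rule AE_I2) (simp add: \<chi>'_def scl_scl cis_mult spr_inv[OF p])
 qed
 hence w\<chi>: "gh p (wannier C \<psi> R) \<simeq> wannier C \<chi>' R'" by (simp add: \<xi>_def)
 \<comment> \<open>The difference is written as a single sum of \<open>Suc n\<close> terms, with
   \<open>\<chi>'\<close> first and coefficient 1, to which \<open>wannier_sum\<close>
   applies.\<close>
 define \<phi>' where "\<phi>' = case_nat \<chi>' \<phi>"
 define c' where "c' = case_nat 1 (\<lambda>\<beta>. - c \<beta>)"
 define \<delta> where "\<delta> k = (\<Sum>\<beta><Suc n. scl (c' \<beta>) (\<phi>' \<beta> k))" for k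
 have \<phi>': "nsec (\<phi>' \<beta>)" if "\<beta> < Suc n" for \<beta> using that \<phi> \<chi> by (cases \<beta>) (auto simp: \<phi>'_def)
 have \<delta>: "nsec \<delta>" unfolding \<delta>_def[abs_def] by (rule nsec_sum[OF \<phi>'])
 have neg: "(\<Sum>\<beta><n. scl (- c \<beta>) (f \<beta>)) = - (\<Sum>\<beta><n. scl (c \<beta>) (f \<beta>))" for f :: "nat \<Rightarrow> ('d, 'v) wavefun"
 proof -
  have "scl (- c \<beta>) (f \<beta>) = - scl (c \<beta>) (f \<beta>)" for \<beta> by (simp add: scl_def fun_eq_iff vec_eq_iff)
  thus ?thesis by (simp only: sum_negf)
 qed
 have "wannier C \<delta> R' \<simeq> (\<Sum>\<beta><Suc n. scl (c' \<beta>) (wannier C (\<phi>' \<beta>) R'))"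
  unfolding \<delta>_def[abs_def] by (rule wannier_sum[OF \<phi>' R'])
 also have "(\<Sum>\<beta><Suc n. scl (c' \<beta>) (wannier C (\<phi>' \<beta>) R')) = wannier C \<chi>' R' - (\<Sum>\<beta><n. scl (c \<beta>) (wannier C (\<phi> \<beta>) R'))"
  unfolding sum.lessThan_Suc_shift by (simp only: c'_def \<phi>'_def nat.case neg scl_one) (simp only: diff_conv_add_uminus)
 finally have "wannier C \<delta> R' \<simeq> wannier C \<chi>' R' - (\<Sum>\<beta><n. scl (c \<beta>) (wannier C (\<phi> \<beta>) R'))" .
 moreover have "wannier C \<chi>' R' \<simeq> (\<Sum>\<beta><n. scl (c \<beta>) (wannier C (\<phi> \<beta>) R'))"
  using aeq_trans[OF aeq_sym[OF w\<chi>] cov] .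
 from aeq_diff[OF this aeq_refl[of "\<Sum>\<beta><n. scl (c \<beta>) (wannier C (\<phi> \<beta>) R')"]] have "wannier C \<chi>' R' - (\<Sum>\<beta><n. scl (c \<beta>) (wannier C (\<phi> \<beta>) R')) \<simeq> 0"
  by (simp only: diff_self)
 ultimately have "wannier C \<delta> R' \<simeq> 0" by (rule aeq_trans)
 from AE_orthogonal_matrix[OF spr_orth[OF p] wannier_zero[OF \<delta> R' this]]
 show ?thesis
 proof eventually_elim
  case (elim k)
  let ?k = "spr p *v k"
  have "\<delta> ?k = \<chi>' ?k - (\<Sum>\<beta><n. scl (c \<beta>) (\<phi> \<beta> ?k))"
   unfolding \<delta>_def sum.lessThan_Suc_shift by (simp only: c'_def \<phi>'_def nat.case neg scl_one) (simp only: diff_conv_add_uminus)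
  hence "\<chi>' ?k - (\<Sum>\<beta><n. scl (c \<beta>) (\<phi> \<beta> ?k)) \<simeq> 0" using elim by simp
  from aeq_add[OF this aeq_refl[of "\<Sum>\<beta><n. scl (c \<beta>) (\<phi> \<beta> ?k)"]]
  have "\<chi>' ?k \<simeq> (\<Sum>\<beta><n. scl (c \<beta>) (\<phi> \<beta> ?k))" by (simp only: diff_add_cancel add_0)
  from aeq_scl[OF this, of "cis (- (?k \<bullet> \<xi>))"]
  have "gh p (\<psi> k) \<simeq> (\<Sum>\<beta><n. scl (cis (- (?k \<bullet> \<xi>)) * c \<beta>) (\<phi> \<beta> ?k))"
   by (simp only: \<chi>'_def scl_sum scl_scl cis_mult spr_inv[OF p]) simp
  thus ?case by (simp add: \<xi>_def mult.commute)
 qed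
qed

section \<open>Band representations in terms of Bloch functions\<close>

lemma ghat_comp:
 assumes "p \<in> P" "R \<in> BL C" "q \<in> P" "T \<in> BL C"
 shows "ghat C (p, R) (ghat C (q, T) f) = ghat C ((p, R) \<otimes>\<^bsub>SG\<^esub> (q, T)) f"
proof -
 have c: "(p, R) \<otimes>\<^bsub>SG\<^esub> (q, T) = (p \<otimes>\<^bsub>PG C\<^esub> q, rot C p *v T + R)" by (simp add: space_group_def)
 have TR: "rot C p *v T + R \<in> BL C" by (intro BL_add rot_L assms)
 show ?thesis
  unfolding c ghat_gh[OF assms(1,2)] ghat_gh[OF assms(3,4)] ghat_gh[OF mult_P[OF assms(1,3)] TR] gh_gh[OF assms(1,3), symmetric]
  by (rule ext, rule ext)
    (simp add: gh_def matrix_vector_mult_diff_distrib matrix_vector_right_distrib rot_inv[OF assms(1)] algebra_simps)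
qed

lemma act_comp:
 assumes "p \<in> P" "q \<in> P"
 shows "act C (p, R) (act C (q, T) x) = act C ((p, R) \<otimes>\<^bsub>SG\<^esub> (q, T)) x"
 using assms by (simp add: act_def space_group_def rot_mult matrix_vector_mul_assoc matrix_vector_right_distrib add.assoc)

lemma ghat_one: "ghat C \<one>\<^bsub>SG\<^esub> f = f" and act_one: "act C \<one>\<^bsub>SG\<^esub> x = x"
 by (simp_all add: space_group_def ghat_0 gh_one act_def)

lemma sg_carrier: "g \<in> carrier (SG) \<longleftrightarrow> fst g \<in> P \<and> snd g \<in> BL C"
 by (cases g) (simp add: space_group_def)

definition sites :: "nat \<Rightarrow> (nat \<Rightarrow> real ^ 'd) \<Rightarrow> (real ^ 'd) set" where
 "sites M \<omega> = {\<omega> n + R | n R. n < M \<and> R \<in> BL C}"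

text \<open>Covariance of the Wannier spaces in terms of Bloch functions, for operations without
  translation and for the sites \<open>\<omega> n\<close> themselves. The site goes to
  \<open>\<omega> n'\<close> displaced by \<open>\<xi>\<close>, and \<open>c\<close> is the constant
  matrix; other sites and operations follow by translation.\<close>

definition bloch_cov :: "nat \<Rightarrow> (nat \<Rightarrow> nat) \<Rightarrow> (nat \<Rightarrow> real ^ 'd) \<Rightarrow>
  (nat \<times> nat \<Rightarrow> real ^ 'd \<Rightarrow> ('d, 'v) wavefun) \<Rightarrow> 'p \<Rightarrow> nat \<Rightarrow> nat \<Rightarrow> real ^ 'd \<Rightarrow> (nat \<Rightarrow> nat \<Rightarrow> complex) \<Rightarrow> bool" where
 "bloch_cov M l \<omega> \<psi> p n n' \<xi> c \<longleftrightarrow> n' < M \<and> \<xi> \<in> BL C \<and> rot C p *v \<omega> n = \<omega> n' + \<xi> \<and>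
   (\<forall>\<alpha><l n. AE k in lborel. gh p (\<psi> (n, \<alpha>) k) \<simeq>
    twisted (l n') (c \<alpha>) p \<xi> (\<lambda>\<beta>. \<psi> (n', \<beta>)) k)"

lemma frame_nsec:
 assumes "apf E J \<psi>" "j \<in> J" shows "nsec (\<psi> j)"
proof (rule gsec_nsec)
 show "gsec (\<psi> j)" using assms by (simp add: apf_iff)
 show "nm (\<psi> j k) = 1" for k
  using assms nrm_ons[OF onb_ons, of k J "\<lambda>j. \<psi> j k" "E k" j] by (simp add: apf_iff)
qed

text \<open>For each \<open>g\<close> an inclusion is enough: applied to the inverse of
  \<open>g\<close> it yields the equalities demanded by \<open>band_rep\<close>.\<close>

lemma band_repI:
 fixes M :: nat
 assumes E: "band C m N E" and l: "\<And>n. n < M \<Longrightarrow> 1 \<le> l n"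
  and dist: "\<And>n n'. n < M \<Longrightarrow> n' < M \<Longrightarrow> n \<noteq> n' \<Longrightarrow> \<omega> n - \<omega> n' \<notin> BL C"
  and fr: "apf E {(n, \<alpha>). n < M \<and> \<alpha> < l n} \<psi>"
  and cov: "\<And>p n. p \<in> P \<Longrightarrow> n < M \<Longrightarrow> \<exists>n' \<xi> c. bloch_cov M l \<omega> \<psi> p n n' \<xi> c"
 shows "band_rep C m E"
proof -
 have ns: "nsec (\<psi> (n, \<alpha>))" if "n < M" "\<alpha> < l n" for n \<alpha> by (rule frame_nsec[OF fr]) (use that in simp)
 have act_in: "act C g x \<in> sites M \<omega>" if g: "g \<in> carrier (SG)" and x: "x \<in> sites M \<omega>" for g x
 proof -
  obtain p T where pT: "g = (p, T)" "p \<in> P" "T \<in> BL C" using g by (cases g) (auto simp: sg_carrier)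
  obtain n R where nR: "x = \<omega> n + R" "n < M" "R \<in> BL C" using x by (auto simp: sites_def)
  obtain n' \<xi> c where c: "bloch_cov M l \<omega> \<psi> p n n' \<xi> c" using cov[OF pT(2) nR(2)] by blast
  have "act C g x = \<omega> n' + (\<xi> + (rot C p *v R + T))"
   using c by (simp add: act_def pT nR matrix_vector_right_distrib bloch_cov_def)
  moreover have "\<xi> + (rot C p *v R + T) \<in> BL C" using c by (intro BL_add rot_L pT nR) (simp add: bloch_cov_def)
  moreover have "n' < M" using c by (simp add: bloch_cov_def)
  ultimately show ?thesis unfolding sites_def by blast
 qed
 let ?W = "wannier_space C m M l \<omega> \<psi>"
 have W_in: "ghat C g f \<in> ?W (act C g x)" if g: "g \<in> carrier (SG)" and f: "f \<in> ?W x" for g x f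
 proof -
  obtain p T where pT: "g = (p, T)" "p \<in> P" "T \<in> BL C" using g by (cases g) (auto simp: sg_carrier)
  obtain n R a where nR: "f \<in> wavefuns m" "n < M" "R \<in> BL C" "x = \<omega> n + R"
    and fa: "f \<simeq> (\<Sum>\<alpha><l n. scl (a \<alpha>) (wannier C (\<psi> (n, \<alpha>)) R))"
   using f by (auto simp: wannier_space_def)
  obtain n' \<xi> c where c: "bloch_cov M l \<omega> \<psi> p n n' \<xi> c" using cov[OF pT(2) nR(2)] by blast
  have n': "n' < M" and \<xi>: "\<xi> \<in> BL C" and \<omega>: "rot C p *v \<omega> n = \<omega> n' + \<xi>"
   and cv: "\<And>\<alpha>. \<alpha> < l n \<Longrightarrow> AE k in lborel. gh p (\<psi> (n, \<alpha>) k) \<simeq>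
    twisted (l n') (c \<alpha>) p \<xi> (\<lambda>\<beta>. \<psi> (n', \<beta>)) k"
   using c by (simp_all add: bloch_cov_def)
  let ?R = "rot C p *v R + \<xi>"
  have R': "?R \<in> BL C" by (intro BL_add rot_L pT nR \<xi>)
  \<comment> \<open>Coefficients of the image of \<open>f\<close>: the old ones, conjugated if
    \<open>p\<close> reverses time, multiplied by the matrix \<open>c\<close>.\<close>
  define b where "b \<beta> = (\<Sum>\<alpha><l n. cj (trs C p) (a \<alpha>) * c \<alpha> \<beta>)" for \<beta>
  have "gh p f \<simeq> gh p (\<Sum>\<alpha><l n. scl (a \<alpha>) (wannier C (\<psi> (n, \<alpha>)) R))" by (rule gh_aeq[OF pT(2) fa])
  also have "gh p (\<Sum>\<alpha><l n. scl (a \<alpha>) (wannier C (\<psi> (n, \<alpha>)) R))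
    = (\<Sum>\<alpha><l n. scl (cj (trs C p) (a \<alpha>)) (gh p (wannier C (\<psi> (n, \<alpha>)) R)))"
   by (simp only: gh_sum[OF pT(2)] gh_scl[OF pT(2)])
  finally have 01: "gh p f \<simeq> (\<Sum>\<alpha><l n. scl (cj (trs C p) (a \<alpha>)) (gh p (wannier C (\<psi> (n, \<alpha>)) R)))" .
  have 02: "(\<Sum>\<alpha><l n. scl (cj (trs C p) (a \<alpha>)) (gh p (wannier C (\<psi> (n, \<alpha>)) R)))
    \<simeq> (\<Sum>\<alpha><l n. scl (cj (trs C p) (a \<alpha>)) (\<Sum>\<beta><l n'. scl (c \<alpha> \<beta>) (wannier C (\<psi> (n', \<beta>)) ?R)))"
  proof (intro aeq_sum aeq_scl)
   fix \<alpha> assume "\<alpha> \<in> {..<l n}"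
   hence \<alpha>: "\<alpha> < l n" by simp
   show "gh p (wannier C (\<psi> (n, \<alpha>)) R) \<simeq> (\<Sum>\<beta><l n'. scl (c \<alpha> \<beta>) (wannier C (\<psi> (n', \<beta>)) ?R))"
    by (rule wannier_covariant[OF pT(2) ns[OF nR(2) \<alpha>] ns[OF n'] nR(3) \<xi> cv[OF \<alpha>]])
  qed
  have 03: "(\<Sum>\<alpha><l n. scl (cj (trs C p) (a \<alpha>)) (\<Sum>\<beta><l n'. scl (c \<alpha> \<beta>) (wannier C (\<psi> (n', \<beta>)) ?R)))
    = (\<Sum>\<beta><l n'. scl (b \<beta>) (wannier C (\<psi> (n', \<beta>)) ?R))"
   unfolding scl_sum b_def scl_sum_left scl_scl by (rule sum.swap)
  have 1: "gh p f \<simeq> (\<Sum>\<beta><l n'. scl (b \<beta>) (wannier C (\<psi> (n', \<beta>)) ?R))"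
   using aeq_trans[OF 01 02] unfolding 03 .
  have 11: "ghat C g f = (\<lambda>r. gh p f (r + - T))" unfolding pT(1) ghat_gh[OF pT(2,3)] by simp
  have 12: "(\<lambda>r. gh p f (r + - T)) \<simeq> (\<lambda>r. (\<Sum>\<beta><l n'. scl (b \<beta>) (wannier C (\<psi> (n', \<beta>)) ?R)) (r + - T))"
   by (rule aeq_shift[OF 1])
  have 13: "(\<lambda>r. (\<Sum>\<beta><l n'. scl (b \<beta>) (wannier C (\<psi> (n', \<beta>)) ?R)) (r + - T))
    = (\<Sum>\<beta><l n'. scl (b \<beta>) (\<lambda>r. wannier C (\<psi> (n', \<beta>)) ?R (r - T)))"
   by (rule ext, rule ext) (simp add: sum_fun_apply2 scl_def)
  have 14: "(\<Sum>\<beta><l n'. scl (b \<beta>) (\<lambda>r. wannier C (\<psi> (n', \<beta>)) ?R (r - T)))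
    \<simeq> (\<Sum>\<beta><l n'. scl (b \<beta>) (wannier C (\<psi> (n', \<beta>)) (?R + T)))"
  proof (intro aeq_sum aeq_scl)
   fix \<beta> assume "\<beta> \<in> {..<l n'}"
   thus "(\<lambda>r. wannier C (\<psi> (n', \<beta>)) ?R (r - T)) \<simeq> wannier C (\<psi> (n', \<beta>)) (?R + T)"
    by (intro wannier_shift ns n' pT) simp
  qed
  have 2: "ghat C g f \<simeq> (\<Sum>\<beta><l n'. scl (b \<beta>) (wannier C (\<psi> (n', \<beta>)) (?R + T)))"
   unfolding 11 using aeq_trans[OF 12[unfolded 13] 14] .
  have "act C g x = \<omega> n' + (?R + T)"
   by (simp add: act_def pT(1) nR(4) matrix_vector_right_distrib \<omega>)
  moreover have "?R + T \<in> BL C" by (intro BL_add R' pT)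
  moreover have "ghat C g f \<in> wavefuns m" unfolding pT(1) by (rule ghat_wavefuns[OF pT(2,3) nR(1)])
  ultimately show ?thesis using n' 2 unfolding wannier_space_def
   by (intro CollectI conjI exI[of _ n'] bexI[of _ "?R + T"] exI[of _ b]) 
 qed
 have inv_facts: "inv\<^bsub>SG\<^esub> g \<in> carrier (SG)"
   "ghat C g (ghat C (inv\<^bsub>SG\<^esub> g) f) = f" "act C g (act C (inv\<^bsub>SG\<^esub> g) x) = x"
   "act C (inv\<^bsub>SG\<^esub> g) (act C g x) = x"
  if g: "g \<in> carrier (SG)" for g f x
 proof -
  let ?h = "inv\<^bsub>SG\<^esub> g"
  show h: "?h \<in> carrier (SG)" using group.inv_closed[OF sg_group g] .
  have m: "g \<otimes>\<^bsub>SG\<^esub> ?h = \<one>\<^bsub>SG\<^esub>" "?h \<otimes>\<^bsub>SG\<^esub> g = \<one>\<^bsub>SG\<^esub>"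
   using group.r_inv[OF sg_group g] group.l_inv[OF sg_group g] by auto
  have gg: "g = (fst g, snd g)" "?h = (fst ?h, snd ?h)" by simp_all
  have gP: "fst g \<in> P" "snd g \<in> BL C" "fst ?h \<in> P" "snd ?h \<in> BL C" using g h by (simp_all add: sg_carrier)
  show "ghat C g (ghat C ?h f) = f"
   using ghat_comp[OF gP, of f] m by (simp add: ghat_one)
  show "act C g (act C ?h x) = x" "act C ?h (act C g x) = x"
   using act_comp[OF gP(1,3), of "snd g" "snd ?h" x] act_comp[OF gP(3,1), of "snd ?h" "snd g" x] m
   by (simp_all add: act_one)
 qed
 have inv2: "ghat C (inv\<^bsub>SG\<^esub> g) f \<in> ?W x" if g: "g \<in> carrier (SG)" and f: "f \<in> ?W (act C g x)" for g f x
  using W_in[OF inv_facts(1)[OF g] f] inv_facts(4)[OF g] by simp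
 have X: "act C g ` sites M \<omega> = sites M \<omega>" if g: "g \<in> carrier (SG)" for g
 proof (intro equalityI subsetI)
  fix x assume x: "x \<in> sites M \<omega>"
  show "x \<in> act C g ` sites M \<omega>"
  proof (rule image_eqI)
   show "x = act C g (act C (inv\<^bsub>SG\<^esub> g) x)" by (rule inv_facts(3)[OF g, symmetric])
  qed (rule act_in[OF inv_facts(1)[OF g] x])
 qed (use act_in[OF g] in auto)
 have W: "ghat C g ` ?W x = ?W (act C g x)" if g: "g \<in> carrier (SG)" for g x
 proof (intro equalityI subsetI)
  fix f assume f: "f \<in> ?W (act C g x)"
  show "f \<in> ghat C g ` ?W x"
  proof (rule image_eqI)
   show "f = ghat C g (ghat C (inv\<^bsub>SG\<^esub> g) f)" by (rule inv_facts(2)[OF g, symmetric])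
  qed (rule inv2[OF g f])
 qed (use W_in[OF g] in auto)
 show ?thesis unfolding band_rep_def Let_def sites_def[symmetric]
 proof (rule conjI)
  show "\<exists>N. band C m N E" using E by blast
  show "\<exists>M l \<omega> \<psi>. (\<forall>n<M. 1 \<le> l n) \<and> (\<forall>n<M. \<forall>n'<M. n \<noteq> n' \<longrightarrow> \<omega> n - \<omega> n' \<notin> BL C) \<and>
   apf E {(n, \<alpha>). n < M \<and> \<alpha> < l n} \<psi> \<and>
   (\<forall>g\<in>carrier (SG). act C g ` sites M \<omega> = sites M \<omega> \<and>
    (\<forall>x\<in>sites M \<omega>. ghat C g ` wannier_space C m M l \<omega> \<psi> x = wannier_space C m M l \<omega> \<psi> (act C g x)))"
   by (rule exI[of _ M], rule exI[of _ l], rule exI[of _ \<omega>], rule exI[of _ \<psi>])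
     (intro conjI allI impI ballI l dist fr X W)
 qed
qed

text \<open>Covariance is tested on the Wannier functions with \<open>R = 0\<close> and on
  \<open>g = (p, 0)\<close>, and \<open>bloch_covariant\<close> translates the outcome.\<close>

lemma band_repE:
 assumes "band_rep C m E"
 obtains M l \<omega> \<psi> where "\<And>n. n < M \<Longrightarrow> 1 \<le> l n"
  "\<And>n n'. n < M \<Longrightarrow> n' < M \<Longrightarrow> n \<noteq> n' \<Longrightarrow> \<omega> n - \<omega> n' \<notin> BL C"
  "apf E {(n, \<alpha>). n < M \<and> \<alpha> < l n} \<psi>"
  "\<And>p n. p \<in> P \<Longrightarrow> n < M \<Longrightarrow> \<exists>n' \<xi> c. bloch_cov M l \<omega> \<psi> p n n' \<xi> c"
proof -
 obtain M l \<omega> \<psi> where l: "\<forall>n<M. 1 \<le> l n"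
  and dist: "\<forall>n<M. \<forall>n'<M. n \<noteq> n' \<longrightarrow> \<omega> n - \<omega> n' \<notin> BL C"
  and fr: "apf E {(n, \<alpha>). n < M \<and> \<alpha> < l n} \<psi>"
  and W: "\<forall>g\<in>carrier (SG). act C g ` sites M \<omega> = sites M \<omega> \<and>
    (\<forall>x\<in>sites M \<omega>. ghat C g ` wannier_space C m M l \<omega> \<psi> x = wannier_space C m M l \<omega> \<psi> (act C g x))"
  using assms unfolding band_rep_def Let_def sites_def[symmetric] by (elim conjE exE)
 have ns: "nsec (\<psi> (n, \<alpha>))" if "n < M" "\<alpha> < l n" for n \<alpha> by (rule frame_nsec[OF fr]) (use that in simp)
 have "\<exists>n' \<xi> c. bloch_cov M l \<omega> \<psi> p n n' \<xi> c" if p: "p \<in> P" and n: "n < M" for p n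
 proof -
  have g: "(p, 0) \<in> carrier (SG)" using p by (simp add: sg_carrier)
  have s: "\<omega> n \<in> sites M \<omega>" using n unfolding sites_def by (intro CollectI exI[of _ n] exI[of _ 0]) simp
  have "act C (p, 0) (\<omega> n) \<in> sites M \<omega>" using W g s by blast
  then obtain n' \<xi> where n': "rot C p *v \<omega> n = \<omega> n' + \<xi>" "n' < M" "\<xi> \<in> BL C"
   by (auto simp: sites_def act_def)
  have "\<exists>c. AE k in lborel. gh p (\<psi> (n, \<alpha>) k) \<simeq>
    twisted (l n') c p \<xi> (\<lambda>\<beta>. \<psi> (n', \<beta>)) k" if \<alpha>: "\<alpha> < l n" for \<alpha>
  proof -
   let ?w = "wannier C (\<psi> (n, \<alpha>)) 0"
   have "?w \<in> wannier_space C m M l \<omega> \<psi> (\<omega> n)"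
   proof -
    have "?w = (\<Sum>\<beta><l n. scl (if \<beta> = \<alpha> then 1 else 0) (wannier C (\<psi> (n, \<beta>)) 0))"
    proof -
     have "(\<Sum>\<beta><l n. scl (if \<beta> = \<alpha> then 1 else 0) (wannier C (\<psi> (n, \<beta>)) 0))
      = (\<Sum>\<beta>\<in>{\<alpha>}. scl (if \<beta> = \<alpha> then 1 else 0) (wannier C (\<psi> (n, \<beta>)) 0))"
      by (rule sum.mono_neutral_right) (use \<alpha> in auto)
     thus ?thesis by simp
    qed
    hence "\<exists>c. ?w \<simeq> (\<Sum>\<beta><l n. scl (c \<beta>) (wannier C (\<psi> (n, \<beta>)) 0))"
     by (intro exI[of _ "\<lambda>\<beta>. if \<beta> = \<alpha> then 1 else 0"]) (metis aeq_refl)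
    thus ?thesis unfolding wannier_space_def
     using nsec_wannier_wavefuns[OF ns[OF n \<alpha>]] n by (intro CollectI conjI exI[of _ n] bexI[of _ 0]) auto
   qed
   hence "ghat C (p, 0) ?w \<in> wannier_space C m M l \<omega> \<psi> (act C (p, 0) (\<omega> n))" using W g s by blast
   then obtain n1 R1 c where 1: "n1 < M" "R1 \<in> BL C" "rot C p *v \<omega> n = \<omega> n1 + R1"
     and c: "gh p ?w \<simeq> (\<Sum>\<beta><l n1. scl (c \<beta>) (wannier C (\<psi> (n1, \<beta>)) R1))"
    by (auto simp: wannier_space_def act_def ghat_0[OF p])
   \<comment> \<open>The two descriptions of the image site coincide because the
     \<open>\<omega> n\<close> are inequivalent modulo the lattice; hence one pair
     \<open>n'\<close>, \<open>\<xi>\<close> serves for all \<open>\<alpha>\<close>.\<close>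
   have "\<omega> n1 - \<omega> n' = \<xi> - R1" using 1(3) n'(1) by (simp add: algebra_simps)
   hence "\<omega> n1 - \<omega> n' \<in> BL C" using BL_diff[OF n'(3) 1(2)] by simp
   hence "n1 = n'" using dist 1(1) n'(2) by blast
   moreover from this have "R1 = \<xi>" using 1(3) n'(1) by simp
   ultimately have c: "gh p ?w \<simeq> (\<Sum>\<beta><l n'. scl (c \<beta>) (wannier C (\<psi> (n', \<beta>)) \<xi>))" using c by simp
   have "AE k in lborel. gh p (\<psi> (n, \<alpha>) k) \<simeq>
    (\<Sum>\<beta><l n'. scl (c \<beta> * cis (- ((spr p *v k) \<bullet> (\<xi> - rot C p *v 0)))) (\<psi> (n', \<beta>) (spr p *v k)))"
    by (rule bloch_covariant[OF p ns[OF n \<alpha>] ns[OF n'(2)] BL_zero n'(3) c])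
   thus ?thesis by (intro exI[of _ c]) simp
  qed
  hence "\<exists>c. \<forall>\<alpha><l n. AE k in lborel. gh p (\<psi> (n, \<alpha>) k) \<simeq>
    twisted (l n') (c \<alpha>) p \<xi> (\<lambda>\<beta>. \<psi> (n', \<beta>)) k"
   using bchoice[of "{..<l n}" "\<lambda>\<alpha> c. AE k in lborel. gh p (\<psi> (n, \<alpha>) k) \<simeq>
    twisted (l n') c p \<xi> (\<lambda>\<beta>. \<psi> (n', \<beta>)) k"] unfolding Ball_def lessThan_iff by blast
  then obtain c where "\<forall>\<alpha><l n. AE k in lborel. gh p (\<psi> (n, \<alpha>) k) \<simeq>
    twisted (l n') (c \<alpha>) p \<xi> (\<lambda>\<beta>. \<psi> (n', \<beta>)) k" by (elim exE)
  hence "bloch_cov M l \<omega> \<psi> p n n' \<xi> c" unfolding bloch_cov_def using n' by (intro conjI)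
  thus ?thesis by (intro exI)
 qed
 thus ?thesis by (intro that[of M l \<omega> \<psi>] fr) (use l dist in simp_all)
qed

end

section \<open>Whitney sums\<close>

text \<open>The pairing inside \<open>whitney_sum\<close>; \<open>pr1\<close> and \<open>pr2\<close>
  recover its components, \<open>pr1\<close> for a first entry in \<open>wavefuns m\<close>.\<close>

definition pr :: "nat \<Rightarrow> ('d::finite, 'v::finite) wavefun \<Rightarrow> ('d, 'v) wavefun \<Rightarrow> ('d, 'v) wavefun" where
 "pr m f g = (\<lambda>r i. if i < m then f r i else g r (i - m))"

lemma pr_add: "pr m (f + f') (g + g') = pr m f g + pr m f' g'"
 and pr_diff: "pr m (f - f') (g - g') = pr m f g - pr m f' g'"
 and pr_scl: "pr m (scl c f) (scl c g) = scl c (pr m f g)"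
 and pr_plane_wave: "pr m (plane_wave k f) (plane_wave k g) = plane_wave k (pr m f g)"
 and pr_zero: "pr m 0 0 = 0"
 by (simp_all add: pr_def fun_eq_iff scl_def plane_wave_def)

lemma pr_sum:
 fixes f g :: "'i \<Rightarrow> ('d::finite, 'v::finite) wavefun"
 shows "pr m (\<Sum>i\<in>I. f i) (\<Sum>i\<in>I. g i) = (\<Sum>i\<in>I. pr m (f i) (g i))"
 by (rule ext, rule ext) (simp add: pr_def sum_fun_apply2)

lemma pr_aeq: "f \<simeq> f' \<Longrightarrow> g \<simeq> g' \<Longrightarrow> pr m f g \<simeq> pr m f' g'"
 unfolding aeq_def by (elim eventually_rev_mp, rule AE_I2) (simp add: pr_def fun_eq_iff)

definition pr1 :: "nat \<Rightarrow> ('d::finite, 'v::finite) wavefun \<Rightarrow> ('d, 'v) wavefun" where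
 "pr1 m f = (\<lambda>r i. if i < m then f r i else 0)"

definition pr2 :: "nat \<Rightarrow> ('d::finite, 'v::finite) wavefun \<Rightarrow> ('d, 'v) wavefun" where
 "pr2 m f = (\<lambda>r i. f r (i + m))"

lemma pair_fst_snd: "pr m (pr1 m f) (pr2 m f) = f"
 by (simp add: pr_def pr1_def pr2_def fun_eq_iff)

lemma fst_pair: "f \<in> wavefuns m \<Longrightarrow> pr1 m (pr m f g) = f"
 using wavefuns_zero[of f m] by (auto simp: pr_def pr1_def fun_eq_iff)

lemma snd_pair: "pr2 m (pr m f g) = g"
 by (auto simp: pr_def pr2_def fun_eq_iff)

lemma pr1_add: "pr1 m (f + g) = pr1 m f + pr1 m g"
 and pr1_scl: "pr1 m (scl c f) = scl c (pr1 m f)"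
 and pr1_plane_wave: "pr1 m (plane_wave k f) = plane_wave k (pr1 m f)"
 and pr2_add: "pr2 m (f + g) = pr2 m f + pr2 m g"
 and pr2_scl: "pr2 m (scl c f) = scl c (pr2 m f)"
 and pr2_plane_wave: "pr2 m (plane_wave k f) = plane_wave k (pr2 m f)"
 by (simp_all add: pr1_def pr2_def fun_eq_iff scl_def plane_wave_def)

lemma pr1_aeq: "f \<simeq> g \<Longrightarrow> pr1 m f \<simeq> pr1 m g"
 and pr2_aeq: "f \<simeq> g \<Longrightarrow> pr2 m f \<simeq> pr2 m g"
 unfolding aeq_def pr1_def pr2_def by (auto elim!: eventually_mono)

lemma LV_I:
 assumes "\<And>i. (\<lambda>r. f r i) \<in> borel_measurable borel" "\<And>r i. i \<ge> m \<Longrightarrow> f r i = 0" "loc_sq_integrable f"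
 shows "f \<in> LV m"
 unfolding LV_def wavefuns_def using assms by (intro CollectI conjI allI impI)

lemma LV_sq_integrable: "f \<in> LV m \<Longrightarrow> compact S \<Longrightarrow> set_integrable lborel S (\<lambda>r. (norm (f r i))\<^sup>2)"
 unfolding LV_def loc_sq_integrable_def by blast

lemma pr_LV: assumes f: "f \<in> LV m" and g: "g \<in> LV m" shows "pr m f g \<in> LV (m + m)"
proof -
 have "(\<lambda>r. pr m f g r i) \<in> borel_measurable borel" for i
  using LV_measurable[OF f, of i] LV_measurable[OF g, of "i - m"] by (cases "i < m") (simp_all add: pr_def)
 moreover have "pr m f g r i = 0" if "i \<ge> m + m" for r i
  using wavefuns_zero[of g m "i - m" r] g that by (simp add: pr_def LV_def)
 moreover have "loc_sq_integrable (pr m f g)"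
  unfolding loc_sq_integrable_def
 proof (intro allI impI)
  fix S :: "(real ^ 'a) set" and i :: nat assume S: "compact S"
  show "set_integrable lborel S (\<lambda>r. (norm (pr m f g r i))\<^sup>2)"
   using LV_sq_integrable[OF f S, of i] LV_sq_integrable[OF g S, of "i - m"] by (cases "i < m") (simp_all only: pr_def if_True if_False)
 qed
 ultimately show ?thesis by (rule LV_I)
qed

lemma pr1_LV: assumes f: "f \<in> LV (m + m)" shows "pr1 m f \<in> LV m"
proof -
 have "(\<lambda>r. pr1 m f r i) \<in> borel_measurable borel" for i
  using LV_measurable[OF f, of i] by (cases "i < m") (simp_all add: pr1_def)
 moreover have "pr1 m f r i = 0" if "i \<ge> m" for r i using that by (simp add: pr1_def)
 moreover have "loc_sq_integrable (pr1 m f)"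
  unfolding loc_sq_integrable_def
 proof (intro allI impI)
  fix S :: "(real ^ 'a) set" and i :: nat assume S: "compact S"
  show "set_integrable lborel S (\<lambda>r. (norm (pr1 m f r i))\<^sup>2)"
   using LV_sq_integrable[OF f S, of i] by (cases "i < m") (simp_all add: pr1_def set_integrable_def)
 qed
 ultimately show ?thesis by (rule LV_I)
qed

lemma pr2_LV: assumes f: "f \<in> LV (m + m)" shows "pr2 m f \<in> LV m"
proof -
 have "pr2 m f r i = 0" if "i \<ge> m" for r i
  using wavefuns_zero[of f "m + m" "i + m" r] f that by (simp add: pr2_def LV_def)
 moreover have "loc_sq_integrable (pr2 m f)"
  unfolding loc_sq_integrable_def pr2_def by (intro allI impI LV_sq_integrable[OF f])
 moreover have "(\<lambda>r. pr2 m f r i) \<in> borel_measurable borel" for i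
  unfolding pr2_def by (rule LV_measurable[OF f])
 ultimately show ?thesis by (intro LV_I)
qed

context mcr
begin

text \<open>The locale predicate depends on the crystal alone, so the whole theory can be
  interpreted again at \<open>m + m\<close>.\<close>

lemma doubled: "mcr C" by (rule mcr.intro[OF mc])

lemma inner_pair:
 assumes f: "f \<in> LV m" "f' \<in> LV m" and g: "g \<in> LV m" "g' \<in> LV m"
 shows "inn2 (pr m f g) (pr m f' g') = inn f f' + inn g g'"
proof -
 have split: "(\<Sum>i<m + m. h i) = (\<Sum>i<m. h i) + (\<Sum>i<m. h (i + m))" for h :: "nat \<Rightarrow> complex"
 proof -
  have "(\<Sum>i<m + m. h i) = (\<Sum>i\<in>{..<m} \<union> {m..<m + m}. h i)" by (rule sum.cong) auto
  also have "\<dots> = (\<Sum>i<m. h i) + (\<Sum>i\<in>{m..<m + m}. h i)" by (rule sum.union_disjoint) auto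
  also have "(\<Sum>i\<in>{m..<m + m}. h i) = (\<Sum>i<m. h (i + m))"
   using sum.shift_bounds_nat_ivl[of h 0 m m] by (simp add: lessThan_atLeast0)
  finally show ?thesis .
 qed
 have "(\<Sum>i<m + m. cdot (pr m f g r i) (pr m f' g' r i))
   = (\<Sum>i<m. cdot (f r i) (f' r i)) + (\<Sum>i<m. cdot (g r i) (g' r i))" for r
  unfolding split by (simp add: pr_def)
 thus ?thesis unfolding inner_cell_def
  using set_integral_add(2)[OF inner_integrable[OF f] inner_integrable[OF g]] by simp
qed

lemma norm_pair:
 assumes "f \<in> LV m" "g \<in> LV m"
 shows "nm2 (pr m f g) = sqrt ((nm f)\<^sup>2 + (nm g)\<^sup>2)"
proof -
 have "(nm f)\<^sup>2 = Re (inn f f)" "(nm g)\<^sup>2 = Re (inn g g)"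
  using ip_self assms by simp_all
 thus ?thesis by (simp add: norm_cell_def[of C "m + m"] inner_pair assms)
qed

lemma pair_bloch:
 assumes f: "f \<in> Bl k" and g: "g \<in> Bl k"
 shows "pr m f g \<in> Bl2 k"
 unfolding mcr.bloch_iff[OF doubled]
proof (intro conjI ballI)
 show "pr m f g \<in> LV (m + m)" by (intro pr_LV bloch_LV[OF f] bloch_LV[OF g])
 fix R assume R: "R \<in> BL C"
 have "pr m (\<lambda>r. f (r + R)) (\<lambda>r. g (r + R)) \<simeq> pr m (scl (cis (k \<bullet> R)) f) (scl (cis (k \<bullet> R)) g)"
  using f g R by (intro pr_aeq) (simp_all add: bloch_iff)
 thus "(\<lambda>r. pr m f g (r + R)) \<simeq> scl (cis (k \<bullet> R)) (pr m f g)"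
  by (simp add: pr_scl) (simp add: pr_def)
qed

lemma fst_bloch: assumes f: "f \<in> Bl2 k" shows "pr1 m f \<in> Bl k"
 unfolding bloch_iff
proof (intro conjI ballI)
 show "pr1 m f \<in> LV m" by (rule pr1_LV[OF mcr.bloch_LV[OF doubled f]])
 fix R assume R: "R \<in> BL C"
 have "pr1 m (\<lambda>r. f (r + R)) \<simeq> pr1 m (scl (cis (k \<bullet> R)) f)"
  using f R by (intro pr1_aeq) (simp add: mcr.bloch_iff[OF doubled])
 thus "(\<lambda>r. pr1 m f (r + R)) \<simeq> scl (cis (k \<bullet> R)) (pr1 m f)"
  by (simp add: pr1_scl) (simp add: pr1_def)
qed

lemma snd_bloch: assumes f: "f \<in> Bl2 k" shows "pr2 m f \<in> Bl k"
 unfolding bloch_iff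
proof (intro conjI ballI)
 show "pr2 m f \<in> LV m" by (rule pr2_LV[OF mcr.bloch_LV[OF doubled f]])
 fix R assume R: "R \<in> BL C"
 have "pr2 m (\<lambda>r. f (r + R)) \<simeq> pr2 m (scl (cis (k \<bullet> R)) f)"
  using f R by (intro pr2_aeq) (simp add: mcr.bloch_iff[OF doubled])
 thus "(\<lambda>r. pr2 m f (r + R)) \<simeq> scl (cis (k \<bullet> R)) (pr2 m f)"
  by (simp add: pr2_scl) (simp add: pr2_def)
qed

lemma norm_sq_fst_snd:
 assumes "f \<in> Bl2 k"
 shows "(nm2 f)\<^sup>2 = (nm (pr1 m f))\<^sup>2 + (nm (pr2 m f))\<^sup>2"
 using norm_pair[OF bloch_LV[OF fst_bloch[OF assms]] bloch_LV[OF snd_bloch[OF assms]]] by (simp add: pair_fst_snd)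

lemma proj_expand:
 assumes o: "onb k J e V" and y: "y \<in> V" and z: "z \<in> Bl k"
  and orth: "\<And>h. h \<in> V \<Longrightarrow> inn h (z - y) = 0"
 shows "y \<simeq> (\<Sum>j\<in>J. scl (inn (e j) z) (e j))"
proof -
 have yb: "y \<in> Bl k" using onb_mem[OF o] y by blast
 have "inn (e j) y = inn (e j) z" if j: "j \<in> J" for j
  using orth[OF onb_basis_mem[OF o j]] ip_diff[OF bloch_LV[OF onb_bloch[OF o j]] bloch_LV[OF z] bloch_LV[OF yb]] by simp
 thus ?thesis using onb_aeq_expand[OF o y] by simp
qed

lemma expand_orth:
 assumes o: "onb k J e V" and z: "z \<in> Bl k" and h: "h \<in> V"
 shows "inn h (z - (\<Sum>j\<in>J. scl (inn (e j) z) (e j))) = 0"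
proof -
 have hb: "h \<in> LV m" "nm (res J e h) = 0" using onb_mem[OF o] h bloch_LV by blast+
 have r: "res J e z \<in> LV m" by (rule res_mem[OF onb_ons[OF o] bloch_LV[OF z]])
 have "\<forall>y\<in>LV m. (\<forall>i\<in>J. inn (e i) y = 0) \<longrightarrow> inn h y = 0"
  using res_null_iff[OF onb_ons[OF o] hb(1)] hb(2) by blast
 hence "inn h (res J e z) = 0"
  using r ip_ons_res[OF onb_ons[OF o] _ bloch_LV[OF z]] by blast
 thus ?thesis by (simp add: res_def)
qed

lemma band_proj_props:
 assumes E: "band C m N E" and f: "f \<in> Bl k"
 shows "band_proj C m E k f \<in> E k" and "h \<in> E k \<Longrightarrow> inn h (f - band_proj C m E k f) = 0"
proof -
 obtain e where o: "onb k {..<N} e (E k)" using band_onb[OF E] .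
 have "\<exists>g. g \<in> E k \<and> (\<forall>h\<in>E k. inn h (f - g) = 0)"
  by (intro exI conjI ballI) (rule onb_sum_mem[OF o], rule expand_orth[OF o f])
 from someI_ex[OF this] show "band_proj C m E k f \<in> E k" "h \<in> E k \<Longrightarrow> inn h (f - band_proj C m E k f) = 0"
  unfolding band_proj_def by blast+
qed

text \<open>\<open>band_proj\<close> is a choice among representatives; its coefficients in an
  orthonormal basis of the fibre determine it almost everywhere.\<close>

lemma band_proj_unique:
 assumes E: "band C m N E" and f: "f \<in> Bl k" and y: "y \<in> E k"
  and orth: "\<And>h. h \<in> E k \<Longrightarrow> inn h (f - y) = 0"
 shows "band_proj C m E k f \<simeq> y"
proof -
 obtain e where o: "onb k {..<N} e (E k)" using band_onb[OF E] .
 show ?thesis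
  using aeq_trans[OF proj_expand[OF o band_proj_props(1)[OF E f] f band_proj_props(2)[OF E f]]
    aeq_sym[OF proj_expand[OF o y f orth]]] by blast
qed

lemma whitney_mem:
 assumes E: "band C m N1 E" and E': "band C m N2 E'"
 shows "f \<in> whitney_sum m E E' k \<longleftrightarrow> pr1 m f \<in> E k \<and> pr2 m f \<in> E' k"
proof
 assume "f \<in> whitney_sum m E E' k"
 then obtain g h where g: "f = pr m g h" "g \<in> E k" "h \<in> E' k" by (auto simp: whitney_sum_def pr_def)
 have "g \<in> wavefuns m" using band_bloch[OF E g(2)] by (simp add: bloch_space_def)
 thus "pr1 m f \<in> E k \<and> pr2 m f \<in> E' k" using g by (simp add: fst_pair snd_pair)
next
 assume "pr1 m f \<in> E k \<and> pr2 m f \<in> E' k"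
 hence "\<exists>g h. f = (\<lambda>r i. if i < m then g r i else h r (i - m)) \<and> g \<in> E k \<and> h \<in> E' k"
  using pair_fst_snd[of m f] unfolding pr_def by (intro exI[of _ "pr1 m f"] exI[of _ "pr2 m f"]) simp
 thus "f \<in> whitney_sum m E E' k" unfolding whitney_sum_def by blast
qed

lemma whitney_pair: "g \<in> E k \<Longrightarrow> h \<in> E' k \<Longrightarrow> pr m g h \<in> whitney_sum m E E' k"
 by (auto simp: whitney_sum_def pr_def)

lemma whitney_bloch:
 assumes E: "band C m N1 E" and E': "band C m N2 E'" and f: "f \<in> whitney_sum m E E' k"
 shows "f \<in> Bl2 k"
proof -
 have "pr m (pr1 m f) (pr2 m f) \<in> Bl2 k"
  using f unfolding whitney_mem[OF E E'] by (intro pair_bloch band_bloch[OF E] band_bloch[OF E']) simp_all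
 thus ?thesis by (simp only: pair_fst_snd)
qed

text \<open>The basis consists of the pairs \<open>(e i, 0)\<close> followed by the pairs
  \<open>(0, e' i)\<close>, shifted by \<open>N1\<close>.\<close>

lemma whitney_onb:
 assumes E: "band C m N1 E" and E': "band C m N2 E'"
 shows "\<exists>\<psi>. orthonormal_basis C (m + m) k {..<N1 + N2} \<psi> (whitney_sum m E E' k)"
proof -
 obtain e where e: "onb k {..<N1} e (E k)" using band_onb[OF E] .
 obtain e' where e': "onb k {..<N2} e' (E' k)" using band_onb[OF E'] .
 define a where "a i = (if i < N1 then e i else 0)" for i
 define b where "b i = (if i < N1 then 0 else e' (i - N1))" for i
 let ?\<psi> = "\<lambda>i. pr m (a i) (b i)"
 have eb: "e i \<in> Bl k" "e i \<in> LV m" if "i < N1" for i using onb_bloch[OF e, of i] bloch_LV that by auto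
 have e'b: "e' i \<in> Bl k" "e' i \<in> LV m" if "i < N2" for i using onb_bloch[OF e', of i] bloch_LV that by auto
 have ab: "a i \<in> Bl k" "b i \<in> Bl k" if "i < N1 + N2" for i
  using that eb(1)[of i] e'b(1)[of "i - N1"] by (auto simp: a_def b_def bloch_zero)
 have sa: "(\<Sum>i<N1 + N2. scl (c i) (a i)) = (\<Sum>i<N1. scl (c i) (e i))" for c
 proof -
  have "(\<Sum>i<N1 + N2. scl (c i) (a i)) = (\<Sum>i<N1. scl (c i) (a i))"
   by (rule sum.mono_neutral_right) (auto simp: a_def)
  also have "\<dots> = (\<Sum>i<N1. scl (c i) (e i))" by (rule sum.cong) (auto simp: a_def)
  finally show ?thesis .
 qed
 have sb: "(\<Sum>i<N1 + N2. scl (c i) (b i)) = (\<Sum>i<N2. scl (c (i + N1)) (e' i))" for c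
 proof -
  have "(\<Sum>i<N1 + N2. scl (c i) (b i)) = (\<Sum>i\<in>{0 + N1..<N2 + N1}. scl (c i) (b i))"
   by (rule sum.mono_neutral_right) (auto simp: b_def)
  also have "\<dots> = (\<Sum>i\<in>{0..<N2}. scl (c (i + N1)) (b (i + N1)))" by (rule sum.shift_bounds_nat_ivl)
  also have "\<dots> = (\<Sum>i<N2. scl (c (i + N1)) (e' i))" by (rule sum.cong) (auto simp: b_def)
  finally show ?thesis .
 qed
 have s: "(\<Sum>i<N1 + N2. scl (c i) (?\<psi> i)) = pr m (\<Sum>i<N1. scl (c i) (e i)) (\<Sum>i<N2. scl (c (i + N1)) (e' i))" for c
  unfolding sa[symmetric] sb[symmetric] pr_sum pr_scl ..
 have "orthonormal_basis C (m + m) k {..<N1 + N2} ?\<psi> (whitney_sum m E E' k)"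
  unfolding orthonormal_basis_def
 proof (intro conjI ballI)
  fix i j assume "i \<in> {..<N1 + N2}" "j \<in> {..<N1 + N2}"
  hence ij: "i < N1 + N2" "j < N1 + N2" by simp_all
  show "?\<psi> i \<in> Bl2 k" by (intro pair_bloch ab ij)
  have ip1: "inn (a i) (a j) = (if i = j \<and> i < N1 then 1 else 0)"
   using e eb ij unfolding orthonormal_basis_def by (auto simp: a_def ip_zero ip_zero_left LV_zero)
  have ip2: "inn (b i) (b j) = (if i = j \<and> \<not> i < N1 then 1 else 0)"
  proof (cases "i < N1 \<or> j < N1")
   case True
   thus ?thesis using e'b ij by (auto simp: b_def ip_zero ip_zero_left LV_zero)
  next
   case False
   hence "i - N1 < N2" "j - N1 < N2" "i - N1 = j - N1 \<longleftrightarrow> i = j" using ij by auto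
   thus ?thesis using e' False unfolding orthonormal_basis_def by (simp add: b_def)
  qed
  show "inn2 (?\<psi> i) (?\<psi> j) = (if i = j then 1 else 0)"
   by (subst inner_pair) (auto simp: ip1 ip2 bloch_LV[OF ab(1)] bloch_LV[OF ab(2)] ij)
 next
  show "whitney_sum m E E' k = {f \<in> Bl2 k. \<exists>c. f \<simeq> (\<Sum>j<N1 + N2. scl (c j) (?\<psi> j))}"
  proof (intro Set.set_eqI iffI)
   fix f assume f: "f \<in> whitney_sum m E E' k"
   hence fm: "pr1 m f \<in> E k" "pr2 m f \<in> E' k" unfolding whitney_mem[OF E E'] by simp_all
   define c where "c i = (if i < N1 then inn (e i) (pr1 m f) else inn (e' (i - N1)) (pr2 m f))" for i
   have "pr m (pr1 m f) (pr2 m f) \<simeq>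
     pr m (\<Sum>i<N1. scl (c i) (e i)) (\<Sum>i<N2. scl (c (i + N1)) (e' i))"
    using onb_aeq_expand[OF e fm(1)] onb_aeq_expand[OF e' fm(2)]
    by (intro pr_aeq) (simp_all add: c_def)
   hence "f \<simeq> (\<Sum>j<N1 + N2. scl (c j) (?\<psi> j))" by (simp only: s pair_fst_snd)
   thus "f \<in> {f \<in> Bl2 k. \<exists>c. f \<simeq> (\<Sum>j<N1 + N2. scl (c j) (?\<psi> j))}"
    using whitney_bloch[OF E E' f] by blast
  next
   fix f assume "f \<in> {f \<in> Bl2 k. \<exists>c. f \<simeq> (\<Sum>j<N1 + N2. scl (c j) (?\<psi> j))}"
   then obtain c where f: "f \<in> Bl2 k"
     and c: "f \<simeq> pr m (\<Sum>i<N1. scl (c i) (e i)) (\<Sum>i<N2. scl (c (i + N1)) (e' i))"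
    unfolding s by blast
   have E1: "(\<Sum>i<N1. scl (c i) (e i)) \<in> E k" by (rule onb_sum_mem[OF e])
   hence w: "(\<Sum>i<N1. scl (c i) (e i)) \<in> wavefuns m" using band_bloch[OF E E1] by (simp add: bloch_space_def)
   have 1: "pr1 m f \<simeq> (\<Sum>i<N1. scl (c i) (e i))" using pr1_aeq[OF c, of m] by (simp only: fst_pair[OF w])
   have 2: "pr2 m f \<simeq> (\<Sum>i<N2. scl (c (i + N1)) (e' i))" using pr2_aeq[OF c, of m] by (simp only: snd_pair)
   show "f \<in> whitney_sum m E E' k" unfolding whitney_mem[OF E E']
    using band_aeq[OF E E1 fst_bloch[OF f] aeq_sym[OF 1]] band_aeq[OF E' onb_sum_mem[OF e'] snd_bloch[OF f] aeq_sym[OF 2]] by blast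
  qed
 qed simp
 thus ?thesis by blast
qed

lemma sqrt_sq_le:
 assumes "0 \<le> x" "0 \<le> y" "x \<le> a" "y \<le> b" shows "sqrt (x\<^sup>2 + y\<^sup>2) \<le> sqrt (a\<^sup>2 + b\<^sup>2)"
 using assms by (intro real_sqrt_le_mono add_mono power_mono) auto

lemma bounded_op_pair:
 assumes T: "bounded_op C m T" and T': "bounded_op C m T'"
 shows "bounded_op C (m + m) (\<lambda>f. pr m (T (pr1 m f)) (T' (pr2 m f)))"
proof -
 interpret w: mcr C "m + m" by (rule doubled)
 obtain B where B: "\<And>f. f \<in> Bl 0 \<Longrightarrow> nm (T f) \<le> B * nm f"
  using T unfolding bounded_op_def by blast
 obtain B' where B': "\<And>f. f \<in> Bl 0 \<Longrightarrow> nm (T' f) \<le> B' * nm f"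
  using T' unfolding bounded_op_def by blast
 have Tb: "T f \<in> Bl 0" "T' f \<in> Bl 0" if "f \<in> Bl 0" for f
  using T T' that by (auto simp: bounded_op_def)
 show ?thesis unfolding bounded_op_def
 proof (intro conjI ballI allI)
  fix f assume f: "f \<in> Bl2 0"
  show "pr m (T (pr1 m f)) (T' (pr2 m f)) \<in> Bl2 0"
   by (intro pair_bloch Tb fst_bloch[OF f] snd_bloch[OF f])
  show "pr m (T (pr1 m (scl c f))) (T' (pr2 m (scl c f))) \<simeq>
    scl c (pr m (T (pr1 m f)) (T' (pr2 m f)))" for c
   using T T' fst_bloch[OF f] snd_bloch[OF f] unfolding pr1_scl pr2_scl pr_scl[symmetric] bounded_op_def
   by (intro pr_aeq) simp_all
  fix g assume g: "g \<in> Bl2 0"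
  show "pr m (T (pr1 m (f + g))) (T' (pr2 m (f + g))) \<simeq>
    pr m (T (pr1 m f)) (T' (pr2 m f)) + pr m (T (pr1 m g)) (T' (pr2 m g))"
   using T T' fst_bloch[OF f] snd_bloch[OF f] fst_bloch[OF g] snd_bloch[OF g]
   unfolding pr1_add pr2_add pr_add[symmetric] bounded_op_def
   by (intro pr_aeq) simp_all
 next
  show "\<exists>B. \<forall>f\<in>Bl2 0. nm2 (pr m (T (pr1 m f)) (T' (pr2 m f)))
    \<le> B * nm2 f"
  proof (intro exI ballI)
   fix f assume f: "f \<in> Bl2 0"
   \<comment> \<open>The bounds \<open>B\<close> and \<open>B'\<close> may be negative, so absolute
     values are added to get one constant for both components.\<close>
   let ?a = "nm (pr1 m f)" and ?b = "nm (pr2 m f)" and ?c = "\<bar>B\<bar> + \<bar>B'\<bar>"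
   note fb = fst_bloch[OF f] and sb = snd_bloch[OF f]
   have 1: "0 \<le> ?a" "0 \<le> ?b" by (rule nrm_ge0[OF bloch_LV[OF fb]], rule nrm_ge0[OF bloch_LV[OF sb]])
   have "nm (T (pr1 m f)) \<le> ?c * ?a"
    using B[OF fb] mult_right_mono[of B ?c ?a] 1 by linarith
   moreover have "nm (T' (pr2 m f)) \<le> ?c * ?b"
    using B'[OF sb] mult_right_mono[of B' ?c ?b] 1 by linarith
   ultimately have "nm2 (pr m (T (pr1 m f)) (T' (pr2 m f))) \<le> sqrt ((?c * ?a)\<^sup>2 + (?c * ?b)\<^sup>2)"
    unfolding norm_pair[OF bloch_LV[OF Tb(1)[OF fb]] bloch_LV[OF Tb(2)[OF sb]]]
    by (intro sqrt_sq_le nrm_ge0 bloch_LV[OF Tb(1)[OF fb]] bloch_LV[OF Tb(2)[OF sb]])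
   also have "(?c * ?a)\<^sup>2 + (?c * ?b)\<^sup>2 = ?c\<^sup>2 * (nm2 f)\<^sup>2"
    unfolding norm_sq_fst_snd[OF f] by (simp add: power_mult_distrib distrib_left)
   also have "sqrt \<dots> = ?c * nm2 f"
    using w.nrm_ge0[OF w.bloch_LV[OF f]] by (simp add: real_sqrt_mult)
   finally show "nm2 (pr m (T (pr1 m f)) (T' (pr2 m f))) \<le> ?c * nm2 f" .
  qed
 qed
qed

lemma whitney_proj:
 assumes E: "band C m N1 E" and E': "band C m N2 E'" and f: "f \<in> Bl2 k"
 shows "band_proj C (m + m) (whitney_sum m E E') k f \<simeq>
   pr m (band_proj C m E k (pr1 m f)) (band_proj C m E' k (pr2 m f))"
  (is "_ \<simeq> ?g")
proof -
 note fb = fst_bloch[OF f] and sb = snd_bloch[OF f]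
 let ?a = "band_proj C m E k (pr1 m f)" and ?b = "band_proj C m E' k (pr2 m f)"
 obtain \<psi> where o: "orthonormal_basis C (m + m) k {..<N1 + N2} \<psi> (whitney_sum m E E' k)" using whitney_onb[OF E E'] by blast
 have g: "?g \<in> whitney_sum m E E' k" by (intro whitney_pair band_proj_props(1)[OF E fb] band_proj_props(1)[OF E' sb])
 have ab: "?a \<in> LV m" "?b \<in> LV m"
  using band_bloch[OF E band_proj_props(1)[OF E fb]] band_bloch[OF E' band_proj_props(1)[OF E' sb]] bloch_LV by blast+
 have orth: "inn2 h (f - ?g) = 0" if h: "h \<in> whitney_sum m E E' k" for h
 proof -
  have hm: "pr1 m h \<in> E k" "pr2 m h \<in> E' k" using h unfolding whitney_mem[OF E E'] by simp_all
  have "f - ?g = pr m (pr1 m f - ?a) (pr2 m f - ?b)" by (simp only: pr_diff pair_fst_snd)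
  hence "inn2 h (f - ?g) = inn2 (pr m (pr1 m h) (pr2 m h)) (pr m (pr1 m f - ?a) (pr2 m f - ?b))"
   by (simp only: pair_fst_snd)
  also have "\<dots> = inn (pr1 m h) (pr1 m f - ?a) + inn (pr2 m h) (pr2 m f - ?b)"
   by (rule inner_pair) (intro diff_mem ab bloch_LV[OF fb] bloch_LV[OF sb] bloch_LV[OF band_bloch[OF E hm(1)]]
     bloch_LV[OF band_bloch[OF E' hm(2)]])+
  also have "\<dots> = 0" using band_proj_props(2)[OF E fb hm(1)] band_proj_props(2)[OF E' sb hm(2)] by simp
  finally show ?thesis .
 qed
 interpret w: mcr C "m + m" by (rule doubled)
 let ?p = "band_proj C (m + m) (whitney_sum m E E') k f"
 have "\<exists>g. g \<in> whitney_sum m E E' k \<and> (\<forall>h\<in>whitney_sum m E E' k. inn2 h (f - g) = 0)"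
  using g orth by blast
 from someI_ex[OF this] have "?p \<in> whitney_sum m E E' k" "\<And>h. h \<in> whitney_sum m E E' k \<Longrightarrow> inn2 h (f - ?p) = 0"
  unfolding band_proj_def by blast+
 from aeq_trans[OF w.proj_expand[OF o this(1) f this(2)] aeq_sym[OF w.proj_expand[OF o g f orth]]] show ?thesis .
qed

text \<open>The coefficient operators are pairs of those of the summands. The projection onto the
  sum is such a pair almost everywhere by \<open>whitney_proj\<close>, and Pythagoras preserves the
  relative error \<open>\<epsilon>\<close>.\<close>

lemma whitney_analytic:
 assumes E: "band C m N1 E" and E': "band C m N2 E'"
 shows "analytic_operators C (m + m) (\<lambda>k f. plane_wave (- k) (band_proj C (m + m) (whitney_sum m E E') k (plane_wave k f)))"
  (is "analytic_operators C (m + m) ?T")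
 unfolding analytic_operators_def
proof
 interpret w: mcr C "m + m" by (rule doubled)
 fix k0
 let ?A = "\<lambda>E k f. plane_wave (- k) (band_proj C m E k (plane_wave k f))"
 have "analytic_operators C m (?A E)" "analytic_operators C m (?A E')" using E E' by (simp_all add: band_def)
 note an = this[unfolded analytic_operators_def, THEN spec[of _ k0]]
 from an(1) obtain \<rho> c where \<rho>: "\<rho> > 0" and c: "\<forall>\<alpha>. bounded_op C m (c \<alpha>)"
  and cc: "\<forall>k. (\<forall>i. \<bar>k $ i - k0 $ i\<bar> < \<rho>) \<longrightarrow> (\<forall>\<epsilon>>0. \<forall>\<^sub>F S in finsets. \<forall>f\<in>Bl 0.
    nm (?A E k f - psum (\<lambda>\<alpha>. c \<alpha> f) S (k - k0)) \<le> \<epsilon> * nm f)"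
  by (elim exE conjE) (rule that)
 from an(2) obtain \<rho>' c' where \<rho>': "\<rho>' > 0" and c': "\<forall>\<alpha>. bounded_op C m (c' \<alpha>)"
  and cc': "\<forall>k. (\<forall>i. \<bar>k $ i - k0 $ i\<bar> < \<rho>') \<longrightarrow> (\<forall>\<epsilon>>0. \<forall>\<^sub>F S in finsets. \<forall>f\<in>Bl 0.
    nm (?A E' k f - psum (\<lambda>\<alpha>. c' \<alpha> f) S (k - k0)) \<le> \<epsilon> * nm f)"
  by (elim exE conjE) (rule that)
 let ?c = "\<lambda>\<alpha> f. pr m (c \<alpha> (pr1 m f)) (c' \<alpha> (pr2 m f))"
 have cb: "c \<alpha> f \<in> Bl 0" "c' \<alpha> f \<in> Bl 0" if "f \<in> Bl 0" for \<alpha> f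
  using spec[OF c, of \<alpha>] spec[OF c', of \<alpha>] that unfolding bounded_op_def by blast+
 have "\<forall>\<^sub>F S in finsets. \<forall>f\<in>Bl2 0.
   nm2 (?T k f - psum (\<lambda>\<alpha>. ?c \<alpha> f) S (k - k0)) \<le> \<epsilon> * nm2 f"
  if k: "\<forall>i. \<bar>k $ i - k0 $ i\<bar> < min \<rho> \<rho>'" and \<epsilon>: "\<epsilon> > 0" for k \<epsilon>
 proof -
  have "\<forall>\<^sub>F S in finsets. \<forall>f\<in>Bl 0.
    nm (?A E k f - psum (\<lambda>\<alpha>. c \<alpha> f) S (k - k0)) \<le> \<epsilon> * nm f"
   using cc k \<epsilon> by simp
  moreover have "\<forall>\<^sub>F S in finsets. \<forall>f\<in>Bl 0.
    nm (?A E' k f - psum (\<lambda>\<alpha>. c' \<alpha> f) S (k - k0)) \<le> \<epsilon> * nm f"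
   using cc' k \<epsilon> by simp
  ultimately show ?thesis
  proof eventually_elim
   case (elim S)
   show ?case
   proof
    fix f assume f: "f \<in> Bl2 0"
    let ?f = "pr1 m f" and ?g = "pr2 m f"
    note fb = fst_bloch[OF f] and gb = snd_bloch[OF f]
    let ?a = "?A E k ?f - psum (\<lambda>\<alpha>. c \<alpha> ?f) S (k - k0)"
    let ?b = "?A E' k ?g - psum (\<lambda>\<alpha>. c' \<alpha> ?g) S (k - k0)"
    let ?s = "psum (\<lambda>\<alpha>. ?c \<alpha> f) S (k - k0)"
    have pf: "plane_wave k f \<in> Bl2 k" using w.bloch_plane_wave_0(2)[OF f] .
    have pfb: "plane_wave k ?f \<in> Bl k" "plane_wave k ?g \<in> Bl k"
     using bloch_plane_wave_0(2)[OF fb] bloch_plane_wave_0(2)[OF gb] by blast+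
    have ab: "?a \<in> Bl 0" "?b \<in> Bl 0"
     using band_bloch[OF E band_proj_props(1)[OF E pfb(1)]] band_bloch[OF E' band_proj_props(1)[OF E' pfb(2)]]
     by (auto intro!: bloch_diff bloch_sum bloch_scl cb[OF fb] cb[OF gb] bloch_plane_wave_0(1))
    have "?T k f \<simeq> plane_wave (- k) (pr m (band_proj C m E k (pr1 m (plane_wave k f))) (band_proj C m E' k (pr2 m (plane_wave k f))))"
     by (rule aeq_plane_wave[OF whitney_proj[OF E E' pf]])
    also have "\<dots> = pr m (?A E k ?f) (?A E' k ?g)"
     by (simp only: pr1_plane_wave pr2_plane_wave pr_plane_wave)
    finally have "?T k f - ?s \<simeq> pr m (?A E k ?f) (?A E' k ?g) - ?s" by (rule aeq_diff) simp
    also have "pr m (?A E k ?f) (?A E' k ?g) - ?s = pr m ?a ?b"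
     by (simp only: pr_diff pr_sum pr_scl)
    finally have ae: "?T k f - ?s \<simeq> pr m ?a ?b" .
    have pab: "pr m ?a ?b \<in> LV (m + m)" by (rule w.bloch_LV[OF pair_bloch[OF ab]])
    have Tw: "?T k f - ?s \<in> wavefuns (m + m)"
    proof -
     have "band_proj C (m + m) (whitney_sum m E E') k (plane_wave k f) \<in> whitney_sum m E E' k"
     proof -
      obtain \<psi> where o: "orthonormal_basis C (m + m) k {..<N1 + N2} \<psi> (whitney_sum m E E' k)" using whitney_onb[OF E E'] by blast
      have "\<exists>g. g \<in> whitney_sum m E E' k \<and> (\<forall>h\<in>whitney_sum m E E' k. inn2 h (plane_wave k f - g) = 0)"
       by (intro exI conjI ballI) (rule w.onb_sum_mem[OF o], rule w.expand_orth[OF o pf])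
      from someI_ex[OF this] show ?thesis unfolding band_proj_def by blast
     qed
     hence "?T k f \<in> Bl2 0" using whitney_bloch[OF E E'] w.bloch_plane_wave_0(1) by blast
     hence "?T k f - ?s \<in> Bl2 0"
      by (intro w.bloch_diff w.bloch_sum w.bloch_scl pair_bloch cb fb gb)
     thus ?thesis by (simp add: bloch_space_def)
    qed
    have "nm2 (?T k f - ?s) = nm2 (pr m ?a ?b)"
     by (rule w.norm_aeq[OF w.LV_aeq[OF Tw pab ae] pab ae])
    also have "\<dots> \<le> sqrt ((\<epsilon> * nm ?f)\<^sup>2 + (\<epsilon> * nm ?g)\<^sup>2)"
     unfolding norm_pair[OF bloch_LV[OF ab(1)] bloch_LV[OF ab(2)]]
     using elim fb gb by (intro sqrt_sq_le nrm_ge0[OF bloch_LV[OF ab(1)]] nrm_ge0[OF bloch_LV[OF ab(2)]]) blast+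
    also have "(\<epsilon> * nm ?f)\<^sup>2 + (\<epsilon> * nm ?g)\<^sup>2 = \<epsilon>\<^sup>2 * (nm2 f)\<^sup>2"
     unfolding norm_sq_fst_snd[OF f] by (simp add: power_mult_distrib distrib_left)
    also have "sqrt \<dots> = \<epsilon> * nm2 f"
     using w.nrm_ge0[OF w.bloch_LV[OF f]] \<epsilon> by (simp add: real_sqrt_mult)
    finally show "nm2 (?T k f - ?s) \<le> \<epsilon> * nm2 f" .
   qed
  qed
 qed
 moreover have "\<forall>\<alpha>. bounded_op C (m + m) (?c \<alpha>)" using c c' bounded_op_pair by blast
 ultimately show "\<exists>\<rho>>0. \<exists>c. (\<forall>\<alpha>. bounded_op C (m + m) (c \<alpha>)) \<and> (\<forall>k. (\<forall>i. \<bar>k $ i - k0 $ i\<bar> < \<rho>) \<longrightarrow>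
   (\<forall>\<epsilon>>0. \<forall>\<^sub>F S in finsets. \<forall>f\<in>Bl2 0.
    nm2 (?T k f - psum (\<lambda>\<alpha>. c \<alpha> f) S (k - k0)) \<le> \<epsilon> * nm2 f))"
  using \<rho> \<rho>' by (intro exI[of _ "min \<rho> \<rho>'"] conjI exI[of _ ?c]) auto
qed

lemma ghat_pair: "p \<in> P \<Longrightarrow> R \<in> BL C \<Longrightarrow> ghat C (p, R) (pr m f g) = pr m (ghat C (p, R) f) (ghat C (p, R) g)"
 by (simp add: ghat_gh gh_def pr_def fun_eq_iff)

lemma gh_pair: "gh p (pr m f g) = pr m (gh p f) (gh p g)"
 by (simp add: gh_def pr_def fun_eq_iff)

lemma whitney_band:
 assumes E: "band C m N1 E" and E': "band C m N2 E'"
 shows "band C (m + m) (N1 + N2) (whitney_sum m E E')"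
 unfolding band_def
proof (intro conjI allI ballI)
 show "1 \<le> m + m" using E by (simp add: band_def)
 show "\<exists>\<psi>. orthonormal_basis C (m + m) k {..<N1 + N2} \<psi> (whitney_sum m E E' k)" for k by (rule whitney_onb[OF E E'])
 show "whitney_sum m E E' (k + K) = whitney_sum m E E' k" if "K \<in> RL C" for k K
  using band_RL[OF E that] band_RL[OF E' that] by (simp add: whitney_sum_def)
 show "analytic_operators C (m + m) (\<lambda>k f. plane_wave (- k) (band_proj C (m + m) (whitney_sum m E E') k (plane_wave k f)))"
  by (rule whitney_analytic[OF E E'])
 fix g k assume g: "g \<in> carrier (SG)"
 then obtain p R where pR: "g = (p, R)" "p \<in> P" "R \<in> BL C" by (cases g) (simp add: sg_carrier)
 have s: "ghat C g ` E k = E (trs C (fst g) *\<^sub>R (rot C (fst g) *v k))" "ghat C g ` E' k = E' (trs C (fst g) *\<^sub>R (rot C (fst g) *v k))"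
  using E E' g by (simp_all add: band_def)
 have w: "whitney_sum m E E' q = (\<lambda>(f, f'). pr m f f') ` (E q \<times> E' q)" for q
  by (auto simp: whitney_sum_def pr_def)
 have "ghat C g ` whitney_sum m E E' k = (\<lambda>(f, f'). pr m f f') ` (ghat C g ` E k \<times> ghat C g ` E' k)"
  unfolding w image_image pR(1) by (force simp: ghat_pair[OF pR(2,3)])
 thus "ghat C g ` whitney_sum m E E' k = whitney_sum m E E' (trs C (fst g) *\<^sub>R (rot C (fst g) *v k))"
  unfolding s w .
qed

lemma gsec_pair:
 assumes \<psi>: "gsec \<psi>" and \<phi>: "gsec \<phi>"
 shows "mcr.gsec C (m + m) (\<lambda>k. pr m (\<psi> k) (\<phi> k))"
proof -
 interpret w: mcr C "m + m" by (rule doubled)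
 show ?thesis unfolding w.gsec_def
 proof (intro conjI allI ballI)
  show "pr m (\<psi> k) (\<phi> k) \<in> Bl2 k" for k by (intro pair_bloch gsec_bloch \<psi> \<phi>)
  show "pr m (\<psi> (k + K)) (\<phi> (k + K)) \<simeq> pr m (\<psi> k) (\<phi> k)" if "K \<in> RL C" for k K
   by (intro pr_aeq gsec_per \<psi> \<phi> that)
  show "(\<lambda>x. pr m (\<psi> (fst x)) (\<phi> (fst x)) (snd x) i) \<in> borel_measurable borel" for i
   using gsec_meas[OF \<psi>, of i] gsec_meas[OF \<phi>, of "i - m"] by (cases "i < m") (simp_all only: pr_def if_True if_False)
  fix k0
  obtain \<rho> c where \<rho>: "\<rho> > 0" and c: "\<forall>\<alpha>. c \<alpha> \<in> Bl 0"
   and cc: "\<forall>k. (\<forall>i. \<bar>k $ i - k0 $ i\<bar> < \<rho>) \<longrightarrow> ((\<lambda>S. nm (plane_wave (- k) (\<psi> k) - psum c S (k - k0))) \<longlongrightarrow> 0)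
     finsets"
   using gsec_avec[OF \<psi>, of k0] unfolding avec_at_def by (elim exE conjE) (rule that)
  obtain \<rho>' c' where \<rho>': "\<rho>' > 0" and c': "\<forall>\<alpha>. c' \<alpha> \<in> Bl 0"
   and cc': "\<forall>k. (\<forall>i. \<bar>k $ i - k0 $ i\<bar> < \<rho>') \<longrightarrow> ((\<lambda>S. nm (plane_wave (- k) (\<phi> k) - psum c' S (k - k0))) \<longlongrightarrow> 0)
     finsets"
   using gsec_avec[OF \<phi>, of k0] unfolding avec_at_def by (elim exE conjE) (rule that)
  let ?c = "\<lambda>\<alpha>. pr m (c \<alpha>) (c' \<alpha>)"
  have "((\<lambda>S. nm2 (plane_wave (- k) (pr m (\<psi> k) (\<phi> k)) - psum ?c S (k - k0))) \<longlongrightarrow> 0)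
     finsets" if k: "\<forall>i. \<bar>k $ i - k0 $ i\<bar> < min \<rho> \<rho>'" for k
  proof -
   let ?a = "\<lambda>S. plane_wave (- k) (\<psi> k) - psum c S (k - k0)"
   let ?b = "\<lambda>S. plane_wave (- k) (\<phi> k) - psum c' S (k - k0)"
   have ab: "?a S \<in> LV m" "?b S \<in> LV m" for S
    by (intro diff_mem sum_mem LV_scl LV_plane_wave gsec_LV \<psi> \<phi> bloch_LV[OF spec[OF c]] bloch_LV[OF spec[OF c']])+
   have t: "((\<lambda>S. nm (?a S)) \<longlongrightarrow> 0) finsets"
    "((\<lambda>S. nm (?b S)) \<longlongrightarrow> 0) finsets"
    using cc cc' k by simp_all
   have "((\<lambda>S. sqrt ((nm (?a S))\<^sup>2 + (nm (?b S))\<^sup>2)) \<longlongrightarrow> sqrt (0\<^sup>2 + 0\<^sup>2)) finsets"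
    by (intro tendsto_real_sqrt tendsto_add tendsto_power t)
   moreover have "sqrt ((nm (?a S))\<^sup>2 + (nm (?b S))\<^sup>2)
    = nm2 (plane_wave (- k) (pr m (\<psi> k) (\<phi> k)) - psum ?c S (k - k0))" for S
    unfolding norm_pair[OF ab, symmetric] by (simp only: pr_diff pr_sum pr_scl pr_plane_wave)
   ultimately show ?thesis by simp
  qed
  thus "w.avec_at k0 (\<lambda>k. plane_wave (- k) (pr m (\<psi> k) (\<phi> k)))"
   unfolding w.avec_at_def using \<rho> \<rho>' c c'
   by (intro exI[of _ "min \<rho> \<rho>'"] conjI exI[of _ ?c]) (simp, blast intro: pair_bloch, blast)
 qed
qed

lemma gsec_add: "gsec \<phi> \<Longrightarrow> gsec \<psi> \<Longrightarrow> gsec (\<lambda>k. \<phi> k + \<psi> k)"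
 using gsec_sum[of "{False, True}" "\<lambda>_ _. 1" "\<lambda>b. if b then \<phi> else \<psi>"] by (simp add: add.commute)

text \<open>\<open>gh p\<close> carries the fibre at \<open>k\<close> onto the fibre at
  \<open>spr p *v k\<close> and preserves orthogonality, so it carries the projection of
  \<open>f\<close> to the projection of the image of \<open>f\<close>.\<close>

lemma gh_expand:
 assumes S: "band C m N S" and o: "\<And>k. onb k {..<N} (\<lambda>l. b l k) (S k)"
  and p: "p \<in> P" and f: "f \<in> Bl k"
 shows "gh p (\<Sum>l<N. scl (inn (b l k) f) (b l k)) \<simeq>
   (\<Sum>l<N. scl (inn (b l (spr p *v k)) (gh p f)) (b l (spr p *v k)))"
proof (rule proj_expand[OF o _ gh_bloch[OF p f]])
 let ?y = "\<Sum>l<N. scl (inn (b l k) f) (b l k)"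
 have y: "?y \<in> S k" by (rule onb_sum_mem[OF o])
 show "gh p ?y \<in> S (spr p *v k)" by (rule band_gh[OF S p y])
 fix h assume "h \<in> S (spr p *v k)"
 then obtain h' where h': "h = gh p h'" "h' \<in> S k" using band_symm[OF S p, of k] by blast
 have "inn (gh p h') (gh p (f - ?y)) = cj (trs C p) (inn h' (f - ?y))"
  by (rule inner_gh[OF p band_bloch[OF S h'(2)] bloch_diff[OF f band_bloch[OF S y]]])
 also have "\<dots> = 0" using expand_orth[OF o f h'(2)] by simp
 finally show "inn h (gh p f - gh p ?y) = 0" by (simp only: h' gh_diff[OF p])
qed

text \<open>Sending \<open>f\<close> to the pair of \<open>f - Q k f\<close> and
  \<open>Q k f\<close> is a fibrewise isometry of \<open>E\<close> onto the sum of \<open>T\<close>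
  and \<open>S\<close> that commutes with the group. Sites, multiplicities and matrices of
  \<open>E\<close> therefore serve for the sum unchanged.\<close>

lemma whitney_band_rep:
 assumes sp: "splits_into C m E [S, T]" and E: "band C m N E" and S: "band C m N1 S" and T: "band C m N2 T"
  and BE: "band_rep C m E" and Sf: "apf S J \<phi>"
 shows "band_rep C (m + m) (whitney_sum m T S)"
proof -
 interpret w: mcr C "m + m" by (rule doubled)
 obtain M l \<omega> \<psi> where l: "\<And>n. n < M \<Longrightarrow> 1 \<le> l n"
  and dist: "\<And>n n'. n < M \<Longrightarrow> n' < M \<Longrightarrow> n \<noteq> n' \<Longrightarrow> \<omega> n - \<omega> n' \<notin> BL C"
  and fr: "apf E {(n, \<alpha>). n < M \<and> \<alpha> < l n} \<psi>"
  and cov: "\<And>p n. p \<in> P \<Longrightarrow> n < M \<Longrightarrow> \<exists>n' \<xi> c. bloch_cov M l \<omega> \<psi> p n n' \<xi> c"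
  using band_repE[OF BE] by blast
 let ?I = "{(n, \<alpha>). n < M \<and> \<alpha> < l n}"
 obtain b where b: "\<And>i. i < N1 \<Longrightarrow> gsec (b i)" "\<And>k. onb k {..<N1} (\<lambda>i. b i k) (S k)"
  using apf_reindex[OF Sf S] by blast
 define Q where "Q k f = (\<Sum>i<N1. scl (inn (b i k) f) (b i k))" for k f
 define q where "q j k = pr m (\<psi> j k - Q k (\<psi> j k)) (Q k (\<psi> j k))" for j k
 have Eo: "onb k ?I (\<lambda>j. \<psi> j k) (E k)" for k using fr by (simp add: analytic_periodic_frame_def)
 have Eg: "gsec (\<psi> j)" if "j \<in> ?I" for j using fr that unfolding apf_iff by blast
 have bL: "b i k \<in> LV m" if "i < N1" for i k using gsec_LV[OF b(1)[OF that]] .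
 have Qg: "gsec (\<lambda>k. Q k (\<psi> j k))" if j: "j \<in> ?I" for j
  unfolding Q_def by (rule gsec_sum) (use b(1) Eg[OF j] gsec_inner in auto)
 have qg: "w.gsec (q j)" if j: "j \<in> ?I" for j
 proof -
  have "gsec (\<lambda>k. \<psi> j k + scl (- 1) (Q k (\<psi> j k)))" by (intro gsec_add gsec_scale Eg[OF j] Qg[OF j]) simp
  hence "gsec (\<lambda>k. \<psi> j k - Q k (\<psi> j k))" by (simp add: scl_minus_one)
  from gsec_pair[OF this Qg[OF j]] show ?thesis unfolding q_def[abs_def] .
 qed
 have QS: "Q k f \<in> S k" for k f unfolding Q_def by (rule onb_sum_mem[OF b(2)])
 \<comment> \<open>The component \<open>g\<close> of \<open>f\<close> in \<open>S\<close> has the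
   defining property of the projection, so it agrees with \<open>Q k f\<close> almost everywhere,
   and \<open>f - Q k f\<close> with the component in \<open>T\<close>.\<close>
 have QT: "f - Q k f \<in> T k" if f: "f \<in> E k" for k f
 proof -
  obtain g h where gh: "g \<in> S k" "h \<in> T k" "f \<simeq> g + h" using f splits_two(2)[OF sp, of f k] by blast
  have fb: "f \<in> Bl k" by (rule band_bloch[OF E f])
  note gb = band_bloch[OF S gh(1)] and hb = band_bloch[OF T gh(2)]
  have "inn x (f - g) = 0" if x: "x \<in> S k" for x
  proof -
   have "f - g \<simeq> h" using aeq_diff[OF gh(3) aeq_refl[of g]] by (simp only: add_diff_cancel_left')
   hence "inn x (f - g) = inn x h"
    by (intro inner_aeq bloch_LV[OF band_bloch[OF S x]] bloch_LV[OF bloch_diff[OF fb gb]] bloch_LV[OF hb]) simp_all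
   thus ?thesis using splits_two(1)[OF sp x gh(2)] by simp
  qed
  from proj_expand[OF b(2) gh(1) fb this] have "g \<simeq> Q k f" unfolding Q_def .
  from aeq_diff[OF gh(3) aeq_sym[OF this]]
  have "h \<simeq> f - Q k f"
   using aeq_diff[OF gh(3) aeq_sym[OF \<open>g \<simeq> Q k f\<close>]] by (simp only: add_diff_cancel_left' aeq_sym)
  from band_aeq[OF T gh(2) bloch_diff[OF fb band_bloch[OF S QS]] this] show ?thesis .
 qed
 have qo: "orthonormal_basis C (m + m) k ?I (\<lambda>j. q j k) (whitney_sum m T S k)" for k
 proof -
  obtain \<chi>' where o: "orthonormal_basis C (m + m) k {..<N2 + N1} \<chi>' (whitney_sum m T S k)" using whitney_onb[OF T S] by blast
  have mem: "\<psi> j k \<in> E k" if "j \<in> ?I" for j using onb_basis_mem[OF Eo that] .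
  have inn: "inn2 (q i k) (q j k) = inn (\<psi> i k) (\<psi> j k)" if ij: "i \<in> ?I" "j \<in> ?I" for i j
  proof -
   let ?a = "\<lambda>i. \<psi> i k - Q k (\<psi> i k)" and ?b = "\<lambda>i. Q k (\<psi> i k)"
   have L: "?a i \<in> LV m" "?b i \<in> LV m" "?a j \<in> LV m" "?b j \<in> LV m"
    using ij by (auto intro!: bloch_LV[OF band_bloch[OF T QT[OF mem]]] bloch_LV[OF band_bloch[OF S QS]] simp del: mem_Collect_eq)
   have z: "inn (?b i) (?a j) = 0" "inn (?b j) (?a i) = 0"
    using splits_two(1)[OF sp QS QT[OF mem]] ij by blast+
   have "inn (?a i) (?b j) = cnj (inn (?b j) (?a i))" by (rule ip_cnj[OF L(4) L(1)])
   hence z': "inn (?a i) (?b j) = 0" using z by simp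
   have "inn (\<psi> i k) (\<psi> j k) = inn (?a i + ?b i) (?a j + ?b j)" by simp
   also have "\<dots> = inn (?a i) (?a j) + inn (?b i) (?b j)"
    unfolding ip_add[OF add_mem[OF L(1,2)] L(3,4)] ip_add_left[OF L(3) L(1,2)] ip_add_left[OF L(4) L(1,2)]
    using z z' by (simp del: diff_add_cancel)
   finally show ?thesis unfolding q_def using inner_pair[OF L(1,3) L(2,4)] by simp
  qed
  have card: "card ?I = card {..<N2 + N1}"
  proof -
   obtain e where e: "onb k {..<N} e (E k)" using band_onb[OF E] .
   have "card ?I = N" using onb_card[OF Eo e] by simp
   thus ?thesis using splits_rank[OF sp E S T] by simp
  qed
  have "w.ons ?I (\<lambda>j. q j k)" unfolding w.ons_def
  proof (intro conjI ballI)
   show "finite ?I" using Eo[of k] unfolding orthonormal_basis_def by blast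
   show "q j k \<in> LV (m + m)" if "j \<in> ?I" for j using w.gsec_LV[OF qg[OF that]] .
   show "inn2 (q i k) (q j k) = (if i = j then 1 else 0)" if "i \<in> ?I" "j \<in> ?I" for i j
    unfolding inn[OF that] using Eo[of k] that unfolding orthonormal_basis_def by (elim conjE) (drule (1) bspec, drule (1) bspec)
  qed
  moreover have "q j k \<in> whitney_sum m T S k" if "j \<in> ?I" for j
   unfolding q_def by (rule whitney_pair) (rule QT[OF mem[OF that]], rule QS)
  ultimately show ?thesis using w.onb_of_ons[OF o _ _ card] by blast
 qed
 show ?thesis
 proof (rule w.band_repI[where M = M and l = l and \<omega> = \<omega> and \<psi> = q, OF whitney_band[OF T S] l dist])
  show "analytic_periodic_frame C (m + m) (whitney_sum m T S) ?I q"
   unfolding w.apf_iff using qo qg by blast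
  fix p n assume p: "p \<in> P" and n: "n < M"
  obtain n' \<xi> c where c: "bloch_cov M l \<omega> \<psi> p n n' \<xi> c" using cov[OF p n] by blast
  have n': "n' < M" "\<xi> \<in> BL C" "rot C p *v \<omega> n = \<omega> n' + \<xi>" using c by (simp_all add: bloch_cov_def)
  have "bloch_cov M l \<omega> q p n n' \<xi> c" unfolding bloch_cov_def
  proof (intro conjI n' allI impI)
   fix \<alpha> assume \<alpha>: "\<alpha> < l n"
   have "AE k in lborel. gh p (\<psi> (n, \<alpha>) k) \<simeq>
    twisted (l n') (c \<alpha>) p \<xi> (\<lambda>\<beta>. \<psi> (n', \<beta>)) k"
    using c \<alpha> by (simp add: bloch_cov_def)
   thus "AE k in lborel. gh p (q (n, \<alpha>) k) \<simeq>
    twisted (l n') (c \<alpha>) p \<xi> (\<lambda>\<beta>. q (n', \<beta>)) k"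
   proof eventually_elim
    case (elim k)
    let ?k = "spr p *v k" and ?d = "\<lambda>\<beta>. c \<alpha> \<beta> * cis (- ((spr p *v k) \<bullet> \<xi>))"
    let ?s = "\<Sum>\<beta><l n'. scl (?d \<beta>) (\<psi> (n', \<beta>) ?k)"
    have \<psi>b: "\<psi> (n', \<beta>) ?k \<in> Bl ?k" if "\<beta> < l n'" for \<beta> using gsec_bloch[OF Eg] n' that by simp
    have \<psi>k: "\<psi> (n, \<alpha>) k \<in> Bl k" using gsec_bloch[OF Eg] n \<alpha> by simp
    have sb: "?s \<in> Bl ?k" by (intro bloch_sum bloch_scl \<psi>b) simp
    have 1: "gh p (Q k (\<psi> (n, \<alpha>) k)) \<simeq> Q ?k (gh p (\<psi> (n, \<alpha>) k))"
     unfolding Q_def by (rule gh_expand[OF S b(2) p \<psi>k])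
    have 2: "Q ?k (gh p (\<psi> (n, \<alpha>) k)) = Q ?k ?s"
     unfolding Q_def by (intro sum.cong refl arg_cong2[where f = scl]
       inner_aeq bL bloch_LV[OF gh_bloch[OF p \<psi>k]] bloch_LV[OF sb] elim) simp_all
    have 3: "Q ?k ?s = (\<Sum>\<beta><l n'. scl (?d \<beta>) (Q ?k (\<psi> (n', \<beta>) ?k)))"
    proof -
     have "inn (b i ?k) ?s = (\<Sum>\<beta><l n'. ?d \<beta> * inn (b i ?k) (\<psi> (n', \<beta>) ?k))" if i: "i < N1" for i
     proof -
      have \<psi>L: "\<psi> (n', \<beta>) ?k \<in> LV m" if "\<beta> \<in> {..<l n'}" for \<beta> using bloch_LV[OF \<psi>b[of \<beta>]] that by simp
      have "inn (b i ?k) ?s = (\<Sum>\<beta><l n'. inn (b i ?k) (scl (?d \<beta>) (\<psi> (n', \<beta>) ?k)))"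
       by (rule ip_sum[OF bL[OF i]]) (rule LV_scl[OF \<psi>L])
      also have "\<dots> = (\<Sum>\<beta><l n'. ?d \<beta> * inn (b i ?k) (\<psi> (n', \<beta>) ?k))"
       by (intro sum.cong refl ip_smul[OF bL[OF i]] \<psi>L)
      finally show ?thesis .
     qed
     hence "Q ?k ?s = (\<Sum>i<N1. \<Sum>\<beta><l n'. scl (?d \<beta>) (scl (inn (b i ?k) (\<psi> (n', \<beta>) ?k)) (b i ?k)))"
      unfolding Q_def by (intro sum.cong refl) (simp only: scl_sum_left scl_scl lessThan_iff)
     also have "\<dots> = (\<Sum>\<beta><l n'. scl (?d \<beta>) (Q ?k (\<psi> (n', \<beta>) ?k)))" unfolding Q_def scl_sum by (rule sum.swap)
     finally show ?thesis .
    qed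
    have q1: "gh p (Q k (\<psi> (n, \<alpha>) k)) \<simeq> (\<Sum>\<beta><l n'. scl (?d \<beta>) (Q ?k (\<psi> (n', \<beta>) ?k)))"
     using 1 unfolding 2 3 .
    have e1: "gh p (q (n, \<alpha>) k) = pr m (gh p (\<psi> (n, \<alpha>) k) - gh p (Q k (\<psi> (n, \<alpha>) k))) (gh p (Q k (\<psi> (n, \<alpha>) k)))"
     by (simp only: q_def gh_pair gh_diff[OF p])
    have e2: "pr m (gh p (\<psi> (n, \<alpha>) k) - gh p (Q k (\<psi> (n, \<alpha>) k))) (gh p (Q k (\<psi> (n, \<alpha>) k))) \<simeq> pr m (?s - (\<Sum>\<beta><l n'. scl (?d \<beta>) (Q ?k (\<psi> (n', \<beta>) ?k)))) (\<Sum>\<beta><l n'. scl (?d \<beta>) (Q ?k (\<psi> (n', \<beta>) ?k)))"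
     by (intro pr_aeq aeq_diff elim q1)
    have e3: "pr m (?s - (\<Sum>\<beta><l n'. scl (?d \<beta>) (Q ?k (\<psi> (n', \<beta>) ?k)))) (\<Sum>\<beta><l n'. scl (?d \<beta>) (Q ?k (\<psi> (n', \<beta>) ?k)))
      = (\<Sum>\<beta><l n'. scl (?d \<beta>) (q (n', \<beta>) ?k))"
     by (simp only: q_def pr_scl[symmetric] pr_sum[symmetric] scl_diff_right sum_subtractf)
    show ?case using e2 unfolding e1 e3 .
   qed
  qed
  thus "\<exists>n' \<xi> c. bloch_cov M l \<omega> q p n n' \<xi> c" by blast
 qed
qed

end

section \<open>Analytic frames of simple bands with vanishing Chern class\<close>

context mcr
begin

section \<open>Partitions of unity and Cech coboundaries on the Brillouin torus\<close>

lemma RL_shift_image: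
 assumes U: "\<And>k K. k \<in> U \<Longrightarrow> K \<in> RL C \<Longrightarrow> k + K \<in> U" and K: "K \<in> RL C"
 shows "(\<lambda>k. k + K) ` U = U"
proof (intro equalityI subsetI)
 fix k assume "k \<in> U"
 thus "k \<in> (\<lambda>k. k + K) ` U" using U[of k "- K"] RL_minus[OF K] by (intro image_eqI[of _ _ "k + - K"]) auto
qed (use U K in auto)

text \<open>By periodicity the minimum over the compact closure of the zone is a minimum over all
  wavevectors.\<close>

lemma periodic_bounded_below:
 fixes f :: "real ^ 'd \<Rightarrow> real"
 assumes f: "continuous_on UNIV f" "\<And>k K. K \<in> RL C \<Longrightarrow> f (k + K) = f k" and pos: "\<And>k. 0 < f k"
 obtains \<delta> where "0 < \<delta>" "\<And>k. \<delta> \<le> f k"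
proof -
 have c: "compact (closure bz.D)" using bz.D_bounded by (simp add: compact_closure)
 have ne: "closure bz.D \<noteq> {}" using bz.fl_D[of 0] by auto
 obtain k0 where k0: "\<And>k. k \<in> closure bz.D \<Longrightarrow> f k0 \<le> f k"
  using continuous_attains_inf[OF c ne continuous_on_subset[OF f(1)]] by blast
 have "f k0 \<le> f k" for k
 proof -
  have "f (k - bz.fl k + bz.fl k) = f (k - bz.fl k)" by (rule f(2)) (simp add: RL_eq bz.fl_L)
  moreover have "f k0 \<le> f (k - bz.fl k)" by (intro k0 subsetD[OF closure_subset] bz.fl_D)
  ultimately show ?thesis by simp
 qed
 thus ?thesis using that[of "f k0"] pos by blast
qed

text \<open>Truncating the distance functions at \<open>\<delta>\<close> confines them to closed
  sets \<open>S c\<close> inside \<open>U c\<close>, so that extension by zero is continuous later.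
  The total stays positive, because the distances add up to at least \<open>\<mu>\<close> and the
  truncation costs at most half of that.\<close>

lemma torus_partition_of_unity:
 assumes U: "torus_cover C n U"
 obtains \<chi>' :: "nat \<Rightarrow> real ^ 'd \<Rightarrow> real" and S where "\<And>c. continuous_on UNIV (\<chi>' c)"
  "\<And>c k K. c < n \<Longrightarrow> K \<in> RL C \<Longrightarrow> \<chi>' c (k + K) = \<chi>' c k"
  "\<And>c. closed (S c)" "\<And>c. c < n \<Longrightarrow> S c \<subseteq> U c" "\<And>c k. k \<notin> S c \<Longrightarrow> \<chi>' c k = 0" "\<And>k. (\<Sum>c<n. \<chi>' c k) = 1"
proof -
 have Uo: "open (U a)" and Up: "\<And>k K. k \<in> U a \<Longrightarrow> K \<in> RL C \<Longrightarrow> k + K \<in> U a" if "a < n" for a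
  using U that by (auto simp: torus_cover_def)
 have cov: "\<exists>a<n. k \<in> U a" for k using U by (auto simp: torus_cover_def)
 \<comment> \<open>\<open>infdist\<close> to the empty set is 0, so the case
   \<open>U c = UNIV\<close> receives the value 1 by hand.\<close>
 define d where "d c k = (if U c = UNIV then 1 else infdist k (- U c))" for c k
 have dc: "continuous_on UNIV (d c)" for c unfolding d_def by (cases "U c = UNIV") (auto intro: continuous_intros)
 have d0: "0 \<le> d c k" for c k by (simp add: d_def infdist_nonneg)
 have dp: "d c (k + K) = d c k" if c: "c < n" and K: "K \<in> RL C" for c k K
 proof -
  have "(\<lambda>k. k + K) ` (- U c) = - U c"
  proof (rule RL_shift_image[OF _ K])
   fix k K' assume "k \<in> - U c" "K' \<in> RL C"
   thus "k + K' \<in> - U c" using Up[OF c, of "k + K'" "- K'"] RL_minus[of K'] by auto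
  qed
  thus ?thesis by (simp add: d_def infdist_shift)
 qed
 have dpos: "0 < d c k" if "c < n" "k \<in> U c" for c k
 proof (cases "U c = UNIV")
  case False
  hence "- U c \<noteq> {}" by auto
  hence "infdist k (- U c) \<noteq> 0"
   using in_closed_iff_infdist_zero[of "- U c" k] Uo[OF that(1)] that(2) by (simp add: closed_Compl)
  thus ?thesis using False infdist_nonneg[of k "- U c"] by (simp add: d_def)
 qed (simp add: d_def)
 obtain \<mu> where \<mu>: "0 < \<mu>" "\<And>k. \<mu> \<le> (\<Sum>c<n. d c k)"
 proof (rule periodic_bounded_below[of "\<lambda>k. \<Sum>c<n. d c k"])
  show "continuous_on UNIV (\<lambda>k. \<Sum>c<n. d c k)" by (intro continuous_on_sum dc)
  show "(\<Sum>c<n. d c (k + K)) = (\<Sum>c<n. d c k)" if "K \<in> RL C" for k K using dp that by (intro sum.cong) auto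
  show "0 < (\<Sum>c<n. d c k)" for k
  proof -
   obtain a where a: "a < n" "k \<in> U a" using cov by blast
   have "d a k \<le> (\<Sum>c<n. d c k)" by (rule member_le_sum) (use a d0 in auto)
   thus ?thesis using dpos[OF a] by simp
  qed
 qed blast
 have n: "0 < n" using cov[of 0] by auto
 define \<delta> where "\<delta> = \<mu> / (2 * of_nat n)"
 define g where "g c k = max 0 (d c k - \<delta>)" for c k
 have \<delta>: "0 < \<delta>" using \<mu> n by (simp add: \<delta>_def)
 have gpos: "0 < (\<Sum>c<n. g c k)" for k
 proof -
  have "(\<Sum>c<n. d c k) - of_nat n * \<delta> \<le> (\<Sum>c<n. g c k)"
   using sum_mono[of "{..<n}" "\<lambda>c. d c k - \<delta>" "\<lambda>c. g c k"] by (simp add: g_def sum_subtractf)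
  moreover have "of_nat n * \<delta> = \<mu> / 2" using n by (simp add: \<delta>_def)
  ultimately show ?thesis using \<mu>(2)[of k] \<mu>(1) by linarith
 qed
 define \<chi>' where "\<chi>' c k = g c k / (\<Sum>c<n. g c k)" for c k
 define S where "S c = {k. \<delta> \<le> d c k}" for c
 have gc: "continuous_on UNIV (g c)" for c unfolding g_def by (intro continuous_intros dc)
 show ?thesis
 proof (rule that[of \<chi>' S])
  show "continuous_on UNIV (\<chi>' c)" for c unfolding \<chi>'_def
   by (intro continuous_on_divide continuous_on_sum gc) (use gpos in \<open>auto simp: less_imp_neq[symmetric]\<close>)
  show "\<chi>' c (k + K) = \<chi>' c k" if "c < n" "K \<in> RL C" for c k K
  proof -
   have "(\<Sum>c<n. g c (k + K)) = (\<Sum>c<n. g c k)" using dp that by (intro sum.cong) (auto simp: g_def)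
   thus ?thesis using dp that by (simp add: \<chi>'_def g_def)
  qed
  show "closed (S c)" for c unfolding S_def by (intro closed_Collect_le dc continuous_on_const)
  show "S c \<subseteq> U c" if c: "c < n" for c
  proof
   fix k assume "k \<in> S c"
   hence "d c k \<noteq> 0" using \<delta> by (simp add: S_def)
   thus "k \<in> U c" by (cases "k \<in> U c") (auto simp: d_def split: if_splits)
  qed
  show "\<chi>' c k = 0" if "k \<notin> S c" for c k using that by (simp add: \<chi>'_def g_def S_def)
  show "(\<Sum>c<n. \<chi>' c k) = 1" for k
   unfolding \<chi>'_def sum_divide_distrib[symmetric] using gpos[of k] by simp
 qed
qed

text \<open>A Cech cocycle of continuous functions is the coboundary of \<open>\<eta>\<^sub>a = \<Sum>\<^sub>c \<chi>\<^sub>c \<theta>\<^sub>c\<^sub>a\<close>.\<close>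

lemma torus_coboundary:
 fixes \<theta> :: "nat \<Rightarrow> nat \<Rightarrow> real ^ 'd \<Rightarrow> real"
 assumes U: "torus_cover C n U"
  and \<theta>: "\<And>a b. a < n \<Longrightarrow> b < n \<Longrightarrow> torus_function C (U a \<inter> U b) (\<theta> a b)"
  and coc: "\<And>a b c k. a < n \<Longrightarrow> b < n \<Longrightarrow> c < n \<Longrightarrow> k \<in> U a \<inter> U b \<inter> U c \<Longrightarrow> \<theta> b c k - \<theta> a c k + \<theta> a b k = 0"
 obtains \<eta> :: "nat \<Rightarrow> real ^ 'd \<Rightarrow> real" where "\<And>a. a < n \<Longrightarrow> torus_function C (U a) (\<eta> a)"
  "\<And>a b k. a < n \<Longrightarrow> b < n \<Longrightarrow> k \<in> U a \<inter> U b \<Longrightarrow> \<theta> a b k = \<eta> b k - \<eta> a k"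
proof -
 obtain \<chi>' :: "nat \<Rightarrow> real ^ 'd \<Rightarrow> real" and S where \<chi>: "\<And>c. continuous_on UNIV (\<chi>' c)"
  "\<And>c k K. c < n \<Longrightarrow> K \<in> RL C \<Longrightarrow> \<chi>' c (k + K) = \<chi>' c k"
  and S: "\<And>c. closed (S c)" "\<And>c. c < n \<Longrightarrow> S c \<subseteq> U c" "\<And>c k. k \<notin> S c \<Longrightarrow> \<chi>' c k = 0"
  and one: "\<And>k. (\<Sum>c<n. \<chi>' c k) = 1"
  using torus_partition_of_unity[OF U] by blast
 have Uo: "open (U a)" and Up: "\<And>k K. k \<in> U a \<Longrightarrow> K \<in> RL C \<Longrightarrow> k + K \<in> U a" if "a < n" for a
  using U that by (auto simp: torus_cover_def)
 have Up': "k + K \<in> U a \<longleftrightarrow> k \<in> U a" if "a < n" "K \<in> RL C" for a k K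
  using Up[OF that(1), of k K] Up[OF that(1), of "k + K" "- K"] that RL_minus by auto
 define h where "h c a k = (if k \<in> U c then \<chi>' c k * \<theta> c a k else 0)" for c a k
 define \<eta> where "\<eta> a k = (\<Sum>c<n. h c a k)" for a k
 have hc: "continuous_on (U a) (h c a)" if a: "a < n" and c: "c < n" for a c
 proof -
  \<comment> \<open>The function \<open>\<theta> c a\<close> is continuous on
    \<open>U c \<inter> U a\<close> only; off \<open>S c\<close> the product is 0, and the two open
    sets together are \<open>U a\<close>.\<close>
  have "continuous_on ((U a \<inter> U c) \<union> (U a - S c)) (h c a)"
  proof (rule continuous_on_open_Un)
   show "open (U a \<inter> U c)" "open (U a - S c)" using Uo a c S by auto
   have "continuous_on (U c \<inter> U a) (\<lambda>k. \<chi>' c k * \<theta> c a k)"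
    using \<theta>[OF c a] by (intro continuous_on_mult continuous_on_subset[OF \<chi>(1)]) (auto simp: torus_function_def)
   thus "continuous_on (U a \<inter> U c) (h c a)"
    by (subst Int_commute) (rule continuous_on_eq, auto simp: h_def)
   show "continuous_on (U a - S c) (h c a)"
    by (rule continuous_on_eq[of _ "\<lambda>_. 0"]) (use S in \<open>auto simp: h_def\<close>)
  qed
  moreover have "(U a \<inter> U c) \<union> (U a - S c) = U a" using S(2)[OF c] by auto
  ultimately show ?thesis by simp
 qed
 have hp: "h c a (k + K) = h c a k" if "a < n" "c < n" "k \<in> U a" "K \<in> RL C" for a c k K
  using \<theta>[OF that(2,1)] that \<chi>(2)[OF that(2,4), of k] by (simp add: h_def Up' torus_function_def)
 show ?thesis
 proof (rule that[of \<eta>])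
  show "torus_function C (U a) (\<eta> a)" if a: "a < n" for a
   unfolding torus_function_def \<eta>_def
   by (intro conjI continuous_on_sum ballI sum.cong refl) (auto intro: hc hp a)
  fix a b k assume a: "a < n" and b: "b < n" and k: "k \<in> U a \<inter> U b"
  have "h c b k - h c a k = \<chi>' c k * \<theta> a b k" if c: "c < n" for c
  proof (cases "k \<in> U c")
   case True
   have "\<theta> a b k - \<theta> c b k + \<theta> c a k = 0" by (rule coc[OF c a b]) (use k True in auto)
   hence "\<theta> a b k = \<theta> c b k - \<theta> c a k" by linarith
   thus ?thesis using True by (simp add: h_def right_diff_distrib)
  next
   case False
   thus ?thesis using S(3)[of k c] S(2)[OF c] by (auto simp: h_def)
  qed
  hence "\<eta> b k - \<eta> a k = (\<Sum>c<n. \<chi>' c k * \<theta> a b k)"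
   unfolding \<eta>_def sum_subtractf[symmetric] by (intro sum.cong) auto
  also have "\<dots> = \<theta> a b k" unfolding sum_distrib_right[symmetric] one by simp
  finally show "\<theta> a b k = \<eta> b k - \<eta> a k" by simp
 qed
qed

lemma cis_int: "cis (2 * pi * of_int n) = 1"
 using cis_multiple_2pi[of "of_int n"] by simp

text \<open>After removal of the plane waves the difference of two values splits into <e - e0, s> +
  <e0, s - s0>, with both norms of differences tending to 0.\<close>

lemma inner_unit_section_continuous:
 assumes e: "gsec e" and s: "unit_section C m F W s" and F: "band C m N F" and W: "open W"
 shows "continuous_on W (\<lambda>k. inn (e k) (s k))"
proof (rule continuous_at_imp_continuous_on, rule ballI)
 fix k0 assume k0: "k0 \<in> W"
 let ?e = "\<lambda>k. plane_wave (- k) (e k)" and ?s = "\<lambda>k. plane_wave (- k) (s k)"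
 have eL: "?e k \<in> LV m" for k by (rule LV_plane_wave[OF gsec_LV[OF e]])
 have sF: "s k \<in> F k" if "k \<in> W" for k using s that by (simp add: unit_section_def)
 have sL: "?s k \<in> LV m" if "k \<in> W" for k by (rule LV_plane_wave[OF bloch_LV[OF band_bloch[OF F sF[OF that]]]])
 have s1: "nm (?s k) = 1" if "k \<in> W" for k using s that by (simp add: unit_section_def norm_cell_def)
 have "((\<lambda>k. nm (?s k - ?s k0)) \<longlongrightarrow> 0) (at k0 within W)" using s k0 by (simp add: unit_section_def)
 hence t1: "((\<lambda>k. nm (?s k - ?s k0)) \<longlongrightarrow> 0) (at k0)" using at_within_open[OF k0 W] by simp
 have nc: "((\<lambda>k. nm (?e k - ?e k0)) \<longlongrightarrow> 0) (at k0)"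
 proof -
  have a: "avec_at k0 ?e" by (rule gsec_avec[OF e])
  have c: "avec_at k0 (\<lambda>_. ?e k0)" by (rule avec_at_const) (rule bloch_plane_wave_0(1)[OF gsec_bloch[OF e]])
  have "avec_at k0 (\<lambda>k. ?e k + scl (- 1) (?e k0))"
   by (rule avec_at_add[OF a eL _ LV_scl[OF eL]]) (rule avec_at_const, intro bloch_scl bloch_plane_wave_0(1) gsec_bloch e)
  hence d: "avec_at k0 (\<lambda>k. ?e k - ?e k0)" by (simp add: scl_minus_one)
  have dL: "?e k - ?e k0 \<in> LV m" for k by (rule diff_mem[OF eL eL])
  have "isCont (\<lambda>k. inn (?e k - ?e k0) (?e k - ?e k0)) k0"
   by (rule ran_at_isCont[OF avec_inner[OF d dL d dL]])
  hence "((\<lambda>k. sqrt (Re (inn (?e k - ?e k0) (?e k - ?e k0)))) \<longlongrightarrow> sqrt (Re (inn (?e k0 - ?e k0) (?e k0 - ?e k0)))) (at k0)"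
   unfolding isCont_def by (intro tendsto_real_sqrt tendsto_Re)
  thus ?thesis by (simp add: norm_cell_def ip_zero LV_zero)
 qed
 have bound: "cmod (inn (e k) (s k) - inn (e k0) (s k0))
   \<le> nm (?e k - ?e k0) + nm (?e k0) * nm (?s k - ?s k0)" if k: "k \<in> W" for k
 proof -
  note L = eL[of k] eL[of k0] sL[OF k] sL[OF k0]
  have eq: "inn (e k) (s k) - inn (e k0) (s k0)
    = inn (?e k - ?e k0) (?s k) + inn (?e k0) (?s k - ?s k0)"
   using ip_diff_left[OF L(3) L(1,2)] ip_diff[OF L(2) L(3,4)] by simp
  have "cmod (inn (?e k - ?e k0) (?s k) + inn (?e k0) (?s k - ?s k0)) \<le> nm (?e k - ?e k0) * nm (?s k) + nm (?e k0) * nm (?s k - ?s k0)"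
   by (intro norm_triangle_le add_mono cauchy_schwarz diff_mem L)
  thus ?thesis by (simp only: eq s1[OF k] mult_1_right)
 qed
 have "((\<lambda>k. nm (?e k - ?e k0) + nm (?e k0) * nm (?s k - ?s k0)) \<longlongrightarrow> 0 + nm (?e k0) * 0) (at k0)"
  by (intro tendsto_add tendsto_mult tendsto_const nc t1)
 hence "((\<lambda>k. inn (e k) (s k) - inn (e k0) (s k0)) \<longlongrightarrow> 0) (at k0)"
 proof (rule Lim_null_comparison[rotated, OF tendsto_eq_rhs])
  show "\<forall>\<^sub>F k in at k0. norm (inn (e k) (s k) - inn (e k0) (s k0))
   \<le> nm (?e k - ?e k0) + nm (?e k0) * nm (?s k - ?s k0)"
   using eventually_at_in_open[OF W k0] by eventually_elim (rule bound, simp)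
 qed simp
 thus "isCont (\<lambda>k. inn (e k) (s k)) k0" unfolding isCont_def by (rule Lim_null[THEN iffD2])
qed

text \<open>
 The continuous section \<open>s\<close> obtained from the trivialised cocycle is only needed through its
 coefficients in analytic frames.
\<close>

lemma continuous_section:
 fixes N :: nat
 assumes F: "band C m 1 F" and c1: "c1_vanishes C m F" and e: "\<And>i. i < N \<Longrightarrow> gsec (e i)"
 obtains s where "\<And>k. s k \<in> F k" "\<And>k. inn (s k) (s k) = 1"
  "\<And>i. i < N \<Longrightarrow> continuous_on UNIV (\<lambda>k. inn (e i k) (s k))"
  "\<And>i k K. i < N \<Longrightarrow> K \<in> RL C \<Longrightarrow> inn (e i (k + K)) (s (k + K)) = inn (e i k) (s k)"
proof -
 obtain n U z \<nu> where cc: "c1_cocycle C m F n U z"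
  and \<nu>: "\<forall>a<n. \<forall>b<n. torus_function C (U a \<inter> U b) (\<nu> a b :: real ^ 'd \<Rightarrow> int)"
  and z\<nu>: "\<forall>a<n. \<forall>b<n. \<forall>c<n. \<forall>k\<in>U a \<inter> U b \<inter> U c. z a b c k = \<nu> b c k - \<nu> a c k + \<nu> a b k"
  using c1 unfolding c1_vanishes_def by (elim exE conjE) (rule that)
 obtain s \<theta> where U: "torus_cover C n U"
  and s: "\<forall>a<n. unit_section C m F (U a) (s a)"
  and \<theta>: "\<forall>a<n. \<forall>b<n. torus_function C (U a \<inter> U b) (\<theta> a b :: real ^ 'd \<Rightarrow> real) \<and>
      (\<forall>k\<in>U a \<inter> U b. s b k \<simeq> scl (cis (2 * pi * \<theta> a b k)) (s a k))"
  and z\<theta>: "\<forall>a<n. \<forall>b<n. \<forall>c<n. \<forall>k\<in>U a \<inter> U b \<inter> U c. of_int (z a b c k) = \<theta> b c k - \<theta> a c k + \<theta> a b k"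
  using cc unfolding c1_cocycle_def by (elim exE conjE) (rule that)
 define \<theta>' where "\<theta>' a b k = \<theta> a b k - of_int (\<nu> a b k)" for a b k
 have Uo: "open (U a)" and Up: "\<And>k K. k \<in> U a \<Longrightarrow> K \<in> RL C \<Longrightarrow> k + K \<in> U a" if "a < n" for a
  using U that by (auto simp: torus_cover_def)
 obtain \<eta> :: "nat \<Rightarrow> real ^ 'd \<Rightarrow> real" where \<eta>: "\<And>a. a < n \<Longrightarrow> torus_function C (U a) (\<eta> a)"
  and d\<eta>: "\<And>a b k. a < n \<Longrightarrow> b < n \<Longrightarrow> k \<in> U a \<inter> U b \<Longrightarrow> \<theta>' a b k = \<eta> b k - \<eta> a k"
 proof (rule torus_coboundary[OF U, of \<theta>'])
  fix a b assume a: "a < n" and b: "b < n"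
  have t: "torus_function C (U a \<inter> U b) (\<theta> a b)" "torus_function C (U a \<inter> U b) (\<nu> a b)" using \<theta> \<nu> a b by blast+
  thus "torus_function C (U a \<inter> U b) (\<theta>' a b)"
   unfolding torus_function_def \<theta>'_def by (auto intro!: continuous_on_diff continuous_on_of_int)
  fix c k assume c: "c < n" and k: "k \<in> U a \<inter> U b \<inter> U c"
  have "of_int (z a b c k) = (of_int (\<nu> b c k) - of_int (\<nu> a c k) + of_int (\<nu> a b k) :: real)"
   using z\<nu> a b c k by simp
  moreover have "of_int (z a b c k) = \<theta> b c k - \<theta> a c k + \<theta> a b k" using z\<theta> a b c k by blast
  ultimately show "\<theta>' b c k - \<theta>' a c k + \<theta>' a b k = 0" unfolding \<theta>'_def by linarith
 qed blast
 \<comment> \<open>The phases \<open>\<eta>\<close> reduce the transition functions to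
   \<open>cis (2 * pi * \<nu> a b k)\<close>, which is 1 since \<open>\<nu>\<close> takes integer
   values; the corrected local sections agree on overlaps almost everywhere.\<close>
 define t where "t a k = scl (cis (- (2 * pi * \<eta> a k))) (s a k)" for a k
 have sF: "s a k \<in> F k" and s1: "inn (s a k) (s a k) = 1" and sp: "K \<in> RL C \<Longrightarrow> s a (k + K) \<simeq> s a k"
  if "a < n" "k \<in> U a" for a k K using s that by (simp_all add: unit_section_def)
 have tF: "t a k \<in> F k" if "a < n" "k \<in> U a" for a k unfolding t_def by (intro band_scl[OF F] sF that)
 have tt: "t b k \<simeq> t a k" if a: "a < n" and b: "b < n" and k: "k \<in> U a \<inter> U b" for a b k
 proof -
  have "s b k \<simeq> scl (cis (2 * pi * \<theta> a b k)) (s a k)" using \<theta> a b k by blast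
  from aeq_scl[OF this, of "cis (- (2 * pi * \<eta> b k))"]
  have "t b k \<simeq> scl (cis (- (2 * pi * \<eta> b k)) * cis (2 * pi * \<theta> a b k)) (s a k)" by (simp only: t_def scl_scl)
  also have "cis (- (2 * pi * \<eta> b k)) * cis (2 * pi * \<theta> a b k) = cis (- (2 * pi * \<eta> a k)) * cis (2 * pi * of_int (\<nu> a b k))"
  proof -
   have "\<theta> a b k = \<eta> b k - \<eta> a k + of_int (\<nu> a b k)" using d\<eta>[OF a b k] by (simp add: \<theta>'_def)
   show ?thesis unfolding cis_mult \<open>\<theta> a b k = _\<close> by (simp add: algebra_simps)
  qed
  finally show ?thesis by (simp add: t_def cis_int)
 qed
 have cov: "\<exists>a. a < n \<and> k \<in> U a" for k using U by (auto simp: torus_cover_def)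
 \<comment> \<open>An arbitrary chart at each \<open>k\<close>. The coefficients computed in it are
   those of any other chart containing \<open>k\<close>, which gives their continuity and
   periodicity.\<close>
 define ch where "ch k = (SOME a. a < n \<and> k \<in> U a)" for k
 have ch: "ch k < n" "k \<in> U (ch k)" for k using someI_ex[OF cov, of k] by (simp_all add: ch_def)
 have tL: "t a k \<in> LV m" if "a < n" "k \<in> U a" for a k by (rule bloch_LV[OF band_bloch[OF F tF[OF that]]])
 have loc: "inn (e i k) (t (ch k) k) = cis (- (2 * pi * \<eta> a k)) * inn (e i k) (s a k)"
  if i: "i < N" and a: "a < n" "k \<in> U a" for i a k
 proof -
  have "inn (e i k) (t (ch k) k) = inn (e i k) (t a k)"
   by (rule inner_aeq) (use ch a in \<open>auto intro: gsec_LV[OF e[OF i]] tL tt\<close>)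
  also have "\<dots> = cis (- (2 * pi * \<eta> a k)) * inn (e i k) (s a k)"
   unfolding t_def by (rule ip_smul[OF gsec_LV[OF e[OF i]] bloch_LV[OF band_bloch[OF F sF[OF a]]]])
  finally show ?thesis .
 qed
 show ?thesis
 proof (rule that[of "\<lambda>k. t (ch k) k"])
  show "t (ch k) k \<in> F k" for k by (rule tF[OF ch])
  show "inn (t (ch k) k) (t (ch k) k) = 1" for k
  proof -
   note L = bloch_LV[OF band_bloch[OF F sF[OF ch]]]
   have "inn (t (ch k) k) (t (ch k) k)
    = cnj (cis (- (2 * pi * \<eta> (ch k) k))) * (cis (- (2 * pi * \<eta> (ch k) k)) * inn (s (ch k) k) (s (ch k) k))"
    unfolding t_def by (simp only: ip_smul_left[OF LV_scl[OF L] L] ip_smul[OF L L])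
   thus ?thesis using s1[OF ch] by (simp add: cis_cnj cis_mult)
  qed
  fix i assume i: "i < N"
  have "continuous_on (\<Union>a\<in>{..<n}. U a) (\<lambda>k. inn (e i k) (t (ch k) k))"
  proof (rule continuous_on_open_UN)
   fix a assume "a \<in> {..<n}"
   hence a: "a < n" by simp
   show "open (U a)" by (rule Uo[OF a])
   have sa: "unit_section C m F (U a) (s a)" using s a by blast
   have "continuous_on (U a) (\<lambda>k. cis (- (2 * pi * \<eta> a k)) * inn (e i k) (s a k))"
    using \<eta>[OF a] by (intro continuous_on_mult inner_unit_section_continuous[OF e[OF i] sa F Uo[OF a]] continuous_intros)
     (auto simp: torus_function_def)
   thus "continuous_on (U a) (\<lambda>k. inn (e i k) (t (ch k) k))"
    by (rule continuous_on_eq) (simp add: loc[OF i a])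
  qed
  thus "continuous_on UNIV (\<lambda>k. inn (e i k) (t (ch k) k))" using U by (simp add: torus_cover_def)
  fix k K assume K: "K \<in> RL C"
  let ?a = "ch k"
  have kK: "k + K \<in> U ?a" using Up[OF ch(1) ch(2) K] .
  have "\<eta> ?a (k + K) = \<eta> ?a k" using \<eta>[OF ch(1)] ch(2) K by (simp add: torus_function_def)
  moreover have "inn (e i (k + K)) (s ?a (k + K)) = inn (e i k) (s ?a k)"
   by (intro inner_aeq gsec_LV[OF e[OF i]] gsec_per[OF e[OF i] K] sp[OF ch K]
     bloch_LV[OF band_bloch[OF F sF[OF ch]]] bloch_LV[OF band_bloch[OF F sF[OF ch(1) kK]]])
  ultimately show "inn (e i (k + K)) (t (ch (k + K)) (k + K)) = inn (e i k) (t (ch k) k)"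
   by (simp only: loc[OF i ch(1) kK] loc[OF i ch(1)[of k] ch(2)[of k]])
 qed
qed

lemma simple_onb:
 assumes F: "band C m 1 F" and s: "s \<in> F k" "inn s s = 1"
 shows "onb k {..<1::nat} (\<lambda>_. s) (F k)"
proof -
 obtain e where o: "onb k {..<1::nat} e (F k)" using band_onb[OF F] .
 show ?thesis
  by (rule onb_of_ons[OF o]) (use s bloch_LV[OF band_bloch[OF F s(1)]] in \<open>auto simp: ons_def\<close>)
qed

lemma simple_expand:
 assumes F: "band C m 1 F" and s: "s \<in> F k" "inn s s = 1" and g: "g \<in> F k"
 shows "g \<simeq> scl (inn s g) s"
 using onb_aeq_expand[OF simple_onb[OF F s] g] by simp

text \<open>
 Near \<open>k0\<close> the projection onto \<open>F k\<close> of the vector \<open>s k0\<close>, moved to \<open>k\<close>, is an analytic nonzero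
 section \<open>\<tau>\<close>, and the product of coefficients of \<open>s\<close> is that of \<open>\<tau>\<close> divided by \<open>\<langle>\<tau>, \<tau>\<rangle>\<close>.
\<close>

lemma proj_coeff_analytic:
 assumes F: "band C m 1 F" and e: "gsec e" and e': "gsec e'"
  and s: "\<And>k. s k \<in> F k" "\<And>k. inn (s k) (s k) = 1"
 shows "ran_at k0 (\<lambda>k. inn (e k) (s k) * cnj (inn (e' k) (s k)))"
proof -
 define v where "v = plane_wave (- k0) (s k0)"
 define \<tau>' where "\<tau>' k = band_proj C m F k (plane_wave k v)" for k
 let ?\<tau> = "\<lambda>k. plane_wave (- k) (\<tau>' k)"
 have sb: "s k \<in> Bl k" and sL: "s k \<in> LV m" for k using band_bloch[OF F s(1)] bloch_LV by blast+
 have v: "v \<in> Bl 0" unfolding v_def by (rule bloch_plane_wave_0(1)[OF sb])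
 have nv: "nm v = 1" unfolding v_def norm_plane_wave using s(2)[of k0] by (simp add: norm_cell_def)
 have vk: "plane_wave k v \<in> Bl k" for k by (rule bloch_plane_wave_0(2)[OF v])
 have \<tau>F: "\<tau>' k \<in> F k" for k unfolding \<tau>'_def by (rule band_proj_props(1)[OF F vk])
 have \<tau>b: "?\<tau> k \<in> Bl 0" for k by (rule bloch_plane_wave_0(1)[OF band_bloch[OF F \<tau>F]])
 note \<tau>L = bloch_LV[OF \<tau>b]
 have \<tau>L': "\<tau>' k \<in> LV m" for k by (rule bloch_LV[OF band_bloch[OF F \<tau>F]])
 have \<tau>a: "avec_at k0 ?\<tau>"
 proof -
  have "analytic_operators C m (\<lambda>k f. plane_wave (- k) (band_proj C m F k (plane_wave k f)))" using F by (simp add: band_def)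
  from this[unfolded analytic_operators_def, THEN spec[of _ k0]]
  obtain \<rho> c where \<rho>: "\<rho> > 0" and c: "\<forall>\<alpha>. bounded_op C m (c \<alpha>)"
   and cc: "\<forall>k. (\<forall>i. \<bar>k $ i - k0 $ i\<bar> < \<rho>) \<longrightarrow> (\<forall>\<epsilon>>0. \<forall>\<^sub>F S in finsets. \<forall>f\<in>Bl 0.
    nm (plane_wave (- k) (band_proj C m F k (plane_wave k f)) - psum (\<lambda>\<alpha>. c \<alpha> f) S (k - k0)) \<le> \<epsilon> * nm f)"
   by (elim exE conjE) (rule that)
  have cb: "c \<alpha> v \<in> Bl 0" for \<alpha> using spec[OF c, of \<alpha>] v unfolding bounded_op_def by blast
  have "((\<lambda>S. nm (?\<tau> k - psum (\<lambda>\<alpha>. c \<alpha> v) S (k - k0))) \<longlongrightarrow> 0) finsets"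
   if k: "\<forall>i. \<bar>k $ i - k0 $ i\<bar> < \<rho>" for k
   unfolding tendsto_iff
  proof (intro allI impI)
   fix \<epsilon> :: real assume \<epsilon>: "0 < \<epsilon>"
   have "\<forall>\<^sub>F S in finsets. \<forall>f\<in>Bl 0.
    nm (plane_wave (- k) (band_proj C m F k (plane_wave k f)) - psum (\<lambda>\<alpha>. c \<alpha> f) S (k - k0)) \<le> \<epsilon> / 2 * nm f"
    using mp[OF spec[OF cc] k, THEN spec[of _ "\<epsilon> / 2"]] \<epsilon> by simp
   thus "\<forall>\<^sub>F S in finsets. dist (nm (?\<tau> k - psum (\<lambda>\<alpha>. c \<alpha> v) S (k - k0))) 0 < \<epsilon>"
   proof eventually_elim
    case (elim S)
    have "?\<tau> k - psum (\<lambda>\<alpha>. c \<alpha> v) S (k - k0) \<in> LV m"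
     by (intro diff_mem \<tau>L sum_mem LV_scl bloch_LV[OF cb])
    from nrm_ge0[OF this] show ?case using bspec[OF elim v] nv \<epsilon> unfolding \<tau>'_def[symmetric] by (simp add: dist_real_def)
   qed
  qed
  thus ?thesis unfolding avec_at_def
   by (intro exI[of _ \<rho>] conjI \<rho> exI[of _ "\<lambda>\<alpha>. c \<alpha> v"] allI impI cb)
 qed
 define n where "n k = inn (?\<tau> k) (?\<tau> k)" for k
 define A where "A k = inn (plane_wave (- k) (e k)) (?\<tau> k)" for k
 define B where "B k = inn (plane_wave (- k) (e' k)) (?\<tau> k)" for k
 have nr: "ran_at k0 n" unfolding n_def[abs_def] by (rule avec_inner[OF \<tau>a \<tau>L \<tau>a \<tau>L])
 have Ar: "ran_at k0 A" unfolding A_def[abs_def] by (rule avec_inner[OF gsec_avec[OF e] LV_plane_wave[OF gsec_LV[OF e]] \<tau>a \<tau>L])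
 have Br: "ran_at k0 B" unfolding B_def[abs_def] by (rule avec_inner[OF gsec_avec[OF e'] LV_plane_wave[OF gsec_LV[OF e']] \<tau>a \<tau>L])
 have n0: "n k0 = 1"
 proof -
  have "\<tau>' k0 \<simeq> s k0" unfolding \<tau>'_def v_def
   by (rule band_proj_unique[OF F _ s(1)]) (simp_all add: sb ip_zero[OF bloch_LV[OF band_bloch[OF F]]])
  hence "inn (\<tau>' k0) (\<tau>' k0) = inn (s k0) (s k0)"
   by (intro inner_aeq \<tau>L' sL)
  thus ?thesis using s(2) by (simp add: n_def)
 qed
 have "\<forall>\<^sub>F k in nhds k0. n k \<noteq> 0"
 proof -
  have "(n \<longlongrightarrow> n k0) (nhds k0)" using ran_at_isCont[OF nr] by (simp add: continuous_at tendsto_at_iff_tendsto_nhds)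
  thus ?thesis using n0 by (intro tendsto_imp_eventually_ne[of _ "n k0"]) auto
 qed
 then obtain W where W: "open W" "k0 \<in> W" "\<And>k. k \<in> W \<Longrightarrow> n k \<noteq> 0" unfolding eventually_nhds by blast
 have r: "ran_at k0 (\<lambda>k. A k * cnj (B k) * inverse (n k))"
  by (intro ran_at_mult ran_at_cnj ran_at_inverse Ar Br nr) (simp add: n0)
 show ?thesis
 proof (rule ran_at_cong[OF r W(1,2)])
  fix k assume k: "k \<in> W"
  define l where "l = inn (s k) (\<tau>' k)"
  have \<tau>s: "\<tau>' k \<simeq> scl l (s k)" unfolding l_def by (rule simple_expand[OF F s \<tau>F])
  have x: "inn x (\<tau>' k) = l * inn x (s k)" if "x \<in> LV m" for x
  proof -
   have "inn x (\<tau>' k) = inn x (scl l (s k))"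
    by (rule inner_aeq[OF that \<tau>L' that LV_scl[OF sL] aeq_refl \<tau>s])
   thus ?thesis using ip_smul[OF that sL] by simp
  qed
  have A: "A k = l * inn (e k) (s k)" and B: "B k = l * inn (e' k) (s k)"
   using x[OF gsec_LV[OF e]] x[OF gsec_LV[OF e']] by (simp_all add: A_def B_def)
  have "inn (\<tau>' k) (s k) = cnj l" unfolding l_def by (rule ip_cnj[OF sL \<tau>L'])
  hence n: "n k = l * cnj l" using x[OF \<tau>L'] by (simp add: n_def)
  hence "l \<noteq> 0" using W(3)[OF k] by auto
  thus "A k * cnj (B k) * inverse (n k) = inn (e k) (s k) * cnj (inn (e' k) (s k))"
   unfolding A B n by (simp add: field_simps)
 qed
qed

text \<open>Analyticity is known for the products \<open>f i * cnj (f j)\<close> of coefficients of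
  the continuous section. The projection of trigonometric polynomials \<open>t i\<close> close to
  \<open>f i\<close> thus has analytic coefficients \<open>a i\<close>, equal to
  \<open>f i * w\<close> for a nowhere vanishing function \<open>w\<close>; it remains to
  normalise.\<close>

lemma simple_analytic_section:
 fixes N :: nat
 assumes F: "band C m 1 F" and c1: "c1_vanishes C m F" and e: "\<And>i. i < N \<Longrightarrow> gsec (e i)"
  and o: "\<And>k. ons {..<N} (\<lambda>i. e i k)"
  and span: "\<And>k f. f \<in> F k \<Longrightarrow> nm (res {..<N} (\<lambda>i. e i k) f) = 0"
 obtains \<psi> where "gsec \<psi>" "\<And>k. \<psi> k \<in> F k" "\<And>k. inn (\<psi> k) (\<psi> k) = 1"
proof -
 obtain s where s: "\<And>k. s k \<in> F k" "\<And>k. inn (s k) (s k) = 1"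
  and sc: "\<And>i. i < N \<Longrightarrow> continuous_on UNIV (\<lambda>k. inn (e i k) (s k))"
  and sp: "\<And>i k K. i < N \<Longrightarrow> K \<in> RL C \<Longrightarrow> inn (e i (k + K)) (s (k + K)) = inn (e i k) (s k)"
 proof (rule continuous_section[where e = e and N = N, OF F c1], erule e)
  fix s assume a: "\<And>k. s k \<in> F k" "\<And>k. inn (s k) (s k) = 1"
   "\<And>i. i < N \<Longrightarrow> continuous_on UNIV (\<lambda>k. inn (e i k) (s k))"
   "\<And>i k K. i < N \<Longrightarrow> K \<in> RL C \<Longrightarrow> inn (e i (k + K)) (s (k + K)) = inn (e i k) (s k)"
  show thesis by (rule that[OF a])
 qed
 define f where "f i k = inn (e i k) (s k)" for i k
 have sL: "s k \<in> LV m" and sb: "s k \<in> Bl k" for k using band_bloch[OF F s(1)] bloch_LV by blast+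
 have eb: "e i k \<in> Bl k" if "i < N" for i k by (rule gsec_bloch[OF e[OF that]])
 have se: "s k \<simeq> (\<Sum>i<N. scl (f i k) (e i k))" for k
 proof -
  have "(\<Sum>i<N. scl (f i k) (e i k)) \<in> Bl k" by (intro bloch_sum bloch_scl eb) simp
  from aeq_iff[OF sb this] show ?thesis using span[OF s(1)] by (simp add: res_def f_def)
 qed
 have f1: "(\<Sum>i<N. (cmod (f i k))\<^sup>2) = 1" for k
 proof -
  have r: "(nm (res {..<N} (\<lambda>i. e i k) (s k)))\<^sup>2 = (nm (s k))\<^sup>2 - (\<Sum>i<N. (cmod (f i k))\<^sup>2)"
   unfolding f_def by (rule nrm_res[OF o sL])
  have "(nm (s k))\<^sup>2 = 1" using s(2) by (simp add: norm_cell_def)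
  thus ?thesis using r span[OF s(1), of k] by simp
 qed
 have fle: "cmod (f i k) \<le> 1" if "i < N" for i k
 proof -
  have "(cmod (f i k))\<^sup>2 \<le> (\<Sum>i<N. (cmod (f i k))\<^sup>2)" by (rule member_le_sum) (use that in auto)
  thus ?thesis unfolding f1 by (simp add: power_le_one_iff abs_square_le_1)
 qed
 \<comment> \<open>\<open>of_nat N * \<epsilon> < 1\<close> gives \<open>cmod (1 - w k) < 1\<close>,
   so \<open>w\<close> has no zeros.\<close>
 define \<epsilon> :: real where "\<epsilon> = 1 / of_nat (Suc N)"
 have \<epsilon>: "0 < \<epsilon>" "of_nat N * \<epsilon> < 1" by (simp_all add: \<epsilon>_def field_simps)
 have "\<exists>t. trig t \<and> (\<forall>k. cmod (f i k - t k) < \<epsilon>)" if "i < N" for i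
  using trig_approx[OF sc[OF that] sp[OF that] \<epsilon>(1)] unfolding f_def by blast
 then obtain t where t: "\<And>i. i < N \<Longrightarrow> trig (t i)" and ft: "\<And>i k. i < N \<Longrightarrow> cmod (f i k - t i k) < \<epsilon>" by metis
 define w where "w k = (\<Sum>j<N. cnj (f j k) * t j k)" for k
 have w0: "w k \<noteq> 0" for k
 proof
  assume w: "w k = 0"
  have "(\<Sum>j<N. cnj (f j k) * f j k) = of_real (\<Sum>i<N. (cmod (f i k))\<^sup>2)"
   unfolding of_real_sum by (intro sum.cong refl) (simp add: mult_cnj_cmod)
  hence "1 - w k = (\<Sum>j<N. cnj (f j k) * (f j k - t j k))"
   unfolding f1 by (simp add: w_def right_diff_distrib sum_subtractf)
  hence "1 = cmod (\<Sum>j<N. cnj (f j k) * (f j k - t j k))" using w by (metis diff_zero norm_one)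
  also have "\<dots> \<le> (\<Sum>j<N. \<epsilon>)"
  proof (intro sum_norm_le)
   fix j assume "j \<in> {..<N}"
   hence j: "j < N" by simp
   show "cmod (cnj (f j k) * (f j k - t j k)) \<le> \<epsilon>"
    using mult_mono[OF fle[OF j, of k] less_imp_le[OF ft[OF j, of k]]] by (simp add: norm_mult)
  qed
  also have "\<dots> < 1" using \<epsilon>(2) by simp
  finally show False by simp
 qed
 define a where "a i k = (\<Sum>j<N. (f i k * cnj (f j k)) * t j k)" for i k
 have aw: "a i k = f i k * w k" for i k by (simp add: a_def w_def sum_distrib_left mult.assoc)
 have ar: "rper (a i)" if i: "i < N" for i
  unfolding a_def[abs_def]
 proof (rule rper_sum)
  fix j assume "j \<in> {..<N}"
  hence j: "j < N" by simp
  have "rper (\<lambda>k. f i k * cnj (f j k))" unfolding rper_def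
  proof (intro conjI allI ballI)
   show "ran_at k (\<lambda>k. f i k * cnj (f j k))" for k
    unfolding f_def by (rule proj_coeff_analytic[OF F e[OF i] e[OF j] s])
   show "f i (k + K) * cnj (f j (k + K)) = f i k * cnj (f j k)" if "K \<in> RL C" for k K
    unfolding f_def using sp[OF i that] sp[OF j that] by simp
  qed
  thus "rper (\<lambda>k. f i k * cnj (f j k) * t j k)" by (rule rper_mult[OF _ trig_rper[OF t[OF j]]])
 qed simp
 define \<sigma>' where "\<sigma>' k = (\<Sum>i<N. scl (a i k) (e i k))" for k
 have \<sigma>g: "gsec \<sigma>'" unfolding \<sigma>'_def[abs_def] by (rule gsec_sum) (use ar e in auto)
 have \<sigma>s: "\<sigma>' k \<simeq> scl (w k) (s k)" for k
  using aeq_scl[OF aeq_sym[OF se[of k]], of "w k"] by (simp only: \<sigma>'_def aw scl_sum scl_scl mult.commute)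
 define n where "n k = inn (\<sigma>' k) (\<sigma>' k)" for k
 have nw: "n k = of_real ((cmod (w k))\<^sup>2)" for k
 proof -
  have "n k = inn (scl (w k) (s k)) (scl (w k) (s k))"
   unfolding n_def by (intro inner_aeq gsec_LV[OF \<sigma>g] LV_scl sL \<sigma>s)
  also have "\<dots> = cnj (w k) * w k"
   using ip_smul_left[OF LV_scl[OF sL] sL] ip_smul[OF sL sL] s(2) by simp
  finally show ?thesis by (simp add: mult_cnj_cmod)
 qed
 \<comment> \<open>\<open>n\<close> is analytic with positive values, where \<open>csqrt\<close> is
   holomorphic; so the norm of \<open>\<sigma>' k\<close> can be divided out analytically.\<close>
 define g where "g k = inverse (csqrt (n k))" for k
 have gw: "cmod (g k) * cmod (w k) = 1" for k
 proof -
  have "csqrt (n k) = of_real (cmod (w k))" unfolding nw by (simp add: csqrt_of_real_nonneg del: of_real_power)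
  thus ?thesis using w0[of k] by (simp add: g_def norm_inverse)
 qed
 have gr: "rper g" unfolding rper_def
 proof (intro conjI allI ballI)
  have n: "rper n" unfolding n_def[abs_def] by (rule gsec_inner[OF \<sigma>g \<sigma>g])
  have npos: "0 < Re (n k)" for k unfolding nw using w0[of k] by (simp del: of_real_power)
  show "g (k + K) = g k" if "K \<in> RL C" for k K unfolding g_def using rper_per[OF n that] by simp
  show "ran_at k g" for k unfolding g_def[abs_def]
  proof (rule ran_at_inverse)
   show "ran_at k (\<lambda>k. csqrt (n k))"
   proof (rule ran_at_compose[OF rper_ran[OF n], of "{z. 0 < Re z}" csqrt])
    show "open {z. 0 < Re z}" by (rule open_halfspace_Re_gt)
    show "csqrt holomorphic_on {z. 0 < Re z}"
     by (intro holomorphic_on_subset[OF holomorphic_on_csqrt]) (auto simp: complex_nonpos_Reals_iff)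
   qed (simp add: npos)
   show "csqrt (n k) \<noteq> 0" using npos[of k] by auto
  qed
 qed
 define \<psi> where "\<psi> k = scl (g k) (\<sigma>' k)" for k
 have \<psi>g: "gsec \<psi>" unfolding \<psi>_def[abs_def] by (rule gsec_scale[OF gr \<sigma>g])
 have \<psi>s: "\<psi> k \<simeq> scl (g k * w k) (s k)" for k unfolding \<psi>_def using aeq_scl[OF \<sigma>s[of k], of "g k"] by (simp only: scl_scl)
 show ?thesis
 proof (rule that[OF \<psi>g])
  show "\<psi> k \<in> F k" for k
   by (rule band_aeq[OF F band_scl[OF F s(1)] gsec_bloch[OF \<psi>g] aeq_sym[OF \<psi>s]])
  show "inn (\<psi> k) (\<psi> k) = 1" for k
  proof -
   have "inn (\<psi> k) (\<psi> k) = cnj (g k) * (g k * n k)"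
    unfolding \<psi>_def n_def by (simp only: ip_smul_left[OF LV_scl[OF gsec_LV[OF \<sigma>g]] gsec_LV[OF \<sigma>g]] ip_smul[OF gsec_LV[OF \<sigma>g] gsec_LV[OF \<sigma>g]])
   also have "\<dots> = of_real ((cmod (g k) * cmod (w k))\<^sup>2)"
    unfolding nw by (simp add: mult.assoc[symmetric] mult_cnj_cmod power_mult_distrib)
   finally show ?thesis unfolding gw by simp
  qed
 qed
qed

end

section \<open>Lattice generators and continuous lifts of phases\<close>

lemma (in lattice) L_generated:
 assumes T: "0 \<in> T" "\<And>u v. u \<in> T \<Longrightarrow> v \<in> T \<Longrightarrow> u + v \<in> T" "\<And>u. u \<in> T \<Longrightarrow> - u \<in> T" "\<And>i. b i \<in> T"
 shows "L \<subseteq> T"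
proof
 fix v assume "v \<in> L"
 then obtain n where v: "v = (\<Sum>i\<in>UNIV. of_int (n i) *\<^sub>R b i)" unfolding L_alt by blast
 have nat: "of_nat k *\<^sub>R b i \<in> T" for k :: nat and i
  by (induction k) (simp_all add: T scaleR_left_distrib)
 have int: "of_int z *\<^sub>R b i \<in> T" for z :: int and i
 proof (cases "0 \<le> z")
  case True
  hence "of_int z = (of_nat (nat z) :: real)" by simp
  thus ?thesis using nat[of "nat z" i] by (simp only:)
 next
  case False
  hence "of_int z = - (of_nat (nat (- z)) :: real)" by simp
  thus ?thesis using T(3)[OF nat[of "nat (- z)" i]] by (simp only: scaleR_minus_left)
 qed
 have "(\<Sum>i\<in>I. of_int (n i) *\<^sub>R b i) \<in> T" if "finite I" for I
  using that by induction (simp_all add: T(1,2) int)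
 thus "v \<in> T" unfolding v by simp
qed

lemma cis_eq_1_iff: "cis x = 1 \<longleftrightarrow> (\<exists>n::int. x = of_int n * 2 * pi)"
proof
 assume "cis x = 1"
 hence "cos x = 1" by (metis Re_complex_of_real cis.sel(1) of_real_1)
 thus "\<exists>n::int. x = of_int n * 2 * pi" by (simp add: cos_one_2pi_int)
next
 assume "\<exists>n::int. x = of_int n * 2 * pi"
 then obtain n :: int where n: "x = of_int n * 2 * pi" by blast
 show "cis x = 1" using cis_multiple_2pi[of "of_int n"] unfolding n by (simp add: mult.commute mult.left_commute)
qed

text \<open>The values of \<open>h\<close> are multiples of \<open>2 * pi\<close>, a discrete set,
  and the domain is connected.\<close>

lemma cis_one_constant:
 fixes h :: "'a::real_normed_vector \<Rightarrow> real"
 assumes h: "continuous_on UNIV h" and 1: "\<And>k. cis (h k) = 1"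
 shows "h k = h 0"
proof -
 have "h constant_on UNIV"
 proof (rule continuous_discrete_range_constant[OF connected_UNIV h])
  fix x
  have "2 * pi \<le> norm (h y - h x)" if ne: "h y \<noteq> h x" for y
  proof -
   obtain n n' :: int where n: "h y = of_int n * 2 * pi" "h x = of_int n' * 2 * pi" using 1 unfolding cis_eq_1_iff by metis
   have "n \<noteq> n'" using ne n by auto
   hence "1 \<le> \<bar>n - n'\<bar>" by linarith
   hence "1 \<le> \<bar>of_int (n - n') :: real\<bar>" unfolding of_int_abs[symmetric] by (simp only: of_int_1_le_iff)
   hence "1 * (2 * pi) \<le> \<bar>of_int (n - n') :: real\<bar> * (2 * pi)" by (rule mult_right_mono) simp
   also have "\<dots> = \<bar>of_int (n - n') * (2 * pi)\<bar>" by (simp add: abs_mult)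
   also have "\<dots> = norm (h y - h x)" unfolding n real_norm_def by (simp add: left_diff_distrib mult.assoc)
   finally show ?thesis by simp
  qed
  thus "\<exists>e>0. \<forall>y. y \<in> UNIV \<and> h y \<noteq> h x \<longrightarrow> e \<le> norm (h y - h x)"
   by (intro exI[of _ "2 * pi"]) auto
 qed
 thus ?thesis unfolding constant_on_def by force
qed

text \<open>The space of wavevectors is contractible, so a continuous logarithm exists. The lift of
  a periodic function need not be periodic, and such defects later determine the position
  \<open>\<omega>\<close>.\<close>

lemma cis_lift:
 fixes \<rho> :: "real ^ 'd::finite \<Rightarrow> complex"
 assumes "continuous_on UNIV \<rho>" "\<And>k. cmod (\<rho> k) = 1"
 obtains \<theta> where "continuous_on UNIV \<theta>" "\<And>k. \<rho> k = cis (\<theta> k)"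
proof -
 have nz: "\<rho> k \<noteq> 0" for k using assms(2)[of k] by auto
 obtain g where g: "continuous_on UNIV g" "\<And>k. \<rho> k = exp (g k)"
 proof (rule continuous_logarithm_on_contractible[OF assms(1) convex_imp_contractible[OF convex_UNIV] nz])
  fix g assume "continuous_on UNIV g" "\<And>x. x \<in> UNIV \<Longrightarrow> \<rho> x = exp (g x)"
  thus thesis by (intro that[of g]) simp_all
 qed
 have "\<rho> k = cis (Im (g k))" for k
 proof -
  have "exp (Re (g k)) = 1" using assms(2)[of k] unfolding g(2) norm_exp_eq_Re .
  thus ?thesis unfolding g(2) exp_eq_polar by simp
 qed
 thus ?thesis by (intro that[of "\<lambda>k. Im (g k)"] continuous_intros g(1))
qed

section \<open>Covariant gauge of a simple band\<close>

context mcr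
begin

text \<open>The two lattices are dual to each other: the generators
  \<open>(2 * pi) *\<^sub>R pd i\<close> of \<open>RL C\<close> read off the coordinates of
  \<open>\<xi>\<close>.\<close>

lemma BL_character:
 assumes "\<And>K. K \<in> RL C \<Longrightarrow> cis (K \<bullet> \<xi>) = 1" shows "\<xi> \<in> BL C"
 unfolding BL_eq cell.L_def
proof (intro CollectI allI)
 fix i
 have "cis (((2 * pi) *\<^sub>R pd i) \<bullet> \<xi>) = 1" by (rule assms) (simp add: RL_eq bz.L_basis)
 then obtain n :: int where "(2 * pi) * (pd i \<bullet> \<xi>) = of_int n * 2 * pi" unfolding cis_eq_1_iff by auto
 hence "\<xi> \<bullet> pd i = of_int n" by (simp add: inner_commute)
 thus "\<xi> \<bullet> pd i \<in> \<int>" by simp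
qed

text \<open>Near \<open>k0\<close> the coefficient is a quotient of two inner products of the
  section with fixed vectors, one at \<open>k\<close> and one at \<open>spr p *v k\<close>. Moving
  the fixed vector by the inverse of \<open>p\<close> avoids any statement about the analyticity of
  \<open>gh p\<close> applied to a section.\<close>

lemma ran_at_gh_coeff:
 assumes p: "p \<in> P" and \<psi>: "gsec \<psi>" "\<And>k. inn (\<psi> k) (\<psi> k) = 1"
  and \<rho>: "\<And>k. gh p (\<psi> k) \<simeq> scl (\<rho> k) (\<psi> (spr p *v k))"
 shows "ran_at k0 \<rho>"
proof -
 let ?A = "spr p" and ?u = "\<lambda>k. plane_wave (- k) (\<psi> k)"
 have \<psi>b: "\<psi> k \<in> Bl k" for k by (rule gsec_bloch[OF \<psi>(1)])
 have ub: "?u k \<in> Bl 0" for k by (rule bloch_plane_wave_0(1)[OF \<psi>b])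
 note uL = bloch_LV[OF ub]
 define v where "v = ?u (?A *v k0)"
 define v' where "v' = gh (pinv p) v"
 have v: "v \<in> Bl 0" unfolding v_def by (rule ub)
 have v': "v' \<in> Bl 0" unfolding v'_def using gh_bloch[OF pinv_P[OF p] v] by simp
 define f where "f k = cj (trs C p) (inn v' (?u k))" for k
 define g where "g k = inn v (?u (?A *v k))" for k
 have an: "ran_at k (\<lambda>k. inn w (?u k))" if w: "w \<in> Bl 0" for w k
  by (rule avec_inner[OF avec_at_const[OF w] bloch_LV[OF w] gsec_avec[OF \<psi>(1)] uL])
 have fr: "ran_at k0 f" unfolding f_def[abs_def] by (intro ran_at_cj an v')
 have gr: "ran_at k0 g" unfolding g_def[abs_def] by (rule ran_at_linear_compose[OF an[OF v]])
 have g0: "g k0 = 1" by (simp add: g_def v_def \<psi>(2))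
 have fg: "f k = \<rho> k * g k" for k
 proof -
  have "f k = inn (gh p v') (gh p (?u k))" unfolding f_def by (rule inner_gh[OF p v' ub, symmetric])
  also have "\<dots> = inn v (gh p (?u k))" by (simp only: v'_def gh_inv(2)[OF p])
  also have "\<dots> = inn v (scl (\<rho> k) (?u (?A *v k)))"
  proof (rule inner_aeq)
   have "gh p (?u k) = plane_wave (- (?A *v k)) (gh p (\<psi> k))"
    unfolding gh_plane_wave[OF p] linear_neg[OF matrix_vector_mul_linear] ..
   moreover have "plane_wave (- (?A *v k)) (gh p (\<psi> k)) \<simeq> plane_wave (- (?A *v k)) (scl (\<rho> k) (\<psi> (?A *v k)))" by (rule aeq_plane_wave[OF \<rho>])
   ultimately show "gh p (?u k) \<simeq> scl (\<rho> k) (?u (?A *v k))" by (simp only: plane_wave_scl)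
  qed (intro aeq_refl bloch_LV[OF v] LV_scl uL gh_LV[OF p])+
  finally show ?thesis using ip_smul[OF bloch_LV[OF v] uL] by (simp add: g_def)
 qed
 have "\<forall>\<^sub>F k in nhds k0. g k \<noteq> 0"
 proof -
  have "(g \<longlongrightarrow> g k0) (nhds k0)" using ran_at_isCont[OF gr] by (simp add: continuous_at tendsto_at_iff_tendsto_nhds)
  thus ?thesis using g0 by (intro tendsto_imp_eventually_ne[of _ "g k0"]) auto
 qed
 then obtain W where W: "open W" "k0 \<in> W" "\<And>k. k \<in> W \<Longrightarrow> g k \<noteq> 0" unfolding eventually_nhds by blast
 have "ran_at k0 (\<lambda>k. f k * inverse (g k))" by (intro ran_at_mult fr ran_at_inverse gr) (simp add: g0)
 thus ?thesis by (rule ran_at_cong[OF _ W(1,2)]) (simp add: fg W(3))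
qed

text \<open>
 The phases \<open>\<theta>\<^sub>p\<close> of \<open>p\<close> in the gauge \<open>\<psi>\<close> form a cocycle up to constants; it is the coboundary of
 their average \<open>\<phi>\<^sub>0\<close>.  What is left after removing \<open>\<phi>\<^sub>0\<close> is the linear part of \<open>\<phi>\<^sub>0\<close>, a position.
\<close>

lemma simple_covariant:
 assumes F: "band C m 1 F" and \<psi>: "gsec \<psi>" "\<And>k. \<psi> k \<in> F k" "\<And>k. inn (\<psi> k) (\<psi> k) = 1"
 obtains \<phi> \<omega> where "gsec \<phi>" "\<And>k. \<phi> k \<in> F k" "\<And>k. inn (\<phi> k) (\<phi> k) = 1" "\<omega> \<in> unit_cell C"
  "\<And>p. p \<in> P \<Longrightarrow> rot C p *v \<omega> - \<omega> \<in> BL C"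
  "\<And>p. p \<in> P \<Longrightarrow> \<exists>c. \<forall>k. gh p (\<phi> k) \<simeq> scl (c * cis (- ((spr p *v k) \<bullet> (rot C p *v \<omega> - \<omega>)))) (\<phi> (spr p *v k))"
proof -
 define \<rho> where "\<rho> p k = inn (\<psi> (spr p *v k)) (gh p (\<psi> k))" for p k
 have \<psi>b: "\<psi> k \<in> Bl k" for k by (rule gsec_bloch[OF \<psi>(1)])
 note \<psi>L = bloch_LV[OF \<psi>b]
 have gL: "gh p (\<psi> k) \<in> LV m" if "p \<in> P" for p k by (rule gh_LV[OF that \<psi>L])
 have cov: "gh p (\<psi> k) \<simeq> scl (\<rho> p k) (\<psi> (spr p *v k))" if p: "p \<in> P" for p k
  unfolding \<rho>_def by (rule simple_expand[OF F \<psi>(2,3) band_gh[OF F p \<psi>(2)]])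
 have uniq: "\<rho> p k = a" if "p \<in> P" "gh p (\<psi> k) \<simeq> scl a (\<psi> (spr p *v k))" for p k a
 proof -
  have "\<rho> p k = inn (\<psi> (spr p *v k)) (scl a (\<psi> (spr p *v k)))"
   unfolding \<rho>_def by (rule inner_aeq[OF \<psi>L gL[OF that(1)] \<psi>L LV_scl[OF \<psi>L] aeq_refl that(2)])
  thus ?thesis using ip_smul[OF \<psi>L \<psi>L, of "spr p *v k" a "spr p *v k"] \<psi>(3) by simp
 qed
 have \<rho>1: "cmod (\<rho> p k) = 1" if p: "p \<in> P" for p k
 proof -
  have n1: "nm (\<psi> k) = 1" for k using \<psi>(3)[of k] by (simp add: norm_cell_def)
  have "nm (gh p (\<psi> k)) = nm (scl (\<rho> p k) (\<psi> (spr p *v k)))"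
   by (rule norm_aeq[OF gL[OF p] LV_scl[OF \<psi>L] cov[OF p]])
  thus ?thesis using norm_gh[OF p \<psi>b, of k] nrm_smul[OF \<psi>L, of "\<rho> p k" "spr p *v k"] n1 by simp
 qed
 have \<rho>mult: "\<rho> (q \<otimes>\<^bsub>PG C\<^esub> p) k = cj (trs C q) (\<rho> p k) * \<rho> q (spr p *v k)" if q: "q \<in> P" and p: "p \<in> P" for q p k
 proof (rule uniq[OF mult_P[OF q p]])
  have "gh q (gh p (\<psi> k)) \<simeq> gh q (scl (\<rho> p k) (\<psi> (spr p *v k)))" by (rule gh_aeq[OF q cov[OF p]])
  moreover have "scl (cj (trs C q) (\<rho> p k)) (gh q (\<psi> (spr p *v k)))
    \<simeq> scl (cj (trs C q) (\<rho> p k)) (scl (\<rho> q (spr p *v k)) (\<psi> (spr q *v (spr p *v k))))"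
   by (rule aeq_scl[OF cov[OF q]])
  ultimately show "gh (q \<otimes>\<^bsub>PG C\<^esub> p) (\<psi> k) \<simeq>
    scl (cj (trs C q) (\<rho> p k) * \<rho> q (spr p *v k)) (\<psi> (spr (q \<otimes>\<^bsub>PG C\<^esub> p) *v k))"
   unfolding gh_gh[OF q p] gh_scl[OF q] scl_scl spr_mult[OF q p] by (rule aeq_trans)
 qed
 have \<rho>per: "\<rho> p (k + K) = \<rho> p k" if p: "p \<in> P" and K: "K \<in> RL C" for p k K
  unfolding \<rho>_def matrix_vector_right_distrib
  by (intro inner_aeq \<psi>L gL[OF p] gsec_per[OF \<psi>(1)] spr_RL[OF p] K gh_aeq[OF p])
 have \<rho>ran: "ran_at k (\<rho> p)" if p: "p \<in> P" for p k by (rule ran_at_gh_coeff[OF p \<psi>(1,3) cov[OF p]])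
 have "\<exists>\<theta>. continuous_on UNIV \<theta> \<and> (\<forall>k. \<rho> p k = cis (\<theta> k))" if p: "p \<in> P" for p
  using cis_lift[OF ran_continuous_on[OF \<rho>ran[OF p]] \<rho>1[OF p]] by blast
 then obtain \<theta> where \<theta>c: "\<And>p. p \<in> P \<Longrightarrow> continuous_on UNIV (\<theta> p)" and \<theta>: "\<And>p k. p \<in> P \<Longrightarrow> \<rho> p k = cis (\<theta> p k)"
  using bchoice[of P "\<lambda>p \<theta>. continuous_on UNIV \<theta> \<and> (\<forall>k. \<rho> p k = cis (\<theta> k))"] by blast
 have \<theta>ran: "ran_at k (\<lambda>k. of_real (\<theta> p k))" if p: "p \<in> P" for p k
  by (rule continuous_lift_ran[OF \<rho>ran[OF p] \<theta>c[OF p] \<theta>[OF p]])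
 have lin: "continuous_on UNIV (\<lambda>k. spr p *v k)" for p by (intro linear_continuous_on matrix_vector_mul_bounded_linear)
 \<comment> \<open>\<open>\<rho>\<close> is multiplicative up to conjugation, so its lifts satisfy
   the cocycle identity up to multiples of \<open>2 * pi\<close>, which by continuity do not depend
   on \<open>k\<close>; \<open>d q p\<close> is their value at 0.\<close>
 define d where "d q p = \<theta> (q \<otimes>\<^bsub>PG C\<^esub> p) 0 - trs C q * \<theta> p 0 - \<theta> q (spr p *v 0)" for q p
 have coc: "\<theta> q (spr p *v k) = \<theta> (q \<otimes>\<^bsub>PG C\<^esub> p) k - trs C q * \<theta> p k - d q p" if q: "q \<in> P" and p: "p \<in> P" for q p k
 proof -
  let ?h = "\<lambda>k. \<theta> (q \<otimes>\<^bsub>PG C\<^esub> p) k - trs C q * \<theta> p k - \<theta> q (spr p *v k)"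
  have "?h k = ?h 0"
  proof (rule cis_one_constant)
   show "continuous_on UNIV ?h"
    by (intro continuous_intros \<theta>c mult_P q p continuous_on_compose2[OF \<theta>c[OF q] lin]) simp
   fix k
   have "cis (\<theta> (q \<otimes>\<^bsub>PG C\<^esub> p) k) = cis (trs C q * \<theta> p k) * cis (\<theta> q (spr p *v k))"
    using \<rho>mult[OF q p, of k] unfolding \<theta>[OF q] \<theta>[OF p] \<theta>[OF mult_P[OF q p]] cj_cis[OF trs_pm[OF q]] .
   hence "cis (?h k) = cis (trs C q * \<theta> p k) * cis (\<theta> q (spr p *v k)) * cis (- (trs C q * \<theta> p k)) * cis (- \<theta> q (spr p *v k))"
    by (metis cis_mult diff_conv_add_uminus)
   thus "cis (?h k) = 1" by (simp add: cis_mult)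
  qed
  thus ?thesis by (simp add: d_def)
 qed
 let ?N = "of_nat (card P) :: real"
 have N: "?N \<noteq> 0" using finP one_P card_gt_0_iff[of P] by (metis empty_iff gr_implies_not0 of_nat_eq_0_iff)
 define \<phi>\<^sub>0 where "\<phi>\<^sub>0 k = (\<Sum>q\<in>P. trs C q * \<theta> q k) / ?N" for k
 have \<phi>c: "continuous_on UNIV \<phi>\<^sub>0" unfolding \<phi>\<^sub>0_def by (intro continuous_intros \<theta>c) (use N in simp_all)
 have \<phi>r: "ran_at k (\<lambda>k. of_real (\<phi>\<^sub>0 k))" for k
 proof -
  have "ran_at k (\<lambda>k. (\<Sum>q\<in>P. of_real (trs C q) * of_real (\<theta> q k)) * of_real (1 / ?N))"
   by (intro ran_at_mult ran_at_sum finP ran_at_const \<theta>ran)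
  thus ?thesis by (simp add: \<phi>\<^sub>0_def)
 qed
 define e where "e p = - (\<Sum>q\<in>P. trs C q * d q p) / ?N" for p
 \<comment> \<open>The sum over the group is reindexed by right multiplication with
   \<open>p\<close>. The sign \<open>trs C q\<close> in the average compensates the conjugation in
   the cocycle identity and leaves the sign \<open>trs C p\<close>.\<close>
 have avg: "\<phi>\<^sub>0 (spr p *v k) = trs C p * \<phi>\<^sub>0 k - \<theta> p k + e p" if p: "p \<in> P" for p k
 proof -
  have bij: "bij_betw (\<lambda>q. q \<otimes>\<^bsub>PG C\<^esub> p) P P"
  proof (rule bij_betw_byWitness[where f' = "\<lambda>q. q \<otimes>\<^bsub>PG C\<^esub> pinv p"])
   show "\<forall>q\<in>P. q \<otimes>\<^bsub>PG C\<^esub> p \<otimes>\<^bsub>PG C\<^esub> pinv p = q" "\<forall>q\<in>P. q \<otimes>\<^bsub>PG C\<^esub> pinv p \<otimes>\<^bsub>PG C\<^esub> p = q"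
    using p grp by (simp_all add: monoid.m_assoc[OF group.is_monoid] pinv_mult monoid.r_one[OF group.is_monoid])
  qed (use p in auto)
  have "(\<Sum>q\<in>P. trs C q * \<theta> q (spr p *v k)) = (\<Sum>q\<in>P. trs C q * \<theta> (q \<otimes>\<^bsub>PG C\<^esub> p) k - \<theta> p k - trs C q * d q p)"
  proof (intro sum.cong refl)
   fix q assume q: "q \<in> P"
   show "trs C q * \<theta> q (spr p *v k) = trs C q * \<theta> (q \<otimes>\<^bsub>PG C\<^esub> p) k - \<theta> p k - trs C q * d q p"
    unfolding coc[OF q p] right_diff_distrib mult.assoc[symmetric] trs_sq[OF q] by simp
  qed
  also have "\<dots> = (\<Sum>q\<in>P. trs C q * \<theta> (q \<otimes>\<^bsub>PG C\<^esub> p) k) - ?N * \<theta> p k - (\<Sum>q\<in>P. trs C q * d q p)"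
   by (simp add: sum_subtractf)
  also have "(\<Sum>q\<in>P. trs C q * \<theta> (q \<otimes>\<^bsub>PG C\<^esub> p) k) = (\<Sum>q\<in>P. trs C p * (trs C (q \<otimes>\<^bsub>PG C\<^esub> p) * \<theta> (q \<otimes>\<^bsub>PG C\<^esub> p) k))"
  proof (intro sum.cong refl)
   fix q assume q: "q \<in> P"
   have "trs C p * trs C (q \<otimes>\<^bsub>PG C\<^esub> p) = trs C q" unfolding trs_mult[OF q p] using trs_sq[OF p] by (simp add: mult.left_commute)
   thus "trs C q * \<theta> (q \<otimes>\<^bsub>PG C\<^esub> p) k = trs C p * (trs C (q \<otimes>\<^bsub>PG C\<^esub> p) * \<theta> (q \<otimes>\<^bsub>PG C\<^esub> p) k)"
    by (simp only: mult.assoc[symmetric])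
  qed
  also have "\<dots> = trs C p * (\<Sum>q\<in>P. trs C q * \<theta> q k)"
   unfolding sum_distrib_left[symmetric] using sum.reindex_bij_betw[OF bij, of "\<lambda>q. trs C q * \<theta> q k"] by simp
  finally have "(\<Sum>q\<in>P. trs C q * \<theta> q (spr p *v k)) = trs C p * (\<Sum>q\<in>P. trs C q * \<theta> q k) - ?N * \<theta> p k - (\<Sum>q\<in>P. trs C q * d q p)" .
  thus ?thesis unfolding \<phi>\<^sub>0_def e_def using N by (simp add: diff_divide_distrib)
 qed
 define \<kappa> where "\<kappa> K = \<phi>\<^sub>0 K - \<phi>\<^sub>0 0" for K
 have \<phi>per: "\<phi>\<^sub>0 (k + K) = \<phi>\<^sub>0 k + \<kappa> K" if K: "K \<in> RL C" for k K
 proof -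
  have "\<theta> q (k + K) - \<theta> q k = \<theta> q (0 + K) - \<theta> q 0" if q: "q \<in> P" for q
  proof (rule cis_one_constant[of "\<lambda>k. \<theta> q (k + K) - \<theta> q k"])
   have "continuous_on UNIV (\<lambda>k. \<theta> q (k + K))" by (rule continuous_on_compose2[OF \<theta>c[OF q]]) (auto intro: continuous_intros)
   thus "continuous_on UNIV (\<lambda>k. \<theta> q (k + K) - \<theta> q k)" by (intro continuous_intros \<theta>c q)
   fix k
   have "cis (\<theta> q (k + K)) = cis (\<theta> q k)" using \<rho>per[OF q K, of k] unfolding \<theta>[OF q] .
   thus "cis (\<theta> q (k + K) - \<theta> q k) = 1" by (simp add: cis_divide[symmetric])
  qed
  hence "(\<Sum>q\<in>P. trs C q * (\<theta> q (k + K) - \<theta> q k)) = (\<Sum>q\<in>P. trs C q * (\<theta> q K - \<theta> q 0))"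
   by (intro sum.cong refl) simp
  thus ?thesis unfolding \<kappa>_def \<phi>\<^sub>0_def using N by (simp add: right_diff_distrib sum_subtractf field_simps)
 qed
 \<comment> \<open>The periodicity defect \<open>\<kappa>\<close> of the average is constant in
   \<open>k\<close>, hence additive on \<open>RL C\<close>; \<open>\<eta>\<close> is the vector that
   represents it as \<open>K \<bullet> \<eta>\<close>.\<close>
 define \<eta> where "\<eta> = (\<Sum>j\<in>UNIV. \<kappa> ((2 * pi) *\<^sub>R pd j) *\<^sub>R ((1 / (2 * pi)) *\<^sub>R prim C j))"
 have \<kappa>\<eta>: "K \<bullet> \<eta> = \<kappa> K" if "K \<in> RL C" for K
 proof -
  have \<kappa>add: "\<kappa> (K + K') = \<kappa> K + \<kappa> K'" if "K' \<in> RL C" for K K'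
   using \<phi>per[OF that, of K] by (simp add: \<kappa>_def)
  have "bz.L \<subseteq> {K \<in> RL C. K \<bullet> \<eta> = \<kappa> K}"
  proof (rule bz.L_generated)
   show "0 \<in> {K \<in> RL C. K \<bullet> \<eta> = \<kappa> K}" by (simp add: RL_eq bz.L_zero \<kappa>_def)
   show "u + v \<in> {K \<in> RL C. K \<bullet> \<eta> = \<kappa> K}" if "u \<in> {K \<in> RL C. K \<bullet> \<eta> = \<kappa> K}" "v \<in> {K \<in> RL C. K \<bullet> \<eta> = \<kappa> K}" for u v
    using that by (simp add: RL_add inner_add_left \<kappa>add)
   show "- u \<in> {K \<in> RL C. K \<bullet> \<eta> = \<kappa> K}" if "u \<in> {K \<in> RL C. K \<bullet> \<eta> = \<kappa> K}" for u
    using that \<kappa>add[of u "- u"] by (simp add: RL_minus) (simp add: \<kappa>_def)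
   show "(2 * pi) *\<^sub>R pd i \<in> {K \<in> RL C. K \<bullet> \<eta> = \<kappa> K}" for i
   proof -
    have "((2 * pi) *\<^sub>R pd i) \<bullet> \<eta> = (\<Sum>j\<in>UNIV. \<kappa> ((2 * pi) *\<^sub>R pd j) * (if i = j then 1 else 0))"
     unfolding \<eta>_def inner_sum_right by (intro sum.cong refl) (simp only: inner_scaleR_right[of _ "\<kappa> _"] bz.dual)
    also have "\<dots> = \<kappa> ((2 * pi) *\<^sub>R pd i)" by (simp add: if_distrib[of "\<lambda>x. _ * x"] cong: if_cong)
    finally show ?thesis using bz.L_basis[of i] by (simp add: RL_eq)
   qed
  qed
  thus ?thesis using that by (auto simp: RL_eq)
 qed
 \<comment> \<open>The position is \<open>- \<eta>\<close> reduced to the unit cell; the lattice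
   vector \<open>R\<close> removed in the reduction changes the factor \<open>u\<close> by a
   periodic character.\<close>
 define \<omega> where "\<omega> = - \<eta> - cell.fl (- \<eta>)"
 define R where "R = cell.fl (- \<eta>)"
 have R: "R \<in> BL C" unfolding R_def BL_eq by (rule cell.fl_L)
 have \<omega>: "- \<omega> = \<eta> + R" by (simp add: \<omega>_def R_def)
 define u where "u k = cis (k \<bullet> (- \<omega>) - \<phi>\<^sub>0 k)" for k
 define \<phi> where "\<phi> k = scl (u k) (\<psi> k)" for k
 have ur: "rper u" unfolding rper_def
 proof (intro conjI allI ballI)
  show "ran_at k u" for k unfolding u_def[abs_def]
   by (rule ran_at_cis) (simp only: of_real_diff, intro ran_at_diff ran_at_inner \<phi>r)
  fix k K assume K: "K \<in> RL C"
  have "(k + K) \<bullet> (- \<omega>) - \<phi>\<^sub>0 (k + K) = (k \<bullet> (- \<omega>) - \<phi>\<^sub>0 k) + K \<bullet> R"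
   unfolding \<phi>per[OF K] \<kappa>\<eta>[OF K, symmetric] \<omega> by (simp add: inner_add_left inner_add_right)
  thus "u (k + K) = u k" unfolding u_def using cis_RL[OF K R] by (simp add: cis_mult[symmetric])
 qed
 have \<phi>g: "gsec \<phi>" unfolding \<phi>_def[abs_def] by (rule gsec_scale[OF ur \<psi>(1)])
 have \<phi>1: "inn (\<phi> k) (\<phi> k) = 1" for k
 proof -
  have "inn (\<phi> k) (\<phi> k) = cnj (u k) * (u k * inn (\<psi> k) (\<psi> k))"
   unfolding \<phi>_def by (simp only: ip_smul_left[OF LV_scl[OF \<psi>L] \<psi>L] ip_smul[OF \<psi>L \<psi>L])
  thus ?thesis unfolding \<psi>(3) u_def by (simp add: cis_cnj cis_mult)
 qed
 have cov\<phi>: "gh p (\<phi> k) \<simeq> scl (cis (e p) * cis (- ((spr p *v k) \<bullet> (rot C p *v \<omega> - \<omega>)))) (\<phi> (spr p *v k))" if p: "p \<in> P" for p k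
 proof -
  let ?k = "spr p *v k"
  have "gh p (\<phi> k) \<simeq> scl (cj (trs C p) (u k) * \<rho> p k) (\<psi> ?k)"
   unfolding \<phi>_def gh_scl[OF p] using aeq_scl[OF cov[OF p], of "cj (trs C p) (u k)" k] by (simp only: scl_scl)
  moreover have "cj (trs C p) (u k) * \<rho> p k = cis (e p) * cis (- (?k \<bullet> (rot C p *v \<omega> - \<omega>))) * u ?k"
  proof -
   have "trs C p * (k \<bullet> \<omega>) = ?k \<bullet> (rot C p *v \<omega>)" by (rule spr_inner[OF p, symmetric])
   hence "trs C p * (k \<bullet> (- \<omega>) - \<phi>\<^sub>0 k) + \<theta> p k = e p + - (?k \<bullet> (rot C p *v \<omega> - \<omega>)) + (?k \<bullet> (- \<omega>) - \<phi>\<^sub>0 ?k)"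
    unfolding avg[OF p] by (simp add: right_diff_distrib inner_diff_right)
   thus ?thesis unfolding u_def \<theta>[OF p] cj_cis[OF trs_pm[OF p]] cis_mult by simp
  qed
  ultimately show ?thesis unfolding \<phi>_def scl_scl by simp
 qed
 show ?thesis
 proof (rule that[OF \<phi>g])
  show "\<phi> k \<in> F k" for k unfolding \<phi>_def by (rule band_scl[OF F \<psi>(2)])
  show "inn (\<phi> k) (\<phi> k) = 1" for k by (rule \<phi>1)
  show "\<omega> \<in> unit_cell C" unfolding unit_cell_eq \<omega>_def by (rule cell.fl_D)
  show "\<exists>c. \<forall>k. gh p (\<phi> k) \<simeq> scl (c * cis (- ((spr p *v k) \<bullet> (rot C p *v \<omega> - \<omega>)))) (\<phi> (spr p *v k))" if "p \<in> P" for p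
   using cov\<phi>[OF that] by blast
  \<comment> \<open>Covariance at the equivalent wavevectors 0 and \<open>?K\<close> involves the
    same functions up to null sets; comparing the factors shows that the character of
    \<open>?\<xi>\<close> is trivial on \<open>RL C\<close>.\<close>
  show "rot C p *v \<omega> - \<omega> \<in> BL C" if p: "p \<in> P" for p
  proof (rule BL_character)
   fix K assume K: "K \<in> RL C"
   let ?\<xi> = "rot C p *v \<omega> - \<omega>" and ?K = "spr (pinv p) *v K"
   have K': "?K \<in> RL C" by (intro spr_RL pinv_P p K)
   have AK: "spr p *v ?K = K" by (rule spr_inv(2)[OF p])
   have \<phi>L: "\<phi> k \<in> LV m" for k by (rule gsec_LV[OF \<phi>g])
   have "gh p (\<phi> (0 + ?K)) \<simeq> scl (cis (e p) * cis (- ((spr p *v (0 + ?K)) \<bullet> ?\<xi>))) (\<phi> (spr p *v (0 + ?K)))" by (rule cov\<phi>[OF p])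
   moreover have "gh p (\<phi> 0) \<simeq> gh p (\<phi> (0 + ?K))" by (rule gh_aeq[OF p aeq_sym[OF gsec_per[OF \<phi>g K']]])
   moreover have "\<phi> (0 + K) \<simeq> \<phi> 0" by (rule gsec_per[OF \<phi>g K])
   ultimately have "gh p (\<phi> 0) \<simeq> scl (cis (e p) * cis (- (K \<bullet> ?\<xi>))) (\<phi> 0)"
    unfolding add_0 AK by (blast intro: aeq_trans aeq_scl)
   moreover have "gh p (\<phi> 0) \<simeq> scl (cis (e p)) (\<phi> 0)" using cov\<phi>[OF p, of 0] by simp
   ultimately have "scl (cis (e p) * cis (- (K \<bullet> ?\<xi>))) (\<phi> 0) \<simeq> scl (cis (e p)) (\<phi> 0)"
    by (blast intro: aeq_trans aeq_sym)
   hence "inn (\<phi> 0) (scl (cis (e p) * cis (- (K \<bullet> ?\<xi>))) (\<phi> 0)) = inn (\<phi> 0) (scl (cis (e p)) (\<phi> 0))"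
    by (intro inner_aeq \<phi>L LV_scl) simp_all
   hence "cis (- (K \<bullet> ?\<xi>)) = 1" unfolding ip_smul[OF \<phi>L \<phi>L] \<phi>1 by simp
   thus "cis (K \<bullet> ?\<xi>) = 1" by (metis cis_cnj complex_cnj_one minus_minus)
  qed
 qed
qed

end

section \<open>Sums of simple bands\<close>

context mcr
begin

lemma splits_part:
 assumes sp: "splits_into C m S Fs" and i: "i < length Fs" and f: "f \<in> (Fs ! i) k"
 shows "f \<in> S k"
proof -
 have b: "\<exists>N. band C m N (Fs ! j)" if "j < length Fs" for j
  using sp nth_mem[OF that] unfolding splits_into_def by blast
 define h where "h j = (if j = i then f else 0)" for j
 have "\<forall>j<length Fs. h j \<in> (Fs ! j) k" using b f band_zero by (auto simp: h_def)
 moreover have "(\<Sum>j<length Fs. h j) = (\<Sum>j\<in>{i}. h j)"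
  by (rule sum.mono_neutral_right) (use i in \<open>auto simp: h_def\<close>)
 hence "f \<simeq> (\<Sum>j<length Fs. h j)" by (simp add: h_def)
 moreover have "f \<in> Bl k" using b[OF i] band_bloch f by blast
 ultimately show ?thesis using sp unfolding splits_into_def by blast
qed

lemma splits_single:
 assumes S: "band C m N S" shows "splits_into C m S [S]"
 unfolding splits_into_def
proof (intro conjI allI impI ballI Set.set_eqI iffI)
 fix k f assume f: "f \<in> S k"
 thus "f \<in> {f \<in> Bl k. \<exists>h. (\<forall>j<length [S]. h j \<in> ([S] ! j) k) \<and> f \<simeq> (\<Sum>j<length [S]. h j)}"
  using band_bloch[OF S f] by (intro CollectI conjI exI[of _ "\<lambda>_. f"]) simp_all
next
 fix k f assume "f \<in> {f \<in> Bl k. \<exists>h. (\<forall>j<length [S]. h j \<in> ([S] ! j) k) \<and> f \<simeq> (\<Sum>j<length [S]. h j)}"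
 then obtain h where "f \<in> Bl k" "h 0 \<in> S k" "f \<simeq> h 0" by auto
 thus "f \<in> S k" using band_aeq[OF S] aeq_sym by blast
qed (use S in auto)

lemma simple_sum_onb:
 assumes sp: "splits_into C m S Fs" and F: "\<And>i. i < length Fs \<Longrightarrow> band C m 1 (Fs ! i)"
  and \<phi>: "\<And>i. i < length Fs \<Longrightarrow> \<phi> i \<in> (Fs ! i) k" "\<And>i. i < length Fs \<Longrightarrow> inn (\<phi> i) (\<phi> i) = 1"
 shows "onb k {..<length Fs} \<phi> (S k)"
 unfolding orthonormal_basis_def
proof (intro conjI ballI)
 have orth: "\<forall>i<length Fs. \<forall>j<length Fs. i \<noteq> j \<longrightarrow> (\<forall>f\<in>(Fs ! i) k. \<forall>g\<in>(Fs ! j) k. inn f g = 0)"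
  and S: "S k = {f \<in> Bl k. \<exists>h. (\<forall>j<length Fs. h j \<in> (Fs ! j) k) \<and> f \<simeq> (\<Sum>j<length Fs. h j)}"
  using sp unfolding splits_into_def by blast+
 fix i j assume "i \<in> {..<length Fs}" "j \<in> {..<length Fs}"
 hence ij: "i < length Fs" "j < length Fs" by simp_all
 show "\<phi> i \<in> Bl k" by (rule band_bloch[OF F[OF ij(1)] \<phi>(1)[OF ij(1)]])
 show "inn (\<phi> i) (\<phi> j) = (if i = j then 1 else 0)"
  using orth ij \<phi>(1)[OF ij(1)] \<phi>(1)[OF ij(2)] \<phi>(2)[OF ij(1)] by auto
next
 have S: "S k = {f \<in> Bl k. \<exists>h. (\<forall>j<length Fs. h j \<in> (Fs ! j) k) \<and> f \<simeq> (\<Sum>j<length Fs. h j)}"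
  using sp unfolding splits_into_def by blast
 show "S k = {f \<in> Bl k. \<exists>c. f \<simeq> (\<Sum>j<length Fs. scl (c j) (\<phi> j))}"
 proof (intro Set.set_eqI iffI)
  fix f assume "f \<in> S k"
  then obtain h where f: "f \<in> Bl k" "f \<simeq> (\<Sum>j<length Fs. h j)" and h: "\<And>j. j < length Fs \<Longrightarrow> h j \<in> (Fs ! j) k"
   unfolding S by blast
  have "(\<Sum>j<length Fs. h j) \<simeq> (\<Sum>j<length Fs. scl (inn (\<phi> j) (h j)) (\<phi> j))"
  proof (rule aeq_sum)
   fix j assume "j \<in> {..<length Fs}"
   hence j: "j < length Fs" by simp
   show "h j \<simeq> scl (inn (\<phi> j) (h j)) (\<phi> j)" by (rule simple_expand[OF F[OF j] \<phi>[OF j] h[OF j]])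
  qed
  from aeq_trans[OF f(2) this] f(1) show "f \<in> {f \<in> Bl k. \<exists>c. f \<simeq> (\<Sum>j<length Fs. scl (c j) (\<phi> j))}"
   by (intro CollectI conjI exI[of _ "\<lambda>j. inn (\<phi> j) (h j)"])
 next
  fix f assume "f \<in> {f \<in> Bl k. \<exists>c. f \<simeq> (\<Sum>j<length Fs. scl (c j) (\<phi> j))}"
  then obtain c where f: "f \<in> Bl k" "f \<simeq> (\<Sum>j<length Fs. scl (c j) (\<phi> j))" by blast
  show "f \<in> S k" unfolding S using f band_scl[OF F \<phi>(1)]
   by (intro CollectI conjI exI[of _ "\<lambda>j. scl (c j) (\<phi> j)"] allI impI)
 qed
qed simp

text \<open>Each position is fixed by the point group modulo \<open>BL C\<close>, so no class of
  sites is moved and the matrices are diagonal. Sections with the same position share a site;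
  different positions in the unit cell are inequivalent modulo \<open>BL C\<close>.\<close>

lemma covariant_sections_band_rep:
 fixes L :: nat
 assumes S: "band C m N S" and o: "\<And>k. onb k {..<L} (\<lambda>i. \<phi> i k) (S k)"
  and \<phi>: "\<And>i. i < L \<Longrightarrow> gsec (\<phi> i)" and \<omega>: "\<And>i. i < L \<Longrightarrow> \<omega> i \<in> unit_cell C"
  and \<xi>: "\<And>i p. i < L \<Longrightarrow> p \<in> P \<Longrightarrow> rot C p *v \<omega> i - \<omega> i \<in> BL C"
  and cov: "\<And>i p. i < L \<Longrightarrow> p \<in> P \<Longrightarrow>
   \<exists>c. \<forall>k. gh p (\<phi> i k) \<simeq> scl (c * cis (- ((spr p *v k) \<bullet> (rot C p *v \<omega> i - \<omega> i)))) (\<phi> i (spr p *v k))"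
 shows "band_rep C m S"
proof -
 \<comment> \<open>\<open>vals\<close> lists the distinct positions, \<open>idx n\<close> the
   sections at the position number \<open>n\<close>, and \<open>h\<close> turns a pair
   \<open>(n, \<alpha>)\<close> into the index of a section.\<close>
 define vals where "vals = remdups (map \<omega> [0..<L])"
 define idx where "idx n = filter (\<lambda>i. \<omega> i = vals ! n) [0..<L]" for n
 define M where "M = length vals"
 define l where "l n = length (idx n)" for n
 define h where "h = (\<lambda>(n, \<alpha>). idx n ! \<alpha>)"
 define \<Psi> where "\<Psi> j = \<phi> (h j)" for j
 let ?I = "{(n, \<alpha>). n < M \<and> \<alpha> < l n}"
 have idx: "idx n ! \<alpha> < L \<and> \<omega> (idx n ! \<alpha>) = vals ! n" if "\<alpha> < l n" for n \<alpha>
  using nth_mem[of \<alpha> "idx n"] that by (auto simp: l_def idx_def)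
 have vset: "set vals = \<omega> ` {..<L}" by (auto simp: vals_def)
 have bij: "bij_betw h ?I {..<L}" unfolding bij_betw_def
 proof
  show "inj_on h ?I"
  proof (rule inj_onI)
   fix x y assume x: "x \<in> ?I" and y: "y \<in> ?I" and e: "h x = h y"
   obtain n \<alpha> where nx: "x = (n, \<alpha>)" "n < M" "\<alpha> < l n" using x by auto
   obtain n' \<beta> where ny: "y = (n', \<beta>)" "n' < M" "\<beta> < l n'" using y by auto
   have "vals ! n = vals ! n'" using idx[OF nx(3)] idx[OF ny(3)] e by (simp add: h_def nx ny)
   hence n: "n = n'" using nx(2) ny(2) by (simp add: nth_eq_iff_index_eq vals_def M_def)
   have "distinct (idx n)" by (simp add: idx_def)
   hence "\<alpha> = \<beta>" using e nx(3) ny(3) n by (simp add: h_def nx ny l_def nth_eq_iff_index_eq)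
   thus "x = y" using n nx ny by simp
  qed
  show "h ` ?I = {..<L}"
  proof (intro equalityI subsetI)
   fix i assume "i \<in> {..<L}"
   hence i: "i < L" by simp
   hence "\<omega> i \<in> set vals" by (simp add: vset)
   then obtain n where n: "n < M" "vals ! n = \<omega> i" unfolding in_set_conv_nth M_def by blast
   hence "i \<in> set (idx n)" using i by (simp add: idx_def)
   then obtain \<alpha> where \<alpha>: "\<alpha> < l n" "idx n ! \<alpha> = i" unfolding in_set_conv_nth l_def by blast
   show "i \<in> h ` ?I" by (rule image_eqI[of _ _ "(n, \<alpha>)"]) (use n \<alpha> in \<open>simp_all add: h_def\<close>)
  qed (use idx in \<open>auto simp: h_def\<close>)
 qed
 have hL: "h j < L" if "j \<in> ?I" for j using bij_betwE[OF bij] that by blast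
 have \<Psi>o: "onb k ?I (\<lambda>j. \<Psi> j k) (S k)" for k
 proof (rule onb_of_ons[OF o])
  show "ons ?I (\<lambda>j. \<Psi> j k)" unfolding \<Psi>_def by (rule ons_reindex[OF onb_ons[OF o] bij])
  show "\<Psi> j k \<in> S k" if "j \<in> ?I" for j unfolding \<Psi>_def by (rule onb_basis_mem[OF o]) (use hL[OF that] in simp)
  show "card ?I = card {..<L}" by (rule bij_betw_same_card[OF bij])
 qed
 have rep: "\<exists>i<L. vals ! n = \<omega> i" if "n < M" for n
  using nth_mem[of n vals] that unfolding M_def vset by auto
 show ?thesis
 proof (rule band_repI[where M = M and l = l and \<omega> = "\<lambda>n. vals ! n" and \<psi> = \<Psi>, OF S])
  fix n assume n: "n < M"
  then obtain i where i: "i < L" "vals ! n = \<omega> i" using rep by blast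
  hence "i \<in> set (idx n)" by (simp add: idx_def)
  thus "1 \<le> l n" unfolding l_def by (cases "idx n") auto
  show "vals ! n - vals ! n' \<notin> BL C" if n': "n' < M" "n \<noteq> n'" for n'
  proof
   assume "vals ! n - vals ! n' \<in> BL C"
   moreover obtain i' where "i' < L" "vals ! n' = \<omega> i'" using rep n'(1) by blast
   ultimately have "vals ! n = vals ! n'" using i \<omega> by (intro cell.D_unique) (simp_all add: BL_eq unit_cell_eq)
   thus False using n n' by (simp add: nth_eq_iff_index_eq vals_def M_def)
  qed
  fix p assume p: "p \<in> P"
  let ?\<xi> = "rot C p *v (vals ! n) - vals ! n"
  have "\<exists>c. \<forall>k. gh p (\<Psi> (n, \<alpha>) k) \<simeq> scl (c * cis (- ((spr p *v k) \<bullet> ?\<xi>))) (\<Psi> (n, \<alpha>) (spr p *v k))" if "\<alpha> < l n" for \<alpha>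
   using cov[of "idx n ! \<alpha>", OF _ p] idx[OF that] by (simp add: \<Psi>_def h_def)
  then obtain c where c: "\<And>\<alpha> k. \<alpha> < l n \<Longrightarrow> gh p (\<Psi> (n, \<alpha>) k) \<simeq> scl (c \<alpha> * cis (- ((spr p *v k) \<bullet> ?\<xi>))) (\<Psi> (n, \<alpha>) (spr p *v k))"
   by metis
  have "bloch_cov M l (\<lambda>n. vals ! n) \<Psi> p n n ?\<xi> (\<lambda>\<alpha> \<beta>. if \<beta> = \<alpha> then c \<alpha> else 0)"
   unfolding bloch_cov_def
  proof (intro conjI n allI impI)
   show "?\<xi> \<in> BL C" unfolding i(2) by (rule \<xi>[OF i(1) p])
   show "rot C p *v vals ! n = vals ! n + ?\<xi>" by simp
   fix \<alpha> assume \<alpha>: "\<alpha> < l n"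
   have "(\<Sum>\<beta><l n. scl ((if \<beta> = \<alpha> then c \<alpha> else 0) * cis (- ((spr p *v k) \<bullet> ?\<xi>))) (\<Psi> (n, \<beta>) (spr p *v k)))
    = (\<Sum>\<beta>\<in>{\<alpha>}. scl ((if \<beta> = \<alpha> then c \<alpha> else 0) * cis (- ((spr p *v k) \<bullet> ?\<xi>))) (\<Psi> (n, \<beta>) (spr p *v k)))" for k
    by (rule sum.mono_neutral_right) (use \<alpha> in auto)
   thus "AE k in lborel. gh p (\<Psi> (n, \<alpha>) k) \<simeq>
    (\<Sum>\<beta><l n. scl ((if \<beta> = \<alpha> then c \<alpha> else 0) * cis (- ((spr p *v k) \<bullet> ?\<xi>))) (\<Psi> (n, \<beta>) (spr p *v k)))"
    using c[OF \<alpha>] by simp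
  qed
  thus "\<exists>n' \<xi> c. bloch_cov M l (\<lambda>n. vals ! n) \<Psi> p n n' \<xi> c" by blast
 next
  show "apf S ?I \<Psi>"
   unfolding apf_iff using \<Psi>o by (intro conjI allI ballI) (use \<phi>[OF hL] in \<open>simp_all add: \<Psi>_def\<close>)
 qed
qed

text \<open>The frame of the larger band \<open>E\<close> supplies the analytic coordinates in which
  the sections of the simple bands are built; a frame of \<open>S\<close> is only an outcome of the
  construction.\<close>

lemma simple_sum_band_rep:
 assumes S: "band C m N S" and sp: "splits_into C m S Fs"
  and F: "\<And>F. F \<in> set Fs \<Longrightarrow> simple_band C m F \<and> c1_vanishes C m F"
  and E: "band C m N' E" and SE: "\<And>f k. f \<in> S k \<Longrightarrow> f \<in> E k" and Ef: "apf E I \<chi>'"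
 shows "band_rep C m S"
proof -
 obtain e where e: "\<And>i. i < N' \<Longrightarrow> gsec (e i)" "\<And>k. onb k {..<N'} (\<lambda>i. e i k) (E k)"
  using apf_reindex[OF Ef E] by blast
 \<comment> \<open>Section and position are bundled in one pair, so that a single choice over
   \<open>i\<close> provides both.\<close>
 let ?Q = "\<lambda>i (\<phi>, \<omega>). gsec \<phi> \<and> (\<forall>k. \<phi> k \<in> (Fs ! i) k) \<and> (\<forall>k. inn (\<phi> k) (\<phi> k) = 1) \<and> \<omega> \<in> unit_cell C \<and>
   (\<forall>p\<in>P. rot C p *v \<omega> - \<omega> \<in> BL C) \<and>
   (\<forall>p\<in>P. \<exists>c. \<forall>k. gh p (\<phi> k) \<simeq> scl (c * cis (- ((spr p *v k) \<bullet> (rot C p *v \<omega> - \<omega>)))) (\<phi> (spr p *v k)))"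
 have F1: "band C m 1 (Fs ! i)" and c1: "c1_vanishes C m (Fs ! i)" if "i < length Fs" for i
  using F[OF nth_mem[OF that]] by (simp_all add: simple_band_def)
 have "\<exists>x. ?Q i x" if i: "i < length Fs" for i
 proof -
  have span: "nm (res {..<N'} (\<lambda>i. e i k) f) = 0" if "f \<in> (Fs ! i) k" for k f
   using onb_mem[OF e(2)] SE[OF splits_part[OF sp i that]] by blast
  obtain \<psi> where \<psi>: "gsec \<psi>" "\<And>k. \<psi> k \<in> (Fs ! i) k" "\<And>k. inn (\<psi> k) (\<psi> k) = 1"
  proof (rule simple_analytic_section[where e = e and N = N', OF F1[OF i] c1[OF i]], erule e(1), rule onb_ons[OF e(2)], erule span)
   fix \<psi> assume a: "gsec \<psi>" "\<And>k. \<psi> k \<in> (Fs ! i) k" "\<And>k. inn (\<psi> k) (\<psi> k) = 1"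
   show thesis by (rule that[OF a])
  qed
  show ?thesis
  proof (rule simple_covariant[OF F1[OF i] \<psi>])
   fix \<phi> \<omega> assume a: "gsec \<phi>" "\<And>k. \<phi> k \<in> (Fs ! i) k" "\<And>k. inn (\<phi> k) (\<phi> k) = 1" "\<omega> \<in> unit_cell C"
    "\<And>p. p \<in> P \<Longrightarrow> rot C p *v \<omega> - \<omega> \<in> BL C"
    "\<And>p. p \<in> P \<Longrightarrow> \<exists>c. \<forall>k. gh p (\<phi> k) \<simeq> scl (c * cis (- ((spr p *v k) \<bullet> (rot C p *v \<omega> - \<omega>)))) (\<phi> (spr p *v k))"
   show ?thesis by (rule exI[of _ "(\<phi>, \<omega>)"]) (use a in simp)
  qed
 qed
 hence "\<forall>i\<in>{..<length Fs}. \<exists>x. ?Q i x" by simp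
 from bchoice[OF this] obtain g where g: "\<forall>i\<in>{..<length Fs}. ?Q i (g i)" by (elim exE)
 define \<phi> where "\<phi> i = fst (g i)" for i
 define \<omega> where "\<omega> i = snd (g i)" for i
 have Q: "?Q i (\<phi> i, \<omega> i)" if "i < length Fs" for i using bspec[OF g, of i] that by (simp add: \<phi>_def \<omega>_def case_prod_unfold)
 show ?thesis
 proof (rule covariant_sections_band_rep[OF S, of "length Fs" \<phi> \<omega>])
  show "onb k {..<length Fs} (\<lambda>i. \<phi> i k) (S k)" for k
   by (rule simple_sum_onb[OF sp F1]) (use Q in simp_all)
 qed (use Q in simp_all)
qed

lemma band_rep_frame:
 assumes "band_rep C m E"
 obtains I :: "(nat \<times> nat) set" and \<psi> where "apf E I \<psi>"
 using assms unfolding band_rep_def by blast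

text \<open>If \<open>T\<close> were a band representation, the list \<open>[S, T]\<close> would
  contradict elementarity, both ranks being positive and smaller than \<open>N\<close>. Fragility is
  witnessed by adding \<open>S\<close> itself.\<close>

lemma complement_fragile:
 assumes d: "CARD('d) \<le> 3" and el: "elementary_band_rep C m N E"
  and S: "band C m N1 S" "N1 > 0" and T: "band C m N2 T" "N2 > 0"
  and sp: "splits_into C m E [S, T]" and BS: "band_rep C m S"
 shows "fragile_localizable_topological C m T"
proof -
 have E: "band C m N E" and BE: "band_rep C m E" using el by (simp_all add: elementary_band_rep_def)
 obtain I :: "(nat \<times> nat) set" and \<psi> where Ef: "apf E I \<psi>" by (rule band_rep_frame[OF BE])
 obtain J :: "(nat \<times> nat) set" and \<phi> where Sf: "apf S J \<phi>" by (rule band_rep_frame[OF BS])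
 have N: "N = N1 + N2" by (rule splits_rank[OF sp E S(1) T(1)])
 have "\<not> band_rep C m T"
 proof
  assume BT: "band_rep C m T"
  have "\<exists>N'. 0 < N' \<and> N' < N \<and> band C m N' S" using S T(2) N by (intro exI[of _ N1]) simp
  moreover have "\<exists>N'. 0 < N' \<and> N' < N \<and> band C m N' T" using T S(2) N by (intro exI[of _ N2]) simp
  ultimately have "\<exists>Fs. length Fs \<ge> 2 \<and> splits_into C m E Fs \<and>
      (\<forall>F\<in>set Fs. band_rep C m F \<and> (\<exists>N'. 0 < N' \<and> N' < N \<and> band C m N' F))"
   using sp BS BT by (intro exI[of _ "[S, T]"]) simp
  thus False using el by (simp add: elementary_band_rep_def)
 qed
 moreover have "localizable C m T" by (rule complement_localizable[OF d sp E S(1) T(1) Ef Sf])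
 moreover have "band_rep C (m + m) (whitney_sum m T S)" by (rule whitney_band_rep[OF sp E S(1) T(1) BE Sf])
 ultimately show ?thesis
  unfolding fragile_localizable_topological_def localizable_topological_def using BS by blast
qed

end

declare [[coercion_enabled = true]]

theorem mainTheorem5:
  fixes C :: "('d::finite, 'p, 'v::finite) crystal"
    and E S\<^sub>1 S\<^sub>2 :: "('d, 'v) fibres"
    and m N N\<^sub>1 N\<^sub>2 :: nat
  assumes "CARD('d) \<le> 3"
    and "magnetic_crystal C"
    and "spinless C \<or> spinful C"
    and "elementary_band_rep C m N E"
    and "band C m N\<^sub>1 S\<^sub>1" and "N\<^sub>1 > 0"
    and "band C m N\<^sub>2 S\<^sub>2" and "N\<^sub>2 > 0"
    and "splits_into C m E [S\<^sub>1, S\<^sub>2]"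
  shows "(band_rep C m S\<^sub>1 \<longrightarrow> fragile_localizable_topological C m S\<^sub>2) \<and>
         ((simple_band C m S\<^sub>1 \<and> c1_vanishes C m S\<^sub>1) \<or>
          (\<exists>Fs. length Fs \<ge> 2 \<and> splits_into C m S\<^sub>1 Fs \<and>
             (\<forall>F\<in>set Fs. simple_band C m F \<and> c1_vanishes C m F)) \<longrightarrow>
          band_rep C m S\<^sub>1 \<and> fragile_localizable_topological C m S\<^sub>2)"
proof -
  interpret mcr C m by (rule mcr.intro) (rule assms(2))
  have a: "fragile_localizable_topological C m S\<^sub>2" if "band_rep C m S\<^sub>1"
    by (rule complement_fragile[OF assms(1,4-9) that])
  have E: "band C m N E" and BE: "band_rep C m E" using assms(4) by (simp_all add: elementary_band_rep_def)
  obtain I :: "(nat \<times> nat) set" and \<psi> where Ef: "analytic_periodic_frame C m E I \<psi>" by (rule band_rep_frame[OF BE])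
  have b: "band_rep C m S\<^sub>1"
    if "splits_into C m S\<^sub>1 Fs" "\<forall>F\<in>set Fs. simple_band C m F \<and> c1_vanishes C m F" for Fs
    by (rule simple_sum_band_rep[OF assms(5) that(1) _ E splits_sub(1)[OF assms(9,5,7)] Ef]) (use that(2) in auto)
  \<comment> \<open>A simple band is the sum of the one-element list that contains it.\<close>
  have b1: "band_rep C m S\<^sub>1" if "simple_band C m S\<^sub>1" "c1_vanishes C m S\<^sub>1"
    by (rule b[OF splits_single[OF assms(5)]]) (use that in simp)
  show ?thesis using a b b1 by blast
qed

end
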